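(* Let $\tau_0\in(0,1)$ and $T=\{\tau_0\}$. Let $\{(Y_{ik},X_{ik}): i\ge 1,\ 1\le k\le c_i\}$ be random vectors in $\mathbb{R}\times\mathbb{R}^d$ ($i$ indexes clusters, $k$ indexes observations within cluster $i$). Assume: (1) the clusters $(Y_{ik},X_{ik})_{1\le k\le c_i}$, $i\ge 1$, are independent of one another (dependence within a cluster is arbitrary), and $c_i\le c_{\max}<\infty$ for all $i\ge 1$; (2) $B\subset\mathbb{R}^d$ is compact and convex, $\beta(\tau_0)$ lies in the interior of $B$, and $Q_{ik}(\tau_0\mid x)=x^\top\beta(\tau_0)$ for all $x$ in the support $\mathcal{X}_{ik}$ of $X_{ik}$, and all $i,k$; (3) (i) for some $q>2$, $\mathrm{E}|X_{ik}|^q<\infty$ uniformly in $i,k$; (ii) $n^{-1}\sum_{i=1}^n\sum_{k=1}^{c_i}\mathrm{E}X_{ik}X_{ik}^\top$ is positive definite uniformly in $n$; (iii) the conditional density $f_{ik}(y\mid X_{ik}=x)$ of $Y_{ik}$ and its derivative in $y$ are bounded in absolute value uniformly in $y$, $x\in\mathcal{X}_{ik}$, $i$ and $k$; (iv) $f_{ik}(x^\top b\mid X_{ik}=x)$ is bounded away from zero uniformly in $b\in B$, $x\in\mathcal{X}_{ik}$, $i$ and $k$; (4) the limits $J(\tau_0)=\lim_{n\to\infty}J_n(\tau_0)$ and $\Sigma(\tau_0,\tau_0)=\lim_{n\to\infty}\Sigma_n(\tau_0,\tau_0)$ exist; (5) $a^\top\Sigma(\tau_0,\tau_0)a>0$ for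 all non-zero $a\in\mathbb{R}^d$. Let $W_1,W_2,\dots$ be iid, independent of the data, with $\mathrm{E}W_1=0$, $\mathrm{Var}\,W_1=1$ and $\mathrm{E}|W_1|^q<\infty$, and let $\hat\beta_n^*(\tau_0)$ be the wild gradient bootstrap estimator. Let $R(\tau_0)$ be an $h\times d$ matrix of full rank with $h\le d$, let $r(\tau_0)\in\mathbb{R}^h$, and consider $\mathrm{H}_0$: $R(\tau_0)\beta(\tau_0)=r(\tau_0)$ against $\mathrm{H}_1$: $R(\tau_0)\beta(\tau_0)\neq r(\tau_0)$. Let $\hat\Omega_n^*(\tau_0)=R(\tau_0)\hat V_n^*(\tau_0,\tau_0)R(\tau_0)^\top$ and $K_n(\hat\Omega_n^*,\tau_0)=\bigl|\hat\Omega_n^{*-1/2}(\tau_0)\sqrt{n}(R(\tau_0)\hat\beta_n(\tau_0)-r(\tau_0))\bigr|$. Then (i) under $\mathrm{H}_0$, $K_n(\hat\Omega_n^*,\tau_0)^2$ converges in distribution to $\chi^2_{\mathrm{rank}\,R(\tau_0)}$; and (ii) under $\mathrm{H}_1$, $\mathrm{P}(K_n(\hat\Omega_n^*,\tau_0)^2>s)\to1$ for every $s\in\mathbb{R}$.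
   Context: $Q_{ik}(\tau\mid x)=\inf\{y:\mathrm{P}(Y_{ik}\le y\mid X_{ik}=x)\ge\tau\}$. $\rho_\tau(z)=(\tau-1\{z<0\})z$ and $\psi_\tau(z)=\tau-1\{z<0\}$. $|\cdot|$ is the Euclidean norm. The quantile regression estimator is $\hat\beta_n(\tau)\in\arg\min_{b\in B}\mathbb{M}_n(b,\tau)$ with $\mathbb{M}_n(b,\tau)=n^{-1}\sum_{i=1}^n\sum_{k=1}^{c_i}\rho_\tau(Y_{ik}-X_{ik}^\top b)$. $$J_n(\tau)=\frac1n\sum_{i=1}^n\sum_{k=1}^{c_i}\mathrm{E}f_{ik}(X_{ik}^\top\beta(\tau)\mid X_{ik})X_{ik}X_{ik}^\top,$$ $$\Sigma_n(\tau,\tau')=\frac1n\sum_{i=1}^n\sum_{k=1}^{c_i}\sum_{l=1}^{c_i}\mathrm{E}\,\psi_\tau(Y_{ik}-X_{ik}^\top\beta(\tau))\psi_{\tau'}(Y_{il}-X_{il}^\top\beta(\tau'))X_{ik}X_{il}^\top.$$ "Positive definite uniformly in $n$" means the smallest eigenvalue is bounded away from zero uniformly in $n$. Wild gradient bootstrap: $\mathbb{W}_n(b,\tau)=n^{-1/2}\sum_{i=1}^nW_i\sum_{k=1}^{c_i}\psi_\tau(Y_{ik}-X_{ik}^\top b)X_{ik}$, $\mathbb{W}_n(\tau)=\mathbb{W}_n(\hat\beta_n(\tau),\tau)$, and $\hat\beta_n^*(\tau)$ is any minimizer over $b\in B$ of $\mathbb{M}_n^*(b,\tau)=\mathbb{M}_n(b,\tau)+\mathbb{W}_n(\tau)^\top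 b/\sqrt{n}$. $\mathrm{E}^*(\cdot)=\mathrm{E}(\cdot\mid D_n)$ with $D_n=\{(Y_{ik},X_{ik}):1\le k\le c_i,1\le i\le n\}$, and $\hat V_n^*(\tau,\tau')=\mathrm{E}^*\,n(\hat\beta_n^*(\tau)-\hat\beta_n(\tau))(\hat\beta_n^*(\tau')-\hat\beta_n(\tau'))^\top$. On the event that $\hat\Omega_n^*(\tau_0)$ is singular the statistic may be defined arbitrarily. $\chi^2_m$ is the chi-square distribution with $m$ degrees of freedom. Possibly non-measurable quantities are treated with outer probability/expectation. *)

theory Defs
  imports "HOL-Probability.Probability"
begin

section \<open>Outer expectation\<close>

text \<open>Minimisers and statistics below are arbitrary functions on the sample space, so expectations
  are outer expectations. All variables to which the next three notions are applied are bounded;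
  for bounded measurable variables they are the usual (conditional) expectation.\<close>

definition outer_expectation :: "'a measure \<Rightarrow> ('a \<Rightarrow> real) \<Rightarrow> real" where
  "outer_expectation M Z = Inf {integral\<^sup>L M U | U. integrable M U \<and> (\<forall>\<omega>\<in>space M. Z \<omega> \<le> U \<omega>)}"

text \<open>The minimal measurable majorant, unique up to null sets.\<close>

definition measurable_cover :: "'a measure \<Rightarrow> ('a \<Rightarrow> real) \<Rightarrow> ('a \<Rightarrow> real)" where
  "measurable_cover M Z = (SOME U. U \<in> borel_measurable M \<and> (\<forall>\<omega>\<in>space M. Z \<omega> \<le> U \<omega>) \<and>
     (\<forall>U'\<in>borel_measurable M. (\<forall>\<omega>\<in>space M. Z \<omega> \<le> U' \<omega>) \<longrightarrow> (AE \<omega> in M. U \<omega> \<le> U' \<omega>)))"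

definition outer_cond_exp :: "'a measure \<Rightarrow> 'a measure \<Rightarrow> ('a \<Rightarrow> real) \<Rightarrow> ('a \<Rightarrow> real)" where
  "outer_cond_exp M F Z = real_cond_exp M F (measurable_cover M Z)"

text \<open>Convergence in distribution of real-valued, possibly non-measurable, maps (in the sense of
  Hoffmann-Jorgensen): outer expectations of bounded continuous functions converge.\<close>

definition converges_in_distribution ::
    "'a measure \<Rightarrow> (nat \<Rightarrow> 'a \<Rightarrow> real) \<Rightarrow> real measure \<Rightarrow> bool" where
  "converges_in_distribution M Z L \<longleftrightarrow>
     (\<forall>h::real \<Rightarrow> real. continuous_on UNIV h \<and> bounded (range h) \<longrightarrow>
        (\<lambda>n. outer_expectation M (\<lambda>\<omega>. h (Z n \<omega>))) \<longlonglongrightarrow> integral\<^sup>L L h)"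

definition chi_square :: "nat \<Rightarrow> real measure" where
  "chi_square m = distr (\<Pi>\<^sub>M j\<in>{..<m}. density lborel (\<lambda>x. ennreal (std_normal_density x))) borel
     (\<lambda>z. \<Sum>j<m. (z j)\<^sup>2)"

section \<open>Matrices\<close>

definition outer_prod :: "real ^ 'm \<Rightarrow> real ^ 'n \<Rightarrow> real ^ 'n ^ 'm" where
  "outer_prod x y = (\<chi> i j. x $ i * y $ j)"

text \<open>Only used for symmetric matrices, where the set of real eigenvalues is finite and non-empty.\<close>

definition min_eigenvalue :: "real ^ 'n ^ 'n \<Rightarrow> real" where
  "min_eigenvalue A = Min {l. \<exists>v. v \<noteq> 0 \<and> A *v v = l *\<^sub>R v}"

text \<open>\<open>S\<close> is the symmetric inverse square root of \<open>A\<close>. There is exactly one such \<open>S\<close> if \<open>A\<close> is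
  symmetric, positive semidefinite and non-singular, and none otherwise.\<close>

definition is_inv_sqrt :: "real ^ 'n ^ 'n \<Rightarrow> real ^ 'n ^ 'n \<Rightarrow> bool" where
  "is_inv_sqrt A S \<longleftrightarrow> invertible A \<and> transpose S = S \<and> (\<forall>a. 0 \<le> a \<bullet> (S *v a)) \<and>
     S ** S = matrix_inv A"

section \<open>Conditional distributions, quantiles and densities\<close>

definition rv_support :: "'a measure \<Rightarrow> ('a \<Rightarrow> 'b::topological_space) \<Rightarrow> 'b set" where
  "rv_support M X = {x. \<forall>U. open U \<and> x \<in> U \<longrightarrow> 0 < measure M {\<omega> \<in> space M. X \<omega> \<in> U}}"

text \<open>\<open>\<kappa> x\<close> is a regular version of the conditional law of \<open>Y\<close> given \<open>X = x\<close>.\<close>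

definition cond_distribution ::
    "'a measure \<Rightarrow> ('a \<Rightarrow> 'b::topological_space) \<Rightarrow> ('a \<Rightarrow> real) \<Rightarrow> ('b \<Rightarrow> real measure) \<Rightarrow> bool" where
  "cond_distribution M X Y \<kappa> \<longleftrightarrow> \<kappa> \<in> borel \<rightarrow>\<^sub>M prob_algebra borel \<and>
     (\<forall>A\<in>sets borel. \<forall>C\<in>sets borel.
        measure M {\<omega> \<in> space M. X \<omega> \<in> A \<and> Y \<omega> \<in> C} =
        (LINT x:A|distr M borel X. measure (\<kappa> x) C))"

definition cond_quantile :: "('b \<Rightarrow> real measure) \<Rightarrow> real \<Rightarrow> 'b \<Rightarrow> real" where
  "cond_quantile \<kappa> \<tau> x = Inf {y. \<tau> \<le> measure (\<kappa> x) {..y}}"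

text \<open>\<open>f x y\<close> stands for \<open>f(y | X = x)\<close>, with \<open>x\<close> ranging over the support \<open>S\<close> of \<open>X\<close>.\<close>

definition cond_density ::
    "('b::topological_space \<Rightarrow> real measure) \<Rightarrow> 'b set \<Rightarrow> ('b \<Rightarrow> real \<Rightarrow> real) \<Rightarrow> bool" where
  "cond_density \<kappa> S f \<longleftrightarrow> (\<lambda>(x, y). f x y) \<in> borel_measurable borel \<and>
     (\<forall>x\<in>S. (\<forall>y. 0 \<le> f x y) \<and> \<kappa> x = density lborel (\<lambda>y. ennreal (f x y)))"

section \<open>Quantile regression and the wild gradient bootstrap\<close>

text \<open>Clusters are \<open>i = 1, 2, \<dots>\<close> and the observations of cluster \<open>i\<close> are \<open>k = 1, \<dots>, c i\<close>. In
  the objective functions, \<open>y\<close>, \<open>x\<close> and \<open>w\<close> are realisations of the data and of the weights.\<close>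

definition rho :: "real \<Rightarrow> real \<Rightarrow> real" where
  "rho \<tau> z = (\<tau> - of_bool (z < 0)) * z"

definition psi :: "real \<Rightarrow> real \<Rightarrow> real" where
  "psi \<tau> z = \<tau> - of_bool (z < 0)"

definition qr_objective ::
    "(nat \<Rightarrow> nat) \<Rightarrow> (nat \<Rightarrow> nat \<Rightarrow> real) \<Rightarrow> (nat \<Rightarrow> nat \<Rightarrow> real ^ 'd) \<Rightarrow> nat \<Rightarrow> real \<Rightarrow> real ^ 'd \<Rightarrow> real" where
  "qr_objective c y x n \<tau> b = (1 / real n) * (\<Sum>i=1..n. \<Sum>k=1..c i. rho \<tau> (y i k - x i k \<bullet> b))"

definition wild_gradient ::
    "(nat \<Rightarrow> nat) \<Rightarrow> (nat \<Rightarrow> real) \<Rightarrow> (nat \<Rightarrow> nat \<Rightarrow> real) \<Rightarrow> (nat \<Rightarrow> nat \<Rightarrow> real ^ 'd) \<Rightarrow>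
      nat \<Rightarrow> real \<Rightarrow> real ^ 'd \<Rightarrow> real ^ 'd" where
  "wild_gradient c w y x n \<tau> b =
     (1 / sqrt (real n)) *\<^sub>R
       (\<Sum>i=1..n. w i *\<^sub>R (\<Sum>k=1..c i. psi \<tau> (y i k - x i k \<bullet> b) *\<^sub>R x i k))"

definition wild_objective ::
    "(nat \<Rightarrow> nat) \<Rightarrow> (nat \<Rightarrow> real) \<Rightarrow> (nat \<Rightarrow> nat \<Rightarrow> real) \<Rightarrow> (nat \<Rightarrow> nat \<Rightarrow> real ^ 'd) \<Rightarrow>
      nat \<Rightarrow> real \<Rightarrow> real ^ 'd \<Rightarrow> real ^ 'd \<Rightarrow> real" where
  "wild_objective c w y x n \<tau> bhat b =
     qr_objective c y x n \<tau> b + (wild_gradient c w y x n \<tau> bhat \<bullet> b) / sqrt (real n)"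

definition J_mat ::
    "'a measure \<Rightarrow> (nat \<Rightarrow> nat) \<Rightarrow> (nat \<Rightarrow> nat \<Rightarrow> 'a \<Rightarrow> real ^ 'd) \<Rightarrow>
      (nat \<Rightarrow> nat \<Rightarrow> real ^ 'd \<Rightarrow> real \<Rightarrow> real) \<Rightarrow> real ^ 'd \<Rightarrow> nat \<Rightarrow> real ^ 'd ^ 'd" where
  "J_mat M c X f \<beta> n =
     (1 / real n) *\<^sub>R (\<Sum>i=1..n. \<Sum>k=1..c i.
        (LINT \<omega>|M. f i k (X i k \<omega>) (X i k \<omega> \<bullet> \<beta>) *\<^sub>R outer_prod (X i k \<omega>) (X i k \<omega>)))"

definition Sigma_mat ::
    "'a measure \<Rightarrow> (nat \<Rightarrow> nat) \<Rightarrow> (nat \<Rightarrow> nat \<Rightarrow> 'a \<Rightarrow> real) \<Rightarrow> (nat \<Rightarrow> nat \<Rightarrow> 'a \<Rightarrow> real ^ 'd) \<Rightarrow>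
      real \<Rightarrow> real ^ 'd \<Rightarrow> real \<Rightarrow> real ^ 'd \<Rightarrow> nat \<Rightarrow> real ^ 'd ^ 'd" where
  "Sigma_mat M c Y X \<tau> \<beta> \<tau>' \<beta>' n =
     (1 / real n) *\<^sub>R (\<Sum>i=1..n. \<Sum>k=1..c i. \<Sum>l=1..c i.
        (LINT \<omega>|M. (psi \<tau> (Y i k \<omega> - X i k \<omega> \<bullet> \<beta>) * psi \<tau>' (Y i l \<omega> - X i l \<omega> \<bullet> \<beta>')) *\<^sub>R
           outer_prod (X i k \<omega>) (X i l \<omega>)))"

text \<open>The data of the clusters in \<open>I\<close>, as one random element of a product space.\<close>

definition data_space ::
    "(nat \<Rightarrow> nat) \<Rightarrow> nat set \<Rightarrow> (nat \<times> nat \<Rightarrow> real \<times> (real ^ 'd)) measure" where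
  "data_space c I = PiM (SIGMA i:I. {1..c i}) (\<lambda>_. borel)"

definition data ::
    "(nat \<Rightarrow> nat) \<Rightarrow> (nat \<Rightarrow> nat \<Rightarrow> 'a \<Rightarrow> real) \<Rightarrow> (nat \<Rightarrow> nat \<Rightarrow> 'a \<Rightarrow> real ^ 'd) \<Rightarrow> nat set \<Rightarrow>
      'a \<Rightarrow> nat \<times> nat \<Rightarrow> real \<times> (real ^ 'd)" where
  "data c Y X I \<omega> = (\<lambda>(i, k)\<in>(SIGMA i:I. {1..c i}). (Y i k \<omega>, X i k \<omega>))"

text \<open>The bootstrap covariance matrix: entrywise conditional expectation, given the data of
  clusters \<open>1, \<dots>, n\<close>, of \<open>n (bstar - bhat) (bstar - bhat)\<^sup>T\<close>.\<close>

definition boot_cov ::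
    "'a measure \<Rightarrow> (nat \<Rightarrow> nat) \<Rightarrow> (nat \<Rightarrow> nat \<Rightarrow> 'a \<Rightarrow> real) \<Rightarrow> (nat \<Rightarrow> nat \<Rightarrow> 'a \<Rightarrow> real ^ 'd) \<Rightarrow>
      nat \<Rightarrow> ('a \<Rightarrow> real ^ 'd) \<Rightarrow> ('a \<Rightarrow> real ^ 'd) \<Rightarrow> 'a \<Rightarrow> real ^ 'd ^ 'd" where
  "boot_cov M c Y X n bstar bhat \<omega> =
     (\<chi> j l. outer_cond_exp M
        (vimage_algebra (space M) (data c Y X {1..n}) (data_space c {1..n}))
        (\<lambda>\<omega>'. (real n *\<^sub>R outer_prod (bstar \<omega>' - bhat \<omega>') (bstar \<omega>' - bhat \<omega>')) $ j $ l) \<omega>)"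

end

theory Submission
  imports Defs
begin

text \<open>With \<open>u = sqrt n (b - \<beta>0)\<close> the centred objective is \<open>H u - G \<bullet> u\<close>, where \<open>G\<close> is the normalised score and
  \<open>H u\<close> is a sum of non-negative convex bumps (Knight's identity). On events depending on the data only
  and of probability close to one, \<open>H\<close> is uniformly close to \<open>u \<bullet> J u / 2\<close> on balls and grows quadratically
  outside a ball, so that the minimiser is \<open>J\<^sup>-\<^sup>1 G\<close> up to a small error.
  The bootstrap objective is \<open>H u - (G - V) \<bullet> u\<close> with the wild gradient \<open>V\<close>; by the quadratic growth its
  minimiser moves by at most a multiple of \<open>1 + norm V\<close>, and as \<open>(norm V)\<^sup>2\<close> is uniformly integrable, the
  difference of the two estimators is \<open>- J\<^sup>-\<^sup>1 V\<close> up to an error that is small in mean square. Its conditional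
  covariance given the data is therefore close to \<open>J\<^sup>-\<^sup>1 \<Sigma> J\<^sup>-\<^sup>1\<close>, the asymptotic covariance of the estimator.
  Hence the squared statistic is, under the null hypothesis, a small perturbation of the squared norm of a whitened
  score. Its Laplace transform is a Gaussian average of the characteristic function of the score, so it
  converges to that of the chi-square law, which determines weak convergence on the half line.\<close>

text \<open>The conditional covariance is a second moment, so linearising the bootstrap estimator in
  probability is not enough: the error must be small in mean square, also where the weights are
  large. Hence the growth bound has to reach radii of order \<open>sqrt n\<close>, the size of the
  rescaled parameter set. There the minimiser is still controlled linearly by its gradient, and only
  uniform integrability of the squared gradient remains. An event can be pulled out of a conditional
  expectation given the data only if it belongs to the data; this is why \<open>hp\<close> carries a
  sigma-algebra. Off such an event nothing is needed, since the covariance only has to converge in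
  probability. The estimators may be non-measurable, so they are compared with measurable linear
  statistics up to measurable dominating errors. Moments of order \<open>q\<close> are lowered to
  \<open>p = min q 3\<close>, because then
  \<open>min (x\<^sup>2) (\<bar>x\<bar> ^ 3) <= \<bar>x\<bar> powr p\<close>, which serves both the
  expansion of the objective and that of the characteristic function.\<close>

section \<open>Knight's identity and its convex remainder\<close>

definition bump :: "real \<Rightarrow> real \<Rightarrow> real" where
  "bump e v = (if 0 \<le> e then max 0 (v - e) else max 0 (e - v))"

text \<open>Knight's identity. The remainder \<open>bump e v\<close> is the integral over
  \<open>s\<close> from 0 to \<open>v\<close> of \<open>of_bool (e < s) - of_bool (e < 0)\<close>,
  written out case by case.\<close>

lemma rho_bump: "rho \<tau> (e - v) = rho \<tau> e - v * psi \<tau> e + bump e v"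
  unfolding rho_def psi_def bump_def by (auto simp: of_bool_def max_def algebra_simps)

lemma bump_nonneg [simp]: "0 \<le> bump e v"
  unfolding bump_def by auto

lemma bump_le: "bump e v \<le> \<bar>v\<bar>"
  unfolding bump_def by auto

lemma bump_0 [simp]: "bump e 0 = 0"
  unfolding bump_def by auto

text \<open>Convexity in \<open>v\<close> and the value 0 at \<open>v = 0\<close>. Summed over the
  observations, this lets a lower bound for \<open>H\<close> on a sphere spread outwards along
  rays.\<close>

lemma bump_scale:
  assumes "0 \<le> t" "t \<le> 1"
  shows "bump e (t * v) \<le> t * bump e v"
proof (cases "0 \<le> e")
  case True
  have "t * v - e \<le> t * (v - e)" using assms True mult_left_le_one_le[of e t] by (simp add: algebra_simps)
  also have "\<dots> \<le> t * max 0 (v - e)" using assms by (intro mult_left_mono) auto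
  finally show ?thesis using True assms by (simp add: bump_def)
next
  case False
  have "t * e - e \<ge> 0" using mult_right_mono_neg[of t 1 e] assms False by simp
  then have "e - t * v \<le> t * (e - v)" by (simp add: algebra_simps)
  also have "\<dots> \<le> t * max 0 (e - v)" using assms by (intro mult_left_mono) auto
  finally show ?thesis using False assms by (simp add: bump_def)
qed

text \<open>For \<open>\<bar>e\<bar> > a\<close> both bumps vanish. The indicator is the gain over a
  plain Lipschitz bound: few residuals fall into the band, since the conditional densities are
  bounded.\<close>

lemma bump_lipschitz:
  assumes "\<bar>v\<bar> \<le> a" "\<bar>v'\<bar> \<le> a"
  shows "\<bar>bump e v - bump e v'\<bar> \<le> \<bar>v - v'\<bar> * of_bool (\<bar>e\<bar> \<le> a)"
  using assms unfolding bump_def by (auto simp: of_bool_def)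

text \<open>The two values differ only if zero separates the two residuals, and then neither is
  further from zero than they are from each other.\<close>

lemma psi_lipschitz: "\<bar>psi \<tau> (e - v) - psi \<tau> (e - v')\<bar> \<le> of_bool (\<bar>e - v'\<bar> \<le> \<bar>v - v'\<bar>)"
  unfolding psi_def by (auto simp: of_bool_def)

lemma abs_psi_le_1: "0 < \<tau> \<Longrightarrow> \<tau> < 1 \<Longrightarrow> \<bar>psi \<tau> z\<bar> \<le> 1"
  unfolding psi_def by (auto simp: of_bool_def)

lemma measurable_bump [measurable]:
  "f \<in> borel_measurable N \<Longrightarrow> g \<in> borel_measurable N \<Longrightarrow> (\<lambda>x. bump (f x) (g x)) \<in> borel_measurable N"
  unfolding bump_def by simp

lemma measurable_psi [measurable]:
  "f \<in> borel_measurable N \<Longrightarrow> (\<lambda>x. psi \<tau> (f x)) \<in> borel_measurable N"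
  unfolding psi_def of_bool_def by measurable

section \<open>A soft truncation for sums\<close>

text \<open>The signed distance of \<open>s\<close> to the interval \<open>{-w..w}\<close>. Its
  square dominates the tail of \<open>s\<^sup>2\<close> beyond \<open>2 * w\<close> up to a factor
  4, but unlike an indicator it admits a second-order expansion, so that independent summands can be
  added one at a time.\<close>

definition clamp_excess :: "real \<Rightarrow> real \<Rightarrow> real" where
  "clamp_excess w s = s - max (- w) (min w s)"

text \<open>The square of \<^term>\<open>clamp_excess w s\<close> is the squared distance of \<open>s\<close> to \<open>{-w..w}\<close>; testing it
  against the projection of \<open>s\<close> gives the bound.\<close>

lemma clamp_excess_add:
  assumes "0 \<le> w"
  shows "(clamp_excess w (s + y))\<^sup>2 \<le> (clamp_excess w s)\<^sup>2 + 2 * clamp_excess w s * y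
           + y\<^sup>2 * (of_bool (w / 2 < \<bar>s\<bar>) + of_bool (w / 2 < \<bar>y\<bar>))"
proof (cases "\<bar>s\<bar> + \<bar>y\<bar> \<le> w")
  case True
  then have "clamp_excess w (s + y) = 0" "clamp_excess w s = 0"
    unfolding clamp_excess_def using assms by (auto simp: max_def min_def)
  then show ?thesis by simp
next
  case False
  have "\<bar>clamp_excess w (s + y)\<bar> \<le> \<bar>clamp_excess w s + y\<bar>"
    unfolding clamp_excess_def using assms by (auto simp: max_def min_def)
  then have "(clamp_excess w (s + y))\<^sup>2 \<le> (clamp_excess w s + y)\<^sup>2"
    by (simp add: abs_le_square_iff)
  also have "\<dots> = (clamp_excess w s)\<^sup>2 + 2 * clamp_excess w s * y + y\<^sup>2"
    by (simp add: power2_eq_square algebra_simps)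
  also have "y\<^sup>2 \<le> y\<^sup>2 * (of_bool (w / 2 < \<bar>s\<bar>) + of_bool (w / 2 < \<bar>y\<bar>))"
    using False by (auto simp: of_bool_def)
  finally show ?thesis by simp
qed

lemma clamp_excess_bounds:
  assumes "0 \<le> w"
  shows "\<bar>clamp_excess w s\<bar> \<le> \<bar>s\<bar>" "s\<^sup>2 * of_bool (2 * w < \<bar>s\<bar>) \<le> 4 * (clamp_excess w s)\<^sup>2"
proof -
  show "\<bar>clamp_excess w s\<bar> \<le> \<bar>s\<bar>"
    unfolding clamp_excess_def using assms by (auto simp: max_def min_def)
  have "\<bar>s\<bar> \<le> \<bar>2 * clamp_excess w s\<bar>" if "2 * w < \<bar>s\<bar>"
    unfolding clamp_excess_def using assms that by (auto simp: max_def min_def)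
  then show "s\<^sup>2 * of_bool (2 * w < \<bar>s\<bar>) \<le> 4 * (clamp_excess w s)\<^sup>2"
    unfolding abs_le_square_iff by (auto simp: power_mult_distrib)
qed

lemma measurable_clamp_excess [measurable]: "clamp_excess w \<in> borel_measurable borel"
  unfolding clamp_excess_def by measurable

lemma finite_net_ball:
  assumes "0 < \<delta>" "0 \<le> s"
  obtains F :: "'a::euclidean_space set"
  where "finite F" "F \<subseteq> cball 0 s" "\<And>u. norm u \<le> s \<Longrightarrow> \<exists>f\<in>F. norm (u - f) \<le> \<delta>"
proof -
  obtain F where "finite F" "F \<subseteq> cball (0::'a) s" "cball (0::'a) s \<subseteq> (\<Union>x\<in>F. ball x \<delta>)"
    using seq_compact_imp_totally_bounded[of "cball (0::'a) s"] assms
    by (metis compact_cball compact_imp_seq_compact)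
  then show ?thesis
    by (intro that[of F]) (auto simp: subset_iff dist_norm norm_minus_commute intro!: less_imp_le)
qed

section \<open>Matrices\<close>

lemma symmetric_adjoint:
  fixes A :: "real ^ 'n ^ 'n"
  assumes "transpose A = A"
  shows "(A *v x) \<bullet> y = x \<bullet> (A *v y)"
  by (metis assms dot_lmul_matrix transpose_matrix_vector)

text \<open>The quadratic form attains its minimum on the unit sphere, and the first-order condition
  at a minimiser, tested in an arbitrary direction \<open>w\<close>, is the eigenvalue
  equation.\<close>

lemma quad_form_minimum:
  fixes A :: "real ^ 'n ^ 'n"
  assumes sym: "transpose A = A"
  obtains v l where "norm v = 1" "A *v v = l *\<^sub>R v" "\<And>x. l * (norm x)\<^sup>2 \<le> x \<bullet> (A *v x)"
proof -
  have ne: "sphere (0::real^'n) 1 \<noteq> {}" by simp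
  have "continuous_on (sphere 0 1) (\<lambda>x. x \<bullet> (A *v x))"
    by (intro continuous_intros linear_continuous_on) (auto simp: linear_linear)
  then obtain v where v: "v \<in> sphere 0 1" "\<And>x. x \<in> sphere 0 1 \<Longrightarrow> v \<bullet> (A *v v) \<le> x \<bullet> (A *v x)"
    using continuous_attains_inf[OF compact_sphere ne] by blast
  define l where "l = v \<bullet> (A *v v)"
  have nv: "norm v = 1" using v(1) by simp
  have min: "l * (norm x)\<^sup>2 \<le> x \<bullet> (A *v x)" for x
  proof (cases "x = 0")
    case False
    have "l \<le> (x /\<^sub>R norm x) \<bullet> (A *v (x /\<^sub>R norm x))"
      unfolding l_def using False by (intro v(2)) simp
    also have "\<dots> = (x \<bullet> (A *v x)) / (norm x)\<^sup>2"
      by (simp add: matrix_vector_mult_scaleR power2_eq_square divide_inverse)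
    finally show ?thesis using False by (simp add: pos_le_divide_eq)
  qed simp
  have adj: "x \<bullet> (A *v y) = y \<bullet> (A *v x)" for x y
    using symmetric_adjoint[OF sym, of y x] by (simp add: inner_commute)
  have "w \<bullet> (A *v v - l *\<^sub>R v) = 0" for w
  proof -
    define a where "a = w \<bullet> (A *v v - l *\<^sub>R v)"
    define b where "b = w \<bullet> (A *v w) - l * (norm w)\<^sup>2"
    have q: "0 \<le> 2 * t * a + t\<^sup>2 * b" for t
    proof -
      have "0 \<le> (v + t *\<^sub>R w) \<bullet> (A *v (v + t *\<^sub>R w)) - l * (norm (v + t *\<^sub>R w))\<^sup>2"
        using min[of "v + t *\<^sub>R w"] by simp
      also have "\<dots> = v \<bullet> (A *v v) - l * (norm v)\<^sup>2 + 2 * t * a + t\<^sup>2 * b"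
        using adj[of v w] unfolding a_def b_def power2_norm_eq_inner
        by (simp add: matrix_vector_right_distrib matrix_vector_mult_scaleR inner_simps
            power2_eq_square algebra_simps inner_commute)
      finally show ?thesis by (simp add: l_def nv)
    qed
    have b: "0 \<le> b" using min[of w] by (simp add: b_def)
    show "a = 0"
    proof (rule ccontr)
      assume a: "a \<noteq> 0"
      \<comment> \<open>The minimiser of \<open>2 * t * a + t\<^sup>2 * (b + 1)\<close>; the
        \<open>+ 1\<close> avoids a division by zero when \<open>b = 0\<close>.\<close>
      define t where "t = - a / (b + 1)"
      have "2 * t * a + t\<^sup>2 * (b + 1) = - (a\<^sup>2 / (b + 1))"
        unfolding t_def using b by (simp add: power2_eq_square)
      moreover have "0 < a\<^sup>2 / (b + 1)" using a b by simp
      moreover have "t\<^sup>2 * b \<le> t\<^sup>2 * (b + 1)" by (intro mult_left_mono) auto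
      ultimately show False using q[of t] by simp
    qed
  qed
  then have "A *v v = l *\<^sub>R v" by (metis eq_iff_diff_eq_0 inner_eq_zero_iff)
  then show ?thesis using that nv min by blast
qed

text \<open>\<open>Min\<close> is meaningful only for a finite set. Eigenvectors of distinct
  eigenvalues of a symmetric matrix are orthogonal, so choosing one per eigenvalue gives a finite
  family.\<close>

lemma quad_form_ge_min_eigenvalue:
  fixes A :: "real ^ 'n ^ 'n"
  assumes sym: "transpose A = A"
  shows "min_eigenvalue A * (norm x)\<^sup>2 \<le> x \<bullet> (A *v x)"
proof -
  define L where "L = {l. \<exists>v. v \<noteq> 0 \<and> A *v v = l *\<^sub>R v}"
  obtain v l where v: "norm v = 1" "A *v v = l *\<^sub>R v" "\<And>x. l * (norm x)\<^sup>2 \<le> x \<bullet> (A *v x)"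
    using quad_form_minimum[OF sym] by blast
  have adj: "x \<bullet> (A *v y) = y \<bullet> (A *v x)" for x y
    using symmetric_adjoint[OF sym, of y x] by (simp add: inner_commute)
  define e where "e = (\<lambda>l. SOME v. v \<noteq> 0 \<and> A *v v = l *\<^sub>R v)"
  have e: "e l \<noteq> 0" "A *v e l = l *\<^sub>R e l" if "l \<in> L" for l
    using someI_ex[of "\<lambda>v. v \<noteq> 0 \<and> A *v v = l *\<^sub>R v"] that unfolding L_def e_def by auto
  have inj: "inj_on e L"
    by (rule inj_onI) (metis e scaleR_cancel_right)
  have "pairwise orthogonal (e ` L)"
  proof (clarsimp simp: pairwise_def orthogonal_def)
    fix l m assume "l \<in> L" "m \<in> L" "e l \<noteq> e m"
    then have "l * (e l \<bullet> e m) = m * (e l \<bullet> e m)"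
      using adj[of "e l" "e m"] e by (auto simp: inner_commute)
    moreover have "l \<noteq> m" using \<open>e l \<noteq> e m\<close> by blast
    ultimately show "e l \<bullet> e m = 0" by simp
  qed
  then have "finite (e ` L)" by (rule pairwise_orthogonal_imp_finite)
  then have "finite L" using inj by (rule finite_imageD)
  moreover have "l \<in> L" unfolding L_def using v(1,2) by (auto intro!: exI[of _ v])
  ultimately have "min_eigenvalue A \<le> l" unfolding min_eigenvalue_def L_def[symmetric] by simp
  then show ?thesis using v(3)[of x] by (smt (verit) mult_right_mono zero_le_power2)
qed

lemma transpose_eqI:
  fixes A :: "real ^ 'n ^ 'n"
  assumes "\<And>x y. (A *v x) \<bullet> y = x \<bullet> (A *v y)"
  shows "transpose A = A"
proof -
  have "A $ i $ j = A $ j $ i" for i j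
    using assms[of "axis j 1" "axis i 1"] by (simp add: inner_axis' inner_axis matrix_vector_mul_component)
  then show ?thesis by (simp add: transpose_def vec_eq_iff)
qed

lemma pos_def_invertible:
  fixes A :: "real ^ 'n ^ 'n"
  assumes "\<And>x. x \<noteq> 0 \<Longrightarrow> 0 < x \<bullet> (A *v x)"
  shows "invertible A"
  unfolding invertible_left_inverse matrix_left_invertible_ker
  using assms by (metis inner_zero_right less_irrefl)

lemma pos_def_coercive:
  fixes A :: "real ^ 'n ^ 'n"
  assumes "transpose A = A" "\<And>x. x \<noteq> 0 \<Longrightarrow> 0 < x \<bullet> (A *v x)"
  obtains l where "0 < l" "\<And>x. l * (norm x)\<^sup>2 \<le> x \<bullet> (A *v x)"
proof -
  obtain v l where v: "norm v = 1" "A *v v = l *\<^sub>R v" "\<And>x. l * (norm x)\<^sup>2 \<le> x \<bullet> (A *v x)"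
    using quad_form_minimum[OF assms(1)] by blast
  have "0 < v \<bullet> (A *v v)" using v(1) by (intro assms(2)) auto
  then have "0 < l" using v(1,2) by (simp add: power2_norm_eq_inner[symmetric])
  then show ?thesis using v(3) by (rule that)
qed

lemma matrix_inv_mult:
  fixes A :: "real ^ 'n ^ 'n"
  assumes "invertible A"
  shows "A ** matrix_inv A = mat 1" "matrix_inv A ** A = mat 1"
  using someI_ex[OF assms[unfolded invertible_def]] unfolding matrix_inv_def by auto

lemma matrix_inv_vec:
  fixes A :: "real ^ 'n ^ 'n"
  assumes "invertible A"
  shows "A *v (matrix_inv A *v x) = x" "matrix_inv A *v (A *v x) = x"
  by (simp_all add: matrix_vector_mul_assoc matrix_inv_mult assms)

lemma matrix_inv_symmetric:
  fixes A :: "real ^ 'n ^ 'n"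
  assumes "transpose A = A" "invertible A"
  shows "transpose (matrix_inv A) = matrix_inv A"
proof (rule transpose_eqI)
  fix x y
  show "(matrix_inv A *v x) \<bullet> y = x \<bullet> (matrix_inv A *v y)"
    using symmetric_adjoint[OF assms(1), of "matrix_inv A *v x" "matrix_inv A *v y"]
    by (simp add: matrix_inv_vec assms(2))
qed

lemma coercive_inv_norm:
  fixes A :: "real ^ 'n ^ 'n"
  assumes "0 < l" "\<And>x. l * (norm x)\<^sup>2 \<le> x \<bullet> (A *v x)" "A *v y = x"
  shows "norm y \<le> norm x / l"
proof -
  have "l * norm y * norm y \<le> norm y * norm x"
    using assms(2)[of y] norm_cauchy_schwarz[of y x] assms(3) by (simp add: power2_eq_square)
  then have "l * norm y \<le> norm x" by (cases "y = 0") auto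
  then show ?thesis using assms(1) by (simp add: field_simps)
qed

lemma symmetric_matrix_of_blinfun:
  fixes Y :: "(real ^ 'n) \<Rightarrow>\<^sub>L (real ^ 'n)"
  assumes "\<forall>x y. Y x \<bullet> y = x \<bullet> Y y"
  shows "transpose (matrix (blinfun_apply Y)) = matrix (blinfun_apply Y)"
  by (rule transpose_eqI) (use assms in \<open>simp add: matrix_works bounded_linear.linear[OF blinfun.bounded_linear_right]\<close>)

text \<open>For \<open>A = L (I - E)\<close> with \<open>norm E < 1\<close>, the map \<open>Y \<mapsto> (E + Y\<^sup>2) / 2\<close> is a contraction, and its
  fixed point satisfies \<open>(I - Y)\<^sup>2 = I - E\<close>.\<close>

lemma pos_def_sqrt_blinfun:
  fixes A :: "'a::euclidean_space \<Rightarrow>\<^sub>L 'a"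
  assumes sym: "\<And>x y. A x \<bullet> y = x \<bullet> A y"
    and l: "0 < l" "\<And>x. l * (norm x)\<^sup>2 \<le> x \<bullet> A x"
  obtains S where "\<And>x y. blinfun_apply S x \<bullet> y = x \<bullet> S y" "\<And>x. 0 \<le> x \<bullet> S x" "S o\<^sub>L S = A"
proof -
  \<comment> \<open>\<open>L\<close> exceeds the norm of \<open>A\<close>, so that \<open>E\<close>
    is positive semidefinite and its form is at most \<open>e\<close> times the identity, with
    \<open>e < 1\<close>.\<close>
  define L where "L = norm A + l"
  have L: "0 < L" "l \<le> L" using l(1) norm_ge_zero[of A] unfolding L_def by linarith+
  define E where "E = id_blinfun - A /\<^sub>R L"
  have Esym: "E x \<bullet> y = x \<bullet> E y" for x y
    by (simp add: E_def blinfun.diff_left blinfun.scaleR_left inner_simps sym)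
  define e where "e = 1 - l / L"
  have e: "0 \<le> e" "e < 1" using L l(1) by (auto simp: e_def field_simps)
  have Ax: "x \<bullet> A x \<le> L * (norm x)\<^sup>2" for x
  proof -
    have "x \<bullet> A x \<le> norm x * (norm A * norm x)"
      using norm_cauchy_schwarz[of x "A x"] mult_left_mono[OF norm_blinfun[of A x], of "norm x"] by simp
    also have "\<dots> \<le> L * (norm x)\<^sup>2" using l(1) by (simp add: L_def power2_eq_square algebra_simps)
    finally show ?thesis .
  qed
  have qE: "0 \<le> x \<bullet> E x" "x \<bullet> E x \<le> e * (norm x)\<^sup>2" for x
    using Ax[of x] l(2)[of x] L
    by (simp_all add: E_def e_def blinfun.diff_left blinfun.scaleR_left inner_simps power2_norm_eq_inner field_simps)
  have nE: "norm E \<le> e"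
  proof (rule norm_blinfun_bound[OF e(1)])
    fix x
    \<comment> \<open>Cauchy-Schwarz for the semidefinite form of \<open>E\<close>, by
      non-negativity of a quadratic polynomial in \<open>t\<close>. Applied to \<open>E x\<close>
      and \<open>x\<close>, it bounds the operator norm of \<open>E\<close> by its form.\<close>
    have cs: "(x \<bullet> E y)\<^sup>2 \<le> (x \<bullet> E x) * (y \<bullet> E y)" for x y
    proof -
      have q: "0 \<le> (x \<bullet> E x) * t\<^sup>2 + 2 * t * (x \<bullet> E y) + y \<bullet> E y" for t
      proof -
        have "0 \<le> (t *\<^sub>R x + y) \<bullet> E (t *\<^sub>R x + y)" by (rule qE)
        also have "\<dots> = (x \<bullet> E x) * t\<^sup>2 + 2 * t * (x \<bullet> E y) + y \<bullet> E y"
          using Esym[of x y] by (simp add: blinfun.add_right blinfun.scaleR_right inner_simps inner_commute power2_eq_square algebra_simps)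
        finally show ?thesis .
      qed
      show ?thesis
      proof (cases "x \<bullet> E x = 0")
        case True
        have "x \<bullet> E y = 0"
        proof (rule ccontr)
          assume a: "x \<bullet> E y \<noteq> 0"
          show False using q[of "- (y \<bullet> E y + 1) / (2 * (x \<bullet> E y))"] True a by (simp add: field_simps)
        qed
        then show ?thesis using True by simp
      next
        case False
        then have p: "0 < x \<bullet> E x" using qE(1)[of x] by simp
        show ?thesis using q[of "- (x \<bullet> E y) / (x \<bullet> E x)"] p
          by (simp add: field_simps power2_eq_square)
      qed
    qed
    have "(norm (E x))\<^sup>2 * (norm (E x))\<^sup>2 = (E x \<bullet> E x)\<^sup>2"
      by (simp only: power2_norm_eq_inner) (simp add: power2_eq_square)
    also have "\<dots> \<le> (E x \<bullet> E (E x)) * (x \<bullet> E x)" by (rule cs)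
    also have "\<dots> \<le> (e * (norm (E x))\<^sup>2) * (e * (norm x)\<^sup>2)"
      using qE e by (intro mult_mono) auto
    finally have "(norm (E x))\<^sup>2 * (norm (E x))\<^sup>2 \<le> (norm (E x))\<^sup>2 * (e * norm x)\<^sup>2"
      by (simp only: power_mult_distrib power2_eq_square ac_simps)
    then have "(norm (E x))\<^sup>2 \<le> (e * norm x)\<^sup>2 \<or> E x = 0"
      by (cases "E x = 0") (simp_all only: mult_le_cancel_left_pos zero_less_power2 norm_eq_zero simp_thms)
    then show "norm (E x) \<le> e * norm x"
      using e by (auto intro: power2_le_imp_le)
  qed
  \<comment> \<open>The smaller root of \<open>r = (e + r\<^sup>2) / 2\<close>: the map then sends
    the ball of radius \<open>r\<close> into itself and contracts it with factor
    \<open>r < 1\<close>.\<close>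
  define r where "r = 1 - sqrt (1 - e)"
  have r: "0 \<le> r" "r < 1" "(e + r\<^sup>2) / 2 = r"
    using e by (auto simp: r_def power2_eq_square field_simps)
  define K where "K = {Y :: 'a \<Rightarrow>\<^sub>L 'a. norm Y \<le> r \<and> (\<forall>x y. blinfun_apply Y x \<bullet> y = x \<bullet> blinfun_apply Y y)}"
  define f where "f = (\<lambda>Y :: 'a \<Rightarrow>\<^sub>L 'a. (E + (Y o\<^sub>L Y)) /\<^sub>R 2)"
  have "closed {Y :: 'a \<Rightarrow>\<^sub>L 'a. \<forall>x y. blinfun_apply Y x \<bullet> y = x \<bullet> blinfun_apply Y y}"
    by (intro closed_Collect_all closed_Collect_eq continuous_intros)
  then have "closed K"
    unfolding K_def by (intro closed_Collect_conj closed_Collect_le continuous_intros)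
  moreover have "K \<noteq> {}" using r(1) by (auto simp: K_def intro!: exI[of _ 0])
  moreover have "f ` K \<subseteq> K"
  proof (rule image_subsetI)
    fix Y assume Y: "Y \<in> K"
    have "norm (Y o\<^sub>L Y) \<le> r * r"
      using norm_blinfun_compose[of Y Y] mult_mono[of "norm Y" r "norm Y" r] Y r unfolding K_def by auto
    then have "norm (E + (Y o\<^sub>L Y)) \<le> e + r\<^sup>2"
      using nE norm_triangle_ineq[of E "Y o\<^sub>L Y"] by (simp add: power2_eq_square)
    then have "norm (f Y) \<le> r" using r by (simp add: f_def)
    moreover have "f Y x \<bullet> y = x \<bullet> f Y y" for x y
    proof -
      have "Y (Y x) \<bullet> y = x \<bullet> Y (Y y)" using Y by (auto simp: K_def)
      then show ?thesis
        by (simp add: f_def blinfun.scaleR_left blinfun.add_left inner_simps Esym)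
    qed
    ultimately show "f Y \<in> K" by (simp add: K_def)
  qed
  moreover have "dist (f Y) (f Z) \<le> r * dist Y Z" if "Y \<in> K" "Z \<in> K" for Y Z
  proof -
    have "(Y o\<^sub>L Y) - (Z o\<^sub>L Z) = (Y o\<^sub>L (Y - Z)) + ((Y - Z) o\<^sub>L Z)"
      by (rule blinfun_eqI) (simp add: blinfun.diff_left blinfun.diff_right blinfun.add_left)
    moreover have "norm (Y o\<^sub>L (Y - Z)) \<le> r * norm (Y - Z)"
      using norm_blinfun_compose[of Y "Y - Z"] that mult_right_mono[of "norm Y" r "norm (Y - Z)"]
      by (auto simp: K_def)
    moreover have "norm ((Y - Z) o\<^sub>L Z) \<le> r * norm (Y - Z)"
      using norm_blinfun_compose[of "Y - Z" Z] that mult_right_mono[of "norm Z" r "norm (Y - Z)"]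
      by (auto simp: K_def mult.commute)
    ultimately have "norm ((Y o\<^sub>L Y) - (Z o\<^sub>L Z)) \<le> 2 * r * norm (Y - Z)"
      using norm_triangle_ineq[of "Y o\<^sub>L (Y - Z)" "(Y - Z) o\<^sub>L Z"] by simp
    moreover have "f Y - f Z = ((Y o\<^sub>L Y) - (Z o\<^sub>L Z)) /\<^sub>R 2"
      by (simp add: f_def algebra_simps)
    ultimately show ?thesis by (simp add: dist_norm)
  qed
  ultimately obtain Y where Y: "Y \<in> K" "f Y = Y"
    using Banach_fix[of K r f] r by (auto simp: complete_eq_closed)
  define S where "S = sqrt L *\<^sub>R (id_blinfun - Y)"
  have "S x \<bullet> y = x \<bullet> S y" for x y
    using Y(1) by (simp add: S_def K_def blinfun.diff_left blinfun.scaleR_left inner_simps)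
  moreover have "0 \<le> x \<bullet> S x" for x
  proof -
    have "x \<bullet> Y x \<le> norm x * (norm Y * norm x)"
      using norm_cauchy_schwarz[of x "Y x"] mult_left_mono[OF norm_blinfun[of Y x], of "norm x"] by simp
    also have "\<dots> \<le> norm x * (1 * norm x)"
      using Y(1) r by (intro mult_left_mono mult_right_mono) (auto simp: K_def)
    finally show ?thesis
      using L by (simp add: S_def blinfun.diff_left blinfun.scaleR_left inner_simps
          power2_norm_eq_inner[symmetric] power2_eq_square)
  qed
  moreover have "S o\<^sub>L S = A"
  proof (rule blinfun_eqI)
    fix x
    have "2 *\<^sub>R ((E + (Y o\<^sub>L Y)) /\<^sub>R 2) = 2 *\<^sub>R Y" using Y(2) by (simp add: f_def)
    then have "(E + (Y o\<^sub>L Y)) = 2 *\<^sub>R Y" by simp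
    then have "E x + Y (Y x) = 2 *\<^sub>R Y x"
      by (metis (no_types, lifting) \<open>(E + (Y o\<^sub>L Y)) = 2 *\<^sub>R Y\<close> blinfun.add_left blinfun.scaleR_left
          blinfun_apply_blinfun_compose)
    then have "x - 2 *\<^sub>R Y x + Y (Y x) = A x /\<^sub>R L"
      by (simp add: E_def blinfun.diff_left blinfun.scaleR_left algebra_simps)
    then have "L *\<^sub>R (x - 2 *\<^sub>R Y x + Y (Y x)) = A x" using L by simp
    moreover have "S (S x) = L *\<^sub>R (x - 2 *\<^sub>R Y x + Y (Y x))"
      using L by (simp add: S_def blinfun.diff_left blinfun.diff_right blinfun.scaleR_left blinfun.scaleR_right
          algebra_simps scaleR_2)
    ultimately show "(S o\<^sub>L S) x = A x" by simp
  qed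
  ultimately show ?thesis by (rule that)
qed

text \<open>The test statistic is pinned down only where an inverse square root exists, so existence
  has to be proved. It is the square root of the inverse.\<close>

lemma pos_def_inv_sqrt:
  fixes A :: "real ^ 'n ^ 'n"
  assumes sym: "transpose A = A" and pd: "\<And>x. x \<noteq> 0 \<Longrightarrow> 0 < x \<bullet> (A *v x)"
  obtains S where "is_inv_sqrt A S"
proof -
  define B where "B = matrix_inv A"
  have inv: "invertible A" using pd by (rule pos_def_invertible)
  have Bsym: "transpose B = B" unfolding B_def using sym inv by (rule matrix_inv_symmetric)
  have "0 < x \<bullet> (B *v x)" if "x \<noteq> 0" for x
  proof -
    have "A *v (B *v x) = x" by (simp add: B_def matrix_inv_vec inv)
    moreover from this have "B *v x \<noteq> 0" using that by auto
    ultimately show ?thesis using pd[of "B *v x"] by (simp add: inner_commute)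
  qed
  then obtain l where l: "0 < l" "\<And>x. l * (norm x)\<^sup>2 \<le> x \<bullet> (B *v x)"
    using pos_def_coercive[OF Bsym] by blast
  define Bl where "Bl = Blinfun (\<lambda>x. B *v x)"
  have Bl: "blinfun_apply Bl = (\<lambda>x. B *v x)"
    unfolding Bl_def by (intro bounded_linear_Blinfun_apply matrix_vector_mul_bounded_linear)
  obtain S where S: "\<And>x y. blinfun_apply S x \<bullet> y = x \<bullet> S y" "\<And>x. 0 \<le> x \<bullet> S x" "S o\<^sub>L S = Bl"
    using pos_def_sqrt_blinfun[of Bl l] l symmetric_adjoint[OF Bsym] unfolding Bl by blast
  define T where "T = matrix (blinfun_apply S)"
  have T: "T *v x = S x" for x by (simp add: T_def matrix_works bounded_linear.linear[OF blinfun.bounded_linear_right])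
  have "T ** T = B"
    unfolding matrix_eq using S(3) Bl by (metis T blinfun_apply_blinfun_compose matrix_vector_mul_assoc)
  then have "is_inv_sqrt A T"
    unfolding is_inv_sqrt_def B_def[symmetric] using inv S(1,2)
    by (auto simp: T) (auto simp: T_def intro!: symmetric_matrix_of_blinfun)
  then show ?thesis by (rule that)
qed

section \<open>Events of high probability\<close>

text \<open>A lower bound for the inner probability of \<open>P\<close>, which need not be
  measurable. The witnessing event is taken from \<open>F\<close> so that statements about the data
  alone can be used inside conditional expectations given the data.\<close>

definition hp :: "'a measure \<Rightarrow> 'a measure \<Rightarrow> real \<Rightarrow> ('a \<Rightarrow> bool) \<Rightarrow> bool" where
  "hp M F \<eta> P \<longleftrightarrow> (\<exists>A\<in>sets F. 1 - \<eta> \<le> measure M A \<and> (\<forall>\<xi>\<in>A. P \<xi>))"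

lemma hp_mono:
  assumes "hp M F \<eta> P" "\<eta> \<le> \<eta>'" "space F = space M" "\<And>\<xi>. \<xi> \<in> space M \<Longrightarrow> P \<xi> \<Longrightarrow> Q \<xi>"
  shows "hp M F \<eta>' Q"
proof -
  from assms(1) obtain A where "A \<in> sets F" "1 - \<eta> \<le> measure M A" "\<forall>\<xi>\<in>A. P \<xi>"
    unfolding hp_def by blast
  with assms(2-4) sets.sets_into_space[of A F] show ?thesis
    unfolding hp_def by (intro bexI[of _ A]) auto
qed

lemma hp_subalgebra: "hp M F \<eta> P \<Longrightarrow> subalgebra M F \<Longrightarrow> hp M M \<eta> P"
  unfolding hp_def subalgebra_def by blast

context prob_space
begin

lemma subalgebra_refl: "subalgebra M M" by (simp add: subalgebra_def)

lemma hp_conj: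
  assumes F: "subalgebra M F" and "hp M F \<eta> P" "hp M F \<eta>' Q"
  shows "hp M F (\<eta> + \<eta>') (\<lambda>\<xi>. P \<xi> \<and> Q \<xi>)"
proof -
  obtain A B where A: "A \<in> sets F" "1 - \<eta> \<le> prob A" "\<forall>\<xi>\<in>A. P \<xi>"
    and B: "B \<in> sets F" "1 - \<eta>' \<le> prob B" "\<forall>\<xi>\<in>B. Q \<xi>"
    using assms(2,3) unfolding hp_def by blast
  have ev: "A \<in> events" "B \<in> events" using A B F unfolding subalgebra_def by auto
  have "prob (A \<union> B) = prob A + prob B - prob (A \<inter> B)"
    using ev by (intro measure_Un3) (auto simp: fmeasurable_eq_sets)
  then have "1 - (\<eta> + \<eta>') \<le> prob (A \<inter> B)" using A(2) B(2) prob_le_1[of "A \<union> B"] by linarith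
  then show ?thesis unfolding hp_def using A B by (intro bexI[of _ "A \<inter> B"]) auto
qed

lemma hp_ball:
  assumes F: "subalgebra M F" and "finite I" "\<And>i. i \<in> I \<Longrightarrow> hp M F (\<eta> i) (P i)"
  shows "hp M F (\<Sum>i\<in>I. \<eta> i) (\<lambda>\<xi>. \<forall>i\<in>I. P i \<xi>)"
  using assms(2,3)
proof (induction I rule: finite_induct)
  case empty
  have "space F \<in> sets F" by simp
  moreover have "prob (space F) = 1" using F by (simp add: subalgebra_def prob_space)
  ultimately show ?case unfolding hp_def by (intro bexI[of _ "space F"]) auto
next
  case (insert i I)
  then have "hp M F (\<eta> i + (\<Sum>i\<in>I. \<eta> i)) (\<lambda>\<xi>. P i \<xi> \<and> (\<forall>i\<in>I. P i \<xi>))"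
    using F by (intro hp_conj) auto
  with insert show ?case by simp
qed

lemma hp_measurable:
  assumes F: "subalgebra M F" and P: "{\<xi>\<in>space M. P \<xi>} \<in> sets F" and "prob {\<xi>\<in>space M. \<not> P \<xi>} \<le> \<eta>"
  shows "hp M F \<eta> P"
proof -
  have ev: "{\<xi>\<in>space M. P \<xi>} \<in> events" using P F unfolding subalgebra_def by auto
  have "{\<xi>\<in>space M. \<not> P \<xi>} = space M - {\<xi>\<in>space M. P \<xi>}" by auto
  then have "prob {\<xi>\<in>space M. \<not> P \<xi>} = 1 - prob {\<xi>\<in>space M. P \<xi>}"
    using prob_compl[OF ev] by simp
  then show ?thesis
    unfolding hp_def using assms by (intro bexI[of _ "{\<xi>\<in>space M. P \<xi>}"]) auto
qed

lemma hp_Markov: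
  fixes X :: "'a \<Rightarrow> real"
  assumes F: "subalgebra M F" and X: "X \<in> borel_measurable F" "integrable M X"
    "\<And>\<xi>. \<xi> \<in> space M \<Longrightarrow> 0 \<le> X \<xi>" and m: "expectation X \<le> m" and a: "0 < a"
  shows "hp M F (m / a) (\<lambda>\<xi>. X \<xi> < a)"
proof (rule hp_measurable[OF F])
  have sp: "space F = space M" using F by (simp add: subalgebra_def)
  show "{\<xi>\<in>space M. X \<xi> < a} \<in> sets F"
    using X(1) unfolding sp[symmetric] by measurable
  have "prob {\<xi>\<in>space M. a \<le> X \<xi>} \<le> expectation X / a"
    using X a by (intro integral_Markov_inequality_measure[where A = "space M"]) auto
  also have "\<dots> \<le> m / a" using m a by (simp add: divide_right_mono)
  finally show "prob {\<xi>\<in>space M. \<not> X \<xi> < a} \<le> m / a" by (simp add: not_less)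
qed

lemma hp_Chebyshev:
  fixes X :: "'a \<Rightarrow> real"
  assumes F: "subalgebra M F" and X: "X \<in> borel_measurable F" "integrable M (\<lambda>\<xi>. (X \<xi> - \<mu>)\<^sup>2)"
    and m: "expectation (\<lambda>\<xi>. (X \<xi> - \<mu>)\<^sup>2) \<le> v" and a: "0 < a"
  shows "hp M F (v / a\<^sup>2) (\<lambda>\<xi>. \<bar>X \<xi> - \<mu>\<bar> < a)"
proof -
  have "hp M F (v / a\<^sup>2) (\<lambda>\<xi>. (X \<xi> - \<mu>)\<^sup>2 < a\<^sup>2)"
    using X m a by (intro hp_Markov F) auto
  then show ?thesis
    using F a by (elim hp_mono) (auto simp: subalgebra_def abs_square_less_1 power2_less_imp_less
        dest: power2_less_imp_less[of "\<bar>_\<bar>", simplified])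
qed

section \<open>Sums of independent variables\<close>

lemma integrable_mult_square:
  fixes f g :: "'a \<Rightarrow> real"
  assumes [measurable]: "f \<in> borel_measurable M" "g \<in> borel_measurable M"
    and "integrable M (\<lambda>x. (f x)\<^sup>2)" "integrable M (\<lambda>x. (g x)\<^sup>2)"
  shows "integrable M (\<lambda>x. f x * g x)"
proof (rule Bochner_Integration.integrable_bound)
  show "integrable M (\<lambda>x. (f x)\<^sup>2 + (g x)\<^sup>2)" using assms by simp
  have "2 * (\<bar>f x\<bar> * \<bar>g x\<bar>) \<le> (f x)\<^sup>2 + (g x)\<^sup>2" for x
    using sum_squares_bound[of "\<bar>f x\<bar>" "\<bar>g x\<bar>"] by simp
  then have "norm (f x * g x) \<le> norm ((f x)\<^sup>2 + (g x)\<^sup>2)" for x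
    using mult_nonneg_nonneg[of "\<bar>f x\<bar>" "\<bar>g x\<bar>"] unfolding real_norm_def abs_mult
    by (smt (verit, del_insts) abs_ge_zero zero_le_power2)
  then show "AE x in M. norm (f x * g x) \<le> norm ((f x)\<^sup>2 + (g x)\<^sup>2)" by simp
qed simp

lemma integrable_square_sum:
  fixes f :: "'i \<Rightarrow> 'a \<Rightarrow> real"
  assumes "finite I" and [measurable]: "\<And>i. i \<in> I \<Longrightarrow> f i \<in> borel_measurable M"
    and "\<And>i. i \<in> I \<Longrightarrow> integrable M (\<lambda>x. (f i x)\<^sup>2)"
  shows "integrable M (\<lambda>x. (\<Sum>i\<in>I. f i x)\<^sup>2)"
  unfolding power2_eq_square sum_product
  using assms by (intro Bochner_Integration.integrable_sum integrable_mult_square) auto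

text \<open>\<open>indep_var\<close> is by definition independence of a family indexed by booleans,
  so the indices \<open>i\<close> and \<open>j\<close> are renamed to \<open>True\<close> and
  \<open>False\<close>.\<close>

lemma indep_vars_pair:
  assumes "indep_vars N Z I" "i \<in> I" "j \<in> I" "i \<noteq> j"
  shows "indep_var (N i) (Z i) (N j) (Z j)"
proof -
  have "indep_vars N Z {i, j}" using assms by (intro indep_vars_subset[OF assms(1)]) auto
  then have rv: "random_variable (N i) (Z i)" "random_variable (N j) (Z j)"
    and ind: "indep_sets (\<lambda>i. {Z i -` A \<inter> space M |A. A \<in> sets (N i)}) {i, j}"
    unfolding indep_vars_def2 by auto
  let ?f = "\<lambda>b. if b then i else j"
  have "indep_sets (\<lambda>b. {Z (?f b) -` A \<inter> space M |A. A \<in> sets (N (?f b))}) UNIV"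
  proof (rule indep_setsI)
    fix b show "{Z (?f b) -` A \<inter> space M |A. A \<in> sets (N (?f b))} \<subseteq> events"
      using rv by auto
  next
    fix A :: "bool \<Rightarrow> 'a set" and K
    assume K: "K \<noteq> {}" "K \<subseteq> UNIV" "\<forall>b\<in>K. A b \<in> {Z (?f b) -` A \<inter> space M |A. A \<in> sets (N (?f b))}"
    have inj: "inj_on ?f K" using assms(4) by (auto simp: inj_on_def)
    have "prob (\<Inter>k\<in>?f ` K. A (k = i)) = (\<Prod>k\<in>?f ` K. prob (A (k = i)))"
      by (rule indep_setsD[OF ind]) (use K assms(4) in \<open>auto split: if_splits\<close>)
    also have "(\<Inter>k\<in>?f ` K. A (k = i)) = (\<Inter>b\<in>K. A b)"
      unfolding image_image by (intro INF_cong refl) (use assms(4) in auto)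
    also have "(\<Prod>k\<in>?f ` K. prob (A (k = i))) = (\<Prod>b\<in>K. prob (A b))"
      using assms(4) by (subst prod.reindex[OF inj]) (auto intro!: prod.cong)
    finally show "prob (\<Inter>b\<in>K. A b) = (\<Prod>b\<in>K. prob (A b))" .
  qed
  with rv have "indep_vars (\<lambda>b. N (?f b)) (\<lambda>b. Z (?f b)) UNIV"
    unfolding indep_vars_def2 by auto
  moreover have "(\<lambda>b. N (?f b)) = case_bool (N i) (N j)" "(\<lambda>b. Z (?f b)) = case_bool (Z i) (Z j)"
    by (auto split: bool.split)
  ultimately show ?thesis unfolding indep_var_def by simp
qed

text \<open>Centred independent variables are orthogonal, so their variances add, and each variance
  is at most the second moment.\<close>

lemma indep_sum_variance:
  fixes Z :: "nat \<Rightarrow> 'a \<Rightarrow> real"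
  assumes ind: "indep_vars (\<lambda>_. borel) Z J" and I: "finite I" "I \<subseteq> J"
    and sq: "\<And>i. i \<in> I \<Longrightarrow> integrable M (\<lambda>\<xi>. (Z i \<xi>)\<^sup>2)"
  shows "integrable M (\<lambda>\<xi>. ((\<Sum>i\<in>I. Z i \<xi>) - (\<Sum>i\<in>I. expectation (Z i)))\<^sup>2)"
    and "expectation (\<lambda>\<xi>. ((\<Sum>i\<in>I. Z i \<xi>) - (\<Sum>i\<in>I. expectation (Z i)))\<^sup>2) \<le> (\<Sum>i\<in>I. expectation (\<lambda>\<xi>. (Z i \<xi>)\<^sup>2))"
proof -
  have rv [measurable]: "Z i \<in> borel_measurable M" if "i \<in> I" for i
    using ind I(2) that by (auto simp: indep_vars_def2)
  have int: "integrable M (Z i)" if "i \<in> I" for i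
    using square_integrable_imp_integrable[OF rv sq] that by auto
  define a where "a = (\<lambda>i \<xi>. Z i \<xi> - expectation (Z i))"
  have rva [measurable]: "a i \<in> borel_measurable M" if "i \<in> I" for i
    using rv[OF that] unfolding a_def by measurable
  have sqa: "integrable M (\<lambda>\<xi>. (a i \<xi>)\<^sup>2)" if "i \<in> I" for i
    using int[OF that] sq[OF that] unfolding a_def power2_diff by simp
  have eq: "(\<Sum>i\<in>I. Z i \<xi>) - (\<Sum>i\<in>I. expectation (Z i)) = (\<Sum>i\<in>I. a i \<xi>)" for \<xi>
    by (simp add: a_def sum_subtractf)
  show "integrable M (\<lambda>\<xi>. ((\<Sum>i\<in>I. Z i \<xi>) - (\<Sum>i\<in>I. expectation (Z i)))\<^sup>2)"
    unfolding eq using I sqa by (intro integrable_square_sum) auto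
  have cross: "expectation (\<lambda>\<xi>. a i \<xi> * a j \<xi>) = 0" if "i \<in> I" "j \<in> I" "i \<noteq> j" for i j
  proof -
    have "indep_var borel (Z i) borel (Z j)"
      using indep_vars_pair[OF ind, of i j] that I by auto
    then have "indep_var borel ((\<lambda>x. x - expectation (Z i)) \<circ> Z i) borel ((\<lambda>x. x - expectation (Z j)) \<circ> Z j)"
      by (rule indep_var_compose) auto
    then have "expectation (\<lambda>\<xi>. a i \<xi> * a j \<xi>) = expectation (a i) * expectation (a j)"
      using int that unfolding a_def comp_def by (intro indep_var_lebesgue_integral) auto
    also have "expectation (a i) = 0" using int that by (simp add: a_def prob_space)
    finally show ?thesis by simp
  qed
  have "expectation (\<lambda>\<xi>. (\<Sum>i\<in>I. a i \<xi>)\<^sup>2) = (\<Sum>i\<in>I. \<Sum>j\<in>I. expectation (\<lambda>\<xi>. a i \<xi> * a j \<xi>))"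
    unfolding power2_eq_square sum_product
    by (subst Bochner_Integration.integral_sum; (intro sum.cong refl Bochner_Integration.integral_sum Bochner_Integration.integrable_sum)?)
       (auto intro!: integrable_mult_square rva sqa)
  also have "\<dots> = (\<Sum>i\<in>I. \<Sum>j\<in>I. if j = i then expectation (\<lambda>\<xi>. (a i \<xi>)\<^sup>2) else 0)"
    using cross by (intro sum.cong refl) (auto simp: power2_eq_square)
  also have "\<dots> = (\<Sum>i\<in>I. expectation (\<lambda>\<xi>. (a i \<xi>)\<^sup>2))" using I by (simp add: sum.delta)
  also have "\<dots> \<le> (\<Sum>i\<in>I. expectation (\<lambda>\<xi>. (Z i \<xi>)\<^sup>2))"
  proof (rule sum_mono)
    fix i assume i: "i \<in> I"
    have "expectation (\<lambda>\<xi>. (a i \<xi>)\<^sup>2) = expectation (\<lambda>\<xi>. (Z i \<xi>)\<^sup>2) - (expectation (Z i))\<^sup>2"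
      unfolding a_def using int[OF i] sq[OF i] by (rule variance_eq)
    then show "expectation (\<lambda>\<xi>. (a i \<xi>)\<^sup>2) \<le> expectation (\<lambda>\<xi>. (Z i \<xi>)\<^sup>2)" by simp
  qed
  finally show "expectation (\<lambda>\<xi>. ((\<Sum>i\<in>I. Z i \<xi>) - (\<Sum>i\<in>I. expectation (Z i)))\<^sup>2) \<le> (\<Sum>i\<in>I. expectation (\<lambda>\<xi>. (Z i \<xi>)\<^sup>2))"
    unfolding eq .
qed

text \<open>Induction over the summands with \<open>clamp_excess_add\<close>. The cross term has
  mean zero by independence. The event that the partial sum exceeds \<open>w / 2\<close> is
  independent of the new summand and has probability at most \<open>4 * V / w\<^sup>2\<close> by
  Chebyshev, so these terms add up to at most \<open>V * (4 * V / w\<^sup>2)\<close>. What remains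
  is a Lindeberg sum of the tails of the single summands. The lemma thus reduces uniform
  integrability of squared sums to tails of their terms.\<close>

lemma clamp_excess_indep_sum:
  fixes Z :: "nat \<Rightarrow> 'a \<Rightarrow> real"
  assumes ind: "indep_vars (\<lambda>_. borel) Z {1..}" and w: "0 < w"
    and sq: "\<And>i. i \<ge> 1 \<Longrightarrow> integrable M (\<lambda>\<xi>. (Z i \<xi>)\<^sup>2)" and mean: "\<And>i. i \<ge> 1 \<Longrightarrow> expectation (Z i) = 0"
    and V: "(\<Sum>i=1..n. expectation (\<lambda>\<xi>. (Z i \<xi>)\<^sup>2)) \<le> V"
  shows "expectation (\<lambda>\<xi>. (clamp_excess w (\<Sum>i=1..n. Z i \<xi>))\<^sup>2)
    \<le> 4 * V\<^sup>2 / w\<^sup>2 + (\<Sum>i=1..n. expectation (\<lambda>\<xi>. (Z i \<xi>)\<^sup>2 * of_bool (w / 2 < \<bar>Z i \<xi>\<bar>)))"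
proof -
  have rv [measurable]: "Z i \<in> borel_measurable M" if "i \<ge> 1" for i
    using ind that by (auto simp: indep_vars_def2)
  have int: "integrable M (Z i)" if "i \<ge> 1" for i
    using square_integrable_imp_integrable[OF rv sq] that by auto
  define S where "S = (\<lambda>m \<xi>. \<Sum>i=1..m. Z i \<xi>)"
  define e where "e = (\<lambda>i. expectation (\<lambda>\<xi>. (Z i \<xi>)\<^sup>2))"
  define t where "t = (\<lambda>i. expectation (\<lambda>\<xi>. (Z i \<xi>)\<^sup>2 * of_bool (w / 2 < \<bar>Z i \<xi>\<bar>)))"
  have e0: "0 \<le> e i" for i by (simp add: e_def)
  have rvS [measurable]: "S m \<in> borel_measurable M" for m unfolding S_def by measurable
  have sqS: "integrable M (\<lambda>\<xi>. (S m \<xi>)\<^sup>2)" for m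
    unfolding S_def using sq by (intro integrable_square_sum) auto
  have sqC: "integrable M (\<lambda>\<xi>. (clamp_excess w (S m \<xi>))\<^sup>2)" for m
    using w clamp_excess_bounds(1)[of w]
    by (intro Bochner_Integration.integrable_bound[OF sqS[of m]]) (auto simp: abs_le_square_iff)
  have V0: "0 \<le> V" using V sum_nonneg[of "{1..n}" e] e0 by (simp add: e_def)
  have "m \<le> n \<longrightarrow> expectation (\<lambda>\<xi>. (clamp_excess w (S m \<xi>))\<^sup>2) \<le> (\<Sum>i=1..m. e i) * (4 * V / w\<^sup>2) + (\<Sum>i=1..m. t i)" for m
  proof (induction m)
    case 0
    then show ?case using w by (simp add: S_def clamp_excess_def)
  next
    case (Suc m)
    show ?case
    proof
      assume m: "Suc m \<le> n"
      define y where "y = Z (Suc m)"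
      have [measurable]: "y \<in> borel_measurable M" unfolding y_def by (rule rv) simp
      have sqy: "integrable M (\<lambda>\<xi>. (y \<xi>)\<^sup>2)" and inty: "integrable M y" and meany: "expectation y = 0"
        unfolding y_def using sq int mean by auto
      have ivar: "indep_var borel y borel (S m)"
        unfolding y_def S_def
        by (rule indep_vars_sum) (auto intro!: indep_vars_subset[OF ind])
      have step: "(clamp_excess w (S (Suc m) \<xi>))\<^sup>2 \<le> (clamp_excess w (S m \<xi>))\<^sup>2 + 2 * (y \<xi> * clamp_excess w (S m \<xi>))
          + ((y \<xi>)\<^sup>2 * of_bool (w / 2 < \<bar>S m \<xi>\<bar>) + (y \<xi>)\<^sup>2 * of_bool (w / 2 < \<bar>y \<xi>\<bar>))" for \<xi>
        using clamp_excess_add[of w "S m \<xi>" "y \<xi>"] w by (simp add: S_def y_def algebra_simps)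
      have i1: "integrable M (\<lambda>\<xi>. y \<xi> * clamp_excess w (S m \<xi>))"
        using sqy sqC by (intro integrable_mult_square) auto
      have i2: "integrable M (\<lambda>\<xi>. (y \<xi>)\<^sup>2 * of_bool (w / 2 < \<bar>S m \<xi>\<bar>))"
        and i3: "integrable M (\<lambda>\<xi>. (y \<xi>)\<^sup>2 * of_bool (w / 2 < \<bar>y \<xi>\<bar>))"
        by (rule Bochner_Integration.integrable_bound[OF sqy]; auto simp: of_bool_def)+
      have "indep_var borel ((\<lambda>x. x) \<circ> y) borel (clamp_excess w \<circ> S m)"
        by (rule indep_var_compose[OF ivar]) auto
      then have "expectation (\<lambda>\<xi>. y \<xi> * clamp_excess w (S m \<xi>)) = expectation y * expectation (\<lambda>\<xi>. clamp_excess w (S m \<xi>))"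
        using inty square_integrable_imp_integrable[OF _ sqC[of m]] unfolding comp_def
        by (intro indep_var_lebesgue_integral) auto
      then have z: "expectation (\<lambda>\<xi>. y \<xi> * clamp_excess w (S m \<xi>)) = 0" by (simp add: meany)
      have "indep_var borel ((\<lambda>x. x\<^sup>2) \<circ> y) borel ((\<lambda>x. of_bool (w / 2 < \<bar>x\<bar>)) \<circ> S m)"
        by (rule indep_var_compose[OF ivar]) auto
      then have "expectation (\<lambda>\<xi>. (y \<xi>)\<^sup>2 * of_bool (w / 2 < \<bar>S m \<xi>\<bar>)) = e (Suc m) * expectation (\<lambda>\<xi>. of_bool (w / 2 < \<bar>S m \<xi>\<bar>))"
        using sqy unfolding comp_def e_def y_def[symmetric]
        by (intro indep_var_lebesgue_integral) (auto intro!: integrable_const_bound[of _ 1])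
      also have "expectation (\<lambda>\<xi>. of_bool (w / 2 < \<bar>S m \<xi>\<bar>)) \<le> 4 * V / w\<^sup>2"
      proof -
        have "expectation (\<lambda>\<xi>. of_bool (w / 2 < \<bar>S m \<xi>\<bar>)) \<le> expectation (\<lambda>\<xi>. 4 / w\<^sup>2 * (S m \<xi>)\<^sup>2)"
        proof (intro integral_mono integrable_mult_right sqS)
          fix \<xi>
          show "of_bool (w / 2 < \<bar>S m \<xi>\<bar>) \<le> 4 / w\<^sup>2 * (S m \<xi>)\<^sup>2"
          proof (cases "w / 2 < \<bar>S m \<xi>\<bar>")
            case True
            then have "\<bar>w\<bar> \<le> \<bar>2 * S m \<xi>\<bar>" using w by simp
            then have "w\<^sup>2 \<le> 4 * (S m \<xi>)\<^sup>2" by (simp only: abs_le_square_iff) (simp add: power_mult_distrib)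
            then show ?thesis using w by (simp add: field_simps)
          qed simp
        qed (auto intro!: integrable_const_bound[of _ 1])
        also have "\<dots> = 4 / w\<^sup>2 * expectation (\<lambda>\<xi>. (S m \<xi> - 0)\<^sup>2)" by simp
        finally have 1: "expectation (\<lambda>\<xi>. of_bool (w / 2 < \<bar>S m \<xi>\<bar>)) \<le> 4 / w\<^sup>2 * expectation (\<lambda>\<xi>. (S m \<xi> - 0)\<^sup>2)" .
        have 2: "expectation (\<lambda>\<xi>. (S m \<xi> - 0)\<^sup>2) \<le> V"
        proof -
          have "expectation (\<lambda>\<xi>. (S m \<xi> - (\<Sum>i\<in>{1..m}. expectation (Z i)))\<^sup>2) \<le> (\<Sum>i\<in>{1..m}. e i)"
            unfolding S_def e_def by (rule indep_sum_variance(2)[OF ind]) (auto intro: sq)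
          also have "(\<Sum>i\<in>{1..m}. expectation (Z i)) = 0" using mean by (intro sum.neutral) auto
          also have "(\<Sum>i\<in>{1..m}. e i) \<le> (\<Sum>i\<in>{1..n}. e i)" using m e0 by (intro sum_mono2) auto
          finally show ?thesis using V by (simp add: e_def)
        qed
        show ?thesis using 1 mult_left_mono[OF 2, of "4 / w\<^sup>2"] by simp
      qed
      finally have b: "expectation (\<lambda>\<xi>. (y \<xi>)\<^sup>2 * of_bool (w / 2 < \<bar>S m \<xi>\<bar>)) \<le> e (Suc m) * (4 * V / w\<^sup>2)"
        using e0 by (simp add: mult_left_mono)
      have "expectation (\<lambda>\<xi>. (clamp_excess w (S (Suc m) \<xi>))\<^sup>2) \<le> expectation (\<lambda>\<xi>. (clamp_excess w (S m \<xi>))\<^sup>2 + 2 * (y \<xi> * clamp_excess w (S m \<xi>))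
          + ((y \<xi>)\<^sup>2 * of_bool (w / 2 < \<bar>S m \<xi>\<bar>) + (y \<xi>)\<^sup>2 * of_bool (w / 2 < \<bar>y \<xi>\<bar>)))"
        using step by (intro integral_mono Bochner_Integration.integrable_add sqC integrable_mult_right i1 i2 i3) auto
      also have "\<dots> = expectation (\<lambda>\<xi>. (clamp_excess w (S m \<xi>))\<^sup>2) + expectation (\<lambda>\<xi>. (y \<xi>)\<^sup>2 * of_bool (w / 2 < \<bar>S m \<xi>\<bar>)) + t (Suc m)"
        using i1 i2 i3 sqC[of m] z by (simp add: t_def y_def)
      also have "\<dots> \<le> ((\<Sum>i=1..m. e i) * (4 * V / w\<^sup>2) + (\<Sum>i=1..m. t i)) + e (Suc m) * (4 * V / w\<^sup>2) + t (Suc m)"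
        using Suc.IH m b by simp
      also have "\<dots> = (\<Sum>i=1..Suc m. e i) * (4 * V / w\<^sup>2) + (\<Sum>i=1..Suc m. t i)"
        by (simp add: algebra_simps add_divide_distrib)
      finally show "expectation (\<lambda>\<xi>. (clamp_excess w (S (Suc m) \<xi>))\<^sup>2) \<le> (\<Sum>i=1..Suc m. e i) * (4 * V / w\<^sup>2) + (\<Sum>i=1..Suc m. t i)" .
    qed
  qed
  from this[of n] have "expectation (\<lambda>\<xi>. (clamp_excess w (S n \<xi>))\<^sup>2) \<le> (\<Sum>i=1..n. e i) * (4 * V / w\<^sup>2) + (\<Sum>i=1..n. t i)"
    by simp
  also have "(\<Sum>i=1..n. e i) * (4 * V / w\<^sup>2) \<le> V * (4 * V / w\<^sup>2)"
    using V V0 by (intro mult_right_mono) (auto simp: e_def)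
  also have "\<dots> = 4 * V\<^sup>2 / w\<^sup>2" by (simp add: power2_eq_square)
  finally show ?thesis by (simp add: S_def t_def)
qed

section \<open>Joint independence of data and weights\<close>

text \<open>Rectangles form an intersection-stable generator of the pair sigma-algebra. On them the
  probability factorises first between the two families, by independence of \<open>\<D>\<close> and
  \<open>\<V>\<close>, and then within each family.\<close>

lemma indep_vars_Pair:
  assumes D: "indep_vars N D I" and V: "indep_vars N' V I"
    and ind: "indep_set \<D> \<V>"
    and sD: "\<And>J A. finite J \<Longrightarrow> J \<noteq> {} \<Longrightarrow> J \<subseteq> I \<Longrightarrow> (\<And>i. i \<in> J \<Longrightarrow> A i \<in> sets (N i)) \<Longrightarrow> (\<Inter>i\<in>J. D i -` A i \<inter> space M) \<in> \<D>"
    and sV: "\<And>J A. finite J \<Longrightarrow> J \<noteq> {} \<Longrightarrow> J \<subseteq> I \<Longrightarrow> (\<And>i. i \<in> J \<Longrightarrow> A i \<in> sets (N' i)) \<Longrightarrow> (\<Inter>i\<in>J. V i -` A i \<inter> space M) \<in> \<V>"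
  shows "indep_vars (\<lambda>i. N i \<Otimes>\<^sub>M N' i) (\<lambda>i \<xi>. (D i \<xi>, V i \<xi>)) I"
proof -
  have rvD: "D i \<in> measurable M (N i)" and rvV: "V i \<in> measurable M (N' i)" if "i \<in> I" for i
    using D V that by (auto simp: indep_vars_def2)
  define E where "E = (\<lambda>i. {D i -` A \<inter> V i -` B \<inter> space M | A B. A \<in> sets (N i) \<and> B \<in> sets (N' i)})"
  have E: "indep_sets E I"
  proof (rule indep_setsI)
    fix i assume i: "i \<in> I"
    show "E i \<subseteq> events"
    proof
      fix X assume "X \<in> E i"
      then obtain A B where AB: "X = D i -` A \<inter> V i -` B \<inter> space M" "A \<in> sets (N i)" "B \<in> sets (N' i)"
        unfolding E_def by blast
      have "X = (D i -` A \<inter> space M) \<inter> (V i -` B \<inter> space M)" using AB by auto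
      then show "X \<in> events" using measurable_sets[OF rvD[OF i] AB(2)] measurable_sets[OF rvV[OF i] AB(3)] by auto
    qed
  next
    fix X J assume J: "J \<noteq> {}" "J \<subseteq> I" "finite J" and X: "\<forall>j\<in>J. X j \<in> E j"
    then have "\<forall>j\<in>J. \<exists>A B. X j = D j -` A \<inter> V j -` B \<inter> space M \<and> A \<in> sets (N j) \<and> B \<in> sets (N' j)"
      unfolding E_def by blast
    then obtain A B where AB: "\<And>j. j \<in> J \<Longrightarrow> X j = D j -` A j \<inter> V j -` B j \<inter> space M"
      "\<And>j. j \<in> J \<Longrightarrow> A j \<in> sets (N j)" "\<And>j. j \<in> J \<Longrightarrow> B j \<in> sets (N' j)" by metis
    have D': "(\<Inter>j\<in>J'. D j -` A j \<inter> space M) \<in> \<D>" if "J' \<subseteq> J" "J' \<noteq> {}" for J'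
      by (rule sD) (use J AB(2) that in \<open>auto intro: finite_subset\<close>)
    have V': "(\<Inter>j\<in>J'. V j -` B j \<inter> space M) \<in> \<V>" if "J' \<subseteq> J" "J' \<noteq> {}" for J'
      by (rule sV) (use J AB(3) that in \<open>auto intro: finite_subset\<close>)
    have pX: "prob (X j) = prob (D j -` A j \<inter> space M) * prob (V j -` B j \<inter> space M)" if "j \<in> J" for j
    proof -
      have "X j = (D j -` A j \<inter> space M) \<inter> (V j -` B j \<inter> space M)" using AB(1)[OF that] by auto
      then show ?thesis using indep_setD[OF ind D'[of "{j}"] V'[of "{j}"]] that by simp
    qed
    have "(\<Inter>j\<in>J. X j) = (\<Inter>j\<in>J. D j -` A j \<inter> space M) \<inter> (\<Inter>j\<in>J. V j -` B j \<inter> space M)"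
      using AB(1) J(1) by auto
    then have "prob (\<Inter>j\<in>J. X j) = prob (\<Inter>j\<in>J. D j -` A j \<inter> space M) * prob (\<Inter>j\<in>J. V j -` B j \<inter> space M)"
      using indep_setD[OF ind D'[of J] V'[of J]] J by simp
    also have "prob (\<Inter>j\<in>J. D j -` A j \<inter> space M) = (\<Prod>j\<in>J. prob (D j -` A j \<inter> space M))"
      by (rule indep_varsD[OF D J(1) J(3) J(2)]) (rule AB(2))
    also have "prob (\<Inter>j\<in>J. V j -` B j \<inter> space M) = (\<Prod>j\<in>J. prob (V j -` B j \<inter> space M))"
      by (rule indep_varsD[OF V J(1) J(3) J(2)]) (rule AB(3))
    finally show "prob (\<Inter>j\<in>J. X j) = (\<Prod>j\<in>J. prob (X j))" by (simp add: pX prod.distrib)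
  qed
  have "Int_stable (E i)" if "i \<in> I" for i
    unfolding Int_stable_def
  proof (intro ballI)
    fix X Y assume "X \<in> E i" "Y \<in> E i"
    then obtain A B A' B' where
      "X = D i -` A \<inter> V i -` B \<inter> space M" "A \<in> sets (N i)" "B \<in> sets (N' i)"
      "Y = D i -` A' \<inter> V i -` B' \<inter> space M" "A' \<in> sets (N i)" "B' \<in> sets (N' i)"
      unfolding E_def by blast
    then show "X \<inter> Y \<in> E i"
      unfolding E_def by (intro CollectI exI[of _ "A \<inter> A'"] exI[of _ "B \<inter> B'"]) auto
  qed
  with E have S: "indep_sets (\<lambda>i. sigma_sets (space M) (E i)) I" by (rule indep_sets_sigma)
  show ?thesis
    unfolding indep_vars_def2
  proof
    show rvP: "\<forall>i\<in>I. random_variable (N i \<Otimes>\<^sub>M N' i) (\<lambda>\<xi>. (D i \<xi>, V i \<xi>))"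
      using rvD rvV by auto
    show "indep_sets (\<lambda>i. {(\<lambda>\<xi>. (D i \<xi>, V i \<xi>)) -` A \<inter> space M |A. A \<in> sets (N i \<Otimes>\<^sub>M N' i)}) I"
    proof (rule indep_sets_mono_sets[OF S])
      fix i assume i: "i \<in> I"
      have maps: "(\<lambda>\<xi>. (D i \<xi>, V i \<xi>)) \<in> space M \<rightarrow> space (N i) \<times> space (N' i)"
        using measurable_space[OF rvD[OF i]] measurable_space[OF rvV[OF i]] by auto
      have "{(\<lambda>\<xi>. (D i \<xi>, V i \<xi>)) -` A \<inter> space M |A. A \<in> sets (N i \<Otimes>\<^sub>M N' i)}
          = sigma_sets (space M) {(\<lambda>\<xi>. (D i \<xi>, V i \<xi>)) -` A \<inter> space M |A. A \<in> {a \<times> b | a b. a \<in> sets (N i) \<and> b \<in> sets (N' i)}}"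
        unfolding sets_pair_measure by (rule sigma_sets_vimage_commute[OF maps])
      also have "\<dots> \<subseteq> sigma_sets (space M) (E i)"
        unfolding E_def by (intro sigma_sets_mono') auto
      finally show "{(\<lambda>\<xi>. (D i \<xi>, V i \<xi>)) -` A \<inter> space M |A. A \<in> sets (N i \<Otimes>\<^sub>M N' i)} \<subseteq> sigma_sets (space M) (E i)" .
    qed
  qed
qed

lemma indep_set_imp_indep_var:
  assumes "indep_set (sets FD) (sets FV)" "space FD = space M" "space FV = space M"
    and f: "f \<in> measurable FD S" and g: "g \<in> measurable FV T"
  shows "indep_var S f T g"
proof -
  have sD: "sets FD \<subseteq> events" and sV: "sets FV \<subseteq> events"
    using indep_setD_ev1[OF assms(1)] indep_setD_ev2[OF assms(1)] .
  have mf: "f \<in> measurable M S" "g \<in> measurable M T"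
    using f g sD sV assms(2,3) by (auto simp: measurable_def)
  have fD: "{f -` A \<inter> space M |A. A \<in> sets S} \<subseteq> sets FD"
    using measurable_sets[OF f] assms(2) by auto
  have gV: "{g -` A \<inter> space M |A. A \<in> sets T} \<subseteq> sets FV"
    using measurable_sets[OF g] assms(3) by auto
  have "indep_set (sigma_sets (space M) {f -` A \<inter> space M |A. A \<in> sets S}) (sigma_sets (space M) {g -` A \<inter> space M |A. A \<in> sets T})"
  proof (rule indep_setI)
    have 1: "sigma_sets (space M) {f -` A \<inter> space M |A. A \<in> sets S} \<subseteq> sets FD"
      using sets.sigma_sets_subset[OF fD] assms(2) by simp
    have 2: "sigma_sets (space M) {g -` A \<inter> space M |A. A \<in> sets T} \<subseteq> sets FV"
      using sets.sigma_sets_subset[OF gV] assms(3) by simp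
    show "sigma_sets (space M) {f -` A \<inter> space M |A. A \<in> sets S} \<subseteq> events" using 1 sD by auto
    show "sigma_sets (space M) {g -` A \<inter> space M |A. A \<in> sets T} \<subseteq> events" using 2 sV by auto
    fix a b assume "a \<in> sigma_sets (space M) {f -` A \<inter> space M |A. A \<in> sets S}" "b \<in> sigma_sets (space M) {g -` A \<inter> space M |A. A \<in> sets T}"
    then show "prob (a \<inter> b) = prob a * prob b" using 1 2 by (intro indep_setD[OF assms(1)]) auto
  qed
  with mf show ?thesis unfolding indep_var_eq by auto
qed

end

section \<open>Outer conditional expectations\<close>

text \<open>\<open>measurable_cover\<close> is a choice, so existence has to be shown. The infimum
  of a sequence of majorants whose expectations approach the least possible value attains it; its
  minimum with any other majorant cannot have smaller expectation, which gives minimality almost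
  everywhere.\<close>

lemma (in prob_space) measurable_cover_bounded:
  fixes Z :: "'a \<Rightarrow> real"
  assumes Z: "\<And>\<xi>. \<xi> \<in> space M \<Longrightarrow> \<bar>Z \<xi>\<bar> \<le> c"
  shows "measurable_cover M Z \<in> borel_measurable M"
    and "\<And>\<xi>. \<xi> \<in> space M \<Longrightarrow> Z \<xi> \<le> measurable_cover M Z \<xi>"
    and "\<And>U. U \<in> borel_measurable M \<Longrightarrow> (\<And>\<xi>. \<xi> \<in> space M \<Longrightarrow> Z \<xi> \<le> U \<xi>) \<Longrightarrow> AE \<xi> in M. measurable_cover M Z \<xi> \<le> U \<xi>"
proof -
  define \<U> where "\<U> = {U \<in> borel_measurable M. \<forall>\<xi>\<in>space M. Z \<xi> \<le> U \<xi> \<and> U \<xi> \<le> c}"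
  define I where "I = Inf ((\<lambda>U. expectation U) ` \<U>)"
  have c: "(\<lambda>_. c) \<in> \<U>" using Z by (auto simp: \<U>_def abs_le_iff)
  have bnd: "\<bar>U \<xi>\<bar> \<le> c" if "U \<in> \<U>" "\<xi> \<in> space M" for U \<xi>
    using that Z[of \<xi>] unfolding \<U>_def by force
  have int: "integrable M U" if "U \<in> \<U>" for U
    using bnd[OF that] that by (intro integrable_const_bound[of _ c]) (auto simp: \<U>_def)
  have below: "bdd_below (expectation ` \<U>)"
  proof (rule bdd_belowI2)
    fix U assume U: "U \<in> \<U>"
    have "expectation (\<lambda>_. - c) \<le> expectation U"
      using bnd[OF U] int[OF U] by (intro integral_mono) (auto simp: abs_le_iff intro: minus_le_iff[THEN iffD1])
    then show "- c \<le> expectation U" by (simp add: prob_space)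
  qed
  have "\<exists>U. U \<in> \<U> \<and> expectation U < I + 1 / real (Suc k)" for k
  proof -
    have "Inf (expectation ` \<U>) < I + 1 / real (Suc k)" unfolding I_def by simp
    then show ?thesis using cInf_lessD[of "expectation ` \<U>"] c by auto
  qed
  then obtain V where V: "\<And>k. V k \<in> \<U>" "\<And>k. expectation (V k) < I + 1 / real (Suc k)" by metis
  define U where "U = (\<lambda>\<xi>. INF k. V k \<xi>)"
  have bb: "bdd_below (range (\<lambda>k. V k \<xi>))" if "\<xi> \<in> space M" for \<xi>
    using bnd[OF V(1) that] by (intro bdd_belowI2[of _ "- c"]) (auto simp: abs_le_iff intro: minus_le_iff[THEN iffD1])
  have Vm [measurable]: "V k \<in> borel_measurable M" for k using V(1)[of k] by (simp add: \<U>_def)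
  have Um [measurable]: "U \<in> borel_measurable M"
    unfolding U_def by measurable
  have UV: "U \<xi> \<le> V k \<xi>" if "\<xi> \<in> space M" for k \<xi>
    unfolding U_def using bb[OF that] by (intro cINF_lower) auto
  have ZU: "Z \<xi> \<le> U \<xi>" if "\<xi> \<in> space M" for \<xi>
    unfolding U_def using V(1) that by (intro cINF_greatest) (auto simp: \<U>_def)
  have U: "U \<in> \<U>"
    using Um ZU UV[of _ 0] V(1)[of 0] unfolding \<U>_def by force
  have EU: "expectation U \<le> I"
  proof (rule field_le_epsilon)
    fix e :: real assume "0 < e"
    then obtain k where k: "1 / real (Suc k) < e" using nat_approx_posE by blast
    have "expectation U \<le> expectation (V k)" by (intro integral_mono int U V UV) 
    then show "expectation U \<le> I + e" using V(2)[of k] k by simp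
  qed
  have min: "AE \<xi> in M. U \<xi> \<le> U' \<xi>" if [measurable]: "U' \<in> borel_measurable M" and ZU': "\<And>\<xi>. \<xi> \<in> space M \<Longrightarrow> Z \<xi> \<le> U' \<xi>" for U'
  proof -
    define W where "W = (\<lambda>\<xi>. min (U \<xi>) (U' \<xi>))"
    have [measurable]: "W \<in> borel_measurable M" unfolding W_def by measurable
    have W: "W \<in> \<U>" using U ZU' ZU unfolding W_def \<U>_def by (auto simp: min_le_iff_disj)
    have "I \<le> expectation W" unfolding I_def using W below by (intro cInf_lower) auto
    then have "expectation (\<lambda>\<xi>. U \<xi> - W \<xi>) \<le> 0" using EU int[OF U] int[OF W] by simp
    moreover have "0 \<le> expectation (\<lambda>\<xi>. U \<xi> - W \<xi>)" by (intro integral_nonneg_AE) (auto simp: W_def)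
    ultimately have "expectation (\<lambda>\<xi>. U \<xi> - W \<xi>) = 0" by simp
    then have "AE \<xi> in M. U \<xi> - W \<xi> = 0"
      using int[OF U] int[OF W] by (subst (asm) integral_nonneg_eq_0_iff_AE) (auto simp: W_def)
    then show ?thesis by eventually_elim (auto simp: W_def min_def split: if_splits)
  qed
  have ex: "\<exists>U. U \<in> borel_measurable M \<and> (\<forall>\<xi>\<in>space M. Z \<xi> \<le> U \<xi>) \<and>
     (\<forall>U'\<in>borel_measurable M. (\<forall>\<xi>\<in>space M. Z \<xi> \<le> U' \<xi>) \<longrightarrow> (AE \<xi> in M. U \<xi> \<le> U' \<xi>))"
    using Um ZU min by blast
  note * = someI_ex[OF ex, folded measurable_cover_def]
  from * show "measurable_cover M Z \<in> borel_measurable M"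
    and "\<And>\<xi>. \<xi> \<in> space M \<Longrightarrow> Z \<xi> \<le> measurable_cover M Z \<xi>"
    and "\<And>U. U \<in> borel_measurable M \<Longrightarrow> (\<And>\<xi>. \<xi> \<in> space M \<Longrightarrow> Z \<xi> \<le> U \<xi>) \<Longrightarrow> AE \<xi> in M. measurable_cover M Z \<xi> \<le> U \<xi>"
    by blast+
qed

text \<open>On \<open>A\<close> the measurable cover of \<open>Z\<close> lies almost surely between
  \<open>L - D\<close> and \<open>L + D\<close>, so it inherits the approximation. As
  \<open>A\<close> belongs to \<open>F\<close>, its indicator passes through the conditional
  expectation, and off \<open>A\<close> boundedness of \<open>Z\<close> is enough. The hypotheses
  make \<open>g\<close> a version of the conditional expectation of \<open>L\<close>, and Markov's
  inequality turns the mean error into a probability.\<close>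

lemma (in prob_space) outer_cond_exp_approx:
  fixes Z L D g :: "'a \<Rightarrow> real"
  assumes F: "subalgebra M F" and Z: "\<And>\<xi>. \<xi> \<in> space M \<Longrightarrow> \<bar>Z \<xi>\<bar> \<le> c"
    and A: "A \<in> sets F" and L: "integrable M L" and D: "integrable M D"
    and D0: "\<And>\<xi>. \<xi> \<in> space M \<Longrightarrow> 0 \<le> D \<xi>"
    and ZL: "\<And>\<xi>. \<xi> \<in> A \<Longrightarrow> \<bar>Z \<xi> - L \<xi>\<bar> \<le> D \<xi>"
    and g: "g \<in> borel_measurable F" "integrable M g"
    and Lg: "\<And>B. B \<in> sets F \<Longrightarrow> (\<integral>\<xi>\<in>B. L \<xi> \<partial>M) = (\<integral>\<xi>\<in>B. g \<xi> \<partial>M)" and a: "0 < a"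
  shows "hp M F (prob (space M - A) + expectation D / a) (\<lambda>\<xi>. \<bar>outer_cond_exp M F Z \<xi> - g \<xi>\<bar> < a)"
proof -
  interpret S: finite_measure_subalgebra M F using F by unfold_locales
  have sp: "space F = space M" and AM [measurable]: "A \<in> sets M" and A': "A \<subseteq> space M"
    using F A sets.sets_into_space[OF A] by (auto simp: subalgebra_def)
  have mi: "integrable M (\<lambda>\<xi>. indicator A \<xi> * f \<xi>)" if "integrable M f" for f :: "'a \<Rightarrow> real"
    using integrable_mult_indicator[OF AM that] by simp
  define C where "C = measurable_cover M Z"
  have cov: "C \<in> borel_measurable M" "\<And>\<xi>. \<xi> \<in> space M \<Longrightarrow> Z \<xi> \<le> C \<xi>"
    "\<And>U. U \<in> borel_measurable M \<Longrightarrow> (\<And>\<xi>. \<xi> \<in> space M \<Longrightarrow> Z \<xi> \<le> U \<xi>) \<Longrightarrow> AE \<xi> in M. C \<xi> \<le> U \<xi>"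
    using measurable_cover_bounded[of Z c] Z unfolding C_def by blast+
  have [measurable]: "C \<in> borel_measurable M" by (rule cov)
  have [measurable]: "L \<in> borel_measurable M" "D \<in> borel_measurable M" using L D by auto
  have "AE \<xi> in M. C \<xi> \<le> c" using Z by (intro cov(3)) (auto simp: abs_le_iff)
  moreover have "- c \<le> C \<xi>" if "\<xi> \<in> space M" for \<xi>
    using Z[OF that] cov(2)[OF that] by linarith
  ultimately have "AE \<xi> in M. \<bar>C \<xi>\<bar> \<le> c"
    using AE_space by (auto simp: abs_le_iff minus_le_iff elim!: eventually_elim2)
  then have Ci: "integrable M C" by (intro integrable_const_bound[of _ c]) auto
  have low: "L \<xi> - D \<xi> \<le> C \<xi>" if "\<xi> \<in> A" for \<xi>
    using ZL[OF that] cov(2)[of \<xi>] that A' by (auto simp: abs_le_iff)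
  \<comment> \<open>Minimality of the cover is tested against a majorant that is sharp on
    \<open>A\<close> and trivial elsewhere.\<close>
  have "AE \<xi> in M. C \<xi> \<le> (if \<xi> \<in> A then L \<xi> + D \<xi> else c)"
  proof (rule cov(3))
    fix \<xi> assume "\<xi> \<in> space M"
    then show "Z \<xi> \<le> (if \<xi> \<in> A then L \<xi> + D \<xi> else c)"
      using ZL[of \<xi>] Z[of \<xi>] by (auto simp: abs_le_iff)
  qed measurable
  then have CL: "AE \<xi> in M. indicator A \<xi> * \<bar>C \<xi> - L \<xi>\<bar> \<le> D \<xi>"
    using AE_space
  proof eventually_elim
    case (elim \<xi>)
    then show ?case
      using D0[of \<xi>] low[of \<xi>]
      by (cases "\<xi> \<in> A") (auto simp: abs_le_iff)
  qed
  define h where "h = (\<lambda>\<xi>. C \<xi> - L \<xi>)"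
  have hi: "integrable M h" unfolding h_def using Ci L by simp
  have oc: "outer_cond_exp M F Z = real_cond_exp M F C" by (simp add: outer_cond_exp_def C_def)
  have "AE \<xi> in M. real_cond_exp M F L \<xi> = g \<xi>"
    using Lg L g(2,1) by (rule S.real_cond_exp_charact)
  with S.real_cond_exp_diff[OF Ci L]
  have e1: "AE \<xi> in M. outer_cond_exp M F Z \<xi> - g \<xi> = real_cond_exp M F h \<xi>"
    unfolding oc h_def by eventually_elim simp
  have "AE \<xi> in M. real_cond_exp M F h \<xi> \<le> real_cond_exp M F (\<lambda>x. norm (h x)) \<xi>"
    using hi by (intro S.real_cond_exp_mono) auto
  moreover have "AE \<xi> in M. real_cond_exp M F (\<lambda>x. (- 1) * h x) \<xi> \<le> real_cond_exp M F (\<lambda>x. norm (h x)) \<xi>"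
    using hi by (intro S.real_cond_exp_mono) (auto simp: abs_le_iff[THEN iffD1, OF order_refl])
  ultimately have jensen: "AE \<xi> in M. \<bar>real_cond_exp M F h \<xi>\<bar> \<le> real_cond_exp M F (\<lambda>x. norm (h x)) \<xi>"
    using S.real_cond_exp_cmult[OF hi, of "- 1"] by eventually_elim (simp add: abs_le_iff)
  have "AE \<xi> in M. indicator A \<xi> * \<bar>outer_cond_exp M F Z \<xi> - g \<xi>\<bar> \<le> indicator A \<xi> * real_cond_exp M F (\<lambda>x. norm (h x)) \<xi>"
    using e1 jensen by eventually_elim (auto simp: indicator_def)
  moreover have i1: "integrable M (\<lambda>\<xi>. indicator A \<xi> * real_cond_exp M F (\<lambda>x. norm (h x)) \<xi>)"
    using hi A by (intro S.real_cond_exp_intg(1)) (auto intro!: mi)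
  moreover have oi: "integrable M (\<lambda>\<xi>. outer_cond_exp M F Z \<xi> - g \<xi>)"
    unfolding oc using S.real_cond_exp_int(1)[OF Ci] g by simp
  then have i2: "integrable M (\<lambda>\<xi>. indicator A \<xi> * \<bar>outer_cond_exp M F Z \<xi> - g \<xi>\<bar>)"
    by (intro mi) auto
  ultimately have "expectation (\<lambda>\<xi>. indicator A \<xi> * \<bar>outer_cond_exp M F Z \<xi> - g \<xi>\<bar>) \<le> expectation (\<lambda>\<xi>. indicator A \<xi> * real_cond_exp M F (\<lambda>x. norm (h x)) \<xi>)"
    by (intro integral_mono_AE)
  also have "\<dots> = expectation (\<lambda>\<xi>. indicator A \<xi> * norm (h \<xi>))"
    using hi A by (intro S.real_cond_exp_intg(2)) (auto intro!: mi)
  also have "\<dots> \<le> expectation D"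
    using CL D hi by (intro integral_mono_AE mi) (auto simp: h_def)
  finally have le: "expectation (\<lambda>\<xi>. indicator A \<xi> * \<bar>outer_cond_exp M F Z \<xi> - g \<xi>\<bar>) \<le> expectation D" .
  have "hp M F (expectation D / a) (\<lambda>\<xi>. indicator A \<xi> * \<bar>outer_cond_exp M F Z \<xi> - g \<xi>\<bar> < a)"
  proof (rule hp_Markov[OF F _ i2 _ le a])
    show "(\<lambda>\<xi>. indicator A \<xi> * \<bar>outer_cond_exp M F Z \<xi> - g \<xi>\<bar>) \<in> borel_measurable F"
      unfolding oc using A g by measurable
  qed auto
  moreover have "hp M F (prob (space M - A)) (\<lambda>\<xi>. \<xi> \<in> A)"
    unfolding hp_def using A prob_compl[OF AM] by (intro bexI[of _ A]) auto
  ultimately have "hp M F (prob (space M - A) + expectation D / a)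
      (\<lambda>\<xi>. \<xi> \<in> A \<and> indicator A \<xi> * \<bar>outer_cond_exp M F Z \<xi> - g \<xi>\<bar> < a)"
    by (intro hp_conj F)
  then show ?thesis by (rule hp_mono) (auto simp: sp)
qed

section \<open>Conditional distributions\<close>

text \<open>The hypothesis determines the joint law on rectangles only. With \<open>K x\<close> the
  law of \<open>(x, y)\<close> for \<open>y\<close> drawn from \<open>\<kappa> x\<close>, the joint
  law and the mixture of \<open>K\<close> over the law of \<open>X\<close> agree on this
  intersection-stable generator, hence everywhere.\<close>

lemma (in prob_space) nn_integral_cond_distribution:
  fixes X :: "'a \<Rightarrow> 'b::second_countable_topology"
  assumes [measurable]: "X \<in> borel_measurable M" "Y \<in> borel_measurable M"
    and cd: "cond_distribution M X Y \<kappa>"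
    and g [measurable]: "g \<in> borel_measurable (borel \<Otimes>\<^sub>M borel)"
  shows "(\<integral>\<^sup>+\<xi>. g (X \<xi>, Y \<xi>) \<partial>M) = (\<integral>\<^sup>+\<xi>. (\<integral>\<^sup>+y. g (X \<xi>, y) \<partial>\<kappa> (X \<xi>)) \<partial>M)"
proof -
  have \<kappa>: "\<kappa> \<in> borel \<rightarrow>\<^sub>M prob_algebra borel"
    and rect: "\<And>A C. A \<in> sets borel \<Longrightarrow> C \<in> sets borel \<Longrightarrow> measure M {\<xi> \<in> space M. X \<xi> \<in> A \<and> Y \<xi> \<in> C} =
        (LINT x:A|distr M borel X. measure (\<kappa> x) C)"
    using cd unfolding cond_distribution_def by blast+
  have [measurable]: "\<kappa> \<in> borel \<rightarrow>\<^sub>M subprob_algebra borel" using \<kappa> by (rule measurable_prob_algebraD)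
  have pk: "prob_space (\<kappa> x)" "sets (\<kappa> x) = sets borel" for x
    using measurable_space[OF \<kappa>, of x] by (auto simp: space_prob_algebra)
  define K where "K = (\<lambda>x. distr (\<kappa> x) (borel \<Otimes>\<^sub>M borel) (Pair x))"
  have K [measurable]: "K \<in> borel \<rightarrow>\<^sub>M subprob_algebra (borel \<Otimes>\<^sub>M borel)"
    unfolding K_def by (rule measurable_distr2[where M = borel]) measurable
  have pX: "prob_space (distr M borel X)" by (rule prob_space_distr) simp
  have eq: "distr M (borel \<Otimes>\<^sub>M borel) (\<lambda>\<xi>. (X \<xi>, Y \<xi>)) = distr M borel X \<bind> K" (is "?L = ?R")
  proof (rule measure_eqI_generator_eq[OF Int_stable_pair_measure_generator[of borel borel]])
    show "{a \<times> b |a b. a \<in> sets (borel :: 'b measure) \<and> b \<in> sets (borel :: real measure)} \<subseteq> Pow UNIV" by simp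
    fix P assume "P \<in> {a \<times> b |a b. a \<in> sets (borel :: 'b measure) \<and> b \<in> sets (borel :: real measure)}"
    then obtain A C where P: "P = A \<times> C" and [measurable]: "A \<in> sets borel" "C \<in> sets borel" by blast
    have KP: "emeasure (K x) P = ennreal (indicator A x * measure (\<kappa> x) C)" for x
    proof -
      interpret k: prob_space "\<kappa> x" by (rule pk)
      have "emeasure (K x) P = emeasure (\<kappa> x) (Pair x -` P \<inter> space (\<kappa> x))"
        unfolding K_def P by (rule emeasure_distr) (auto simp: pk measurable_cong_sets[OF pk(2) refl])
      also have "Pair x -` P \<inter> space (\<kappa> x) = (if x \<in> A then C else {})"
        using sets_eq_imp_space_eq[OF pk(2)[of x]] by (auto simp: P)
      finally show ?thesis by (auto simp: k.emeasure_eq_measure)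
    qed
    have "emeasure ?L P = emeasure M {\<xi> \<in> space M. X \<xi> \<in> A \<and> Y \<xi> \<in> C}"
      unfolding P by (subst emeasure_distr) (auto intro!: arg_cong[where f = "emeasure M"])
    also have "\<dots> = ennreal (LINT x|distr M borel X. indicator A x * measure (\<kappa> x) C)"
      by (simp add: emeasure_eq_measure rect set_lebesgue_integral_def)
    also have "\<dots> = (\<integral>\<^sup>+x. ennreal (indicator A x * measure (\<kappa> x) C) \<partial>distr M borel X)"
    proof (rule nn_integral_eq_integral[symmetric])
      interpret X: prob_space "distr M borel X" by (rule pX)
      have [measurable]: "(\<lambda>x. measure (\<kappa> x) C) \<in> borel_measurable borel"
        unfolding measure_def
        by (rule measurable_compose[OF measurable_compose[OF _ measurable_emeasure_subprob_algebra[OF \<open>C \<in> sets borel\<close>]]]) auto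
      show "integrable (distr M borel X) (\<lambda>x. indicator A x * measure (\<kappa> x) C)"
        by (rule X.integrable_const_bound[of _ 1])
           (auto simp: indicator_def intro!: prob_space.prob_le_1 pk)
    qed auto
    also have "\<dots> = (\<integral>\<^sup>+x. emeasure (K x) P \<partial>distr M borel X)" by (simp add: KP)
    also have "\<dots> = emeasure ?R P"
      by (rule emeasure_bind[symmetric, of _ _ "borel \<Otimes>\<^sub>M borel"]) (auto simp: P)
    finally show "emeasure ?L P = emeasure ?R P" .
  next
    show "sets ?L = sigma_sets UNIV {a \<times> b |a b. a \<in> sets (borel :: 'b measure) \<and> b \<in> sets (borel :: real measure)}"
      by (simp add: sets_pair_measure)
    have "sets ?R = sets (borel \<Otimes>\<^sub>M borel)" by (rule sets_bind) (auto simp: K_def)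
    then show "sets ?R = sigma_sets UNIV {a \<times> b |a b. a \<in> sets (borel :: 'b measure) \<and> b \<in> sets (borel :: real measure)}"
      by (simp add: sets_pair_measure)
    show "range (\<lambda>_::nat. UNIV \<times> UNIV) \<subseteq> {a \<times> b |a b. a \<in> sets (borel :: 'b measure) \<and> b \<in> sets (borel :: real measure)}"
      by (auto intro!: exI[of _ UNIV])
    show "\<And>i. emeasure ?L (UNIV \<times> UNIV) \<noteq> \<infinity>"
      unfolding infinity_ennreal_def by (intro finite_measure.emeasure_finite finite_measure_distr) simp
  qed auto
  have "(\<integral>\<^sup>+\<xi>. g (X \<xi>, Y \<xi>) \<partial>M) = (\<integral>\<^sup>+p. g p \<partial>distr M (borel \<Otimes>\<^sub>M borel) (\<lambda>\<xi>. (X \<xi>, Y \<xi>)))"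
    by (rule nn_integral_distr[symmetric]) auto
  also have "\<dots> = (\<integral>\<^sup>+x. (\<integral>\<^sup>+p. g p \<partial>K x) \<partial>distr M borel X)"
    unfolding eq by (rule nn_integral_bind[of _ "borel \<Otimes>\<^sub>M borel"]) auto
  also have "\<dots> = (\<integral>\<^sup>+\<xi>. (\<integral>\<^sup>+p. g p \<partial>K (X \<xi>)) \<partial>M)"
    by (rule nn_integral_distr) auto
  also have "\<dots> = (\<integral>\<^sup>+\<xi>. (\<integral>\<^sup>+y. g (X \<xi>, y) \<partial>\<kappa> (X \<xi>)) \<partial>M)"
    unfolding K_def
    by (intro nn_integral_cong nn_integral_distr) (auto simp: measurable_cong_sets[OF pk(2) refl])
  finally show ?thesis .
qed

text \<open>The complement of the support is covered by the null members of a countable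
  base.\<close>

lemma (in prob_space) AE_rv_support:
  fixes X :: "'a \<Rightarrow> 'b::second_countable_topology"
  assumes [measurable]: "X \<in> borel_measurable M"
  shows "AE \<xi> in M. X \<xi> \<in> rv_support M X"
proof -
  obtain B :: "'b set set" where B: "countable B" "\<And>C. C \<in> B \<Longrightarrow> open C" "\<And>S. open S \<Longrightarrow> \<exists>U. U \<subseteq> B \<and> S = \<Union>U"
    by (metis univ_second_countable)
  define B0 where "B0 = {C \<in> B. prob {\<xi> \<in> space M. X \<xi> \<in> C} = 0}"
  have "countable B0" using B(1) by (simp add: B0_def)
  moreover have "AE \<xi> in M. X \<xi> \<notin> C" if "C \<in> B0" for C
  proof (rule AE_I[where N = "{\<xi> \<in> space M. X \<xi> \<in> C}"])
    have [measurable]: "C \<in> sets borel" using that B(2) by (auto simp: B0_def)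
    show "{\<xi> \<in> space M. X \<xi> \<in> C} \<in> events" by measurable
    show "emeasure M {\<xi> \<in> space M. X \<xi> \<in> C} = 0" using that by (simp add: emeasure_eq_measure B0_def)
  qed auto
  ultimately have "AE \<xi> in M. \<forall>C\<in>B0. X \<xi> \<notin> C" by (simp add: AE_ball_countable)
  then show ?thesis
  proof eventually_elim
    case (elim \<xi>)
    show ?case unfolding rv_support_def
    proof (intro CollectI allI impI)
      fix U :: "'b set" assume U: "open U \<and> X \<xi> \<in> U"
      then obtain \<U> where \<U>: "\<U> \<subseteq> B" "U = \<Union>\<U>" using B(3) by blast
      then obtain C where C: "C \<in> \<U>" "X \<xi> \<in> C" using U by blast
      then have "C \<notin> B0" "C \<in> B" using elim \<U> by auto
      then have "0 < prob {\<xi> \<in> space M. X \<xi> \<in> C}" by (simp add: B0_def zero_less_measure_iff)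
      also have "\<dots> \<le> prob {\<xi> \<in> space M. X \<xi> \<in> U}"
      proof (rule finite_measure_mono)
        have [measurable]: "U \<in> sets borel" using U by auto
        show "{\<xi> \<in> space M. X \<xi> \<in> U} \<in> events" by measurable
      qed (use C \<U> in auto)
      finally show "0 < prob {\<xi> \<in> space M. X \<xi> \<in> U}" .
    qed
  qed
qed

section \<open>Convergence in distribution\<close>

lemma exp_minus_approx:
  fixes x :: real
  assumes "0 \<le> x"
  shows "\<bar>exp (- x) - (1 - x)\<bar> \<le> x\<^sup>2"
proof -
  have "1 - x \<le> exp (- x)" using exp_ge_add_one_self[of "- x"] by simp
  moreover have "exp (- x) \<le> 1 - x + x\<^sup>2"
  proof -
    \<comment> \<open>The product is \<open>1 + x ^ 3\<close>.\<close>
    have "1 \<le> (1 - x + x\<^sup>2) * (1 + x)"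
      using assms by (simp add: power2_eq_square algebra_simps)
    also have "\<dots> \<le> (1 - x + x\<^sup>2) * exp x"
    proof (intro mult_left_mono)
      have "0 \<le> (x - 1/2)\<^sup>2 + 3/4" by simp
      then show "0 \<le> 1 - x + x\<^sup>2" by (simp add: power2_eq_square algebra_simps)
    qed (use exp_ge_add_one_self[of x] in simp)
    finally show ?thesis by (simp add: exp_minus field_simps)
  qed
  ultimately show ?thesis by simp
qed

lemma min_square_cube_le_powr:
  fixes x p :: real
  assumes "2 < p" "p \<le> 3"
  shows "min (x\<^sup>2) (\<bar>x\<bar> ^ 3) \<le> \<bar>x\<bar> powr p"
proof (cases "x = 0")
  case False
  show ?thesis
  proof (cases "1 \<le> \<bar>x\<bar>")
    case True
    then have "\<bar>x\<bar> powr 2 \<le> \<bar>x\<bar> powr p" using assms by (intro powr_mono) auto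
    then show ?thesis using False by (simp add: powr_numeral)
  next
    case 1: False
    then have "\<bar>x\<bar> powr 3 \<le> \<bar>x\<bar> powr p" using assms False by (intro powr_mono') auto
    then show ?thesis using False by (simp add: powr_numeral)
  qed
qed simp

lemma iexp_quadratic_approx:
  fixes x p :: real
  assumes "2 < p" "p \<le> 3"
  shows "cmod (iexp x - (1 + \<i> * x - x\<^sup>2 / 2)) \<le> \<bar>x\<bar> powr p"
proof -
  have "{..2::nat} = {0, 1, 2}" by auto
  then have s: "(\<Sum>k\<le>2. (\<i> * x)^k / fact k) = 1 + \<i> * x - x\<^sup>2 / 2"
    by (simp add: power_mult_distrib)
  have "cmod (iexp x - (1 + \<i> * x - x\<^sup>2 / 2)) \<le> \<bar>x\<bar> ^ 3 / 6"
    using iexp_approx1[of x 2] unfolding s by (simp add: fact_numeral eval_nat_numeral)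
  moreover have "cmod (iexp x - (1 + \<i> * x - x\<^sup>2 / 2)) \<le> x\<^sup>2"
    using iexp_approx2[of x 2] unfolding s by (simp add: fact_numeral)
  ultimately have "cmod (iexp x - (1 + \<i> * x - x\<^sup>2 / 2)) \<le> min (x\<^sup>2) (\<bar>x\<bar> ^ 3)"
    using zero_le_power[of "\<bar>x\<bar>" 3] by (intro min.boundedI) linarith+
  also have "\<dots> \<le> \<bar>x\<bar> powr p" using assms by (rule min_square_cube_le_powr)
  finally show ?thesis .
qed

lemma norm_integral_le:
  fixes f :: "'a \<Rightarrow> 'b::{banach, second_countable_topology}"
  assumes "integrable M f" "integrable M g" "AE x in M. norm (f x) \<le> g x"
  shows "norm (\<integral>x. f x \<partial>M) \<le> (\<integral>x. g x \<partial>M)"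
  by (rule order_trans[OF integral_norm_bound integral_mono_AE]) (use assms in auto)

lemma powr_ge_square_minus_1:
  fixes x p :: real
  assumes "2 < p"
  shows "x\<^sup>2 \<le> 1 + \<bar>x\<bar> powr p"
proof (cases "1 \<le> \<bar>x\<bar>")
  case True
  then have "\<bar>x\<bar> powr 2 \<le> \<bar>x\<bar> powr p" using assms by (intro powr_mono) auto
  then show ?thesis using True by (simp add: powr_numeral)
next
  case False
  then have "x\<^sup>2 \<le> 1" by (simp add: abs_square_le_1)
  then show ?thesis using powr_ge_zero[of "\<bar>x\<bar>" p] by linarith
qed

context prob_space
begin

lemma second_moment_le:
  fixes x :: "'a \<Rightarrow> real"
  assumes p: "2 < p" and [measurable]: "x \<in> borel_measurable M" and i: "integrable M (\<lambda>\<xi>. \<bar>x \<xi>\<bar> powr p)"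
  shows "integrable M (\<lambda>\<xi>. (x \<xi>)\<^sup>2)" "expectation (\<lambda>\<xi>. (x \<xi>)\<^sup>2) \<le> 1 + expectation (\<lambda>\<xi>. \<bar>x \<xi>\<bar> powr p)"
proof -
  show sq: "integrable M (\<lambda>\<xi>. (x \<xi>)\<^sup>2)"
  proof (rule Bochner_Integration.integrable_bound)
    show "integrable M (\<lambda>\<xi>. 1 + \<bar>x \<xi>\<bar> powr p)" using i by simp
    show "AE \<xi> in M. norm ((x \<xi>)\<^sup>2) \<le> norm (1 + \<bar>x \<xi>\<bar> powr p)"
      using powr_ge_square_minus_1[OF p] by (auto intro!: AE_I2 simp: abs_of_nonneg)
  qed measurable
  have "expectation (\<lambda>\<xi>. (x \<xi>)\<^sup>2) \<le> expectation (\<lambda>\<xi>. 1 + \<bar>x \<xi>\<bar> powr p)"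
    using sq i powr_ge_square_minus_1[OF p] by (intro integral_mono) auto
  then show "expectation (\<lambda>\<xi>. (x \<xi>)\<^sup>2) \<le> 1 + expectation (\<lambda>\<xi>. \<bar>x \<xi>\<bar> powr p)"
    using i by (simp add: prob_space)
qed

lemma integrable_inner_square:
  fixes X :: "'a \<Rightarrow> 'b::euclidean_space"
  assumes [measurable]: "X \<in> borel_measurable M" and sq: "integrable M (\<lambda>\<xi>. (norm (X \<xi>))\<^sup>2)"
  shows "integrable M (\<lambda>\<xi>. (X \<xi> \<bullet> u)\<^sup>2)"
proof (rule Bochner_Integration.integrable_bound)
  show "integrable M (\<lambda>\<xi>. (norm u)\<^sup>2 * (norm (X \<xi>))\<^sup>2)" using sq by simp
  have "(x \<bullet> u)\<^sup>2 \<le> (norm u)\<^sup>2 * (norm x)\<^sup>2" for x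
    using power_mono[OF Cauchy_Schwarz_ineq2[of x u] abs_ge_zero, of 2] by (simp add: power_mult_distrib mult.commute)
  then show "AE \<xi> in M. norm ((X \<xi> \<bullet> u)\<^sup>2) \<le> norm ((norm u)\<^sup>2 * (norm (X \<xi>))\<^sup>2)" by (intro AE_I2) simp
qed measurable

text \<open>Lyapunov's central limit theorem on the level of characteristic functions. Products of
  numbers of modulus at most one differ by at most the sum of the differences of their factors, and
  each factor differs by order \<open>n powr (- p / 2)\<close> from its own Gaussian factor, up to a
  term of order \<open>1 / n\<^sup>2\<close>. The summands need not be identically distributed, only
  their averaged variance converges. The cosine is all that the Gaussian averaging below asks
  for.\<close>

lemma char_indep_sum_tendsto:
  fixes a :: "nat \<Rightarrow> 'a \<Rightarrow> real"
  assumes ind: "indep_vars (\<lambda>_. borel) a {1..}" and p: "2 < p" "p \<le> 3"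
    and mom: "\<And>i. i \<ge> 1 \<Longrightarrow> integrable M (\<lambda>\<xi>. \<bar>a i \<xi>\<bar> powr p)"
      "\<And>i. i \<ge> 1 \<Longrightarrow> expectation (\<lambda>\<xi>. \<bar>a i \<xi>\<bar> powr p) \<le> C"
    and mean: "\<And>i. i \<ge> 1 \<Longrightarrow> expectation (a i) = 0"
    and var: "(\<lambda>n. (1 / real n) * (\<Sum>i=1..n. expectation (\<lambda>\<xi>. (a i \<xi>)\<^sup>2))) \<longlonglongrightarrow> v"
  shows "(\<lambda>n. expectation (\<lambda>\<xi>. cos ((1 / sqrt (real n)) * (\<Sum>i=1..n. a i \<xi>)))) \<longlonglongrightarrow> exp (- v / 2)"
proof -
  have rv [measurable]: "a i \<in> borel_measurable M" if "i \<ge> 1" for i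
    using ind that by (auto simp: indep_vars_def2)
  have sq: "integrable M (\<lambda>\<xi>. (a i \<xi>)\<^sup>2)" if "i \<ge> 1" for i
    by (rule second_moment_le(1)[OF p(1) rv[OF that] mom(1)[OF that]])
  have int: "integrable M (a i)" if "i \<ge> 1" for i
    using square_integrable_imp_integrable[OF rv sq] that by auto
  define \<sigma> where "\<sigma> = (\<lambda>i. expectation (\<lambda>\<xi>. (a i \<xi>)\<^sup>2))"
  have \<sigma>: "0 \<le> \<sigma> i" "\<sigma> i \<le> 1 + C" if "i \<ge> 1" for i
  proof -
    show "0 \<le> \<sigma> i" by (simp add: \<sigma>_def)
    show "\<sigma> i \<le> 1 + C"
      using second_moment_le(2)[OF p(1) rv[OF that] mom(1)[OF that]] mom(2)[OF that] by (simp add: \<sigma>_def)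
  qed
  have C0: "0 \<le> C" by (rule order_trans[OF _ mom(2)[of 1]]) auto
  define \<phi> where "\<phi> = (\<lambda>i s. char (distr M borel (a i)) s)"
  have \<phi>: "\<phi> i s = expectation (\<lambda>\<xi>. iexp (s * a i \<xi>))" if "i \<ge> 1" for i s
    unfolding \<phi>_def char_def using rv[OF that] by (subst integral_distr) auto
  have \<phi>1: "cmod (\<phi> i s) \<le> 1" if "i \<ge> 1" for i s
    unfolding \<phi>_def using rv[OF that] real_distribution_distr[of "a i"]
    by (intro real_distribution.cmod_char_le_1) auto
  have ie: "integrable M (\<lambda>\<xi>. iexp (s * a i \<xi>))" if "i \<ge> 1" for i s
    using rv[OF that] by (intro integrable_iexp) auto
  have \<phi>_approx: "cmod (\<phi> i s - complex_of_real (exp (- (s\<^sup>2 * \<sigma> i / 2)))) \<le> \<bar>s\<bar> powr p * C + s ^ 4 * (1 + C)\<^sup>2" if i: "i \<ge> 1" for i s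
  proof -
    have ci: "integrable M (\<lambda>\<xi>. complex_of_real (a i \<xi>))" "integrable M (\<lambda>\<xi>. complex_of_real ((a i \<xi>)\<^sup>2))"
      using int[OF i] sq[OF i] by (auto simp del: of_real_power)
    have "expectation (\<lambda>\<xi>. 1 + \<i> * complex_of_real s * complex_of_real (a i \<xi>) - complex_of_real (s\<^sup>2 / 2) * complex_of_real ((a i \<xi>)\<^sup>2))
        = complex_of_real (1 - s\<^sup>2 * \<sigma> i / 2)"
      using ci mean[OF i] by (simp add: \<sigma>_def prob_space integral_complex_of_real del: of_real_power)
    then have "\<phi> i s - complex_of_real (1 - s\<^sup>2 * \<sigma> i / 2)
      = expectation (\<lambda>\<xi>. iexp (s * a i \<xi>)) - expectation (\<lambda>\<xi>. 1 + \<i> * complex_of_real s * complex_of_real (a i \<xi>) - complex_of_real (s\<^sup>2 / 2) * complex_of_real ((a i \<xi>)\<^sup>2))"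
      by (simp add: \<phi>[OF i])
    also have "\<dots> = expectation (\<lambda>\<xi>. iexp (s * a i \<xi>) - (1 + \<i> * complex_of_real s * complex_of_real (a i \<xi>) - complex_of_real (s\<^sup>2 / 2) * complex_of_real ((a i \<xi>)\<^sup>2)))"
      using ci ie[OF i] by (intro Bochner_Integration.integral_diff[symmetric]) auto
    also have "\<dots> = expectation (\<lambda>\<xi>. iexp (s * a i \<xi>) - (1 + \<i> * complex_of_real (s * a i \<xi>) - complex_of_real ((s * a i \<xi>)\<^sup>2 / 2)))"
      by (intro Bochner_Integration.integral_cong refl) (simp add: power_mult_distrib)
    also have "cmod \<dots> \<le> expectation (\<lambda>\<xi>. \<bar>s * a i \<xi>\<bar> powr p)"
    proof (rule norm_integral_le)
      show "integrable M (\<lambda>\<xi>. \<bar>s * a i \<xi>\<bar> powr p)"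
        using mom(1)[OF i] by (simp add: abs_mult powr_mult)
      have "integrable M (\<lambda>\<xi>. iexp (s * a i \<xi>) - (1 + \<i> * complex_of_real s * complex_of_real (a i \<xi>) - complex_of_real (s\<^sup>2 / 2) * complex_of_real ((a i \<xi>)\<^sup>2)))"
        using ci ie[OF i] by auto
      then show "integrable M (\<lambda>\<xi>. iexp (s * a i \<xi>) - (1 + \<i> * complex_of_real (s * a i \<xi>) - complex_of_real ((s * a i \<xi>)\<^sup>2 / 2)))"
        by (rule Bochner_Integration.integrable_cong[THEN iffD1, OF refl, rotated]) (simp add: power_mult_distrib)
      show "AE \<xi> in M. cmod (iexp (s * a i \<xi>) - (1 + \<i> * complex_of_real (s * a i \<xi>) - complex_of_real ((s * a i \<xi>)\<^sup>2 / 2))) \<le> \<bar>s * a i \<xi>\<bar> powr p"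
        using iexp_quadratic_approx[OF p] by (intro AE_I2) (simp del: of_real_mult)
    qed
    also have "\<dots> \<le> \<bar>s\<bar> powr p * C"
      using mom[OF i] by (simp add: abs_mult powr_mult mult_left_mono)
    finally have 1: "cmod (\<phi> i s - complex_of_real (1 - s\<^sup>2 * \<sigma> i / 2)) \<le> \<bar>s\<bar> powr p * C" .
    have "cmod (complex_of_real (1 - s\<^sup>2 * \<sigma> i / 2) - complex_of_real (exp (- (s\<^sup>2 * \<sigma> i / 2)))) = \<bar>exp (- (s\<^sup>2 * \<sigma> i / 2)) - (1 - s\<^sup>2 * \<sigma> i / 2)\<bar>"
      by (metis abs_minus_commute norm_of_real of_real_diff)
    also have "\<dots> \<le> (s\<^sup>2 * \<sigma> i / 2)\<^sup>2" using \<sigma>[OF i] by (intro exp_minus_approx) auto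
    also have "\<dots> \<le> (s\<^sup>2 * (1 + C))\<^sup>2"
    proof (rule power_mono)
      have "0 \<le> s\<^sup>2 * \<sigma> i" using \<sigma>[OF i] by simp
      then show "0 \<le> s\<^sup>2 * \<sigma> i / 2" "s\<^sup>2 * \<sigma> i / 2 \<le> s\<^sup>2 * (1 + C)"
        using mult_left_mono[OF \<sigma>(2)[OF i], of "s\<^sup>2"] by auto
    qed
    also have "\<dots> = s ^ 4 * (1 + C)\<^sup>2" by (simp add: power_mult_distrib)
    finally show ?thesis
      using 1 norm_triangle_ineq[of "\<phi> i s - complex_of_real (1 - s\<^sup>2 * \<sigma> i / 2)" "complex_of_real (1 - s\<^sup>2 * \<sigma> i / 2) - complex_of_real (exp (- (s\<^sup>2 * \<sigma> i / 2)))"]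
      by simp
  qed
  define E where "E = (\<lambda>n. expectation (\<lambda>\<xi>. iexp ((1 / sqrt (real n)) * (\<Sum>i=1..n. a i \<xi>))))"
  define w where "w = (\<lambda>n. exp (- ((1 / real n) * (\<Sum>i=1..n. \<sigma> i)) / 2))"
  have Ew: "cmod (E n - w n) \<le> real n powr (1 - p / 2) * C + (1 + C)\<^sup>2 / real n" if n: "n \<ge> 1" for n
  proof -
    let ?s = "1 / sqrt (real n)"
    have s: "?s\<^sup>2 = 1 / real n" "?s ^ 4 = 1 / (real n)\<^sup>2" using n
      by (simp_all add: power_divide power4_eq_xxxx power2_eq_square)
    have sp: "\<bar>?s\<bar> powr p = real n powr (- (p / 2))"
    proof -
      have "\<bar>?s\<bar> = real n powr (- (1 / 2))"
        using n by (simp add: powr_minus powr_half_sqrt inverse_eq_divide)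
      then show ?thesis by (simp only: powr_powr) simp
    qed
    have ind': "indep_vars (\<lambda>_. borel) a {1..n}" by (rule indep_vars_subset[OF ind]) auto
    have "E n = char (distr M borel (\<lambda>\<xi>. \<Sum>i=1..n. a i \<xi>)) ?s"
      unfolding E_def char_def by (subst integral_distr) auto
    also have "\<dots> = (\<Prod>i=1..n. \<phi> i ?s)" unfolding \<phi>_def by (rule char_distr_sum[OF ind'])
    finally have "E n = (\<Prod>i=1..n. \<phi> i ?s)" .
    moreover have "complex_of_real (w n) = (\<Prod>i=1..n. complex_of_real (exp (- (?s\<^sup>2 * \<sigma> i / 2))))"
      unfolding w_def of_real_prod[symmetric] exp_sum[symmetric, OF finite_atLeastAtMost] s
      by (simp add: sum_negf sum_divide_distrib sum_distrib_left)
    ultimately have "cmod (E n - w n) \<le> (\<Sum>i=1..n. cmod (\<phi> i ?s - complex_of_real (exp (- (?s\<^sup>2 * \<sigma> i / 2)))))"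
      using \<phi>1 \<sigma> by (simp only:) (intro norm_prod_diff, auto)
    also have "\<dots> \<le> (\<Sum>i=1..n. \<bar>?s\<bar> powr p * C + ?s ^ 4 * (1 + C)\<^sup>2)"
      by (intro sum_mono \<phi>_approx) auto
    also have "\<dots> = real n powr (1 - p / 2) * C + (1 + C)\<^sup>2 / real n"
    proof -
      have "real n * real n powr (- (p / 2)) = real n powr (1 - p / 2)"
        using n powr_add[of "real n" 1 "- (p / 2)"] by simp
      moreover have "real n * (1 / (real n)\<^sup>2 * (1 + C)\<^sup>2) = (1 + C)\<^sup>2 / real n"
        using n by (simp add: power2_eq_square)
      ultimately show ?thesis
        unfolding sp s by (simp add: distrib_left mult.assoc[symmetric])
    qed
    finally show ?thesis .
  qed
  have "(\<lambda>n. E n - w n) \<longlonglongrightarrow> 0"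
  proof (rule Lim_null_comparison)
    show "\<forall>\<^sub>F n in sequentially. cmod (E n - w n) \<le> real n powr (1 - p / 2) * C + (1 + C)\<^sup>2 / real n"
      by (rule eventually_mono[OF eventually_ge_at_top[of 1] Ew])
    have "(\<lambda>n. real n powr (1 - p / 2)) \<longlonglongrightarrow> 0"
      using p by (intro tendsto_neg_powr filterlim_real_sequentially) auto
    moreover have "(\<lambda>n. (1 + C)\<^sup>2 / real n) \<longlonglongrightarrow> 0" by (rule lim_const_over_n)
    ultimately have "(\<lambda>n. real n powr (1 - p / 2) * C + (1 + C)\<^sup>2 / real n) \<longlonglongrightarrow> 0 * C + 0"
      by (intro tendsto_add tendsto_mult tendsto_const)
    then show "(\<lambda>n. real n powr (1 - p / 2) * C + (1 + C)\<^sup>2 / real n) \<longlonglongrightarrow> 0" by simp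
  qed
  moreover have "(\<lambda>n. complex_of_real (w n)) \<longlonglongrightarrow> complex_of_real (exp (- v / 2))"
    using var unfolding w_def \<sigma>_def by (intro tendsto_intros) auto
  ultimately have "E \<longlonglongrightarrow> complex_of_real (exp (- v / 2))"
    using tendsto_add[of "\<lambda>n. E n - w n" 0 _ "\<lambda>n. complex_of_real (w n)"] by simp
  then have "(\<lambda>n. Re (E n)) \<longlonglongrightarrow> exp (- v / 2)" using tendsto_Re by fastforce
  moreover have "Re (E n) = expectation (\<lambda>\<xi>. cos ((1 / sqrt (real n)) * (\<Sum>i=1..n. a i \<xi>)))" for n
  proof -
    have "integrable M (\<lambda>\<xi>. iexp ((1 / sqrt (real n)) * (\<Sum>i=1..n. a i \<xi>)))"
      by (intro integrable_iexp) auto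
    then show ?thesis unfolding E_def by (subst integral_Re[symmetric]) (simp_all add: Re_exp)
  qed
  ultimately show ?thesis by simp
qed

end

section \<open>Gaussian averaging, Laplace transforms and weak convergence\<close>

lemma std_normal_product_cos:
  fixes x :: "nat \<Rightarrow> real"
  shows
  "(\<integral>z. cos (\<Sum>j<m. z j * x j) \<partial>(\<Pi>\<^sub>M j\<in>{..<m}. std_normal_distribution)) = exp (- (\<Sum>j<m. (x j)\<^sup>2) / 2)"
proof -
  interpret N: real_distribution std_normal_distribution by (rule real_dist_normal_dist)
  interpret P: product_prob_space "\<lambda>_::nat. std_normal_distribution" "{..<m}" by unfold_locales
  have i: "integrable std_normal_distribution (\<lambda>z. iexp (z * x j))" for j
    by (intro N.integrable_iexp) auto
  have eq: "(\<Prod>j<m. iexp (z j * x j)) = iexp (\<Sum>j<m. z j * x j)" for z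
    by (simp add: exp_sum[symmetric] sum_distrib_left)
  have "(\<integral>z. iexp (\<Sum>j<m. z j * x j) \<partial>(\<Pi>\<^sub>M j\<in>{..<m}. std_normal_distribution)) = (\<Prod>j<m. \<integral>z. iexp (z * x j) \<partial>std_normal_distribution)"
    unfolding eq[symmetric] by (rule P.product_integral_prod) (use i in auto)
  also have "\<dots> = (\<Prod>j<m. char std_normal_distribution (x j))"
    by (simp add: char_def mult.commute)
  also have "\<dots> = complex_of_real (\<Prod>j<m. exp (- (x j)\<^sup>2 / 2))"
    by (simp add: char_std_normal_distribution)
  also have "(\<Prod>j<m. exp (- (x j)\<^sup>2 / 2)) = exp (- (\<Sum>j<m. (x j)\<^sup>2) / 2)"
    by (simp add: exp_sum[symmetric] sum_negf sum_divide_distrib)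
  finally have c: "(\<integral>z. iexp (\<Sum>j<m. z j * x j) \<partial>(\<Pi>\<^sub>M j\<in>{..<m}. std_normal_distribution)) = complex_of_real (exp (- (\<Sum>j<m. (x j)\<^sup>2) / 2))" .
  have "integrable (\<Pi>\<^sub>M j\<in>{..<m}. std_normal_distribution) (\<lambda>z. iexp (\<Sum>j<m. z j * x j))"
    unfolding eq[symmetric] using i by (intro P.product_integrable_prod) auto
  then have "(\<integral>z. Re (iexp (\<Sum>j<m. z j * x j)) \<partial>(\<Pi>\<^sub>M j\<in>{..<m}. std_normal_distribution)) = Re (complex_of_real (exp (- (\<Sum>j<m. (x j)\<^sup>2) / 2)))"
    using c by (subst integral_Re) auto
  then show ?thesis by (simp add: Re_exp)
qed

text \<open>A continuous substitute for the indicator of \<open>{..k}\<close>: tightness can be read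
  off from convergence of continuous test functions.\<close>

definition taper :: "nat \<Rightarrow> real \<Rightarrow> real" where
  "taper k y = max 0 (min 1 (real k + 1 - y))"

lemma continuous_on_taper: "continuous_on UNIV (taper k)"
  unfolding taper_def[abs_def] by (intro continuous_intros)

lemma measurable_taper [measurable]: "taper k \<in> borel_measurable borel"
  by (rule borel_measurable_continuous_onI[OF continuous_on_taper])

lemma taper_bounds: "0 \<le> taper k y" "taper k y \<le> 1"
  by (auto simp: taper_def)

lemma taper_tight:
  assumes "real_distribution L"
  shows "(\<lambda>k. \<integral>y. taper k y \<partial>L) \<longlonglongrightarrow> 1"
proof -
  interpret L: real_distribution L by (rule assms)
  have "(\<lambda>k. \<integral>y. taper k y \<partial>L) \<longlonglongrightarrow> (\<integral>y. 1 \<partial>L)"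
  proof (rule integral_dominated_convergence[where w = "\<lambda>_. 1"])
    show "AE y in L. (\<lambda>k. taper k y) \<longlonglongrightarrow> 1"
    proof (intro AE_I2 tendsto_eventually)
      fix y :: real
      have "\<forall>\<^sub>F k in sequentially. y \<le> real k"
        using eventually_ge_at_top[of "nat \<lceil>y\<rceil>"] by eventually_elim linarith
      then show "\<forall>\<^sub>F k in sequentially. taper k y = 1" by eventually_elim (simp add: taper_def)
    qed
  qed (use taper_bounds in auto)
  then show ?thesis using L.prob_space by simp
qed

context prob_space
begin

text \<open>The square is linearised: with \<open>N\<close> the squared norm of \<open>x\<close>,
  \<open>exp (- s * N / 2)\<close> is the average of \<open>cos (sqrt s * (z \<bullet> x))\<close>
  over a standard Gaussian vector \<open>z\<close>. After Fubini the hypothesis applies for each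
  fixed \<open>z\<close>, and dominated convergence leaves the Gaussian average of
  \<open>exp (- s * y / 2)\<close>, with \<open>y\<close> the sum of squares of \<open>z\<close>.
  That is the Laplace transform of \<open>chi_square m\<close>.\<close>

lemma laplace_tendsto_chi_square:
  fixes x :: "nat \<Rightarrow> nat \<Rightarrow> 'a \<Rightarrow> real"
  assumes x [measurable]: "\<And>n j. j < m \<Longrightarrow> x n j \<in> borel_measurable M"
    and cf: "\<And>z :: nat \<Rightarrow> real. (\<lambda>n. expectation (\<lambda>\<xi>. cos (\<Sum>j<m. z j * x n j \<xi>))) \<longlonglongrightarrow> exp (- (\<Sum>j<m. (z j)\<^sup>2) / 2)"
    and s: "0 \<le> s"
  shows "(\<lambda>n. expectation (\<lambda>\<xi>. exp (- s * (\<Sum>j<m. (x n j \<xi>)\<^sup>2) / 2))) \<longlonglongrightarrow> (\<integral>y. exp (- s * y / 2) \<partial>chi_square m)"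
proof -
  let ?N = "\<Pi>\<^sub>M j\<in>{..<m}. std_normal_distribution"
  interpret N: real_distribution std_normal_distribution by (rule real_dist_normal_dist)
  interpret P: product_prob_space "\<lambda>_::nat. std_normal_distribution" "{..<m}" by unfold_locales
  interpret PM: pair_prob_space M ?N by unfold_locales
  have [measurable]: "(\<lambda>z. z j) \<in> borel_measurable ?N" if "j < m" for j
    using measurable_component_singleton[of j "{..<m}" "\<lambda>_. std_normal_distribution"] that
    by (simp add: measurable_cong_sets[OF refl N.events_eq_borel])
  have *: "expectation (\<lambda>\<xi>. exp (- s * (\<Sum>j<m. (x n j \<xi>)\<^sup>2) / 2)) = (\<integral>z. expectation (\<lambda>\<xi>. cos (\<Sum>j<m. (sqrt s * z j) * x n j \<xi>)) \<partial>?N)" for n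
  proof -
    have "expectation (\<lambda>\<xi>. exp (- s * (\<Sum>j<m. (x n j \<xi>)\<^sup>2) / 2)) = expectation (\<lambda>\<xi>. \<integral>z. cos (\<Sum>j<m. z j * (sqrt s * x n j \<xi>)) \<partial>?N)"
      unfolding std_normal_product_cos using s by (simp add: power_mult_distrib sum_distrib_left sum_negf)
    also have "\<dots> = (\<integral>z. expectation (\<lambda>\<xi>. cos (\<Sum>j<m. z j * (sqrt s * x n j \<xi>))) \<partial>?N)"
      by (rule PM.Fubini_integral[symmetric], rule PM.P.integrable_const_bound[of _ 1]) auto
    finally show ?thesis by (simp add: ac_simps)
  qed
  have "(\<lambda>n. \<integral>z. expectation (\<lambda>\<xi>. cos (\<Sum>j<m. (sqrt s * z j) * x n j \<xi>)) \<partial>?N) \<longlonglongrightarrow> (\<integral>z. exp (- (\<Sum>j<m. (sqrt s * z j)\<^sup>2) / 2) \<partial>?N)"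
  proof (rule integral_dominated_convergence[where w = "\<lambda>_. 1"])
    show "AE z in ?N. (\<lambda>n. expectation (\<lambda>\<xi>. cos (\<Sum>j<m. (sqrt s * z j) * x n j \<xi>))) \<longlonglongrightarrow> exp (- (\<Sum>j<m. (sqrt s * z j)\<^sup>2) / 2)"
      by (intro AE_I2 cf)
    show "AE z in ?N. norm (expectation (\<lambda>\<xi>. cos (\<Sum>j<m. (sqrt s * z j) * x n j \<xi>))) \<le> 1" for n
    proof (intro AE_I2)
      fix z
      have "norm (expectation (\<lambda>\<xi>. cos (\<Sum>j<m. (sqrt s * z j) * x n j \<xi>))) \<le> expectation (\<lambda>\<xi>. 1)"
        by (rule norm_integral_le) (auto intro!: integrable_const_bound[of _ 1])
      then show "norm (expectation (\<lambda>\<xi>. cos (\<Sum>j<m. (sqrt s * z j) * x n j \<xi>))) \<le> 1" by (simp add: prob_space)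
    qed
    show "(\<lambda>z. expectation (\<lambda>\<xi>. cos (\<Sum>j<m. (sqrt s * z j) * x n j \<xi>))) \<in> borel_measurable ?N" for n
      by (rule borel_measurable_lebesgue_integral) measurable
  qed auto
  also have "(\<integral>z. exp (- (\<Sum>j<m. (sqrt s * z j)\<^sup>2) / 2) \<partial>?N) = (\<integral>y. exp (- s * y / 2) \<partial>chi_square m)"
    unfolding chi_square_def using s
    by (subst integral_distr) (auto simp: power_mult_distrib sum_distrib_left sum_negf)
  finally show ?thesis unfolding * .
qed

text \<open>Everything lives on the half line, which \<open>exp (- y / 2)\<close> maps into
  \<open>{0..1}\<close>. The Laplace transforms at natural \<open>k\<close> are the moments there,
  so Weierstrass approximation gives convergence for every continuous function of
  \<open>exp (- y / 2)\<close>. This covers continuous functions that vanish beyond some point, and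
  tightness extends it to bounded continuous \<open>h\<close>.\<close>

lemma integral_tendsto_of_laplace:
  fixes Q :: "nat \<Rightarrow> 'a \<Rightarrow> real" and L :: "real measure" and h :: "real \<Rightarrow> real"
  assumes Q [measurable]: "\<And>n. Q n \<in> borel_measurable M" and Q0: "\<And>n \<xi>. 0 \<le> Q n \<xi>"
    and L: "real_distribution L" and L0: "AE y in L. 0 \<le> y"
    and lap: "\<And>k::nat. (\<lambda>n. expectation (\<lambda>\<xi>. exp (- real k * Q n \<xi> / 2))) \<longlonglongrightarrow> (\<integral>y. exp (- real k * y / 2) \<partial>L)"
    and h: "continuous_on UNIV h" "bounded (range h)"
  shows "(\<lambda>n. expectation (\<lambda>\<xi>. h (Q n \<xi>))) \<longlonglongrightarrow> (\<integral>y. h y \<partial>L)"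
proof -
  interpret L: real_distribution L by (rule L)
  have cont: "(\<lambda>n. expectation (\<lambda>\<xi>. g (exp (- Q n \<xi> / 2)))) \<longlonglongrightarrow> (\<integral>y. g (exp (- y / 2)) \<partial>L)"
    if g: "continuous_on UNIV g" for g :: "real \<Rightarrow> real"
  proof (rule LIMSEQ_I)
    fix e :: real assume e: "0 < e"
    have g': "continuous_on {0..1} g" using g continuous_on_subset by blast
    obtain q where q: "real_polynomial_function q" "\<And>x. x \<in> {0..1} \<Longrightarrow> \<bar>g x - q x\<bar> < e / 3"
      using Stone_Weierstrass_real_polynomial_function[OF _ g', of "e / 3"] e by auto
    obtain a d where qa: "q = (\<lambda>x. \<Sum>i\<le>d. a i * x ^ i)" using q(1) real_polynomial_function_imp_sum by blast
    have [measurable]: "g \<in> borel_measurable borel" using g by (rule borel_measurable_continuous_onI)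
    have [measurable]: "q \<in> borel_measurable borel" unfolding qa by measurable
    have pw: "exp (- y / 2) ^ i = exp (- real i * y / 2)" for y :: real and i
      by (simp add: exp_of_nat_mult[symmetric])
    have bq: "\<bar>q x\<bar> \<le> (\<Sum>i\<le>d. \<bar>a i\<bar>)" if "x \<in> {0..1}" for x
      unfolding qa using that by (intro order_trans[OF sum_abs] sum_mono) (auto simp: abs_mult power_le_one mult_left_le)
    have bg: "\<bar>g x\<bar> \<le> (\<Sum>i\<le>d. \<bar>a i\<bar>) + e" if "x \<in> {0..1}" for x
      using bq[OF that] q(2)[OF that] e by linarith
    have in01: "exp (- Q n \<xi> / 2) \<in> {0..1}" for n \<xi> using Q0[of n \<xi>] by auto
    have in01L: "AE y in L. exp (- y / 2) \<in> {0..1}" using L0 by eventually_elim auto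
    have "(\<lambda>n. expectation (\<lambda>\<xi>. q (exp (- Q n \<xi> / 2)))) \<longlonglongrightarrow> (\<integral>y. q (exp (- y / 2)) \<partial>L)"
    proof -
      have i1: "integrable M (\<lambda>\<xi>. exp (- real i * Q n \<xi> / 2))" for i n
        using Q0 by (intro integrable_const_bound[of _ 1]) auto
      have i2: "integrable L (\<lambda>y. exp (- real i * y / 2))" for i
        by (intro L.integrable_const_bound[of _ 1]) (use L0 in \<open>auto elim!: eventually_mono\<close>)
      have "(\<lambda>n. \<Sum>i\<le>d. a i * expectation (\<lambda>\<xi>. exp (- real i * Q n \<xi> / 2))) \<longlonglongrightarrow> (\<Sum>i\<le>d. a i * (\<integral>y. exp (- real i * y / 2) \<partial>L))"
        by (intro tendsto_intros lap)
      then show ?thesis unfolding qa pw using i1 i2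
        by simp
    qed
    from LIMSEQ_D[OF this, of "e / 3"] e
    obtain n0 where n0: "\<And>n. n \<ge> n0 \<Longrightarrow> \<bar>expectation (\<lambda>\<xi>. q (exp (- Q n \<xi> / 2))) - (\<integral>y. q (exp (- y / 2)) \<partial>L)\<bar> < e / 3"
      by auto
    have "\<bar>expectation (\<lambda>\<xi>. g (exp (- Q n \<xi> / 2))) - (\<integral>y. g (exp (- y / 2)) \<partial>L)\<bar> < e" if "n \<ge> n0" for n
    proof -
      have ig: "integrable M (\<lambda>\<xi>. g (exp (- Q n \<xi> / 2)))" "integrable M (\<lambda>\<xi>. q (exp (- Q n \<xi> / 2)))"
        by (rule integrable_const_bound[OF AE_I2], rule bg[OF in01, folded real_norm_def], simp)
          (rule integrable_const_bound[OF AE_I2], rule bq[OF in01, folded real_norm_def], simp)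
      have ig': "integrable L (\<lambda>y. g (exp (- y / 2)))" "integrable L (\<lambda>y. q (exp (- y / 2)))"
        using in01L bg bq
        by (auto intro!: L.integrable_const_bound[where B = "(\<Sum>i\<le>d. \<bar>a i\<bar>) + e" and f = "\<lambda>y. g (exp (- y / 2))", simplified]
            L.integrable_const_bound[where B = "\<Sum>i\<le>d. \<bar>a i\<bar>" and f = "\<lambda>y. q (exp (- y / 2))", simplified] elim!: eventually_mono)
      have "\<bar>expectation (\<lambda>\<xi>. g (exp (- Q n \<xi> / 2)) - q (exp (- Q n \<xi> / 2)))\<bar> \<le> expectation (\<lambda>\<xi>. e / 3)"
        using ig q(2)[OF in01[of n]] less_imp_le[OF q(2)[OF in01[of n]]]
        by (intro norm_integral_le[where 'b = real, unfolded real_norm_def]) auto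
      moreover have "\<bar>(\<integral>y. g (exp (- y / 2)) - q (exp (- y / 2)) \<partial>L)\<bar> \<le> e / 3"
      proof -
        have "\<bar>(\<integral>y. g (exp (- y / 2)) - q (exp (- y / 2)) \<partial>L)\<bar> \<le> (\<integral>y. \<bar>g (exp (- y / 2)) - q (exp (- y / 2))\<bar> \<partial>L)"
          by (rule integral_abs_bound)
        also have "\<dots> \<le> (\<integral>y. e / 3 \<partial>L)"
          using ig' in01L q(2) by (intro integral_mono_AE) (auto elim!: eventually_mono intro: less_imp_le)
        finally show ?thesis using L.prob_space by simp
      qed
      ultimately have "\<bar>expectation (\<lambda>\<xi>. g (exp (- Q n \<xi> / 2))) - expectation (\<lambda>\<xi>. q (exp (- Q n \<xi> / 2)))\<bar> \<le> e / 3"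
        "\<bar>(\<integral>y. g (exp (- y / 2)) \<partial>L) - (\<integral>y. q (exp (- y / 2)) \<partial>L)\<bar> \<le> e / 3"
        using ig ig' by (simp_all add: prob_space)
      then show ?thesis using n0[OF that] by linarith
    qed
    then show "\<exists>n0. \<forall>n\<ge>n0. norm (expectation (\<lambda>\<xi>. g (exp (- Q n \<xi> / 2))) - (\<integral>y. g (exp (- y / 2)) \<partial>L)) < e"
      by auto
  qed
  have cutoff: "(\<lambda>n. expectation (\<lambda>\<xi>. \<phi> (Q n \<xi>))) \<longlonglongrightarrow> (\<integral>y. \<phi> y \<partial>L)"
    if \<phi>: "continuous_on UNIV \<phi>" "\<And>y. c \<le> y \<Longrightarrow> \<phi> y = 0" for \<phi> :: "real \<Rightarrow> real" and c
  proof -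
    \<comment> \<open>The change of variables \<open>x = exp (- y / 2)\<close>. The maximum keeps
      the logarithm away from zero; this changes nothing, because \<open>\<phi>\<close> vanishes
      from \<open>c\<close> on.\<close>
    define g where "g = (\<lambda>x. \<phi> (- 2 * ln (max x (exp (- c / 2)))))"
    have "continuous_on UNIV (\<lambda>x::real. - 2 * ln (max x (exp (- c / 2))))"
      by (intro continuous_intros) (auto simp: max_def intro: less_imp_neq[symmetric] elim: less_le_trans[rotated])
    then have "continuous_on UNIV g"
      unfolding g_def by (rule continuous_on_compose2[OF \<phi>(1)]) auto
    moreover have "g (exp (- y / 2)) = \<phi> y" for y
    proof (cases "y \<le> c")
      case True
      then have "max (exp (- y / 2)) (exp (- c / 2)) = exp (- y / 2)" by (simp add: max_def)
      then show ?thesis by (simp add: g_def)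
    next
      case False
      then have "max (exp (- y / 2)) (exp (- c / 2)) = exp (- c / 2)" by (simp add: max_def)
      then show ?thesis using \<phi>(2)[of y] \<phi>(2)[of c] False by (simp add: g_def)
    qed
    ultimately show ?thesis using cont[of g] by simp
  qed
  obtain B where B: "\<And>y. \<bar>h y\<bar> \<le> B" "0 < B"
    using h(2) unfolding bounded_pos by (auto simp: image_iff)
  have hm [measurable]: "h \<in> borel_measurable borel" using h(1) by (rule borel_measurable_continuous_onI)
  have ct0: "taper k y = 0" if "real k + 1 \<le> y" for k y using that by (auto simp: taper_def)
  note tight = taper_tight[OF L]
  show ?thesis
  proof (rule LIMSEQ_I)
    fix e :: real assume e: "0 < e"
    then have "0 < e / (4 * B)" using B(2) by simp
    then obtain k where "\<bar>(\<integral>y. taper k y \<partial>L) - 1\<bar> < e / (4 * B)"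
      using LIMSEQ_D[OF tight] by (metis order_refl real_norm_def)
    then have k: "1 - (\<integral>y. taper k y \<partial>L) < e / (4 * B)" by linarith
    \<comment> \<open>Convergence for the cutoff carries the tightness of \<open>L\<close> over to
      the laws of \<open>Q n\<close>.\<close>
    have "(\<lambda>n. expectation (\<lambda>\<xi>. taper k (Q n \<xi>))) \<longlonglongrightarrow> (\<integral>y. taper k y \<partial>L)"
      using continuous_on_taper ct0 by (rule cutoff)
    then have "\<forall>\<^sub>F n in sequentially. 1 - expectation (\<lambda>\<xi>. taper k (Q n \<xi>)) < e / (4 * B)"
      using k by (intro order_tendstoD(2)[of _ "1 - (\<integral>y. taper k y \<partial>L)"] tendsto_intros)
    moreover have "(\<lambda>n. expectation (\<lambda>\<xi>. h (Q n \<xi>) * taper k (Q n \<xi>))) \<longlonglongrightarrow> (\<integral>y. h y * taper k y \<partial>L)"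
      using h(1) continuous_on_taper ct0 by (intro cutoff[of "\<lambda>y. h y * taper k y" "real k + 1"] continuous_on_mult) auto
    then have "\<forall>\<^sub>F n in sequentially. dist (expectation (\<lambda>\<xi>. h (Q n \<xi>) * taper k (Q n \<xi>))) (\<integral>y. h y * taper k y \<partial>L) < e / 4"
      using e by (intro tendstoD) auto
    ultimately have "\<forall>\<^sub>F n in sequentially. norm (expectation (\<lambda>\<xi>. h (Q n \<xi>)) - (\<integral>y. h y \<partial>L)) < e"
    proof eventually_elim
      case (elim n)
      have hct: "\<bar>h y * taper k y\<bar> \<le> B" for y
        using mult_mono[OF B(1)[of y] taper_bounds(2)[of k y]] B(2) taper_bounds[of k y] by (simp add: abs_mult)
      have i: "integrable M (\<lambda>\<xi>. h (Q n \<xi>))" "integrable M (\<lambda>\<xi>. taper k (Q n \<xi>))" "integrable M (\<lambda>\<xi>. h (Q n \<xi>) * taper k (Q n \<xi>))"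
        by (rule integrable_const_bound[of _ B] integrable_const_bound[of _ 1]; use B(1) taper_bounds hct in auto)+
      have iL: "integrable L h" "integrable L (taper k)" "integrable L (\<lambda>y. h y * taper k y)"
        by (rule L.integrable_const_bound[of _ B] L.integrable_const_bound[of _ 1]; use B(1) taper_bounds hct in auto)+
      have hb: "\<bar>h y - h y * taper k y\<bar> \<le> B * (1 - taper k y)" for y
      proof -
        have "h y - h y * taper k y = h y * (1 - taper k y)" by (simp add: algebra_simps)
        then show ?thesis using B(1)[of y] taper_bounds[of k y] by (simp add: abs_mult mult_right_mono)
      qed
      have "\<bar>expectation (\<lambda>\<xi>. h (Q n \<xi>) - h (Q n \<xi>) * taper k (Q n \<xi>))\<bar> \<le> expectation (\<lambda>\<xi>. B * (1 - taper k (Q n \<xi>)))"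
        using i hb by (intro norm_integral_le[where 'b = real, unfolded real_norm_def]) auto
      also have "\<dots> = B * (1 - expectation (\<lambda>\<xi>. taper k (Q n \<xi>)))" using i by (simp add: prob_space)
      also have "\<dots> < B * (e / (4 * B))" using elim(1) B(2) by (intro mult_strict_left_mono)
      finally have 1: "\<bar>expectation (\<lambda>\<xi>. h (Q n \<xi>)) - expectation (\<lambda>\<xi>. h (Q n \<xi>) * taper k (Q n \<xi>))\<bar> < e / 4"
        using i B(2) by simp
      have "\<bar>(\<integral>y. h y - h y * taper k y \<partial>L)\<bar> \<le> (\<integral>y. B * (1 - taper k y) \<partial>L)"
        using iL hb by (intro norm_integral_le[where 'b = real, unfolded real_norm_def]) auto
      also have "\<dots> = B * (1 - (\<integral>y. taper k y \<partial>L))" using iL L.prob_space by simp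
      also have "\<dots> < B * (e / (4 * B))" using k B(2) by (intro mult_strict_left_mono)
      finally have 2: "\<bar>(\<integral>y. h y \<partial>L) - (\<integral>y. h y * taper k y \<partial>L)\<bar> < e / 4"
        using iL B(2) by simp
      show ?case using 1 2 elim(2) unfolding dist_real_def real_norm_def by linarith
    qed
    then show "\<exists>n0. \<forall>n\<ge>n0. norm (expectation (\<lambda>\<xi>. h (Q n \<xi>)) - (\<integral>y. h y \<partial>L)) < e"
      unfolding eventually_sequentially .
  qed
qed

text \<open>\<open>Z n\<close> may be non-measurable, so its outer expectation is squeezed between
  the expectations of two measurable functions. They differ from \<open>h (Q n)\<close> by a modulus
  of continuity on a good event and by \<open>2 * B\<close> more off it.\<close>

lemma converges_in_distribution_perturb:
  fixes Q Z :: "nat \<Rightarrow> 'a \<Rightarrow> real" and L :: "real measure"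
  assumes Q [measurable]: "\<And>n. Q n \<in> borel_measurable M" and Q0: "\<And>n \<xi>. 0 \<le> Q n \<xi>"
    and L: "real_distribution L"
    and conv: "\<And>h::real \<Rightarrow> real. continuous_on UNIV h \<Longrightarrow> bounded (range h) \<Longrightarrow> (\<lambda>n. expectation (\<lambda>\<xi>. h (Q n \<xi>))) \<longlonglongrightarrow> (\<integral>y. h y \<partial>L)"
    and close: "\<And>\<eta>. 0 < \<eta> \<Longrightarrow> \<forall>\<^sub>F n in sequentially. hp M M \<eta> (\<lambda>\<xi>. \<bar>Z n \<xi> - Q n \<xi>\<bar> < \<eta>)"
  shows "converges_in_distribution M Z L"
  unfolding converges_in_distribution_def
proof (intro allI impI, elim conjE)
  fix h :: "real \<Rightarrow> real" assume h: "continuous_on UNIV h" "bounded (range h)"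
  interpret L: real_distribution L by (rule L)
  obtain B where B: "\<And>y. \<bar>h y\<bar> \<le> B" "0 < B"
    using h(2) unfolding bounded_pos by (auto simp: image_iff)
  have [measurable]: "h \<in> borel_measurable borel" using h(1) by (rule borel_measurable_continuous_onI)
  note tight = taper_tight[OF L]
  show "(\<lambda>n. outer_expectation M (\<lambda>\<xi>. h (Z n \<xi>))) \<longlonglongrightarrow> (\<integral>y. h y \<partial>L)"
  proof (rule LIMSEQ_I)
    fix e :: real assume e: "0 < e"
    define \<epsilon> where "\<epsilon> = min 1 (e / (4 + 4 * B))"
    have \<epsilon>: "0 < \<epsilon>" "\<epsilon> \<le> 1" "4 * \<epsilon> + 4 * B * \<epsilon> \<le> e"
    proof -
      show "0 < \<epsilon>" "\<epsilon> \<le> 1" using e B by (auto simp: \<epsilon>_def)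
      have "\<epsilon> * (4 + 4 * B) \<le> e / (4 + 4 * B) * (4 + 4 * B)"
        using B by (intro mult_right_mono) (auto simp: \<epsilon>_def)
      also have "\<dots> = e" using B(2) by simp
      finally show "4 * \<epsilon> + 4 * B * \<epsilon> \<le> e" by (simp add: algebra_simps)
    qed
    obtain k where "\<bar>(\<integral>y. taper k y \<partial>L) - 1\<bar> < \<epsilon>"
      using LIMSEQ_D[OF tight \<epsilon>(1)] by (metis order_refl real_norm_def)
    then have k: "1 - (\<integral>y. taper k y \<partial>L) < \<epsilon>" by linarith
    \<comment> \<open>On the good event \<open>Q n\<close> lies between 0 and \<open>k + 1\<close>,
      and \<open>Z n\<close> is within distance 1 of it.\<close>
    have "uniformly_continuous_on {-1..real k + 2} h"
      using h(1) by (intro compact_uniformly_continuous) (auto intro: continuous_on_subset)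
    then obtain \<delta> where \<delta>: "0 < \<delta>" "\<And>x y. x \<in> {-1..real k + 2} \<Longrightarrow> y \<in> {-1..real k + 2} \<Longrightarrow> \<bar>y - x\<bar> < \<delta> \<Longrightarrow> \<bar>h y - h x\<bar> < \<epsilon>"
      unfolding uniformly_continuous_on_def dist_real_def using \<epsilon>(1) by metis
    have "bounded (range (taper k))" using taper_bounds by (intro boundedI[of _ 1]) auto
    then have "(\<lambda>n. expectation (\<lambda>\<xi>. taper k (Q n \<xi>))) \<longlonglongrightarrow> (\<integral>y. taper k y \<partial>L)"
      using continuous_on_taper by (intro conv)
    then have "\<forall>\<^sub>F n in sequentially. 1 - expectation (\<lambda>\<xi>. taper k (Q n \<xi>)) < \<epsilon>"
      using k by (intro order_tendstoD(2)[of _ "1 - (\<integral>y. taper k y \<partial>L)"] tendsto_intros)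
    moreover have "\<forall>\<^sub>F n in sequentially. dist (expectation (\<lambda>\<xi>. h (Q n \<xi>))) (\<integral>y. h y \<partial>L) < \<epsilon>"
      using conv[OF h] \<epsilon>(1) by (intro tendstoD)
    moreover have "\<forall>\<^sub>F n in sequentially. hp M M (min \<epsilon> (min \<delta> 1)) (\<lambda>\<xi>. \<bar>Z n \<xi> - Q n \<xi>\<bar> < min \<epsilon> (min \<delta> 1))"
      using \<epsilon> \<delta> by (intro close) auto
    ultimately have "\<forall>\<^sub>F n in sequentially. norm (outer_expectation M (\<lambda>\<xi>. h (Z n \<xi>)) - (\<integral>y. h y \<partial>L)) < e"
    proof eventually_elim
      case (elim n)
      have "prob {\<xi>\<in>space M. \<not> Q n \<xi> < real k + 1} \<le> 1 - expectation (\<lambda>\<xi>. taper k (Q n \<xi>))"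
      proof -
        have "prob {\<xi>\<in>space M. \<not> Q n \<xi> < real k + 1} = expectation (indicator {\<xi>\<in>space M. \<not> Q n \<xi> < real k + 1})"
          by simp
        also have "\<dots> \<le> expectation (\<lambda>\<xi>. 1 - taper k (Q n \<xi>))"
          using taper_bounds by (intro integral_mono) (auto simp: taper_def indicator_def intro!: integrable_const_bound[of _ 1])
        also have "\<dots> = 1 - expectation (\<lambda>\<xi>. taper k (Q n \<xi>))"
          using taper_bounds by (subst Bochner_Integration.integral_diff) (auto simp: prob_space intro!: integrable_const_bound[of _ 1])
        finally show ?thesis .
      qed
      then have "hp M M \<epsilon> (\<lambda>\<xi>. Q n \<xi> < real k + 1)"
        using elim(1) by (intro hp_measurable subalgebra_refl) auto
      from hp_conj[OF subalgebra_refl this elim(3)] obtain A where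
        A [measurable]: "A \<in> events" and pA: "1 - (\<epsilon> + min \<epsilon> (min \<delta> 1)) \<le> prob A"
        and A': "\<And>\<xi>. \<xi> \<in> A \<Longrightarrow> Q n \<xi> < real k + 1 \<and> \<bar>Z n \<xi> - Q n \<xi>\<bar> < min \<epsilon> (min \<delta> 1)"
        unfolding hp_def by blast
      have pc: "prob (space M - A) \<le> 2 * \<epsilon>" using pA prob_compl[OF A] by simp
      define U where "U = (\<lambda>\<xi>. h (Q n \<xi>) + \<epsilon> + 2 * B * indicator (space M - A) \<xi>)"
      define V where "V = (\<lambda>\<xi>. h (Q n \<xi>) - \<epsilon> - 2 * B * indicator (space M - A) \<xi>)"
      have iQ: "integrable M (\<lambda>\<xi>. h (Q n \<xi>))" using B(1) by (intro integrable_const_bound[of _ B]) auto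
      have iI: "integrable M (indicat_real (space M - A))"
        by (intro integrable_real_indicator) (auto simp: less_top[symmetric])
      have iU: "integrable M U" "integrable M V" 
        unfolding U_def V_def using iQ iI by simp_all
      have UV: "V \<xi> \<le> h (Z n \<xi>)" "h (Z n \<xi>) \<le> U \<xi>" if "\<xi> \<in> space M" for \<xi>
      proof -
        have "V \<xi> \<le> h (Z n \<xi>) \<and> h (Z n \<xi>) \<le> U \<xi>"
        proof (cases "\<xi> \<in> A")
          case True
          have "\<bar>h (Z n \<xi>) - h (Q n \<xi>)\<bar> < \<epsilon>"
            using A'[OF True] Q0[of n \<xi>] by (intro \<delta>(2)) auto
          then show ?thesis using True by (auto simp: U_def V_def)
        next
          case False
          then show ?thesis using that B(1)[of "Z n \<xi>"] B(1)[of "Q n \<xi>"] \<epsilon>(1) by (auto simp: U_def V_def)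
        qed
        then show "V \<xi> \<le> h (Z n \<xi>)" "h (Z n \<xi>) \<le> U \<xi>" by auto
      qed
      have EUV: "expectation U = expectation (\<lambda>\<xi>. h (Q n \<xi>)) + \<epsilon> + 2 * B * prob (space M - A)"
        "expectation V = expectation (\<lambda>\<xi>. h (Q n \<xi>)) - \<epsilon> - 2 * B * prob (space M - A)"
        unfolding U_def V_def using iQ iI by (simp_all add: prob_space)
      have low: "expectation V \<le> expectation U'" if "integrable M U'" "\<forall>\<xi>\<in>space M. h (Z n \<xi>) \<le> U' \<xi>" for U'
        using that iU UV by (intro integral_mono) (auto intro: order_trans)
      have "outer_expectation M (\<lambda>\<xi>. h (Z n \<xi>)) \<le> expectation U"
        unfolding outer_expectation_def using iU UV low by (intro cInf_lower bdd_belowI[of _ "expectation V"]) auto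
      moreover have "expectation V \<le> outer_expectation M (\<lambda>\<xi>. h (Z n \<xi>))"
        unfolding outer_expectation_def using low iU UV by (intro cInf_greatest) auto
      moreover have "2 * B * prob (space M - A) \<le> 4 * B * \<epsilon>"
        using mult_left_mono[OF pc, of "2 * B"] B(2) by simp
      ultimately show ?case using elim(2) EUV \<epsilon> unfolding dist_real_def real_norm_def by linarith
    qed
    then show "\<exists>n0. \<forall>n\<ge>n0. norm (outer_expectation M (\<lambda>\<xi>. h (Z n \<xi>)) - (\<integral>y. h y \<partial>L)) < e"
      unfolding eventually_sequentially .
  qed
qed

end

section \<open>A single observation\<close>

lemma nn_integral_bump:
  "(\<integral>\<^sup>+y. ennreal (bump (y - a) v) \<partial>lborel) = ennreal (v\<^sup>2 / 2)"
proof (cases "0 \<le> v")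
  case True
  have "(\<integral>\<^sup>+y. ennreal (bump (y - a) v) \<partial>lborel) = (\<integral>\<^sup>+y. ennreal (v - (y - a)) * indicator {a..a + v} y \<partial>lborel)"
    using True by (intro nn_integral_cong) (auto simp: bump_def indicator_def ennreal_neg)
  also have "\<dots> = - (v - ((a + v) - a))\<^sup>2 / 2 - (- (v - (a - a))\<^sup>2 / 2)"
    using True by (intro nn_integral_FTC_Icc) (auto intro!: derivative_eq_intros simp: has_real_derivative_iff_has_vector_derivative[symmetric] field_simps)
  finally show ?thesis by simp
next
  case False
  have "(\<integral>\<^sup>+y. ennreal (bump (y - a) v) \<partial>lborel) = (\<integral>\<^sup>+y. ennreal ((y - a) - v) * indicator {a + v..a} y \<partial>lborel)"
  proof (rule nn_integral_cong_AE)
    \<comment> \<open>At \<open>y = a\<close> the bump takes the branch \<open>0 \<le> e\<close> and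
      is 0, while the right-hand integrand is \<open>- v\<close>; a single point is null.\<close>
    have "AE y in lborel. y \<noteq> a" by (rule AE_lborel_singleton)
    then show "AE y in lborel. ennreal (bump (y - a) v) = ennreal ((y - a) - v) * indicator {a + v..a} y"
      by (rule eventually_mono) (use False in \<open>auto simp: bump_def indicator_def ennreal_neg\<close>)
  qed
  also have "\<dots> = ((a - a) - v)\<^sup>2 / 2 - (((a + v) - a) - v)\<^sup>2 / 2"
    using False by (intro nn_integral_FTC_Icc) (auto intro!: derivative_eq_intros simp: has_real_derivative_iff_has_vector_derivative[symmetric] field_simps)
  finally show ?thesis by simp
qed

lemma bump_pos_imp_between:
  assumes "bump e v \<noteq> 0"
  shows "\<exists>t\<in>{0..1}. e = t * v" "\<bar>e\<bar> \<le> \<bar>v\<bar>"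
proof -
  have "v \<noteq> 0" using assms by auto
  moreover have "(0 \<le> e \<and> e < v) \<or> (v < e \<and> e < 0)" using assms by (auto simp: bump_def max_def split: if_splits)
  ultimately show "\<exists>t\<in>{0..1}. e = t * v" "\<bar>e\<bar> \<le> \<bar>v\<bar>"
    by (auto intro!: bexI[of _ "e / v"] simp: divide_simps)
qed

lemma integral_le_of_nn_integral_le:
  fixes g h :: "'a \<Rightarrow> real"
  assumes "integrable M g" "integrable M h" "\<And>x. x \<in> space M \<Longrightarrow> 0 \<le> g x" "\<And>x. x \<in> space M \<Longrightarrow> 0 \<le> h x"
    and "(\<integral>\<^sup>+x. ennreal (g x) \<partial>M) \<le> (\<integral>\<^sup>+x. ennreal (h x) \<partial>M)"
  shows "integral\<^sup>L M g \<le> integral\<^sup>L M h"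
proof -
  have "ennreal (integral\<^sup>L M g) \<le> ennreal (integral\<^sup>L M h)"
    using assms by (subst (1 2) nn_integral_eq_integral[symmetric]) auto
  then show ?thesis
    using assms by (subst (asm) ennreal_le_iff) (auto intro!: Bochner_Integration.integral_nonneg)
qed

locale observation = prob_space M for M :: "'a measure" +
  fixes X :: "'a \<Rightarrow> real ^ 'd" and Y :: "'a \<Rightarrow> real" and \<kappa> :: "real ^ 'd \<Rightarrow> real measure"
    and f f' :: "real ^ 'd \<Rightarrow> real \<Rightarrow> real" and \<tau> :: real and \<beta>0 :: "real ^ 'd" and C :: real
  assumes X [measurable]: "X \<in> borel_measurable M" and Y [measurable]: "Y \<in> borel_measurable M"
    and cd: "cond_distribution M X Y \<kappa>"
    and dens: "cond_density \<kappa> (rv_support M X) f"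
    and deriv: "\<And>x y. x \<in> rv_support M X \<Longrightarrow> ((f x) has_real_derivative f' x y) (at y)"
    and bounded_f: "\<And>x y. x \<in> rv_support M X \<Longrightarrow> \<bar>f x y\<bar> \<le> C"
    and bounded_f': "\<And>x y. x \<in> rv_support M X \<Longrightarrow> \<bar>f' x y\<bar> \<le> C"
    and quantile: "\<And>x. x \<in> rv_support M X \<Longrightarrow> cond_quantile \<kappa> \<tau> x = x \<bullet> \<beta>0"
    and \<tau>: "0 < \<tau>" "\<tau> < 1"
begin

lemma f_meas [measurable]: "(\<lambda>(x, y). f x y) \<in> borel_measurable (borel \<Otimes>\<^sub>M borel)"
  using dens by (simp add: cond_density_def borel_prod)

lemma f_nonneg: "x \<in> rv_support M X \<Longrightarrow> 0 \<le> f x y"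
  using dens unfolding cond_density_def by blast

lemma kernel: "x \<in> rv_support M X \<Longrightarrow> \<kappa> x = density lborel (\<lambda>y. ennreal (f x y))"
  using dens unfolding cond_density_def by blast

lemma kernel_prob: "prob_space (\<kappa> x)" "sets (\<kappa> x) = sets borel"
  using cd measurable_space[of \<kappa> borel "prob_algebra borel" x] by (auto simp: space_prob_algebra cond_distribution_def)

lemma AE_support: "AE \<xi> in M. X \<xi> \<in> rv_support M X"
  by (rule AE_rv_support) simp

lemma f_lipschitz:
  assumes "x \<in> rv_support M X"
  shows "\<bar>f x y - f x z\<bar> \<le> C * \<bar>y - z\<bar>"
  using field_differentiable_bound[of UNIV "f x" "f' x" C y z] deriv[OF assms] bounded_f'[OF assms]
  by (auto simp: has_field_derivative_at_within)

lemma nn_integral_density: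
  assumes g [measurable]: "g \<in> borel_measurable (borel \<Otimes>\<^sub>M borel)"
  shows "(\<integral>\<^sup>+\<xi>. g (X \<xi>, Y \<xi>) \<partial>M) = (\<integral>\<^sup>+\<xi>. (\<integral>\<^sup>+y. ennreal (f (X \<xi>) y) * g (X \<xi>, y) \<partial>lborel) \<partial>M)"
proof -
  have "(\<integral>\<^sup>+\<xi>. g (X \<xi>, Y \<xi>) \<partial>M) = (\<integral>\<^sup>+\<xi>. (\<integral>\<^sup>+y. g (X \<xi>, y) \<partial>\<kappa> (X \<xi>)) \<partial>M)"
    using cd g by (intro nn_integral_cond_distribution) auto
  also have "\<dots> = (\<integral>\<^sup>+\<xi>. (\<integral>\<^sup>+y. ennreal (f (X \<xi>) y) * g (X \<xi>, y) \<partial>lborel) \<partial>M)"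
  proof (rule nn_integral_cong_AE)
    show "AE \<xi> in M. (\<integral>\<^sup>+y. g (X \<xi>, y) \<partial>\<kappa> (X \<xi>)) = (\<integral>\<^sup>+y. ennreal (f (X \<xi>) y) * g (X \<xi>, y) \<partial>lborel)"
      using AE_support
    proof eventually_elim
      case (elim \<xi>)
      have [measurable]: "(\<lambda>y. g (X \<xi>, y)) \<in> borel_measurable borel"
        using measurable_Pair2[OF g, of "X \<xi>"] by simp
      show ?case unfolding kernel[OF elim] by (subst Nonnegative_Lebesgue_Integration.nn_integral_density) auto
    qed
  qed
  finally show ?thesis .
qed

text \<open>Given \<open>X\<close>, the band is an interval of length \<open>2 * r * norm X\<close>,
  so the bounded density controls its probability. The minimum with 1 is kept because a moment of
  order at most 3 cannot always absorb another full factor \<open>norm X\<close>.\<close>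

lemma nn_integral_band:
  assumes \<phi> [measurable]: "\<phi> \<in> borel_measurable borel" and r: "0 \<le> r"
  shows "(\<integral>\<^sup>+\<xi>. \<phi> (X \<xi>) * indicator {\<xi>. \<bar>Y \<xi> - X \<xi> \<bullet> b\<bar> \<le> r * norm (X \<xi>)} \<xi> \<partial>M)
    \<le> (\<integral>\<^sup>+\<xi>. \<phi> (X \<xi>) * ennreal (min 1 (2 * C * r * norm (X \<xi>))) \<partial>M)"
proof -
  define g where "g = (\<lambda>(x, y). \<phi> x * indicator {p :: (real ^ 'd) \<times> real. \<bar>snd p - fst p \<bullet> b\<bar> \<le> r * norm (fst p)} (x, y))"
  have gm [measurable]: "g \<in> borel_measurable (borel \<Otimes>\<^sub>M borel)"
  proof -
    have "{p :: (real ^ 'd) \<times> real. \<bar>snd p - fst p \<bullet> b\<bar> \<le> r * norm (fst p)} \<in> sets (borel \<Otimes>\<^sub>M borel)"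
      unfolding borel_prod by (intro borel_closed closed_Collect_le continuous_intros)
    then show ?thesis unfolding g_def by measurable
  qed
  have "(\<integral>\<^sup>+\<xi>. \<phi> (X \<xi>) * indicator {\<xi>. \<bar>Y \<xi> - X \<xi> \<bullet> b\<bar> \<le> r * norm (X \<xi>)} \<xi> \<partial>M) = (\<integral>\<^sup>+\<xi>. g (X \<xi>, Y \<xi>) \<partial>M)"
    by (intro nn_integral_cong) (auto simp: g_def indicator_def)
  also have "\<dots> = (\<integral>\<^sup>+\<xi>. (\<integral>\<^sup>+y. ennreal (f (X \<xi>) y) * g (X \<xi>, y) \<partial>lborel) \<partial>M)"
    by (rule nn_integral_density) simp
  also have "\<dots> \<le> (\<integral>\<^sup>+\<xi>. \<phi> (X \<xi>) * ennreal (min 1 (2 * C * r * norm (X \<xi>))) \<partial>M)"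
  proof (rule nn_integral_mono_AE)
    show "AE \<xi> in M. (\<integral>\<^sup>+y. ennreal (f (X \<xi>) y) * g (X \<xi>, y) \<partial>lborel) \<le> \<phi> (X \<xi>) * ennreal (min 1 (2 * C * r * norm (X \<xi>)))"
      using AE_support
    proof eventually_elim
      case (elim \<xi>)
      let ?x = "X \<xi>"
      let ?I = "{?x \<bullet> b - r * norm ?x..?x \<bullet> b + r * norm ?x}"
      have C0: "0 \<le> C" using bounded_f[OF elim, of 0] by linarith
      have "(\<integral>\<^sup>+y. ennreal (f ?x y) * g (?x, y) \<partial>lborel) = (\<integral>\<^sup>+y. \<phi> ?x * (ennreal (f ?x y) * indicator ?I y) \<partial>lborel)"
        by (intro nn_integral_cong) (auto simp: g_def indicator_def abs_le_iff mult.commute)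
      also have "\<dots> = \<phi> ?x * (\<integral>\<^sup>+y. ennreal (f ?x y) * indicator ?I y \<partial>lborel)"
        by (rule nn_integral_cmult) simp
      also have "(\<integral>\<^sup>+y. ennreal (f ?x y) * indicator ?I y \<partial>lborel) \<le> ennreal (min 1 (2 * C * r * norm ?x))"
      proof -
        have "(\<integral>\<^sup>+y. ennreal (f ?x y) * indicator ?I y \<partial>lborel) = emeasure (\<kappa> ?x) ?I"
          unfolding kernel[OF elim] by (rule emeasure_density[symmetric]) auto
        also have "\<dots> \<le> 1" by (rule prob_space.measure_le_1[OF kernel_prob(1)])
        finally have 1: "(\<integral>\<^sup>+y. ennreal (f ?x y) * indicator ?I y \<partial>lborel) \<le> ennreal 1" by simp
        have "(\<integral>\<^sup>+y. ennreal (f ?x y) * indicator ?I y \<partial>lborel) \<le> (\<integral>\<^sup>+y. ennreal C * indicator ?I y \<partial>lborel)"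
          using bounded_f[OF elim] by (intro nn_integral_mono mult_right_mono ennreal_leI) (auto simp: abs_le_iff)
        also have "\<dots> = ennreal C * ennreal (2 * (r * norm ?x))"
          using r by (subst nn_integral_cmult_indicator) auto
        also have "\<dots> = ennreal (2 * C * r * norm ?x)"
          using C0 r by (simp add: ennreal_mult[symmetric] algebra_simps)
        finally show ?thesis using 1 by (auto simp: min_def)
      qed
      finally show ?case by (simp add: mult_left_mono)
    qed
  qed
  finally show ?thesis .
qed

lemma expectation_band:
  assumes sq: "integrable M (\<lambda>\<xi>. (norm (X \<xi>))\<^sup>2)" and r: "0 \<le> r" and C: "0 \<le> C"
  shows "expectation (\<lambda>\<xi>. norm (X \<xi>) * of_bool (\<bar>Y \<xi> - X \<xi> \<bullet> b\<bar> \<le> r * norm (X \<xi>))) \<le> 2 * C * r * expectation (\<lambda>\<xi>. (norm (X \<xi>))\<^sup>2)"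
proof -
  have "expectation (\<lambda>\<xi>. norm (X \<xi>) * of_bool (\<bar>Y \<xi> - X \<xi> \<bullet> b\<bar> \<le> r * norm (X \<xi>))) \<le> expectation (\<lambda>\<xi>. 2 * C * r * (norm (X \<xi>))\<^sup>2)"
  proof (rule integral_le_of_nn_integral_le)
    have n: "integrable M (\<lambda>\<xi>. norm (X \<xi>))"
      by (rule square_integrable_imp_integrable) (use sq in auto)
    show "integrable M (\<lambda>\<xi>. norm (X \<xi>) * of_bool (\<bar>Y \<xi> - X \<xi> \<bullet> b\<bar> \<le> r * norm (X \<xi>)))"
      by (rule Bochner_Integration.integrable_bound[OF n]) auto
    have "(\<integral>\<^sup>+\<xi>. ennreal (norm (X \<xi>) * of_bool (\<bar>Y \<xi> - X \<xi> \<bullet> b\<bar> \<le> r * norm (X \<xi>))) \<partial>M)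
      = (\<integral>\<^sup>+\<xi>. ennreal (norm (X \<xi>)) * indicator {\<xi>. \<bar>Y \<xi> - X \<xi> \<bullet> b\<bar> \<le> r * norm (X \<xi>)} \<xi> \<partial>M)"
      by (intro nn_integral_cong) (auto simp: indicator_def)
    also have "\<dots> \<le> (\<integral>\<^sup>+\<xi>. ennreal (norm (X \<xi>)) * ennreal (min 1 (2 * C * r * norm (X \<xi>))) \<partial>M)"
      by (rule nn_integral_band[OF _ r]) simp
    also have "\<dots> \<le> (\<integral>\<^sup>+\<xi>. ennreal (2 * C * r * (norm (X \<xi>))\<^sup>2) \<partial>M)"
    proof (intro nn_integral_mono)
      fix \<xi>
      have "ennreal (norm (X \<xi>)) * ennreal (min 1 (2 * C * r * norm (X \<xi>))) = ennreal (norm (X \<xi>) * min 1 (2 * C * r * norm (X \<xi>)))"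
        using C r by (simp add: ennreal_mult[symmetric])
      also have "\<dots> \<le> ennreal (norm (X \<xi>) * (2 * C * r * norm (X \<xi>)))"
        by (intro ennreal_leI mult_left_mono) auto
      finally show "ennreal (norm (X \<xi>)) * ennreal (min 1 (2 * C * r * norm (X \<xi>))) \<le> ennreal (2 * C * r * (norm (X \<xi>))\<^sup>2)"
        by (simp add: power2_eq_square algebra_simps)
    qed
    finally show "(\<integral>\<^sup>+\<xi>. ennreal (norm (X \<xi>) * of_bool (\<bar>Y \<xi> - X \<xi> \<bullet> b\<bar> \<le> r * norm (X \<xi>))) \<partial>M) \<le> (\<integral>\<^sup>+\<xi>. ennreal (2 * C * r * (norm (X \<xi>))\<^sup>2) \<partial>M)" .
  qed (use sq C r in auto)
  then show ?thesis by simp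
qed

lemma expectation_band_sq:
  assumes p: "2 < p" "p \<le> 3" and mom: "integrable M (\<lambda>\<xi>. norm (X \<xi>) powr p)" and r: "0 \<le> r" and C: "0 \<le> C"
  shows "expectation (\<lambda>\<xi>. (norm (X \<xi>))\<^sup>2 * of_bool (\<bar>Y \<xi> - X \<xi> \<bullet> b\<bar> \<le> r * norm (X \<xi>)))
    \<le> (2 * C * r) powr (p - 2) * expectation (\<lambda>\<xi>. norm (X \<xi>) powr p)"
proof -
  have "expectation (\<lambda>\<xi>. (norm (X \<xi>))\<^sup>2 * of_bool (\<bar>Y \<xi> - X \<xi> \<bullet> b\<bar> \<le> r * norm (X \<xi>))) \<le> expectation (\<lambda>\<xi>. (2 * C * r) powr (p - 2) * norm (X \<xi>) powr p)"
  proof (rule integral_le_of_nn_integral_le)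
    have n: "integrable M (\<lambda>\<xi>. 1 + norm (X \<xi>) powr p)" using mom by simp
    show "integrable M (\<lambda>\<xi>. (norm (X \<xi>))\<^sup>2 * of_bool (\<bar>Y \<xi> - X \<xi> \<bullet> b\<bar> \<le> r * norm (X \<xi>)))"
      by (rule Bochner_Integration.integrable_bound[OF n])
         (use powr_ge_square_minus_1[OF p(1), of "norm (X _)"] in \<open>auto simp: of_bool_def\<close>)
    have "(\<integral>\<^sup>+\<xi>. ennreal ((norm (X \<xi>))\<^sup>2 * of_bool (\<bar>Y \<xi> - X \<xi> \<bullet> b\<bar> \<le> r * norm (X \<xi>))) \<partial>M)
      = (\<integral>\<^sup>+\<xi>. ennreal ((norm (X \<xi>))\<^sup>2) * indicator {\<xi>. \<bar>Y \<xi> - X \<xi> \<bullet> b\<bar> \<le> r * norm (X \<xi>)} \<xi> \<partial>M)"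
      by (intro nn_integral_cong) (auto simp: indicator_def)
    also have "\<dots> \<le> (\<integral>\<^sup>+\<xi>. ennreal ((norm (X \<xi>))\<^sup>2) * ennreal (min 1 (2 * C * r * norm (X \<xi>))) \<partial>M)"
      by (rule nn_integral_band[OF _ r]) simp
    also have "\<dots> \<le> (\<integral>\<^sup>+\<xi>. ennreal ((2 * C * r) powr (p - 2) * norm (X \<xi>) powr p) \<partial>M)"
    proof (intro nn_integral_mono)
      fix \<xi>
      let ?t = "2 * C * r * norm (X \<xi>)"
      have t0: "0 \<le> ?t" using C r by simp
      \<comment> \<open>Interpolation, valid since \<open>p - 2\<close> lies between 0 and 1; the
        exponent is chosen to produce exactly the moment of order \<open>p\<close>.\<close>
      have "min 1 ?t \<le> ?t powr (p - 2)"
      proof (cases "?t \<le> 1")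
        case True
        then show ?thesis using t0 p powr_mono'[of "p - 2" 1 ?t] by (auto simp: min_le_iff_disj)
      next
        case False
        then show ?thesis using p ge_one_powr_ge_zero[of ?t "p - 2"] by (auto simp: min_le_iff_disj)
      qed
      then have "(norm (X \<xi>))\<^sup>2 * min 1 ?t \<le> (norm (X \<xi>))\<^sup>2 * ?t powr (p - 2)" by (intro mult_left_mono) auto
      also have "\<dots> = (2 * C * r) powr (p - 2) * (norm (X \<xi>) powr 2 * norm (X \<xi>) powr (p - 2))"
        using C r by (cases "norm (X \<xi>) = 0") (auto simp: powr_mult powr_numeral)
      also have "norm (X \<xi>) powr 2 * norm (X \<xi>) powr (p - 2) = norm (X \<xi>) powr p"
        by (simp only: powr_add[symmetric]) simp
      finally have "(norm (X \<xi>))\<^sup>2 * min 1 ?t \<le> (2 * C * r) powr (p - 2) * norm (X \<xi>) powr p" .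
      then show "ennreal ((norm (X \<xi>))\<^sup>2) * ennreal (min 1 ?t) \<le> ennreal ((2 * C * r) powr (p - 2) * norm (X \<xi>) powr p)"
        using t0 by (subst ennreal_mult[symmetric]) (auto intro!: ennreal_leI)
    qed
    finally show "(\<integral>\<^sup>+\<xi>. ennreal ((norm (X \<xi>))\<^sup>2 * of_bool (\<bar>Y \<xi> - X \<xi> \<bullet> b\<bar> \<le> r * norm (X \<xi>))) \<partial>M) \<le> (\<integral>\<^sup>+\<xi>. ennreal ((2 * C * r) powr (p - 2) * norm (X \<xi>) powr p) \<partial>M)" .
  qed (use mom in auto)
  then show ?thesis by simp
qed

section \<open>The conditional quantile and the mean of the score\<close>

text \<open>The infimum that defines the quantile gives \<open>cdf\<close> at least
  \<open>\<tau>\<close> there by right-continuity, and mass at most \<open>\<tau>\<close> strictly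
  below by left limits. The density excludes an atom, so the two masses agree. The open ray matches
  the strict inequality in \<open>psi\<close>.\<close>

lemma kernel_below_quantile:
  assumes x: "x \<in> rv_support M X"
  shows "measure (\<kappa> x) {..<x \<bullet> \<beta>0} = \<tau>"
proof -
  interpret k: real_distribution "\<kappa> x"
    using kernel_prob[of x] by (intro real_distribution.intro real_distribution_axioms.intro)
  define S where "S = {y. \<tau> \<le> cdf (\<kappa> x) y}"
  define a where "a = Inf S"
  have a: "a = x \<bullet> \<beta>0" using quantile[OF x] by (simp add: a_def S_def cond_quantile_def cdf_def)
  have ne: "S \<noteq> {}"
  proof -
    have "\<forall>\<^sub>F y in at_top. \<tau> < cdf (\<kappa> x) y"
      using k.cdf_lim_at_top_prob \<tau> by (intro order_tendstoD(1)[where y = 1]) auto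
    then obtain y where "\<tau> < cdf (\<kappa> x) y" using eventually_happens[of _ at_top] by fastforce
    then show ?thesis unfolding S_def using less_imp_le by blast
  qed
  have bdd: "bdd_below S"
  proof -
    have "\<forall>\<^sub>F y in at_bot. cdf (\<kappa> x) y < \<tau>"
      using k.cdf_lim_at_bot \<tau> by (intro order_tendstoD(2)[where y = 0]) auto
    then obtain y0 where y0: "\<And>y. y \<le> y0 \<Longrightarrow> cdf (\<kappa> x) y < \<tau>" unfolding eventually_at_bot_linorder by blast
    show ?thesis
    proof (rule bdd_belowI[of _ y0])
      fix y assume "y \<in> S"
      then show "y0 \<le> y" using y0[of y] unfolding S_def by (metis le_cases mem_Collect_eq not_less)
    qed
  qed
  have "\<tau> \<le> cdf (\<kappa> x) a"
  proof (rule tendsto_lowerbound)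
    show "(cdf (\<kappa> x) \<longlongrightarrow> cdf (\<kappa> x) a) (at_right a)"
      using k.cdf_is_right_cont[of a] by (simp add: continuous_within)
    have "\<tau> \<le> cdf (\<kappa> x) y" if ay: "a < y" for y
    proof -
      obtain z where "z \<in> S" "z < y" using ay ne unfolding a_def by (metis cInf_lessD)
      then show ?thesis using k.cdf_nondecreasing[of z y] by (simp add: S_def)
    qed
    then show "\<forall>\<^sub>F y in at_right a. \<tau> \<le> cdf (\<kappa> x) y" by (auto simp: eventually_at_filter)
  qed simp
  moreover have "measure (\<kappa> x) {..<a} \<le> \<tau>"
  proof (rule tendsto_upperbound)
    show "(cdf (\<kappa> x) \<longlongrightarrow> measure (\<kappa> x) {..<a}) (at_left a)" by (rule k.cdf_at_left)
    have "cdf (\<kappa> x) y \<le> \<tau>" if "y < a" for y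
    proof -
      have "y \<notin> S" using that bdd unfolding a_def by (meson cInf_lower not_less)
      then show ?thesis by (simp add: S_def)
    qed
    then show "\<forall>\<^sub>F y in at_left a. cdf (\<kappa> x) y \<le> \<tau>" by (auto simp: eventually_at_filter)
  qed simp
  moreover have "cdf (\<kappa> x) a = measure (\<kappa> x) {..<a}"
  proof -
    have "emeasure (\<kappa> x) {a} = (\<integral>\<^sup>+y. ennreal (f x y) * indicator {a} y \<partial>lborel)"
      unfolding kernel[OF x] by (rule emeasure_density) auto
    also have "\<dots> = (\<integral>\<^sup>+(y::real). 0 \<partial>lborel)"
      by (rule nn_integral_cong_AE, rule eventually_mono[OF AE_lborel_singleton[of a]]) (simp add: indicator_def)
    finally have "measure (\<kappa> x) {a} = 0" by (simp add: measure_def)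
    moreover have "{..a} = {..<a} \<union> {a}" by auto
    moreover have "measure (\<kappa> x) ({..<a} \<union> {a}) = measure (\<kappa> x) {..<a} + measure (\<kappa> x) {a}"
      by (intro k.finite_measure_Union) auto
    ultimately show ?thesis unfolding cdf_def by simp
  qed
  ultimately show ?thesis unfolding a by simp
qed

lemma nn_integral_below:
  assumes \<phi> [measurable]: "\<phi> \<in> borel_measurable borel"
  shows "(\<integral>\<^sup>+\<xi>. \<phi> (X \<xi>) * indicator {\<xi>. Y \<xi> - X \<xi> \<bullet> \<beta>0 < 0} \<xi> \<partial>M) = ennreal \<tau> * (\<integral>\<^sup>+\<xi>. \<phi> (X \<xi>) \<partial>M)"
proof -
  define g where "g = (\<lambda>(x, y). \<phi> x * indicator {p :: (real ^ 'd) \<times> real. snd p - fst p \<bullet> \<beta>0 < 0} (x, y))"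
  have gm [measurable]: "g \<in> borel_measurable (borel \<Otimes>\<^sub>M borel)"
  proof -
    have "{p :: (real ^ 'd) \<times> real. snd p - fst p \<bullet> \<beta>0 < 0} \<in> sets (borel \<Otimes>\<^sub>M borel)"
      unfolding borel_prod by (intro borel_open open_Collect_less continuous_intros)
    then show ?thesis unfolding g_def by measurable
  qed
  have "(\<integral>\<^sup>+\<xi>. \<phi> (X \<xi>) * indicator {\<xi>. Y \<xi> - X \<xi> \<bullet> \<beta>0 < 0} \<xi> \<partial>M) = (\<integral>\<^sup>+\<xi>. g (X \<xi>, Y \<xi>) \<partial>M)"
    by (intro nn_integral_cong) (auto simp: g_def indicator_def)
  also have "\<dots> = (\<integral>\<^sup>+\<xi>. (\<integral>\<^sup>+y. g (X \<xi>, y) \<partial>\<kappa> (X \<xi>)) \<partial>M)"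
    using cd by (intro nn_integral_cond_distribution) auto
  also have "\<dots> = (\<integral>\<^sup>+\<xi>. ennreal \<tau> * \<phi> (X \<xi>) \<partial>M)"
  proof (rule nn_integral_cong_AE)
    show "AE \<xi> in M. (\<integral>\<^sup>+y. g (X \<xi>, y) \<partial>\<kappa> (X \<xi>)) = ennreal \<tau> * \<phi> (X \<xi>)"
      using AE_support
    proof eventually_elim
      case (elim \<xi>)
      interpret k: prob_space "\<kappa> (X \<xi>)" by (rule kernel_prob)
      have "(\<integral>\<^sup>+y. g (X \<xi>, y) \<partial>\<kappa> (X \<xi>)) = (\<integral>\<^sup>+y. \<phi> (X \<xi>) * indicator {..<X \<xi> \<bullet> \<beta>0} y \<partial>\<kappa> (X \<xi>))"
        by (intro nn_integral_cong) (auto simp: g_def indicator_def)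
      also have "\<dots> = \<phi> (X \<xi>) * emeasure (\<kappa> (X \<xi>)) {..<X \<xi> \<bullet> \<beta>0}"
        by (rule nn_integral_cmult_indicator) (simp add: kernel_prob)
      finally show ?case
        by (simp add: k.emeasure_eq_measure kernel_below_quantile[OF elim] mult.commute)
    qed
  qed
  also have "\<dots> = ennreal \<tau> * (\<integral>\<^sup>+\<xi>. \<phi> (X \<xi>) \<partial>M)" by (rule nn_integral_cmult) simp
  finally show ?thesis .
qed

text \<open>Given \<open>X\<close>, the residual is negative with probability \<open>\<tau>\<close>.
  The function \<open>g\<close> is split into positive and negative parts because that fact is
  available for non-negative integrals.\<close>

lemma expectation_psi:
  assumes g [measurable]: "g \<in> borel_measurable borel" and int: "integrable M (\<lambda>\<xi>. g (X \<xi>))"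
  shows "expectation (\<lambda>\<xi>. psi \<tau> (Y \<xi> - X \<xi> \<bullet> \<beta>0) * g (X \<xi>)) = 0"
proof -
  have pos: "expectation (\<lambda>\<xi>. h (X \<xi>) * of_bool (Y \<xi> - X \<xi> \<bullet> \<beta>0 < 0)) = \<tau> * expectation (\<lambda>\<xi>. h (X \<xi>))"
    and posi: "integrable M (\<lambda>\<xi>. h (X \<xi>) * of_bool (Y \<xi> - X \<xi> \<bullet> \<beta>0 < 0))"
    if [measurable]: "h \<in> borel_measurable borel" and h: "integrable M (\<lambda>\<xi>. h (X \<xi>))" "\<And>x. 0 \<le> h x" for h :: "real ^ 'd \<Rightarrow> real"
  proof -
    show i: "integrable M (\<lambda>\<xi>. h (X \<xi>) * of_bool (Y \<xi> - X \<xi> \<bullet> \<beta>0 < 0))"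
      by (rule Bochner_Integration.integrable_bound[OF h(1)]) (use h(2) in auto)
    have "ennreal (expectation (\<lambda>\<xi>. h (X \<xi>) * of_bool (Y \<xi> - X \<xi> \<bullet> \<beta>0 < 0))) = (\<integral>\<^sup>+\<xi>. ennreal (h (X \<xi>) * of_bool (Y \<xi> - X \<xi> \<bullet> \<beta>0 < 0)) \<partial>M)"
      using i h(2) by (intro nn_integral_eq_integral[symmetric]) auto
    also have "\<dots> = (\<integral>\<^sup>+\<xi>. ennreal (h (X \<xi>)) * indicator {\<xi>. Y \<xi> - X \<xi> \<bullet> \<beta>0 < 0} \<xi> \<partial>M)"
      by (intro nn_integral_cong) (auto simp: indicator_def)
    also have "\<dots> = ennreal \<tau> * (\<integral>\<^sup>+\<xi>. ennreal (h (X \<xi>)) \<partial>M)" by (rule nn_integral_below) simp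
    also have "\<dots> = ennreal (\<tau> * expectation (\<lambda>\<xi>. h (X \<xi>)))"
      using h \<tau> by (simp add: nn_integral_eq_integral ennreal_mult)
    finally show "expectation (\<lambda>\<xi>. h (X \<xi>) * of_bool (Y \<xi> - X \<xi> \<bullet> \<beta>0 < 0)) = \<tau> * expectation (\<lambda>\<xi>. h (X \<xi>))"
      using h \<tau> by (subst (asm) ennreal_inj) (auto intro!: Bochner_Integration.integral_nonneg)
  qed
  have i: "integrable M (\<lambda>\<xi>. max 0 (g (X \<xi>)))" "integrable M (\<lambda>\<xi>. max 0 (- g (X \<xi>)))"
    using int by auto
  have split: "g (X \<xi>) = max 0 (g (X \<xi>)) - max 0 (- g (X \<xi>))" for \<xi> by (simp add: max_def)
  have "psi \<tau> (Y \<xi> - X \<xi> \<bullet> \<beta>0) * g (X \<xi>) = \<tau> * max 0 (g (X \<xi>)) - \<tau> * max 0 (- g (X \<xi>))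
      - (max 0 (g (X \<xi>)) * of_bool (Y \<xi> - X \<xi> \<bullet> \<beta>0 < 0) - max 0 (- g (X \<xi>)) * of_bool (Y \<xi> - X \<xi> \<bullet> \<beta>0 < 0))" for \<xi>
    by (simp add: psi_def max_def algebra_simps)
  then show ?thesis
    using i pos[of "\<lambda>x. max 0 (g x)"] pos[of "\<lambda>x. max 0 (- g x)"] posi[of "\<lambda>x. max 0 (g x)"] posi[of "\<lambda>x. max 0 (- g x)"]
    by simp
qed

section \<open>The expected remainder\<close>

text \<open>The bump lives on residuals of size at most \<open>\<bar>v\<bar>\<close>, where a
  Lipschitz density differs from its value at the quantile by at most
  \<open>C * \<bar>v\<bar>\<close>; this gives the cubic error. For large \<open>v\<close> a crude
  bound by \<open>C * v\<^sup>2\<close> is better. The minimum of the two is what a moment of order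
  \<open>p\<close> can pay for.\<close>

lemma nn_integral_bump_density:
  assumes x: "x \<in> rv_support M X"
  shows "(\<integral>\<^sup>+y. ennreal (f x y) * ennreal (bump (y - x \<bullet> \<beta>0) v) \<partial>lborel) \<le> ennreal (f x (x \<bullet> \<beta>0) * v\<^sup>2 / 2 + C * min (v\<^sup>2) (\<bar>v\<bar> ^ 3))" (is "?I \<le> _")
    and "ennreal (f x (x \<bullet> \<beta>0) * v\<^sup>2 / 2) \<le> (\<integral>\<^sup>+y. ennreal (f x y) * ennreal (bump (y - x \<bullet> \<beta>0) v) \<partial>lborel) + ennreal (C * min (v\<^sup>2) (\<bar>v\<bar> ^ 3))"
proof -
  let ?a = "x \<bullet> \<beta>0"
  have C0: "0 \<le> C" using bounded_f[OF x, of 0] by linarith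
  have f0: "0 \<le> f x ?a" "f x ?a \<le> C" using f_nonneg[OF x] bounded_f[OF x, of ?a] by auto
  have near: "\<bar>f x y - f x ?a\<bar> \<le> C * \<bar>v\<bar>" if "bump (y - ?a) v \<noteq> 0" for y
    using f_lipschitz[OF x, of y ?a] bump_pos_imp_between(2)[OF that] C0
    by (meson mult_left_mono order_trans)
  have const: "(\<integral>\<^sup>+y. ennreal c * ennreal (bump (y - ?a) v) \<partial>lborel) = ennreal (c * v\<^sup>2 / 2)" if "0 \<le> c" for c
    using that by (subst nn_integral_cmult) (auto simp: nn_integral_bump ennreal_mult[symmetric])
  have "?I \<le> (\<integral>\<^sup>+y. ennreal (f x ?a + C * \<bar>v\<bar>) * ennreal (bump (y - ?a) v) \<partial>lborel)"
  proof (intro nn_integral_mono)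
    fix y
    show "ennreal (f x y) * ennreal (bump (y - ?a) v) \<le> ennreal (f x ?a + C * \<bar>v\<bar>) * ennreal (bump (y - ?a) v)"
      using near[of y] by (cases "bump (y - ?a) v = 0") (auto intro!: mult_right_mono ennreal_leI simp: abs_le_iff)
  qed
  also have "\<dots> = ennreal ((f x ?a + C * \<bar>v\<bar>) * v\<^sup>2 / 2)" using C0 f0 by (intro const) auto
  finally have u1: "?I \<le> ennreal ((f x ?a + C * \<bar>v\<bar>) * v\<^sup>2 / 2)" .
  have "?I \<le> (\<integral>\<^sup>+y. ennreal C * ennreal (bump (y - ?a) v) \<partial>lborel)"
    using bounded_f[OF x] by (intro nn_integral_mono mult_right_mono ennreal_leI) (auto simp: abs_le_iff)
  also have "\<dots> = ennreal (C * v\<^sup>2 / 2)" using C0 by (intro const) auto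
  finally have u2: "?I \<le> ennreal (C * v\<^sup>2 / 2)" .
  have cube: "\<bar>v\<bar> * v\<^sup>2 = \<bar>v\<bar> ^ 3" by (simp add: power2_eq_square power3_eq_cube)
  have Cm: "0 \<le> C * v\<^sup>2" "0 \<le> C * \<bar>v\<bar> ^ 3" "0 \<le> f x ?a * v\<^sup>2" using C0 f0 by auto
  show "?I \<le> ennreal (f x ?a * v\<^sup>2 / 2 + C * min (v\<^sup>2) (\<bar>v\<bar> ^ 3))"
  proof (cases "v\<^sup>2 \<le> \<bar>v\<bar> ^ 3")
    case True
    have "ennreal (C * v\<^sup>2 / 2) \<le> ennreal (f x ?a * v\<^sup>2 / 2 + C * min (v\<^sup>2) (\<bar>v\<bar> ^ 3))"
      using True Cm by (intro ennreal_leI) (simp add: min_def)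
    with u2 show ?thesis by (rule order_trans)
  next
    case False
    have "ennreal ((f x ?a + C * \<bar>v\<bar>) * v\<^sup>2 / 2) \<le> ennreal (f x ?a * v\<^sup>2 / 2 + C * min (v\<^sup>2) (\<bar>v\<bar> ^ 3))"
      using False Cm by (intro ennreal_leI) (simp add: min_def distrib_right add_divide_distrib mult.assoc cube)
    with u1 show ?thesis by (rule order_trans)
  qed
  show "ennreal (f x ?a * v\<^sup>2 / 2) \<le> ?I + ennreal (C * min (v\<^sup>2) (\<bar>v\<bar> ^ 3))"
  proof (cases "v\<^sup>2 \<le> \<bar>v\<bar> ^ 3")
    case True
    have "f x ?a * v\<^sup>2 / 2 \<le> C * v\<^sup>2"
      using Cm mult_right_mono[OF f0(2), of "v\<^sup>2"] by simp
    then have "ennreal (f x ?a * v\<^sup>2 / 2) \<le> ennreal (C * min (v\<^sup>2) (\<bar>v\<bar> ^ 3))" using True by (intro ennreal_leI) (simp add: min_def)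
    then show ?thesis by (rule order_trans) simp
  next
    case False
    have "ennreal (f x ?a * v\<^sup>2 / 2) = (\<integral>\<^sup>+y. ennreal (f x ?a) * ennreal (bump (y - ?a) v) \<partial>lborel)" using f0 by (intro const[symmetric]) auto
    also have "\<dots> \<le> (\<integral>\<^sup>+y. ennreal (f x y) * ennreal (bump (y - ?a) v) + ennreal (C * \<bar>v\<bar>) * ennreal (bump (y - ?a) v) \<partial>lborel)"
    proof (intro nn_integral_mono)
      fix y
      show "ennreal (f x ?a) * ennreal (bump (y - ?a) v) \<le> ennreal (f x y) * ennreal (bump (y - ?a) v) + ennreal (C * \<bar>v\<bar>) * ennreal (bump (y - ?a) v)"
      proof (cases "bump (y - ?a) v = 0")
        case False
        have "ennreal (f x ?a) \<le> ennreal (f x y + C * \<bar>v\<bar>)" using near[OF False] by (intro ennreal_leI) linarith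
        also have "\<dots> = ennreal (f x y) + ennreal (C * \<bar>v\<bar>)" using C0 f_nonneg[OF x] by (intro ennreal_plus) auto
        finally show ?thesis unfolding distrib_right[symmetric] by (intro mult_right_mono) auto
      qed simp
    qed
    also have "\<dots> = ?I + ennreal (C * \<bar>v\<bar> * v\<^sup>2 / 2)"
      using C0 by (subst nn_integral_add) (auto simp: const)
    also have "\<dots> \<le> ?I + ennreal (C * min (v\<^sup>2) (\<bar>v\<bar> ^ 3))"
      using False Cm by (intro add_left_mono ennreal_leI) (simp add: min_def mult.assoc cube)
    finally show ?thesis .
  qed
qed

lemma nn_integral_bump_XY:
  "(\<integral>\<^sup>+\<xi>. ennreal (bump (Y \<xi> - X \<xi> \<bullet> \<beta>0) (X \<xi> \<bullet> u)) \<partial>M)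
    = (\<integral>\<^sup>+\<xi>. (\<integral>\<^sup>+y. ennreal (f (X \<xi>) y) * ennreal (bump (y - X \<xi> \<bullet> \<beta>0) (X \<xi> \<bullet> u)) \<partial>lborel) \<partial>M)"
proof -
  have [measurable]: "(\<lambda>p :: (real ^ 'd) \<times> real. ennreal (bump (snd p - fst p \<bullet> \<beta>0) (fst p \<bullet> u))) \<in> borel_measurable (borel \<Otimes>\<^sub>M borel)"
    by measurable
  show ?thesis
    using nn_integral_density[of "\<lambda>p. ennreal (bump (snd p - fst p \<bullet> \<beta>0) (fst p \<bullet> u))"] by simp
qed

text \<open>Where the bump is non-zero, \<open>y = x \<bullet> (\<beta>0 + t *\<^sub>R u)\<close>
  for some \<open>t\<close> in \<open>{0..1}\<close>, and by convexity this parameter lies in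
  \<open>B\<close>. So the lower bound on the density applies exactly where it is needed, and the
  Lebesgue integral of the bump supplies the factor one half.\<close>

lemma expectation_bump_ge:
  assumes sq: "integrable M (\<lambda>\<xi>. (norm (X \<xi>))\<^sup>2)"
    and B: "convex B" "\<beta>0 \<in> B" "\<beta>0 + u \<in> B" and eps: "0 \<le> \<epsilon>" "\<And>x b. x \<in> rv_support M X \<Longrightarrow> b \<in> B \<Longrightarrow> \<epsilon> \<le> f x (x \<bullet> b)"
  shows "\<epsilon> / 2 * expectation (\<lambda>\<xi>. (X \<xi> \<bullet> u)\<^sup>2) \<le> expectation (\<lambda>\<xi>. bump (Y \<xi> - X \<xi> \<bullet> \<beta>0) (X \<xi> \<bullet> u))"
proof -
  have n: "integrable M (\<lambda>\<xi>. norm (X \<xi>))"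
    by (rule square_integrable_imp_integrable) (use sq in auto)
  have n2: "integrable M (\<lambda>\<xi>. (X \<xi> \<bullet> u)\<^sup>2)" by (rule integrable_inner_square[OF X sq])
  have "expectation (\<lambda>\<xi>. \<epsilon> / 2 * (X \<xi> \<bullet> u)\<^sup>2) \<le> expectation (\<lambda>\<xi>. bump (Y \<xi> - X \<xi> \<bullet> \<beta>0) (X \<xi> \<bullet> u))"
  proof (rule integral_le_of_nn_integral_le)
    show "integrable M (\<lambda>\<xi>. bump (Y \<xi> - X \<xi> \<bullet> \<beta>0) (X \<xi> \<bullet> u))"
    proof (rule Bochner_Integration.integrable_bound)
      show "integrable M (\<lambda>\<xi>. norm u * norm (X \<xi>))" using n by simp
      have "bump (Y \<xi> - X \<xi> \<bullet> \<beta>0) (X \<xi> \<bullet> u) \<le> norm u * norm (X \<xi>)" for \<xi>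
        using bump_le[of "Y \<xi> - X \<xi> \<bullet> \<beta>0" "X \<xi> \<bullet> u"] Cauchy_Schwarz_ineq2[of "X \<xi>" u] by (simp add: mult.commute)
      then show "AE \<xi> in M. norm (bump (Y \<xi> - X \<xi> \<bullet> \<beta>0) (X \<xi> \<bullet> u)) \<le> norm (norm u * norm (X \<xi>))"
        by simp
    qed simp
    show "(\<integral>\<^sup>+\<xi>. ennreal (\<epsilon> / 2 * (X \<xi> \<bullet> u)\<^sup>2) \<partial>M) \<le> (\<integral>\<^sup>+\<xi>. ennreal (bump (Y \<xi> - X \<xi> \<bullet> \<beta>0) (X \<xi> \<bullet> u)) \<partial>M)"
      unfolding nn_integral_bump_XY
    proof (rule nn_integral_mono_AE)
      show "AE \<xi> in M. ennreal (\<epsilon> / 2 * (X \<xi> \<bullet> u)\<^sup>2) \<le> (\<integral>\<^sup>+y. ennreal (f (X \<xi>) y) * ennreal (bump (y - X \<xi> \<bullet> \<beta>0) (X \<xi> \<bullet> u)) \<partial>lborel)"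
        using AE_support
      proof eventually_elim
        case (elim \<xi>)
        let ?x = "X \<xi>"
        have "ennreal (\<epsilon> / 2 * (?x \<bullet> u)\<^sup>2) = (\<integral>\<^sup>+y. ennreal \<epsilon> * ennreal (bump (y - ?x \<bullet> \<beta>0) (?x \<bullet> u)) \<partial>lborel)"
          using eps by (subst nn_integral_cmult) (auto simp: nn_integral_bump ennreal_mult[symmetric])
        also have "\<dots> \<le> (\<integral>\<^sup>+y. ennreal (f ?x y) * ennreal (bump (y - ?x \<bullet> \<beta>0) (?x \<bullet> u)) \<partial>lborel)"
        proof (intro nn_integral_mono)
          fix y
          show "ennreal \<epsilon> * ennreal (bump (y - ?x \<bullet> \<beta>0) (?x \<bullet> u)) \<le> ennreal (f ?x y) * ennreal (bump (y - ?x \<bullet> \<beta>0) (?x \<bullet> u))"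
          proof (cases "bump (y - ?x \<bullet> \<beta>0) (?x \<bullet> u) = 0")
            case False
            then obtain t where t: "t \<in> {0..1}" "y - ?x \<bullet> \<beta>0 = t * (?x \<bullet> u)"
              using bump_pos_imp_between(1) by blast
            have "(1 - t) *\<^sub>R \<beta>0 + t *\<^sub>R (\<beta>0 + u) \<in> B"
              using B t by (intro convexD) auto
            moreover have "(1 - t) *\<^sub>R \<beta>0 + t *\<^sub>R (\<beta>0 + u) = \<beta>0 + t *\<^sub>R u" by (simp add: algebra_simps)
            moreover have "y = ?x \<bullet> (\<beta>0 + t *\<^sub>R u)" using t(2) by (simp add: inner_add_right)
            ultimately have "\<epsilon> \<le> f ?x y" using eps(2)[OF elim] by auto
            then show ?thesis by (intro mult_right_mono ennreal_leI) auto
          qed simp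
        qed
        finally show ?case .
      qed
    qed
  qed (use n2 eps in auto)
  then show ?thesis by simp
qed

lemma expectation_bump_approx:
  assumes p: "2 < p" "p \<le> 3" and mom: "integrable M (\<lambda>\<xi>. norm (X \<xi>) powr p)" and C: "0 \<le> C"
  shows "\<bar>expectation (\<lambda>\<xi>. bump (Y \<xi> - X \<xi> \<bullet> \<beta>0) (X \<xi> \<bullet> u)) - expectation (\<lambda>\<xi>. f (X \<xi>) (X \<xi> \<bullet> \<beta>0) * (X \<xi> \<bullet> u)\<^sup>2) / 2\<bar>
    \<le> C * (norm u powr p * expectation (\<lambda>\<xi>. norm (X \<xi>) powr p))"
    and "integrable M (\<lambda>\<xi>. f (X \<xi>) (X \<xi> \<bullet> \<beta>0) * (X \<xi> \<bullet> u)\<^sup>2)"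
proof -
  let ?b = "\<lambda>\<xi>. bump (Y \<xi> - X \<xi> \<bullet> \<beta>0) (X \<xi> \<bullet> u)"
  let ?q = "\<lambda>\<xi>. f (X \<xi>) (X \<xi> \<bullet> \<beta>0) * (X \<xi> \<bullet> u)\<^sup>2"
  let ?r = "\<lambda>\<xi>. C * (norm u powr p * norm (X \<xi>) powr p)"
  have sq: "integrable M (\<lambda>\<xi>. (norm (X \<xi>))\<^sup>2)"
    using second_moment_le(1)[OF p(1), of "\<lambda>\<xi>. norm (X \<xi>)"] mom by simp
  have n: "integrable M (\<lambda>\<xi>. norm (X \<xi>))"
    by (rule square_integrable_imp_integrable) (use sq in auto)
  have XU: "\<bar>X \<xi> \<bullet> u\<bar> \<le> norm u * norm (X \<xi>)" for \<xi>
    using Cauchy_Schwarz_ineq2[of "X \<xi>" u] by (simp add: mult.commute)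
  have ib: "integrable M ?b"
  proof (rule Bochner_Integration.integrable_bound)
    show "integrable M (\<lambda>\<xi>. norm u * norm (X \<xi>))" using n by simp
    have "?b \<xi> \<le> norm u * norm (X \<xi>)" for \<xi>
      using bump_le[of "Y \<xi> - X \<xi> \<bullet> \<beta>0" "X \<xi> \<bullet> u"] XU[of \<xi>] by simp
    then show "AE \<xi> in M. norm (?b \<xi>) \<le> norm (norm u * norm (X \<xi>))" by simp
  qed simp
  have fm [measurable]: "(\<lambda>\<xi>. f (X \<xi>) (X \<xi> \<bullet> \<beta>0)) \<in> borel_measurable M"
    using measurable_compose[OF _ f_meas, of "\<lambda>\<xi>. (X \<xi>, X \<xi> \<bullet> \<beta>0)" M] by simp
  show iq: "integrable M ?q"
  proof (rule Bochner_Integration.integrable_bound)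
    show "integrable M (\<lambda>\<xi>. C * ((norm u)\<^sup>2 * (norm (X \<xi>))\<^sup>2))" using sq by simp
    show "AE \<xi> in M. norm (?q \<xi>) \<le> norm (C * ((norm u)\<^sup>2 * (norm (X \<xi>))\<^sup>2))"
      using AE_support
    proof eventually_elim
      case (elim \<xi>)
      have "(X \<xi> \<bullet> u)\<^sup>2 \<le> (norm u * norm (X \<xi>))\<^sup>2" using XU[of \<xi>] by (simp add: abs_le_square_iff[symmetric])
      then show ?case using bounded_f[OF elim, of "X \<xi> \<bullet> \<beta>0"] C
        by (auto simp: abs_mult power_mult_distrib intro!: mult_mono)
    qed
  qed measurable
  have ir: "integrable M ?r" using mom by simp
  have rr: "C * min ((X \<xi> \<bullet> u)\<^sup>2) (\<bar>X \<xi> \<bullet> u\<bar> ^ 3) \<le> ?r \<xi>" for \<xi>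
  proof -
    have "min ((X \<xi> \<bullet> u)\<^sup>2) (\<bar>X \<xi> \<bullet> u\<bar> ^ 3) \<le> \<bar>X \<xi> \<bullet> u\<bar> powr p" using p by (rule min_square_cube_le_powr)
    also have "\<dots> \<le> (norm u * norm (X \<xi>)) powr p" using XU p by (intro powr_mono2) auto
    also have "\<dots> = norm u powr p * norm (X \<xi>) powr p" by (simp add: powr_mult)
    finally show ?thesis using C by (rule mult_left_mono)
  qed
  have q0: "AE \<xi> in M. 0 \<le> ?q \<xi>"
    using AE_support by eventually_elim (simp add: f_nonneg)
  \<comment> \<open>The density is known to be non-negative only for \<open>X\<close> in its
    support, so the quadratic term is modified on a null set before passing to non-negative
    integrals.\<close>
  define q where "q = (\<lambda>\<xi>. max 0 (?q \<xi>))"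
  have q: "AE \<xi> in M. q \<xi> = ?q \<xi>" using q0 by eventually_elim (simp add: q_def)
  have qn: "0 \<le> q \<xi>" for \<xi> by (simp add: q_def)
  have iq': "integrable M q" unfolding q_def using iq by auto
  have Eq: "expectation q = expectation ?q" using q iq' iq by (intro integral_cong_AE) auto
  have m1: "(\<lambda>\<xi>. \<integral>\<^sup>+y. ennreal (f (X \<xi>) y) * ennreal (bump (y - X \<xi> \<bullet> \<beta>0) (X \<xi> \<bullet> u)) \<partial>lborel) \<in> borel_measurable M"
  proof -
    have "(\<lambda>x. \<integral>\<^sup>+y. ennreal (f x y) * ennreal (bump (y - x \<bullet> \<beta>0) (x \<bullet> u)) \<partial>lborel) \<in> borel_measurable borel"
      by (rule lborel.borel_measurable_nn_integral) (use f_meas in measurable)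
    then show ?thesis by (rule measurable_compose[OF X])
  qed
  have "expectation ?b \<le> expectation (\<lambda>\<xi>. q \<xi> / 2 + ?r \<xi>)"
  proof (rule integral_le_of_nn_integral_le)
    show "(\<integral>\<^sup>+\<xi>. ennreal (?b \<xi>) \<partial>M) \<le> (\<integral>\<^sup>+\<xi>. ennreal (q \<xi> / 2 + ?r \<xi>) \<partial>M)"
      unfolding nn_integral_bump_XY
    proof (rule nn_integral_mono_AE)
      show "AE \<xi> in M. (\<integral>\<^sup>+y. ennreal (f (X \<xi>) y) * ennreal (bump (y - X \<xi> \<bullet> \<beta>0) (X \<xi> \<bullet> u)) \<partial>lborel) \<le> ennreal (q \<xi> / 2 + ?r \<xi>)"
        using AE_support q
      proof eventually_elim
        case (elim \<xi>)
        show ?case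
          by (rule order_trans[OF nn_integral_bump_density(1)[OF elim(1)]])
             (use rr[of \<xi>] elim(2) in \<open>auto intro!: ennreal_leI\<close>)
      qed
    qed
  qed (use ib iq' ir qn C in auto)
  then have 1: "expectation ?b \<le> expectation ?q / 2 + expectation ?r" using iq' ir Eq by simp
  have "expectation (\<lambda>\<xi>. q \<xi> / 2) \<le> expectation (\<lambda>\<xi>. ?b \<xi> + ?r \<xi>)"
  proof (rule integral_le_of_nn_integral_le)
    have "(\<integral>\<^sup>+\<xi>. ennreal (q \<xi> / 2) \<partial>M) \<le> (\<integral>\<^sup>+\<xi>. (\<integral>\<^sup>+y. ennreal (f (X \<xi>) y) * ennreal (bump (y - X \<xi> \<bullet> \<beta>0) (X \<xi> \<bullet> u)) \<partial>lborel) + ennreal (?r \<xi>) \<partial>M)"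
    proof (rule nn_integral_mono_AE)
      show "AE \<xi> in M. ennreal (q \<xi> / 2) \<le> (\<integral>\<^sup>+y. ennreal (f (X \<xi>) y) * ennreal (bump (y - X \<xi> \<bullet> \<beta>0) (X \<xi> \<bullet> u)) \<partial>lborel) + ennreal (?r \<xi>)"
        using AE_support q
      proof eventually_elim
        case (elim \<xi>)
        have "ennreal (q \<xi> / 2) \<le> (\<integral>\<^sup>+y. ennreal (f (X \<xi>) y) * ennreal (bump (y - X \<xi> \<bullet> \<beta>0) (X \<xi> \<bullet> u)) \<partial>lborel) + ennreal (C * min ((X \<xi> \<bullet> u)\<^sup>2) (\<bar>X \<xi> \<bullet> u\<bar> ^ 3))"
          using nn_integral_bump_density(2)[OF elim(1), of "X \<xi> \<bullet> u"] elim(2) by simp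
        also have "\<dots> \<le> (\<integral>\<^sup>+y. ennreal (f (X \<xi>) y) * ennreal (bump (y - X \<xi> \<bullet> \<beta>0) (X \<xi> \<bullet> u)) \<partial>lborel) + ennreal (?r \<xi>)"
          using rr[of \<xi>] by (intro add_left_mono ennreal_leI)
        finally show ?case .
      qed
    qed
    also have "\<dots> = (\<integral>\<^sup>+\<xi>. ennreal (?b \<xi>) \<partial>M) + (\<integral>\<^sup>+\<xi>. ennreal (?r \<xi>) \<partial>M)"
      unfolding nn_integral_bump_XY by (rule nn_integral_add[OF m1]) simp
    also have "\<dots> = (\<integral>\<^sup>+\<xi>. ennreal (?b \<xi> + ?r \<xi>) \<partial>M)"
      using C by (subst nn_integral_add[symmetric]) (auto simp: ennreal_plus)
    finally show "(\<integral>\<^sup>+\<xi>. ennreal (q \<xi> / 2) \<partial>M) \<le> (\<integral>\<^sup>+\<xi>. ennreal (?b \<xi> + ?r \<xi>) \<partial>M)" .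
  qed (use ib iq' ir qn C in auto)
  then have 2: "expectation ?q / 2 \<le> expectation ?b + expectation ?r" using ib iq' ir Eq by simp
  have "expectation ?r = C * (norm u powr p * expectation (\<lambda>\<xi>. norm (X \<xi>) powr p))" by simp
  with 1 2 show "\<bar>expectation ?b - expectation ?q / 2\<bar> \<le> C * (norm u powr p * expectation (\<lambda>\<xi>. norm (X \<xi>) powr p))"
    by linarith
qed

end

section \<open>Clustered data with independent weights\<close>

lemma measurable_fst_snd_borel [measurable]:
  "fst \<in> borel_measurable (borel :: (real \<times> (real ^ 'd)) measure)"
  "snd \<in> borel_measurable (borel :: (real \<times> (real ^ 'd)) measure)"
  by (intro borel_measurable_continuous_onI continuous_intros)+

locale clusters = prob_space M for M :: "'a measure" +
  fixes c :: "nat \<Rightarrow> nat" and cmax :: nat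
    and Y :: "nat \<Rightarrow> nat \<Rightarrow> 'a \<Rightarrow> real" and X :: "nat \<Rightarrow> nat \<Rightarrow> 'a \<Rightarrow> real ^ 'd"
    and W :: "nat \<Rightarrow> 'a \<Rightarrow> real"
  assumes rv: "\<And>i k. i \<ge> 1 \<Longrightarrow> k \<in> {1..c i} \<Longrightarrow> Y i k \<in> borel_measurable M"
      "\<And>i k. i \<ge> 1 \<Longrightarrow> k \<in> {1..c i} \<Longrightarrow> X i k \<in> borel_measurable M"
    and clusters_indep: "indep_vars (\<lambda>i. data_space c {i}) (\<lambda>i. data c Y X {i}) {1..}"
    and cluster_size: "\<And>i. i \<ge> 1 \<Longrightarrow> c i \<le> cmax"
    and W_indep: "indep_vars (\<lambda>_. borel) W {1..}"
    and W_data_indep: "indep_set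
      (sets (vimage_algebra (space M) (data c Y X {1..}) (data_space c {1..})))
      (sets (vimage_algebra (space M) (\<lambda>\<xi>. \<lambda>i\<in>{1..}. W i \<xi>) (PiM {1..} (\<lambda>_. borel))))"
    and W_sq: "\<And>i. i \<ge> 1 \<Longrightarrow> integrable M (\<lambda>\<xi>. (W i \<xi>)\<^sup>2)"
    and W_mean: "\<And>i. i \<ge> 1 \<Longrightarrow> expectation (W i) = 0"
    and W_var: "\<And>i. i \<ge> 1 \<Longrightarrow> expectation (\<lambda>\<xi>. (W i \<xi>)\<^sup>2) = 1"
begin

definition \<F> :: "nat set \<Rightarrow> 'a measure" where
  "\<F> I = vimage_algebra (space M) (data c Y X I) (data_space c I)"

definition \<W> :: "'a measure" where
  "\<W> = vimage_algebra (space M) (\<lambda>\<xi>. \<lambda>i\<in>{1..}. W i \<xi>) (PiM {1..} (\<lambda>_. borel))"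

lemma space_F [simp]: "space (\<F> I) = space M" and space_W [simp]: "space \<W> = space M"
  by (simp_all add: \<F>_def \<W>_def)

lemma data_in_space: "data c Y X I \<in> space M \<rightarrow> space (data_space c I)"
  by (auto simp: data_def data_space_def space_PiM)

lemma data_measurable_F: "data c Y X I \<in> measurable (\<F> I) (data_space c I)"
  unfolding \<F>_def by (rule measurable_vimage_algebra1[OF data_in_space])

lemma YX_measurable_F:
  assumes "i \<in> I" "k \<in> {1..c i}"
  shows "(\<lambda>\<xi>. (Y i k \<xi>, X i k \<xi>)) \<in> borel_measurable (\<F> I)"
proof -
  have "(\<lambda>D. D (i, k)) \<in> measurable (data_space c I) borel"
    unfolding data_space_def using assms by (intro measurable_component_singleton) auto
  then have "(\<lambda>\<xi>. data c Y X I \<xi> (i, k)) \<in> borel_measurable (\<F> I)"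
    by (rule measurable_compose[OF data_measurable_F])
  then show ?thesis using assms by (simp add: data_def)
qed

lemma YX_measurable:
  assumes "i \<ge> 1" "k \<in> {1..c i}"
  shows "(\<lambda>\<xi>. (Y i k \<xi>, X i k \<xi>)) \<in> borel_measurable M"
  using rv[OF assms] by (simp add: borel_prod[symmetric])

lemma data_measurable: "I \<subseteq> {1..} \<Longrightarrow> data c Y X I \<in> measurable M (data_space c I)"
  unfolding data_def data_space_def
proof (rule measurable_PiM_single')
  fix ik assume "I \<subseteq> {1..}" "ik \<in> (SIGMA i:I. {1..c i})"
  then show "(\<lambda>\<xi>. (\<lambda>(i, k)\<in>SIGMA i:I. {1..c i}. (Y i k \<xi>, X i k \<xi>)) ik) \<in> borel_measurable M"
    using YX_measurable by (cases ik) auto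
qed (rule Pi_I, rule PiE_I, simp_all only: space_borel UNIV_I restrict_def if_False simp_thms)

lemma subalgebra_F: "I \<subseteq> {1..} \<Longrightarrow> subalgebra M (\<F> I)"
  unfolding subalgebra_def \<F>_def using data_measurable[of I]
  by (auto simp: sets_vimage_algebra2[OF data_in_space])

lemma F_mono:
  assumes "I \<subseteq> J"
  shows "sets (\<F> I) \<subseteq> sets (\<F> J)"
proof -
  have "data c Y X I \<in> measurable (\<F> J) (data_space c I)"
    unfolding data_def data_space_def
  proof (rule measurable_PiM_single')
    fix ik assume "ik \<in> (SIGMA i:I. {1..c i})"
    then show "(\<lambda>\<xi>. (\<lambda>(i, k)\<in>SIGMA i:I. {1..c i}. (Y i k \<xi>, X i k \<xi>)) ik) \<in> borel_measurable (\<F> J)"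
      using YX_measurable_F assms by (cases ik) auto
  qed (rule Pi_I, rule PiE_I, simp_all only: space_borel UNIV_I restrict_def if_False simp_thms)
  then show ?thesis
    unfolding \<F>_def[of I] by (auto simp: sets_vimage_algebra2[OF data_in_space] dest: measurable_sets)
qed

lemma W_measurable_W: "i \<ge> 1 \<Longrightarrow> W i \<in> borel_measurable \<W>"
proof -
  assume i: "i \<ge> 1"
  have "(\<lambda>\<xi>. \<lambda>i\<in>{1..}. W i \<xi>) \<in> measurable \<W> (PiM {1..} (\<lambda>_. borel))"
    unfolding \<W>_def by (rule measurable_vimage_algebra1) (auto simp: space_PiM)
  from measurable_compose[OF this measurable_component_singleton[of i]] i
  show ?thesis by simp
qed

lemma W_measurable [measurable]: "i \<ge> 1 \<Longrightarrow> W i \<in> borel_measurable M"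
  using W_indep by (auto simp: indep_vars_def2)

lemma W_integrable: "i \<ge> 1 \<Longrightarrow> integrable M (W i)"
  by (rule square_integrable_imp_integrable) (auto intro: W_sq)

lemma indep_data_weight:
  assumes "f \<in> measurable (\<F> {1..}) S" "g \<in> measurable \<W> T"
  shows "indep_var S f T g"
  using W_data_indep assms unfolding \<F>_def[symmetric] \<W>_def[symmetric]
  by (intro indep_set_imp_indep_var) auto

lemma indep_pairs:
  "indep_vars (\<lambda>i. data_space c {i} \<Otimes>\<^sub>M borel) (\<lambda>i \<xi>. (data c Y X {i} \<xi>, W i \<xi>)) {1..}"
proof (rule indep_vars_Pair[OF clusters_indep W_indep W_data_indep])
  fix J :: "nat set" and A :: "nat \<Rightarrow> (nat \<times> nat \<Rightarrow> real \<times> (real ^ 'd)) set"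
  assume J: "finite J" "J \<noteq> {}" "J \<subseteq> {1..}" and A: "\<And>i. i \<in> J \<Longrightarrow> A i \<in> sets (data_space c {i})"
  have "data c Y X {i} -` A i \<inter> space M \<in> sets (\<F> {1..})" if "i \<in> J" for i
  proof -
    have "data c Y X {i} -` A i \<inter> space (\<F> {i}) \<in> sets (\<F> {i})"
      by (rule measurable_sets[OF data_measurable_F A[OF that]])
    then show ?thesis using F_mono[of "{i}" "{1..}"] that J by auto
  qed
  then show "(\<Inter>i\<in>J. data c Y X {i} -` A i \<inter> space M) \<in> sets (vimage_algebra (space M) (data c Y X {1..}) (data_space c {1..}))"
    using J unfolding \<F>_def[symmetric] by (intro sets.finite_INT) auto
next
  fix J :: "nat set" and A :: "nat \<Rightarrow> real set"
  assume J: "finite J" "J \<noteq> {}" "J \<subseteq> {1..}" and A: "\<And>i. i \<in> J \<Longrightarrow> A i \<in> sets borel"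
  have "W i -` A i \<inter> space M \<in> sets \<W>" if "i \<in> J" for i
    using measurable_sets[OF W_measurable_W A] that J by auto
  then show "(\<Inter>i\<in>J. W i -` A i \<inter> space M) \<in> sets (vimage_algebra (space M) (\<lambda>\<xi>. \<lambda>i\<in>{1..}. W i \<xi>) (PiM {1..} (\<lambda>_. borel)))"
    using J unfolding \<W>_def[symmetric] by (intro sets.finite_INT) auto
qed

text \<open>Cluster totals are the independent units, since dependence inside a cluster is
  arbitrary. A statistic is a sum of these over \<open>i\<close>.\<close>

definition csum :: "(nat \<Rightarrow> nat \<Rightarrow> real \<times> (real ^ 'd) \<Rightarrow> real) \<Rightarrow> nat \<Rightarrow> 'a \<Rightarrow> real" where
  "csum t i \<xi> = (\<Sum>k=1..c i. t i k (Y i k \<xi>, X i k \<xi>))"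

lemma csum_measurable_F:
  assumes "\<And>i k. t i k \<in> borel_measurable borel" "i \<in> I"
  shows "csum t i \<in> borel_measurable (\<F> I)"
proof -
  have "(\<lambda>\<xi>. t i k (Y i k \<xi>, X i k \<xi>)) \<in> borel_measurable (\<F> I)" if "k \<in> {1..c i}" for k
    using assms that by (intro measurable_compose[OF YX_measurable_F]) auto
  then show ?thesis unfolding csum_def[abs_def] by (intro borel_measurable_sum)
qed

lemma csum_measurable:
  assumes "\<And>i k. t i k \<in> borel_measurable borel" "i \<ge> 1"
  shows "csum t i \<in> borel_measurable M"
  using measurable_from_subalg[OF subalgebra_F[of "{i}"] csum_measurable_F[of t i "{i}"]] assms by auto

lemma csum_as_data:
  assumes "\<And>i k. t i k \<in> borel_measurable borel"
  shows "(\<lambda>D. \<Sum>k=1..c i. t i k (D (i, k))) \<in> borel_measurable (data_space c {i})"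
    "csum t i \<xi> = (\<Sum>k=1..c i. t i k (data c Y X {i} \<xi> (i, k)))"
proof -
  have "(\<lambda>D. t i k (D (i, k))) \<in> borel_measurable (data_space c {i})" if "k \<in> {1..c i}" for k
    unfolding data_space_def using assms that
    by (intro measurable_compose[OF measurable_component_singleton]) auto
  then show "(\<lambda>D. \<Sum>k=1..c i. t i k (D (i, k))) \<in> borel_measurable (data_space c {i})"
    by (intro borel_measurable_sum)
  show "csum t i \<xi> = (\<Sum>k=1..c i. t i k (data c Y X {i} \<xi> (i, k)))"
    unfolding csum_def data_def by (intro sum.cong) auto
qed

text \<open>The version with two totals serves truncated products of two scores.\<close>

lemma indep_csum2:
  assumes "\<And>i k. t i k \<in> borel_measurable borel" and "\<And>i k. t' i k \<in> borel_measurable borel"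
    and \<phi>: "(\<lambda>(x, y). \<phi> x y) \<in> borel_measurable (borel \<Otimes>\<^sub>M borel)"
  shows "indep_vars (\<lambda>_. borel) (\<lambda>i \<xi>. \<phi> (csum t i \<xi>) (csum t' i \<xi>) :: real) {1..}"
proof -
  have m: "(\<lambda>D. \<phi> (\<Sum>k=1..c i. t i k (D (i, k))) (\<Sum>k=1..c i. t' i k (D (i, k)))) \<in> borel_measurable (data_space c {i})" for i
    using measurable_compose[OF measurable_Pair[OF csum_as_data(1)[of t i] csum_as_data(1)[of t' i]] \<phi>] assms(1,2) by simp
  show ?thesis
    unfolding csum_as_data(2)[of t, OF assms(1)] csum_as_data(2)[of t', OF assms(2)]
    by (rule indep_vars_compose2[OF clusters_indep]) (rule m)
qed

lemma indep_csum:
  assumes "\<And>i k. t i k \<in> borel_measurable borel"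
  shows "indep_vars (\<lambda>_. borel) (csum t) {1..}"
  using indep_csum2[of t t "\<lambda>x y. x"] assms by simp

lemma indep_wsum:
  assumes t: "\<And>i k. t i k \<in> borel_measurable borel" and h: "h \<in> borel_measurable borel"
  shows "indep_vars (\<lambda>_. borel) (\<lambda>i \<xi>. a * (h (W i \<xi>) * csum t i \<xi>) :: real) {1..}"
proof -
  have "(\<lambda>p. \<Sum>k=1..c i. t i k (fst p (i, k))) \<in> borel_measurable (data_space c {i} \<Otimes>\<^sub>M borel)" for i
    by (rule measurable_compose[OF measurable_fst csum_as_data(1)]) (rule t)
  moreover have "(\<lambda>p. h (snd p)) \<in> borel_measurable (data_space c {i} \<Otimes>\<^sub>M borel)" for i
    by (rule measurable_compose[OF measurable_snd h])
  ultimately have m: "(\<lambda>p. a * (h (snd p) * (\<Sum>k=1..c i. t i k (fst p (i, k))))) \<in> borel_measurable (data_space c {i} \<Otimes>\<^sub>M borel)" for i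
    by (intro borel_measurable_times borel_measurable_const)
  have "indep_vars (\<lambda>_. borel) (\<lambda>i \<xi>. (\<lambda>p. a * (h (snd p) * (\<Sum>k=1..c i. t i k (fst p (i, k))))) (data c Y X {i} \<xi>, W i \<xi>)) {1..}"
    by (rule indep_vars_compose2[OF indep_pairs]) (rule m)
  then show ?thesis unfolding csum_as_data(2)[of t, OF t] by simp
qed

lemma weight_csum:
  assumes t: "\<And>i k. t i k \<in> borel_measurable borel" and h [measurable]: "h \<in> borel_measurable borel" and i: "i \<ge> 1"
    and int: "integrable M (\<lambda>\<xi>. h (W i \<xi>) :: real)" "integrable M (csum t i)"
  shows "integrable M (\<lambda>\<xi>. h (W i \<xi>) * csum t i \<xi>)"
    "expectation (\<lambda>\<xi>. h (W i \<xi>) * csum t i \<xi>) = expectation (\<lambda>\<xi>. h (W i \<xi>)) * expectation (csum t i)"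
proof -
  have "(\<lambda>\<xi>. h (W i \<xi>)) \<in> borel_measurable \<W>"
    by (rule measurable_compose[OF W_measurable_W[OF i] h])
  then have "indep_var borel (csum t i) borel (\<lambda>\<xi>. h (W i \<xi>))"
    using t i by (intro indep_data_weight csum_measurable_F) auto
  from indep_var_integrable[OF this int(2,1)] indep_var_lebesgue_integral[OF this int(2,1)]
  show "integrable M (\<lambda>\<xi>. h (W i \<xi>) * csum t i \<xi>)"
    "expectation (\<lambda>\<xi>. h (W i \<xi>) * csum t i \<xi>) = expectation (\<lambda>\<xi>. h (W i \<xi>)) * expectation (csum t i)"
    by (simp_all add: mult.commute)
qed

lemma weight_csum_sq:
  assumes t: "\<And>i k. t i k \<in> borel_measurable borel" and i: "i \<ge> 1"
    and int: "integrable M (\<lambda>\<xi>. (csum t i \<xi>)\<^sup>2)"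
  shows "integrable M (\<lambda>\<xi>. (W i \<xi> * csum t i \<xi>)\<^sup>2)"
    "expectation (\<lambda>\<xi>. (W i \<xi> * csum t i \<xi>)\<^sup>2) = expectation (\<lambda>\<xi>. (csum t i \<xi>)\<^sup>2)"
proof -
  have "(\<lambda>\<xi>. (W i \<xi>)\<^sup>2) \<in> borel_measurable \<W>"
    using W_measurable_W[OF i] by measurable
  moreover have "(\<lambda>\<xi>. (csum t i \<xi>)\<^sup>2) \<in> borel_measurable (\<F> {1..})"
    using csum_measurable_F[of t i "{1..}"] t i by (intro borel_measurable_power) auto
  ultimately have "indep_var borel (\<lambda>\<xi>. (csum t i \<xi>)\<^sup>2) borel (\<lambda>\<xi>. (W i \<xi>)\<^sup>2)"
    by (intro indep_data_weight)
  from indep_var_integrable[OF this int W_sq[OF i]] indep_var_lebesgue_integral[OF this int W_sq[OF i]]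
  show "integrable M (\<lambda>\<xi>. (W i \<xi> * csum t i \<xi>)\<^sup>2)"
    "expectation (\<lambda>\<xi>. (W i \<xi> * csum t i \<xi>)\<^sup>2) = expectation (\<lambda>\<xi>. (csum t i \<xi>)\<^sup>2)"
    using W_var[OF i] by (simp_all add: power_mult_distrib mult.commute)
qed

text \<open>Arbitrary dependence inside the cluster costs a factor \<open>cmax\<close>, by
  Cauchy-Schwarz.\<close>

lemma csum_sq:
  assumes t: "\<And>i k. t i k \<in> borel_measurable borel" and i: "i \<ge> 1"
    and int: "\<And>k. k \<in> {1..c i} \<Longrightarrow> integrable M (\<lambda>\<xi>. (t i k (Y i k \<xi>, X i k \<xi>))\<^sup>2)"
  shows "integrable M (\<lambda>\<xi>. (csum t i \<xi>)\<^sup>2)"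
    "expectation (\<lambda>\<xi>. (csum t i \<xi>)\<^sup>2) \<le> real cmax * (\<Sum>k=1..c i. expectation (\<lambda>\<xi>. (t i k (Y i k \<xi>, X i k \<xi>))\<^sup>2))"
proof -
  have m: "(\<lambda>\<xi>. t i k (Y i k \<xi>, X i k \<xi>)) \<in> borel_measurable M" if "k \<in> {1..c i}" for k
    using t that i by (intro measurable_compose[OF YX_measurable]) auto
  show i1: "integrable M (\<lambda>\<xi>. (csum t i \<xi>)\<^sup>2)"
    unfolding csum_def using m int by (intro integrable_square_sum) auto
  have "expectation (\<lambda>\<xi>. (csum t i \<xi>)\<^sup>2) \<le> expectation (\<lambda>\<xi>. real cmax * (\<Sum>k=1..c i. (t i k (Y i k \<xi>, X i k \<xi>))\<^sup>2))"
  proof (intro integral_mono i1 integrable_mult_right Bochner_Integration.integrable_sum)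
    fix \<xi>
    have "(csum t i \<xi>)\<^sup>2 \<le> (\<Sum>k=1..c i. (t i k (Y i k \<xi>, X i k \<xi>))\<^sup>2) * real (card {1..c i})"
      unfolding csum_def by (rule sum_squared_le_sum_of_squares) 
    also have "\<dots> \<le> (\<Sum>k=1..c i. (t i k (Y i k \<xi>, X i k \<xi>))\<^sup>2) * real cmax"
      using cluster_size[OF i] by (intro mult_left_mono sum_nonneg) auto
    finally show "(csum t i \<xi>)\<^sup>2 \<le> real cmax * (\<Sum>k=1..c i. (t i k (Y i k \<xi>, X i k \<xi>))\<^sup>2)" by (simp add: mult.commute)
  qed (use int in auto)
  also have "\<dots> = real cmax * (\<Sum>k=1..c i. expectation (\<lambda>\<xi>. (t i k (Y i k \<xi>, X i k \<xi>))\<^sup>2))"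
    using int by simp
  finally show "expectation (\<lambda>\<xi>. (csum t i \<xi>)\<^sup>2) \<le> real cmax * (\<Sum>k=1..c i. expectation (\<lambda>\<xi>. (t i k (Y i k \<xi>, X i k \<xi>))\<^sup>2))" .
qed

lemma double_sum_le:
  assumes "\<And>i k. i \<in> {1..n} \<Longrightarrow> k \<in> {1..c i} \<Longrightarrow> a i k \<le> b" "0 \<le> b"
  shows "(\<Sum>i=1..n. \<Sum>k=1..c i. a i k) \<le> real n * (real cmax * b)"
proof -
  have "(\<Sum>k=1..c i. a i k) \<le> real cmax * b" if "i \<in> {1..n}" for i
  proof -
    have "(\<Sum>k=1..c i. a i k) \<le> real (card {1..c i}) * b" using assms(1)[OF that] by (intro sum_bounded_above)
    also have "\<dots> \<le> real cmax * b" using cluster_size[of i] that assms(2) by (intro mult_right_mono) auto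
    finally show ?thesis .
  qed
  then have "(\<Sum>i=1..n. \<Sum>k=1..c i. a i k) \<le> real (card {1..n}) * (real cmax * b)" by (intro sum_bounded_above)
  then show ?thesis by simp
qed

text \<open>Chebyshev over independent clusters. One factor \<open>cmax\<close> comes from
  Cauchy-Schwarz within a cluster, the other from counting its observations.\<close>

lemma csum_sum_hp:
  assumes t: "\<And>i k. t i k \<in> borel_measurable borel"
    and int: "\<And>i k. i \<in> {1..n} \<Longrightarrow> k \<in> {1..c i} \<Longrightarrow> integrable M (\<lambda>\<xi>. (t i k (Y i k \<xi>, X i k \<xi>))\<^sup>2)"
    and v: "\<And>i k. i \<in> {1..n} \<Longrightarrow> k \<in> {1..c i} \<Longrightarrow> expectation (\<lambda>\<xi>. (t i k (Y i k \<xi>, X i k \<xi>))\<^sup>2) \<le> v" "0 \<le> v"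
    and a: "0 < a"
  shows "hp M (\<F> {1..n}) (real n * ((real cmax)\<^sup>2 * v) / a\<^sup>2)
    (\<lambda>\<xi>. \<bar>(\<Sum>i=1..n. csum t i \<xi>) - (\<Sum>i=1..n. \<Sum>k=1..c i. expectation (\<lambda>\<xi>. t i k (Y i k \<xi>, X i k \<xi>)))\<bar> < a)"
proof -
  have m: "(\<lambda>\<xi>. t i k (Y i k \<xi>, X i k \<xi>)) \<in> borel_measurable M" if "i \<in> {1..n}" "k \<in> {1..c i}" for i k
    using t that by (intro measurable_compose[OF YX_measurable]) auto
  have sq: "integrable M (\<lambda>\<xi>. (csum t i \<xi>)\<^sup>2)" if "i \<in> {1..n}" for i
    using that t int by (intro csum_sq(1)) auto
  have "integrable M (\<lambda>\<xi>. t i k (Y i k \<xi>, X i k \<xi>))" if "i \<in> {1..n}" "k \<in> {1..c i}" for i k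
    using square_integrable_imp_integrable[OF m[OF that] int[OF that]] by simp
  then have E: "(\<Sum>i=1..n. expectation (csum t i)) = (\<Sum>i=1..n. \<Sum>k=1..c i. expectation (\<lambda>\<xi>. t i k (Y i k \<xi>, X i k \<xi>)))"
    unfolding csum_def[abs_def] by (intro sum.cong refl Bochner_Integration.integral_sum) auto
  note iv = indep_sum_variance[OF indep_csum[of t, OF t], of "{1..n}", OF _ _ sq]
  have "(\<Sum>i=1..n. expectation (\<lambda>\<xi>. (csum t i \<xi>)\<^sup>2)) \<le> (\<Sum>i=1..n. real cmax * (\<Sum>k=1..c i. expectation (\<lambda>\<xi>. (t i k (Y i k \<xi>, X i k \<xi>))\<^sup>2)))"
    using t int by (intro sum_mono csum_sq(2)) auto
  also have "\<dots> \<le> real cmax * (real n * (real cmax * v))"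
    unfolding sum_distrib_left[symmetric] using v by (intro mult_left_mono double_sum_le) auto
  finally have "(\<Sum>i=1..n. expectation (\<lambda>\<xi>. (csum t i \<xi>)\<^sup>2)) \<le> real n * ((real cmax)\<^sup>2 * v)"
    by (simp add: power2_eq_square algebra_simps)
  then have "expectation (\<lambda>\<xi>. ((\<Sum>i=1..n. csum t i \<xi>) - (\<Sum>i=1..n. expectation (csum t i)))\<^sup>2) \<le> real n * ((real cmax)\<^sup>2 * v)"
    by (intro order_trans[OF iv(2)]) auto
  moreover have "(\<lambda>\<xi>. \<Sum>i=1..n. csum t i \<xi>) \<in> borel_measurable (\<F> {1..n})"
    using t by (intro borel_measurable_sum csum_measurable_F) auto
  ultimately have "hp M (\<F> {1..n}) (real n * ((real cmax)\<^sup>2 * v) / a\<^sup>2)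
    (\<lambda>\<xi>. \<bar>(\<Sum>i=1..n. csum t i \<xi>) - (\<Sum>i=1..n. expectation (csum t i))\<bar> < a)"
    using a by (intro hp_Chebyshev subalgebra_F iv(1)) auto
  then show ?thesis unfolding E .
qed

text \<open>The identity as \<open>h\<close> is for the wild gradient and its increments, where the
  mean \<open>\<mu>\<close> vanishes. The absolute value is for envelopes of increments, whose mean
  has to be kept.\<close>

lemma wsum_second_moment:
  assumes t: "\<And>i k. t i k \<in> borel_measurable borel"
    and int: "\<And>i k. i \<in> {1..n} \<Longrightarrow> k \<in> {1..c i} \<Longrightarrow> integrable M (\<lambda>\<xi>. (t i k (Y i k \<xi>, X i k \<xi>))\<^sup>2)"
    and v: "\<And>i k. i \<in> {1..n} \<Longrightarrow> k \<in> {1..c i} \<Longrightarrow> expectation (\<lambda>\<xi>. (t i k (Y i k \<xi>, X i k \<xi>))\<^sup>2) \<le> v" "0 \<le> v"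
    and h: "h = (\<lambda>x. x) \<or> h = abs" and n: "n \<ge> 1"
  defines "S \<equiv> \<lambda>\<xi>. (1 / sqrt (real n)) * (\<Sum>i=1..n. h (W i \<xi>) * csum t i \<xi>)"
  defines "\<mu> \<equiv> (1 / sqrt (real n)) * (\<Sum>i=1..n. expectation (\<lambda>\<xi>. h (W i \<xi>)) * (\<Sum>k=1..c i. expectation (\<lambda>\<xi>. t i k (Y i k \<xi>, X i k \<xi>))))"
  shows "S \<in> borel_measurable M" "integrable M (\<lambda>\<xi>. (S \<xi> - \<mu>)\<^sup>2)"
    "expectation (\<lambda>\<xi>. (S \<xi> - \<mu>)\<^sup>2) \<le> (real cmax)\<^sup>2 * v"
proof -
  have hm: "h \<in> borel_measurable borel" using h by auto
  have m: "(\<lambda>\<xi>. t i k (Y i k \<xi>, X i k \<xi>)) \<in> borel_measurable M" if "i \<in> {1..n}" "k \<in> {1..c i}" for i k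
    using t that by (intro measurable_compose[OF YX_measurable]) auto
  have sq: "integrable M (\<lambda>\<xi>. (csum t i \<xi>)\<^sup>2)" if "i \<in> {1..n}" for i
    using that t int by (intro csum_sq(1)) auto
  have cm: "csum t i \<in> borel_measurable M" if "i \<in> {1..n}" for i
    using that t by (intro csum_measurable) auto
  have ci: "integrable M (csum t i)" if "i \<in> {1..n}" for i
    using square_integrable_imp_integrable[OF cm[OF that] sq[OF that]] by simp
  have hi: "integrable M (\<lambda>\<xi>. h (W i \<xi>))" if "i \<in> {1..n}" for i
    using h W_integrable[of i] that by auto
  have ti: "integrable M (\<lambda>\<xi>. t i k (Y i k \<xi>, X i k \<xi>))" if "i \<in> {1..n}" "k \<in> {1..c i}" for i k
    using square_integrable_imp_integrable[OF m[OF that] int[OF that]] by simp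
  have E: "expectation (csum t i) = (\<Sum>k=1..c i. expectation (\<lambda>\<xi>. t i k (Y i k \<xi>, X i k \<xi>)))" if "i \<in> {1..n}" for i
    unfolding csum_def[abs_def] using ti that by (intro Bochner_Integration.integral_sum) auto
  let ?Z = "\<lambda>i \<xi>. (1 / sqrt (real n)) * (h (W i \<xi>) * csum t i \<xi>)"
  have hsq: "(h x)\<^sup>2 = x\<^sup>2" for x using h by auto
  have Zsq: "(?Z i \<xi>)\<^sup>2 = (1 / real n) * (W i \<xi> * csum t i \<xi>)\<^sup>2" for i \<xi>
    using n by (simp add: power_mult_distrib power_divide hsq)
  have zi: "integrable M (\<lambda>\<xi>. (?Z i \<xi>)\<^sup>2)" if "i \<in> {1..n}" for i
    unfolding Zsq using that t sq by (intro integrable_mult_right weight_csum_sq(1)) auto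
  note iv = indep_sum_variance[OF indep_wsum[OF t hm, of "1 / sqrt (real n)"], of "{1..n}", OF _ _ zi]
  have S: "S = (\<lambda>\<xi>. \<Sum>i=1..n. ?Z i \<xi>)" unfolding S_def sum_distrib_left ..
  have \<mu>: "\<mu> = (\<Sum>i=1..n. expectation (?Z i))"
    unfolding \<mu>_def sum_distrib_left
  proof (intro sum.cong refl)
    fix i assume i: "i \<in> {1..n}"
    have "expectation (\<lambda>\<xi>. h (W i \<xi>) * csum t i \<xi>) = expectation (\<lambda>\<xi>. h (W i \<xi>)) * expectation (csum t i)"
      using i t hm hi ci by (intro weight_csum) auto
    then show "(\<Sum>k=1..c i. 1 / sqrt (real n) * (expectation (\<lambda>\<xi>. h (W i \<xi>)) * expectation (\<lambda>\<xi>. t i k (Y i k \<xi>, X i k \<xi>)))) = expectation (?Z i)"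
      using E[OF i] by (simp add: sum_distrib_left sum_divide_distrib)
  qed
  show "S \<in> borel_measurable M"
    unfolding S_def using cm hm by (intro borel_measurable_times borel_measurable_const borel_measurable_sum) (auto intro: measurable_compose[OF W_measurable])
  show "integrable M (\<lambda>\<xi>. (S \<xi> - \<mu>)\<^sup>2)" unfolding S \<mu> by (rule iv(1)) auto
  have "expectation (\<lambda>\<xi>. (S \<xi> - \<mu>)\<^sup>2) \<le> (\<Sum>i=1..n. expectation (\<lambda>\<xi>. (?Z i \<xi>)\<^sup>2))"
    unfolding S \<mu> by (rule iv(2)) auto
  also have "\<dots> = (\<Sum>i=1..n. (1 / real n) * expectation (\<lambda>\<xi>. (csum t i \<xi>)\<^sup>2))"
    unfolding Zsq using t sq weight_csum_sq(2) by (intro sum.cong refl) auto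
  also have "\<dots> \<le> (\<Sum>i=1..n. (1 / real n) * (real cmax * (\<Sum>k=1..c i. expectation (\<lambda>\<xi>. (t i k (Y i k \<xi>, X i k \<xi>))\<^sup>2))))"
    using t int by (intro sum_mono mult_left_mono csum_sq(2)) auto
  also have "\<dots> = (1 / real n) * (real cmax * (\<Sum>i=1..n. \<Sum>k=1..c i. expectation (\<lambda>\<xi>. (t i k (Y i k \<xi>, X i k \<xi>))\<^sup>2)))"
    by (simp only: sum_distrib_left)
  also have "\<dots> \<le> (1 / real n) * (real cmax * (real n * (real cmax * v)))"
    using v by (intro mult_left_mono double_sum_le) auto
  also have "\<dots> = (real cmax)\<^sup>2 * v" using n by (simp add: power2_eq_square)
  finally show "expectation (\<lambda>\<xi>. (S \<xi> - \<mu>)\<^sup>2) \<le> (real cmax)\<^sup>2 * v" .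
qed

lemma abs_W_mean: "i \<ge> 1 \<Longrightarrow> expectation (\<lambda>\<xi>. \<bar>W i \<xi>\<bar>) \<le> 1"
proof -
  assume i: "i \<ge> 1"
  have "expectation (\<lambda>\<xi>. \<bar>W i \<xi>\<bar>) \<le> expectation (\<lambda>\<xi>. (1 + (W i \<xi>)\<^sup>2) / 2)"
  proof (intro integral_mono)
    fix \<xi>
    have "0 \<le> (\<bar>W i \<xi>\<bar> - 1)\<^sup>2" by simp
    then show "\<bar>W i \<xi>\<bar> \<le> (1 + (W i \<xi>)\<^sup>2) / 2" unfolding power2_diff by simp
  qed (use W_integrable[OF i] W_sq[OF i] in auto)
  also have "\<dots> = 1" using W_sq[OF i] W_var[OF i] by (simp add: prob_space)
  finally show ?thesis .
qed

text \<open>As \<open>W i * W j\<close> has expectation \<open>of_bool (i = j)\<close> and the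
  weights are independent of the data, only the diagonal of the double sum survives. The last claim
  is the defining property of a conditional expectation given the data: \<open>g\<close> is a
  version of that of the product.\<close>

lemma wsum_product_cond:
  assumes t: "\<And>i k. t i k \<in> borel_measurable borel" and t': "\<And>i k. t' i k \<in> borel_measurable borel"
    and int: "\<And>i k. i \<in> {1..n} \<Longrightarrow> k \<in> {1..c i} \<Longrightarrow> integrable M (\<lambda>\<xi>. (t i k (Y i k \<xi>, X i k \<xi>))\<^sup>2)"
      "\<And>i k. i \<in> {1..n} \<Longrightarrow> k \<in> {1..c i} \<Longrightarrow> integrable M (\<lambda>\<xi>. (t' i k (Y i k \<xi>, X i k \<xi>))\<^sup>2)"
    and n: "n \<ge> 1"
  defines "S \<equiv> \<lambda>t \<xi>. (1 / sqrt (real n)) * (\<Sum>i=1..n. W i \<xi> * csum t i \<xi>)"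
  defines "g \<equiv> \<lambda>\<xi>. (1 / real n) * (\<Sum>i=1..n. csum t i \<xi> * csum t' i \<xi>)"
  shows "integrable M (\<lambda>\<xi>. S t \<xi> * S t' \<xi>)" "integrable M g" "g \<in> borel_measurable (\<F> {1..n})"
    "\<And>B. B \<in> sets (\<F> {1..n}) \<Longrightarrow> (\<integral>\<xi>\<in>B. S t \<xi> * S t' \<xi> \<partial>M) = (\<integral>\<xi>\<in>B. g \<xi> \<partial>M)"
proof -
  have sq: "integrable M (\<lambda>\<xi>. (csum t i \<xi>)\<^sup>2)" "integrable M (\<lambda>\<xi>. (csum t' i \<xi>)\<^sup>2)" if "i \<in> {1..n}" for i
    using that t t' int by (auto intro!: csum_sq(1))
  have cm: "csum t i \<in> borel_measurable M" "csum t' i \<in> borel_measurable M" if "i \<in> {1..n}" for i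
    using that t t' by (auto intro!: csum_measurable)
  have cF: "csum t i \<in> borel_measurable (\<F> {1..n})" "csum t' i \<in> borel_measurable (\<F> {1..n})" if "i \<in> {1..n}" for i
    using that t t' by (auto intro!: csum_measurable_F)
  have cp: "integrable M (\<lambda>\<xi>. csum t i \<xi> * csum t' j \<xi>)" if "i \<in> {1..n}" "j \<in> {1..n}" for i j
    using that sq cm by (intro integrable_mult_square) auto
  have sub: "subalgebra (\<F> {1..}) (\<F> {1..n})" using F_mono[of "{1..n}" "{1..}"] by (auto simp: subalgebra_def)
  have WW: "expectation (\<lambda>\<xi>. W i \<xi> * W j \<xi>) = of_bool (i = j)" and WWi: "integrable M (\<lambda>\<xi>. W i \<xi> * W j \<xi>)"
    if "i \<in> {1..n}" "j \<in> {1..n}" for i j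
  proof -
    show "integrable M (\<lambda>\<xi>. W i \<xi> * W j \<xi>)"
      using that W_sq by (intro integrable_mult_square) auto
    show "expectation (\<lambda>\<xi>. W i \<xi> * W j \<xi>) = of_bool (i = j)"
    proof (cases "i = j")
      case True
      then show ?thesis using W_var[of i] that by (simp add: power2_eq_square)
    next
      case False
      have "indep_var borel (W i) borel (W j)" using indep_vars_pair[OF W_indep, of i j] that False by auto
      then have "expectation (\<lambda>\<xi>. W i \<xi> * W j \<xi>) = expectation (W i) * expectation (W j)"
        using that by (intro indep_var_lebesgue_integral) (auto intro: W_integrable)
      then show ?thesis using False W_mean[of i] that by simp
    qed
  qed
  have key: "integrable M (\<lambda>\<xi>. indicator B \<xi> * ((W i \<xi> * W j \<xi>) * (csum t i \<xi> * csum t' j \<xi>)))"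
    "expectation (\<lambda>\<xi>. indicator B \<xi> * ((W i \<xi> * W j \<xi>) * (csum t i \<xi> * csum t' j \<xi>))) = of_bool (i = j) * expectation (\<lambda>\<xi>. indicator B \<xi> * (csum t i \<xi> * csum t' j \<xi>))"
    if ij: "i \<in> {1..n}" "j \<in> {1..n}" and B: "B \<in> sets (\<F> {1..n})" for i j B
  proof -
    have [measurable]: "B \<in> sets M" using B subalgebra_F[of "{1..n}"] by (auto simp: subalgebra_def)
    have "(\<lambda>\<xi>. indicator B \<xi> * (csum t i \<xi> * csum t' j \<xi>)) \<in> borel_measurable (\<F> {1..n})"
      using cF ij B by (intro borel_measurable_times) auto
    then have "(\<lambda>\<xi>. indicator B \<xi> * (csum t i \<xi> * csum t' j \<xi>)) \<in> borel_measurable (\<F> {1..})"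
      by (rule measurable_from_subalg[OF sub])
    moreover have "(\<lambda>\<xi>. W i \<xi> * W j \<xi>) \<in> borel_measurable \<W>"
      using ij by (intro borel_measurable_times W_measurable_W) auto
    ultimately have iv: "indep_var borel (\<lambda>\<xi>. indicator B \<xi> * (csum t i \<xi> * csum t' j \<xi>)) borel (\<lambda>\<xi>. W i \<xi> * W j \<xi>)"
      by (rule indep_data_weight)
    have ib: "integrable M (\<lambda>\<xi>. indicator B \<xi> * (csum t i \<xi> * csum t' j \<xi>))"
      using integrable_mult_indicator[OF \<open>B \<in> sets M\<close> cp[OF ij]] by simp
    from indep_var_integrable[OF iv ib WWi[OF ij]]
    show "integrable M (\<lambda>\<xi>. indicator B \<xi> * ((W i \<xi> * W j \<xi>) * (csum t i \<xi> * csum t' j \<xi>)))"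
      by (simp add: mult.assoc mult.left_commute mult.commute)
    from indep_var_lebesgue_integral[OF iv ib WWi[OF ij]]
    show "expectation (\<lambda>\<xi>. indicator B \<xi> * ((W i \<xi> * W j \<xi>) * (csum t i \<xi> * csum t' j \<xi>))) = of_bool (i = j) * expectation (\<lambda>\<xi>. indicator B \<xi> * (csum t i \<xi> * csum t' j \<xi>))"
      unfolding WW[OF ij] by (simp add: mult.assoc mult.left_commute mult.commute)
  qed
  have SS: "S t \<xi> * S t' \<xi> = (1 / real n) * (\<Sum>i=1..n. \<Sum>j=1..n. (W i \<xi> * W j \<xi>) * (csum t i \<xi> * csum t' j \<xi>))" for \<xi>
  proof -
    have "(1 / sqrt (real n)) * (1 / sqrt (real n)) = 1 / real n" by simp
    then show ?thesis unfolding S_def by (simp add: sum_product ac_simps)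
  qed
  show gF: "g \<in> borel_measurable (\<F> {1..n})"
    unfolding g_def using cF by (intro borel_measurable_times borel_measurable_const borel_measurable_sum) auto
  show "integrable M g" unfolding g_def using cp by (intro integrable_mult_right Bochner_Integration.integrable_sum) auto
  have Mn: "space M \<in> sets (\<F> {1..n})" using sets.top[of "\<F> {1..n}"] by simp
  have "integrable M (\<lambda>\<xi>. (W i \<xi> * W j \<xi>) * (csum t i \<xi> * csum t' j \<xi>))" if "i \<in> {1..n}" "j \<in> {1..n}" for i j
    using key(1)[OF that Mn] by (rule Bochner_Integration.integrable_cong[THEN iffD1, OF refl, rotated]) auto
  then show "integrable M (\<lambda>\<xi>. S t \<xi> * S t' \<xi>)"
    unfolding SS by (intro integrable_mult_right Bochner_Integration.integrable_sum) auto
  have dbl: "expectation (\<lambda>\<xi>. a * (\<Sum>i=1..n. \<Sum>j=1..n. K i j \<xi>)) = a * (\<Sum>i=1..n. \<Sum>j=1..n. expectation (K i j))"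
    if "\<And>i j. i \<in> {1..n} \<Longrightarrow> j \<in> {1..n} \<Longrightarrow> integrable M (K i j)" for K :: "nat \<Rightarrow> nat \<Rightarrow> 'a \<Rightarrow> real" and a
  proof -
    have "expectation (\<lambda>\<xi>. \<Sum>i=1..n. \<Sum>j=1..n. K i j \<xi>) = (\<Sum>i=1..n. expectation (\<lambda>\<xi>. \<Sum>j=1..n. K i j \<xi>))"
      using that by (intro Bochner_Integration.integral_sum Bochner_Integration.integrable_sum)
    also have "\<dots> = (\<Sum>i=1..n. \<Sum>j=1..n. expectation (K i j))"
      using that by (intro sum.cong refl Bochner_Integration.integral_sum)
    finally show ?thesis by simp
  qed
  show "(\<integral>\<xi>\<in>B. S t \<xi> * S t' \<xi> \<partial>M) = (\<integral>\<xi>\<in>B. g \<xi> \<partial>M)" if B: "B \<in> sets (\<F> {1..n})" for B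
  proof -
    have [measurable]: "B \<in> sets M" using B subalgebra_F[of "{1..n}"] by (auto simp: subalgebra_def)
    have "(\<integral>\<xi>\<in>B. S t \<xi> * S t' \<xi> \<partial>M) = expectation (\<lambda>\<xi>. (1 / real n) * (\<Sum>i=1..n. \<Sum>j=1..n. indicator B \<xi> * ((W i \<xi> * W j \<xi>) * (csum t i \<xi> * csum t' j \<xi>))))"
      unfolding set_lebesgue_integral_def SS by (simp only: real_scaleR_def sum_distrib_left ac_simps)
    also have "\<dots> = (1 / real n) * (\<Sum>i=1..n. \<Sum>j=1..n. expectation (\<lambda>\<xi>. indicator B \<xi> * ((W i \<xi> * W j \<xi>) * (csum t i \<xi> * csum t' j \<xi>))))"
      by (rule dbl) (rule key(1)[OF _ _ B])
    also have "\<dots> = (1 / real n) * (\<Sum>i=1..n. \<Sum>j=1..n. if j = i then expectation (\<lambda>\<xi>. indicator B \<xi> * (csum t i \<xi> * csum t' i \<xi>)) else 0)"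
      using key(2)[OF _ _ B] by (intro arg_cong2[where f = "(*)"] refl sum.cong) auto
    also have "\<dots> = (1 / real n) * (\<Sum>i=1..n. expectation (\<lambda>\<xi>. indicator B \<xi> * (csum t i \<xi> * csum t' i \<xi>)))"
      by (simp add: sum.delta)
    also have "\<dots> = expectation (\<lambda>\<xi>. (1 / real n) * (\<Sum>i=1..n. indicator B \<xi> * (csum t i \<xi> * csum t' i \<xi>)))"
      using cp integrable_mult_indicator[OF \<open>B \<in> sets M\<close> cp] by (subst integral_mult_right_zero, subst Bochner_Integration.integral_sum) auto
    also have "\<dots> = (\<integral>\<xi>\<in>B. g \<xi> \<partial>M)"
      unfolding set_lebesgue_integral_def g_def by (simp only: real_scaleR_def sum_distrib_left ac_simps)
    finally show ?thesis .
  qed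
qed

end

section \<open>The localised objective function\<close>

text \<open>The assumptions are the inequalities for single observations on which the analysis
  rests; \<open>C\<close> serves as the common upper bound and \<open>lam\<close> as the common
  lower eigenvalue bound. \<open>q i k u\<close> is the contribution of one observation to the
  quadratic form of \<open>J\<close>.\<close>

locale qr_core = clusters M c cmax Y X W
  for M :: "'a measure" and c :: "nat \<Rightarrow> nat" and cmax :: nat
    and Y :: "nat \<Rightarrow> nat \<Rightarrow> 'a \<Rightarrow> real" and X :: "nat \<Rightarrow> nat \<Rightarrow> 'a \<Rightarrow> real ^ 'd"
    and W :: "nat \<Rightarrow> 'a \<Rightarrow> real" +
  fixes \<tau> :: real and \<beta>0 :: "real ^ 'd" and C p \<epsilon> r0 lam :: real
    and J \<Sigma> :: "real ^ 'd ^ 'd" and q :: "nat \<Rightarrow> nat \<Rightarrow> real ^ 'd \<Rightarrow> real"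
  assumes tau: "0 < \<tau>" "\<tau> < 1" and p: "2 < p" "p \<le> 3" and C: "1 \<le> C"
    and pos: "0 < \<epsilon>" "0 < r0" "0 < lam"
    and mom: "\<And>i k. i \<ge> 1 \<Longrightarrow> k \<in> {1..c i} \<Longrightarrow> integrable M (\<lambda>\<xi>. norm (X i k \<xi>) powr p)"
      "\<And>i k. i \<ge> 1 \<Longrightarrow> k \<in> {1..c i} \<Longrightarrow> expectation (\<lambda>\<xi>. norm (X i k \<xi>) powr p) \<le> C"
    and band: "\<And>i k r b. i \<ge> 1 \<Longrightarrow> k \<in> {1..c i} \<Longrightarrow> 0 \<le> r \<Longrightarrow>
        expectation (\<lambda>\<xi>. norm (X i k \<xi>) * of_bool (\<bar>Y i k \<xi> - X i k \<xi> \<bullet> b\<bar> \<le> r * norm (X i k \<xi>))) \<le> C * r"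
      "\<And>i k r b. i \<ge> 1 \<Longrightarrow> k \<in> {1..c i} \<Longrightarrow> 0 \<le> r \<Longrightarrow>
        expectation (\<lambda>\<xi>. (norm (X i k \<xi>))\<^sup>2 * of_bool (\<bar>Y i k \<xi> - X i k \<xi> \<bullet> b\<bar> \<le> r * norm (X i k \<xi>))) \<le> C * r powr (p - 2)"
    and bump_ge: "\<And>i k u. i \<ge> 1 \<Longrightarrow> k \<in> {1..c i} \<Longrightarrow> norm u \<le> r0 \<Longrightarrow>
        \<epsilon> * expectation (\<lambda>\<xi>. (X i k \<xi> \<bullet> u)\<^sup>2) \<le> expectation (\<lambda>\<xi>. bump (Y i k \<xi> - X i k \<xi> \<bullet> \<beta>0) (X i k \<xi> \<bullet> u))"
    and bump_approx: "\<And>i k u. i \<ge> 1 \<Longrightarrow> k \<in> {1..c i} \<Longrightarrow>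
        \<bar>expectation (\<lambda>\<xi>. bump (Y i k \<xi> - X i k \<xi> \<bullet> \<beta>0) (X i k \<xi> \<bullet> u)) - q i k u / 2\<bar> \<le> C * norm u powr p"
    and q_scale: "\<And>i k t u. q i k (t *\<^sub>R u) = t\<^sup>2 * q i k u"
    and psi_mean: "\<And>i k a. i \<ge> 1 \<Longrightarrow> k \<in> {1..c i} \<Longrightarrow>
        expectation (\<lambda>\<xi>. psi \<tau> (Y i k \<xi> - X i k \<xi> \<bullet> \<beta>0) * (X i k \<xi> \<bullet> a)) = 0"
    and eig: "\<And>n u. n \<ge> 1 \<Longrightarrow> lam * (norm u)\<^sup>2 \<le> (1 / real n) * (\<Sum>i=1..n. \<Sum>k=1..c i. expectation (\<lambda>\<xi>. (X i k \<xi> \<bullet> u)\<^sup>2))"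
    and J_lim: "\<And>u. (\<lambda>n. (1 / real n) * (\<Sum>i=1..n. \<Sum>k=1..c i. q i k u)) \<longlonglongrightarrow> u \<bullet> (J *v u)"
    and J_sym: "transpose J = J" and J_pos: "\<And>u. lam * (norm u)\<^sup>2 \<le> u \<bullet> (J *v u)"
begin

lemma C0: "0 \<le> C" using C by simp

lemma sq_le_mom:
  assumes "i \<ge> 1" "k \<in> {1..c i}"
  shows "integrable M (\<lambda>\<xi>. (norm (X i k \<xi>))\<^sup>2)" "expectation (\<lambda>\<xi>. (norm (X i k \<xi>))\<^sup>2) \<le> 2 * C"
  using second_moment_le[OF p(1), of "\<lambda>\<xi>. norm (X i k \<xi>)"] rv(2)[OF assms] mom[OF assms] C by auto

lemma dominated:
  assumes i: "i \<ge> 1" "k \<in> {1..c i}" and t: "t \<in> borel_measurable borel"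
    and dom: "\<And>y x. \<bar>t (y, x)\<bar> \<le> a * norm x" and a: "0 \<le> a"
  shows "integrable M (\<lambda>\<xi>. (t (Y i k \<xi>, X i k \<xi>))\<^sup>2)" "integrable M (\<lambda>\<xi>. t (Y i k \<xi>, X i k \<xi>))"
    "expectation (\<lambda>\<xi>. (t (Y i k \<xi>, X i k \<xi>))\<^sup>2) \<le> a\<^sup>2 * (2 * C)"
proof -
  note [measurable] = rv[OF i] measurable_compose[OF YX_measurable[OF i] t]
  have le: "(t (Y i k \<xi>, X i k \<xi>))\<^sup>2 \<le> a\<^sup>2 * (norm (X i k \<xi>))\<^sup>2" for \<xi>
    using power_mono[OF dom abs_ge_zero, of "Y i k \<xi>" "X i k \<xi>" 2] by (simp add: power_mult_distrib)
  show i2: "integrable M (\<lambda>\<xi>. (t (Y i k \<xi>, X i k \<xi>))\<^sup>2)"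
  proof (rule Bochner_Integration.integrable_bound)
    show "integrable M (\<lambda>\<xi>. a\<^sup>2 * (norm (X i k \<xi>))\<^sup>2)" using sq_le_mom(1)[OF i] by simp
    show "AE \<xi> in M. norm ((t (Y i k \<xi>, X i k \<xi>))\<^sup>2) \<le> norm (a\<^sup>2 * (norm (X i k \<xi>))\<^sup>2)"
      using le by auto
  qed measurable
  then show "integrable M (\<lambda>\<xi>. t (Y i k \<xi>, X i k \<xi>))"
    by (rule square_integrable_imp_integrable[rotated]) measurable
  have "expectation (\<lambda>\<xi>. (t (Y i k \<xi>, X i k \<xi>))\<^sup>2) \<le> expectation (\<lambda>\<xi>. a\<^sup>2 * (norm (X i k \<xi>))\<^sup>2)"
    using i2 sq_le_mom(1)[OF i] le by (intro integral_mono) auto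
  also have "\<dots> \<le> a\<^sup>2 * (2 * C)" using sq_le_mom[OF i] by (simp add: mult_left_mono)
  finally show "expectation (\<lambda>\<xi>. (t (Y i k \<xi>, X i k \<xi>))\<^sup>2) \<le> a\<^sup>2 * (2 * C)" .
qed

definition tB :: "nat \<Rightarrow> real ^ 'd \<Rightarrow> nat \<Rightarrow> nat \<Rightarrow> real \<times> (real ^ 'd) \<Rightarrow> real" where
  "tB n u = (\<lambda>i k z. bump (fst z - snd z \<bullet> \<beta>0) (snd z \<bullet> u / sqrt (real n)))"

text \<open>Envelope for the increments of \<open>tB\<close> in its parameter over the ball of
  radius \<open>s\<close>; see \<open>H_lipschitz\<close>.\<close>

definition tT :: "nat \<Rightarrow> real \<Rightarrow> nat \<Rightarrow> nat \<Rightarrow> real \<times> (real ^ 'd) \<Rightarrow> real" where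
  "tT n s = (\<lambda>i k z. norm (snd z) * of_bool (\<bar>fst z - snd z \<bullet> \<beta>0\<bar> \<le> s / sqrt (real n) * norm (snd z)))"

definition H :: "nat \<Rightarrow> real ^ 'd \<Rightarrow> 'a \<Rightarrow> real" where
  "H n u \<xi> = (\<Sum>i=1..n. csum (tB n u) i \<xi>)"

definition T :: "nat \<Rightarrow> real \<Rightarrow> 'a \<Rightarrow> real" where
  "T n s \<xi> = (1 / sqrt (real n)) * (\<Sum>i=1..n. csum (tT n s) i \<xi>)"

lemma tB_meas: "tB n u i k \<in> borel_measurable borel"
  unfolding tB_def by measurable

lemma tT_meas: "tT n s i k \<in> borel_measurable borel"
  unfolding tT_def of_bool_def by measurable

lemma inner_scaled_le: "\<bar>x \<bullet> u / sqrt (real n)\<bar> \<le> norm u / sqrt (real n) * norm x"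
  using Cauchy_Schwarz_ineq2[of x u] by (simp add: abs_divide divide_right_mono mult.commute)

lemma tB_dom: "\<bar>tB n u i k (y, x)\<bar> \<le> norm u / sqrt (real n) * norm x"
  unfolding tB_def using order_trans[OF bump_le inner_scaled_le] by simp

lemma tT_dom: "\<bar>tT n s i k (y, x)\<bar> \<le> 1 * norm x"
  unfolding tT_def by simp

lemma H_0 [simp]: "H n 0 \<xi> = 0" by (simp add: H_def csum_def tB_def)

lemma H_scale:
  assumes "0 \<le> t" "t \<le> 1"
  shows "H n (t *\<^sub>R u) \<xi> \<le> t * H n u \<xi>"
  unfolding H_def csum_def sum_distrib_left tB_def
  using bump_scale[OF assms] by (intro sum_mono) (simp add: times_divide_eq_right[symmetric] del: times_divide_eq_right)

lemma H_lipschitz: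
  assumes "norm u \<le> s" "norm v \<le> s"
  shows "\<bar>H n u \<xi> - H n v \<xi>\<bar> \<le> norm (u - v) * T n s \<xi>"
proof -
  have "\<bar>tB n u i k z - tB n v i k z\<bar> \<le> (norm (u - v) / sqrt (real n)) * tT n s i k z" for i k z
  proof -
    have b: "\<bar>snd z \<bullet> w / sqrt (real n)\<bar> \<le> s / sqrt (real n) * norm (snd z)" if "norm w \<le> s" for w
      by (rule order_trans[OF inner_scaled_le]) (use that in \<open>auto intro!: mult_right_mono divide_right_mono\<close>)
    have "\<bar>tB n u i k z - tB n v i k z\<bar> \<le> \<bar>snd z \<bullet> u / sqrt (real n) - snd z \<bullet> v / sqrt (real n)\<bar> * of_bool (\<bar>fst z - snd z \<bullet> \<beta>0\<bar> \<le> s / sqrt (real n) * norm (snd z))"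
      unfolding tB_def using b assms by (intro bump_lipschitz)
    also have "snd z \<bullet> u / sqrt (real n) - snd z \<bullet> v / sqrt (real n) = snd z \<bullet> (u - v) / sqrt (real n)"
      by (simp add: inner_diff_right diff_divide_distrib)
    also have "\<bar>snd z \<bullet> (u - v) / sqrt (real n)\<bar> * of_bool (\<bar>fst z - snd z \<bullet> \<beta>0\<bar> \<le> s / sqrt (real n) * norm (snd z)) \<le> (norm (u - v) / sqrt (real n) * norm (snd z)) * of_bool (\<bar>fst z - snd z \<bullet> \<beta>0\<bar> \<le> s / sqrt (real n) * norm (snd z))"
      by (intro mult_right_mono inner_scaled_le) auto
    finally show ?thesis by (simp add: tT_def)
  qed
  then have "\<bar>H n u \<xi> - H n v \<xi>\<bar> \<le> (\<Sum>i=1..n. \<Sum>k=1..c i. (norm (u - v) / sqrt (real n)) * tT n s i k (Y i k \<xi>, X i k \<xi>))"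
    unfolding H_def csum_def sum_subtractf[symmetric] by (intro order_trans[OF sum_abs] sum_mono)
  also have "\<dots> = norm (u - v) * T n s \<xi>"
    unfolding T_def csum_def by (simp add: sum_distrib_left ac_simps)
  finally show ?thesis .
qed

text \<open>Each observation contributes an expectation of order \<open>s / sqrt n\<close> by the
  band estimate. After the division by \<open>sqrt n\<close>, the sum over \<open>n\<close> clusters
  still has a mean of order \<open>s\<close> only.\<close>

lemma T_hp:
  assumes n: "n \<ge> 1" and s: "0 \<le> s" and a: "0 < a"
  shows "hp M (\<F> {1..n}) ((real cmax)\<^sup>2 * (2 * C) / a\<^sup>2) (\<lambda>\<xi>. T n s \<xi> < real cmax * C * s + a)"
proof -
  let ?E = "\<Sum>i=1..n. \<Sum>k=1..c i. expectation (\<lambda>\<xi>. tT n s i k (Y i k \<xi>, X i k \<xi>))"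
  have "hp M (\<F> {1..n}) (real n * ((real cmax)\<^sup>2 * (1\<^sup>2 * (2 * C))) / (sqrt (real n) * a)\<^sup>2)
    (\<lambda>\<xi>. \<bar>(\<Sum>i=1..n. csum (tT n s) i \<xi>) - ?E\<bar> < sqrt (real n) * a)"
    using n a C0 by (intro csum_sum_hp dominated[OF _ _ tT_meas tT_dom]) (auto simp: tT_meas)
  moreover have "real n * ((real cmax)\<^sup>2 * (1\<^sup>2 * (2 * C))) / (sqrt (real n) * a)\<^sup>2 = (real cmax)\<^sup>2 * (2 * C) / a\<^sup>2"
    using n by (simp add: power_mult_distrib)
  moreover have "?E \<le> real n * (real cmax * (C * (s / sqrt (real n))))"
    unfolding tT_def fst_conv snd_conv using s n C0 by (intro double_sum_le band) auto
  ultimately show ?thesis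
  proof (elim hp_mono)
    fix \<xi> assume E: "?E \<le> real n * (real cmax * (C * (s / sqrt (real n))))"
      and d: "\<bar>(\<Sum>i=1..n. csum (tT n s) i \<xi>) - ?E\<bar> < sqrt (real n) * a"
    have "real n * (real cmax * (C * (s / sqrt (real n)))) = sqrt (real n) * (real cmax * C * s)"
      using n by (simp add: real_div_sqrt field_simps)
    then have "(\<Sum>i=1..n. csum (tT n s) i \<xi>) < sqrt (real n) * (real cmax * C * s + a)"
      using E d by (simp add: distrib_left)
    then show "T n s \<xi> < real cmax * C * s + a"
      unfolding T_def using n by (simp add: divide_less_eq mult.commute)
  qed auto
qed

definition EH :: "nat \<Rightarrow> real ^ 'd \<Rightarrow> real" where
  "EH n u = (\<Sum>i=1..n. \<Sum>k=1..c i. expectation (\<lambda>\<xi>. tB n u i k (Y i k \<xi>, X i k \<xi>)))"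

lemma H_hp:
  assumes n: "n \<ge> 1" and a: "0 < a"
  shows "hp M (\<F> {1..n}) ((real cmax)\<^sup>2 * (2 * C) * (norm u)\<^sup>2 / a\<^sup>2) (\<lambda>\<xi>. \<bar>H n u \<xi> - EH n u\<bar> < a)"
proof -
  have "hp M (\<F> {1..n}) (real n * ((real cmax)\<^sup>2 * ((norm u / sqrt (real n))\<^sup>2 * (2 * C))) / a\<^sup>2) (\<lambda>\<xi>. \<bar>H n u \<xi> - EH n u\<bar> < a)"
    unfolding H_def EH_def
    using n a C0 by (intro csum_sum_hp dominated[OF _ _ tB_meas tB_dom]) (auto simp: tB_meas)
  moreover have "real n * ((real cmax)\<^sup>2 * ((norm u / sqrt (real n))\<^sup>2 * (2 * C))) / a\<^sup>2 = (real cmax)\<^sup>2 * (2 * C) * (norm u)\<^sup>2 / a\<^sup>2"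
    using n by (simp add: power_divide)
  ultimately show ?thesis by simp
qed

lemma scaled_inner: "x \<bullet> u / sqrt (real n) = x \<bullet> (u /\<^sub>R sqrt (real n))"
  by (simp add: divide_inverse mult.commute)

lemma EH_ge:
  assumes n: "n \<ge> 1" and u: "norm u \<le> r0 * sqrt (real n)"
  shows "\<epsilon> * lam * (norm u)\<^sup>2 \<le> EH n u"
proof -
  let ?v = "u /\<^sub>R sqrt (real n)"
  have "norm ?v \<le> r0" using n u by (simp add: field_simps)
  then have "\<epsilon> * (\<Sum>i=1..n. \<Sum>k=1..c i. expectation (\<lambda>\<xi>. (X i k \<xi> \<bullet> ?v)\<^sup>2)) \<le> EH n u"
    unfolding EH_def tB_def sum_distrib_left scaled_inner fst_conv snd_conv
    by (intro sum_mono bump_ge) auto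
  moreover have "lam * (norm ?v)\<^sup>2 \<le> (1 / real n) * (\<Sum>i=1..n. \<Sum>k=1..c i. expectation (\<lambda>\<xi>. (X i k \<xi> \<bullet> ?v)\<^sup>2))"
    by (rule eig[OF n])
  then have "lam * (norm u)\<^sup>2 \<le> (\<Sum>i=1..n. \<Sum>k=1..c i. expectation (\<lambda>\<xi>. (X i k \<xi> \<bullet> ?v)\<^sup>2))"
    using n by (simp add: power_mult_distrib power_inverse field_simps)
  ultimately show ?thesis using pos(1) by (smt (verit) mult.assoc mult_left_mono)
qed

section \<open>Quadratic growth of the localised objective\<close>

text \<open>On the sphere of radius \<open>s\<close> the mean of \<open>H\<close> is of order
  \<open>s\<^sup>2\<close>, while its standard deviation at a point and its Lipschitz constant are
  of order \<open>s\<close>. A net of fixed cardinality, rescaled by \<open>s\<close>, is therefore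
  enough. The failure probability decays like \<open>1 / s\<^sup>2\<close>, which is summable over
  dyadic radii.\<close>

lemma sphere_growth:
  obtains K3 where "0 \<le> K3" "\<And>n s. n \<ge> 1 \<Longrightarrow> 0 < s \<Longrightarrow> s \<le> r0 * sqrt (real n) \<Longrightarrow>
    hp M (\<F> {1..n}) (K3 / s\<^sup>2) (\<lambda>\<xi>. \<forall>u. norm u = s \<longrightarrow> \<epsilon> * lam / 4 * s\<^sup>2 \<le> H n u \<xi>)"
proof -
  define c1 where "c1 = \<epsilon> * lam"
  have c1: "0 < c1" using pos by (simp add: c1_def)
  define Dt where "Dt = real cmax * C + 1"
  have Dt: "1 \<le> Dt" using C0 by (simp add: Dt_def)
  \<comment> \<open>A mesh of 1/4 keeps the relevant net points at norm at least 3/4, where the mean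
    is at least \<open>c1 * s\<^sup>2 / 2\<close>; the second bound keeps the Lipschitz error below
    \<open>c1 * s\<^sup>2 / 8\<close>. With another eighth for the deviation, a quarter
    remains.\<close>
  define \<delta> where "\<delta> = min (1 / 4) (c1 / (8 * Dt))"
  have \<delta>: "0 < \<delta>" "\<delta> \<le> 1 / 4" "\<delta> * Dt \<le> c1 / 8"
  proof -
    show "0 < \<delta>" "\<delta> \<le> 1 / 4" using c1 Dt by (auto simp: \<delta>_def)
    have "\<delta> * Dt \<le> c1 / (8 * Dt) * Dt" using Dt by (intro mult_right_mono) (auto simp: \<delta>_def)
    then show "\<delta> * Dt \<le> c1 / 8" using Dt by simp
  qed
  obtain N :: "(real ^ 'd) set" where N: "finite N" "N \<subseteq> cball 0 1" "\<And>u. norm u \<le> 1 \<Longrightarrow> \<exists>f\<in>N. norm (u - f) \<le> \<delta>"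
    using finite_net_ball[OF \<delta>(1), of 1] by auto
  define K where "K = (real cmax)\<^sup>2 * (2 * C)"
  have K: "0 \<le> K" using C0 by (simp add: K_def)
  define K3 where "K3 = K + real (card N) * (K * 64 / c1\<^sup>2)"
  have "hp M (\<F> {1..n}) (K3 / s\<^sup>2) (\<lambda>\<xi>. \<forall>u. norm u = s \<longrightarrow> \<epsilon> * lam / 4 * s\<^sup>2 \<le> H n u \<xi>)"
    if n: "n \<ge> 1" and s: "0 < s" "s \<le> r0 * sqrt (real n)" for n s
  proof -
    have sub: "subalgebra M (\<F> {1..n})" by (rule subalgebra_F) auto
    have 1: "hp M (\<F> {1..n}) (K / s\<^sup>2) (\<lambda>\<xi>. T n s \<xi> < Dt * s)"
      using T_hp[OF n, of s s] s by (simp add: K_def Dt_def distrib_right)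
    have "hp M (\<F> {1..n}) (\<Sum>f\<in>N. K * 64 / c1\<^sup>2 / s\<^sup>2) (\<lambda>\<xi>. \<forall>f\<in>N. \<bar>H n (s *\<^sub>R f) \<xi> - EH n (s *\<^sub>R f)\<bar> < c1 * s\<^sup>2 / 8)"
    proof (rule hp_ball[OF sub N(1)])
      fix f assume f: "f \<in> N"
      then have f1: "norm f \<le> 1" using N by auto
      have "(real cmax)\<^sup>2 * (2 * C) * (norm (s *\<^sub>R f))\<^sup>2 / (c1 * s\<^sup>2 / 8)\<^sup>2 \<le> K * s\<^sup>2 / (c1 * s\<^sup>2 / 8)\<^sup>2"
        unfolding K_def using C0 f1 s
        by (intro divide_right_mono mult_left_mono) (auto simp: power_mult_distrib intro: mult_left_le power_le_one)
      also have "\<dots> = K * 64 / c1\<^sup>2 / s\<^sup>2"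
        using s c1 by (simp add: field_simps power2_eq_square)
      finally show "hp M (\<F> {1..n}) (K * 64 / c1\<^sup>2 / s\<^sup>2) (\<lambda>\<xi>. \<bar>H n (s *\<^sub>R f) \<xi> - EH n (s *\<^sub>R f)\<bar> < c1 * s\<^sup>2 / 8)"
        using c1 s by (intro hp_mono[OF H_hp[OF n, of "c1 * s\<^sup>2 / 8" "s *\<^sub>R f"]]) auto
    qed
    from hp_conj[OF sub 1 this] show ?thesis
    proof (rule hp_mono)
      show "K / s\<^sup>2 + (\<Sum>f\<in>N. K * 64 / c1\<^sup>2 / s\<^sup>2) \<le> K3 / s\<^sup>2"
        by (simp add: K3_def add_divide_distrib)
      fix \<xi> assume \<xi>: "T n s \<xi> < Dt * s \<and> (\<forall>f\<in>N. \<bar>H n (s *\<^sub>R f) \<xi> - EH n (s *\<^sub>R f)\<bar> < c1 * s\<^sup>2 / 8)"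
      show "\<forall>u. norm u = s \<longrightarrow> \<epsilon> * lam / 4 * s\<^sup>2 \<le> H n u \<xi>"
      proof (intro allI impI)
        fix u :: "real ^ 'd" assume u: "norm u = s"
        obtain f where f: "f \<in> N" "norm (u /\<^sub>R s - f) \<le> \<delta>" using N(3)[of "u /\<^sub>R s"] u s by auto
        have f1: "norm f \<le> 1" using N f by auto
        have "norm (u /\<^sub>R s) = 1" using u s by simp
        then have "3 / 4 \<le> norm f"
          using norm_triangle_ineq2[of "u /\<^sub>R s" f] f(2) \<delta>(2) by linarith
        then have "(3 / 4)\<^sup>2 \<le> (norm f)\<^sup>2" by (intro power_mono) auto
        then have "c1 * s\<^sup>2 * (1 / 2) \<le> c1 * s\<^sup>2 * (norm f)\<^sup>2" using c1 by (intro mult_left_mono) (auto simp: power2_eq_square)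
        also have "\<dots> = \<epsilon> * lam * (norm (s *\<^sub>R f))\<^sup>2" using s by (simp add: c1_def power_mult_distrib)
        also have "\<dots> \<le> EH n (s *\<^sub>R f)"
        proof (rule EH_ge[OF n])
          have "norm (s *\<^sub>R f) \<le> s" using s f1 by (simp add: mult_left_le)
          then show "norm (s *\<^sub>R f) \<le> r0 * sqrt (real n)" using s(2) by (rule order_trans)
        qed
        finally have 1: "c1 * s\<^sup>2 * (1 / 2) \<le> EH n (s *\<^sub>R f)" .
        have "u - s *\<^sub>R f = s *\<^sub>R (u /\<^sub>R s - f)" using s by (simp add: algebra_simps)
        then have d: "norm (u - s *\<^sub>R f) \<le> s * \<delta>" using f(2) s by simp
        have "\<bar>H n u \<xi> - H n (s *\<^sub>R f) \<xi>\<bar> \<le> norm (u - s *\<^sub>R f) * T n s \<xi>"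
          using u s f1 by (intro H_lipschitz) (auto simp: mult_left_le)
        also have "\<dots> \<le> norm (u - s *\<^sub>R f) * (Dt * s)" using \<xi> by (intro mult_left_mono) auto
        also have "\<dots> \<le> (s * \<delta>) * (Dt * s)" using d Dt s by (intro mult_right_mono) auto
        also have "\<dots> = (\<delta> * Dt) * s\<^sup>2" by (simp add: power2_eq_square)
        also have "\<dots> \<le> c1 / 8 * s\<^sup>2" using \<delta>(3) by (intro mult_right_mono) auto
        finally have 2: "\<bar>H n u \<xi> - H n (s *\<^sub>R f) \<xi>\<bar> \<le> c1 / 8 * s\<^sup>2" .
        have "\<bar>H n (s *\<^sub>R f) \<xi> - EH n (s *\<^sub>R f)\<bar> < c1 * s\<^sup>2 / 8" using \<xi> f(1) by blast
        with 1 2 show "\<epsilon> * lam / 4 * s\<^sup>2 \<le> H n u \<xi>" unfolding c1_def[symmetric] by (simp, linarith)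
      qed
    qed simp
  qed
  moreover have "0 \<le> K3" using K by (simp add: K3_def)
  ultimately show ?thesis using that by blast
qed

lemma dyadic_scale:
  fixes t K :: real
  assumes "0 < K" "K \<le> t"
  obtains j :: nat where "2 ^ j * K \<le> t" "t < 2 ^ Suc j * K"
proof -
  obtain m :: nat where "t / K < 2 ^ m" using real_arch_pow[of 2 "t / K"] by auto
  then have m: "t < 2 ^ m * K" using assms by (simp add: field_simps)
  define l where "l = (LEAST m. t < 2 ^ m * K)"
  have l: "t < 2 ^ l * K" unfolding l_def using m by (rule LeastI)
  have "l \<noteq> 0" using l assms by (cases l) auto
  then obtain j where j: "l = Suc j" by (cases l) auto
  have "\<not> t < 2 ^ j * K" using not_less_Least[of j "\<lambda>m. t < 2 ^ m * K"] j by (simp add: l_def)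
  then show ?thesis using that[of j] l j by auto
qed

lemma geometric_quarter_sum:
  assumes "finite (A :: nat set)"
  shows "(\<Sum>j\<in>A. (1 / 4 :: real) ^ j) \<le> 2"
proof -
  have "(\<Sum>j\<in>A. (1 / 4 :: real) ^ j) \<le> (\<Sum>j. (1 / 4 :: real) ^ j)"
    using assms by (intro sum_le_suminf summable_geometric) auto
  also have "\<dots> = 4 / 3" by (subst suminf_geometric) auto
  finally show ?thesis by simp
qed

text \<open>Spheres of radius \<open>2 ^ j * K\<close> up to \<open>r0 * sqrt n\<close> have
  geometrically decreasing failure probabilities. From the last sphere inside, \<open>H\<close>
  grows at least linearly along rays. Between spheres this loses a factor 2, and from
  \<open>r0 * sqrt n\<close> out to \<open>D * sqrt n\<close> a factor \<open>r0 / D\<close>, so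
  quadratic growth holds on the whole rescaled parameter set.\<close>

lemma growth:
  assumes D: "0 < D"
  obtains \<kappa> where "0 < \<kappa>" "\<And>\<eta>. 0 < \<eta> \<Longrightarrow> \<exists>K>0. \<forall>\<^sub>F n in sequentially.
    hp M (\<F> {1..n}) \<eta> (\<lambda>\<xi>. \<forall>u. K \<le> norm u \<longrightarrow> norm u \<le> D * sqrt (real n) \<longrightarrow> \<kappa> * (norm u)\<^sup>2 \<le> H n u \<xi>)"
proof -
  obtain K3 where K3: "0 \<le> K3" "\<And>n s. n \<ge> 1 \<Longrightarrow> 0 < s \<Longrightarrow> s \<le> r0 * sqrt (real n) \<Longrightarrow>
    hp M (\<F> {1..n}) (K3 / s\<^sup>2) (\<lambda>\<xi>. \<forall>u. norm u = s \<longrightarrow> \<epsilon> * lam / 4 * s\<^sup>2 \<le> H n u \<xi>)"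
    using sphere_growth by blast
  define c1 where "c1 = \<epsilon> * lam"
  have c1: "0 < c1" using pos by (simp add: c1_def)
  \<comment> \<open>The quarter from \<open>sphere_growth\<close>, halved by the dyadic gap and
    reduced by the factor for radii beyond \<open>r0 * sqrt n\<close>.\<close>
  define \<kappa> where "\<kappa> = c1 / 8 * min 1 (r0 / D)"
  have "0 < \<kappa>" using c1 pos D by (simp add: \<kappa>_def)
  moreover have "\<exists>K>0. \<forall>\<^sub>F n in sequentially.
    hp M (\<F> {1..n}) \<eta> (\<lambda>\<xi>. \<forall>u. K \<le> norm u \<longrightarrow> norm u \<le> D * sqrt (real n) \<longrightarrow> \<kappa> * (norm u)\<^sup>2 \<le> H n u \<xi>)" if \<eta>: "0 < \<eta>" for \<eta>
  proof -
    \<comment> \<open>The innermost radius: the failure probabilities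
      \<open>K3 / (2 ^ j * K)\<^sup>2\<close> add up to at most \<open>2 * K3 / K\<^sup>2\<close>,
      which must not exceed \<open>\<eta>\<close>.\<close>
    define K where "K = 1 + sqrt (2 * K3 / \<eta>)"
    have K: "1 \<le> K" using K3 \<eta> by (simp add: K_def)
    have "2 * K3 / \<eta> = (sqrt (2 * K3 / \<eta>))\<^sup>2" using K3 \<eta> by simp
    also have "\<dots> \<le> K\<^sup>2" using K3 \<eta> by (intro power_mono) (auto simp: K_def)
    finally have K2: "2 * K3 / K\<^sup>2 \<le> \<eta>" using \<eta> K by (simp add: field_simps)
    have "\<forall>\<^sub>F n in sequentially. K \<le> r0 * sqrt (real n)"
    proof -
      have "filterlim (\<lambda>n. r0 * sqrt (real n)) at_top sequentially"
        using pos by (intro filterlim_tendsto_pos_mult_at_top[OF tendsto_const] filterlim_compose[OF sqrt_at_top] filterlim_real_sequentially)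
      then show ?thesis by (simp add: filterlim_at_top)
    qed
    then have "\<forall>\<^sub>F n in sequentially.
      hp M (\<F> {1..n}) \<eta> (\<lambda>\<xi>. \<forall>u. K \<le> norm u \<longrightarrow> norm u \<le> D * sqrt (real n) \<longrightarrow> \<kappa> * (norm u)\<^sup>2 \<le> H n u \<xi>)"
      using eventually_ge_at_top[of 1]
    proof eventually_elim
      case (elim n)
      have sub: "subalgebra M (\<F> {1..n})" by (rule subalgebra_F) auto
      define A where "A = {j::nat. 2 ^ j * K \<le> r0 * sqrt (real n)}"
      have A: "finite A"
      proof -
        obtain m :: nat where m: "r0 * sqrt (real n) < real m" using reals_Archimedean2 by blast
        have "j \<le> m" if "j \<in> A" for j
        proof -
          have "real j \<le> 2 ^ j" by (metis less_imp_le of_nat_less_two_power)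
          also have "\<dots> \<le> 2 ^ j * K" using K by (simp add: mult_le_cancel_left1)
          also have "\<dots> \<le> r0 * sqrt (real n)" using that by (simp add: A_def)
          finally show ?thesis using m by linarith
        qed
        then show ?thesis by (meson finite_nat_set_iff_bounded_le)
      qed
      have "hp M (\<F> {1..n}) (\<Sum>j\<in>A. K3 / (2 ^ j * K)\<^sup>2) (\<lambda>\<xi>. \<forall>j\<in>A. \<forall>u. norm u = 2 ^ j * K \<longrightarrow> \<epsilon> * lam / 4 * (2 ^ j * K)\<^sup>2 \<le> H n u \<xi>)"
        using elim(2) K by (intro hp_ball[OF sub A] K3(2)) (auto simp: A_def)
      moreover have "(\<Sum>j\<in>A. K3 / (2 ^ j * K)\<^sup>2) \<le> \<eta>"
      proof -
        have "K3 / (2 ^ j * K)\<^sup>2 = K3 / K\<^sup>2 * (1 / 4) ^ j" for j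
          by (simp add: power_mult_distrib power_divide power_mult[symmetric] mult.commute[of j 2] power_mult)
        then have "(\<Sum>j\<in>A. K3 / (2 ^ j * K)\<^sup>2) = K3 / K\<^sup>2 * (\<Sum>j\<in>A. (1 / 4) ^ j)"
          by (simp add: sum_distrib_left)
        also have "\<dots> \<le> K3 / K\<^sup>2 * 2" using K3 by (intro mult_left_mono geometric_quarter_sum A) auto
        finally show ?thesis using K2 by (simp add: mult.commute)
      qed
      ultimately show ?case
      proof (rule hp_mono)
        fix \<xi> assume \<xi>: "\<forall>j\<in>A. \<forall>u. norm u = 2 ^ j * K \<longrightarrow> \<epsilon> * lam / 4 * (2 ^ j * K)\<^sup>2 \<le> H n u \<xi>"
        show "\<forall>u. K \<le> norm u \<longrightarrow> norm u \<le> D * sqrt (real n) \<longrightarrow> \<kappa> * (norm u)\<^sup>2 \<le> H n u \<xi>"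
        proof (intro allI impI)
          fix u :: "real ^ 'd" assume u: "K \<le> norm u" "norm u \<le> D * sqrt (real n)"
          define t where "t = min (norm u) (r0 * sqrt (real n))"
          have "K \<le> t" using u elim by (simp add: t_def)
          then obtain j where j: "2 ^ j * K \<le> t" "t < 2 ^ Suc j * K" using dyadic_scale[of K t] K by auto
          define s where "s = 2 ^ j * K"
          have s: "0 < s" "s \<le> norm u" "t \<le> 2 * s" using K j by (auto simp: s_def t_def)
          have "j \<in> A" using j by (auto simp: A_def t_def)
          define v where "v = (s / norm u) *\<^sub>R u"
          have nu: "0 < norm u" using s by linarith
          then have "norm v = s" using s by (simp add: v_def)
          then have 1: "c1 / 4 * s\<^sup>2 \<le> H n v \<xi>" using \<xi> \<open>j \<in> A\<close> by (auto simp: c1_def s_def)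
          have "H n v \<xi> \<le> (s / norm u) * H n u \<xi>"
            unfolding v_def using s nu by (intro H_scale) auto
          then have "c1 / 4 * s\<^sup>2 \<le> (s / norm u) * H n u \<xi>" using 1 by linarith
          then have "s * (c1 / 4 * s * norm u) \<le> s * H n u \<xi>"
            using nu by (simp add: field_simps power2_eq_square)
          then have 2: "c1 / 4 * s * norm u \<le> H n u \<xi>" using s by simp
          have "min 1 (r0 / D) * norm u \<le> t"
          proof -
            have "r0 / D * norm u \<le> r0 / D * (D * sqrt (real n))" using u(2) pos D by (intro mult_left_mono) auto
            then have "r0 / D * norm u \<le> r0 * sqrt (real n)" using D by simp
            moreover have "min 1 (r0 / D) * norm u \<le> 1 * norm u" "min 1 (r0 / D) * norm u \<le> r0 / D * norm u"
              by (intro mult_right_mono; simp)+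
            ultimately show ?thesis by (simp add: t_def)
          qed
          then have "min 1 (r0 / D) * norm u \<le> 2 * s" using s(3) by linarith
          then have "c1 / 8 * norm u * (min 1 (r0 / D) * norm u) \<le> c1 / 8 * norm u * (2 * s)"
            using c1 by (intro mult_left_mono) auto
          then have "\<kappa> * (norm u)\<^sup>2 \<le> c1 / 4 * s * norm u"
            by (simp add: \<kappa>_def power2_eq_square algebra_simps)
          with 2 show "\<kappa> * (norm u)\<^sup>2 \<le> H n u \<xi>" by linarith
        qed
      qed simp
    qed
    then show ?thesis using K by (intro exI[of _ K]) auto
  qed
  ultimately show ?thesis using that by blast
qed

section \<open>Uniform quadratic approximation on balls\<close>

lemma tB_sq_le_band:
  "(tB n u i k (y, x))\<^sup>2 \<le> (norm u)\<^sup>2 / real n * ((norm x)\<^sup>2 * of_bool (\<bar>y - x \<bullet> \<beta>0\<bar> \<le> norm u / sqrt (real n) * norm x))"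
proof (cases "tB n u i k (y, x) = 0")
  case False
  then have "bump (y - x \<bullet> \<beta>0) (x \<bullet> u / sqrt (real n)) \<noteq> 0" by (simp add: tB_def)
  then have "\<bar>y - x \<bullet> \<beta>0\<bar> \<le> \<bar>x \<bullet> u / sqrt (real n)\<bar>" by (rule bump_pos_imp_between(2))
  then have "\<bar>y - x \<bullet> \<beta>0\<bar> \<le> norm u / sqrt (real n) * norm x"
    by (rule order_trans[OF _ inner_scaled_le])
  moreover have "(tB n u i k (y, x))\<^sup>2 \<le> (norm u / sqrt (real n) * norm x)\<^sup>2"
    using power_mono[OF tB_dom abs_ge_zero, of n u i k y x 2] by simp
  ultimately show ?thesis by (simp add: power_mult_distrib power_divide)
qed simp

text \<open>For fixed \<open>u\<close> this sharpens \<open>H_hp\<close>: the bump is supported on a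
  band whose width shrinks like \<open>1 / sqrt n\<close>, so the variance tends to zero, at a rate
  set by \<open>p - 2\<close>.\<close>

lemma H_hp_small:
  assumes n: "n \<ge> 1" and a: "0 < a"
  shows "hp M (\<F> {1..n}) ((real cmax)\<^sup>2 * ((norm u)\<^sup>2 * (C * (norm u / sqrt (real n)) powr (p - 2))) / a\<^sup>2) (\<lambda>\<xi>. \<bar>H n u \<xi> - EH n u\<bar> < a)"
proof -
  let ?v = "(norm u)\<^sup>2 / real n * (C * (norm u / sqrt (real n)) powr (p - 2))"
  have "hp M (\<F> {1..n}) (real n * ((real cmax)\<^sup>2 * ?v) / a\<^sup>2) (\<lambda>\<xi>. \<bar>H n u \<xi> - EH n u\<bar> < a)"
    unfolding H_def EH_def
  proof (rule csum_sum_hp)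
    fix i k assume ik: "i \<in> {1..n}" "k \<in> {1..c i}"
    then have i: "i \<ge> 1" by simp
    note [measurable] = rv[OF i ik(2)]
    show int: "integrable M (\<lambda>\<xi>. (tB n u i k (Y i k \<xi>, X i k \<xi>))\<^sup>2)"
      using ik by (intro dominated[OF _ _ tB_meas tB_dom]) auto
    have i2: "integrable M (\<lambda>\<xi>. (norm (X i k \<xi>))\<^sup>2 * of_bool (\<bar>Y i k \<xi> - X i k \<xi> \<bullet> \<beta>0\<bar> \<le> norm u / sqrt (real n) * norm (X i k \<xi>)))"
      by (rule Bochner_Integration.integrable_bound[OF sq_le_mom(1)[OF i ik(2)]]) (auto simp: of_bool_def)
    have "expectation (\<lambda>\<xi>. (tB n u i k (Y i k \<xi>, X i k \<xi>))\<^sup>2) \<le> expectation (\<lambda>\<xi>. (norm u)\<^sup>2 / real n * ((norm (X i k \<xi>))\<^sup>2 * of_bool (\<bar>Y i k \<xi> - X i k \<xi> \<bullet> \<beta>0\<bar> \<le> norm u / sqrt (real n) * norm (X i k \<xi>))))"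
      using int i2 tB_sq_le_band by (intro integral_mono) auto
    also have "\<dots> \<le> ?v"
      using band(2)[OF i ik(2), of "norm u / sqrt (real n)" \<beta>0] by (simp add: divide_right_mono mult_left_mono)
    finally show "expectation (\<lambda>\<xi>. (tB n u i k (Y i k \<xi>, X i k \<xi>))\<^sup>2) \<le> ?v" .
  qed (use C0 a in \<open>auto simp: tB_meas\<close>)
  then show ?thesis using n by (simp add: algebra_simps)
qed

text \<open>The error per observation is of order \<open>n powr (- p / 2)\<close>, and the sum over
  \<open>n\<close> clusters vanishes because \<open>p > 2\<close>.\<close>

lemma EH_tendsto: "(\<lambda>n. EH n u) \<longlonglongrightarrow> (u \<bullet> (J *v u)) / 2"
proof -
  let ?q = "\<lambda>n. (1 / real n) * (\<Sum>i=1..n. \<Sum>k=1..c i. q i k u)"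
  have "(\<lambda>n. EH n u - ?q n / 2) \<longlonglongrightarrow> 0"
  proof (rule Lim_null_comparison)
    show "\<forall>\<^sub>F n in sequentially. norm (EH n u - ?q n / 2) \<le> real cmax * C * norm u powr p * real n powr (1 - p / 2)"
      using eventually_ge_at_top[of 1]
    proof eventually_elim
      case (elim n)
      let ?v = "u /\<^sub>R sqrt (real n)"
      have qv: "q i k ?v = (1 / real n) * q i k u" for i k
        unfolding q_scale using elim by (simp add: power_inverse divide_inverse)
      have nv: "norm ?v powr p = norm u powr p * real n powr (- (p / 2))"
      proof -
        have e: "norm ?v = norm u * real n powr (- (1 / 2))"
          using elim by (simp add: powr_minus powr_half_sqrt mult.commute)
        show ?thesis unfolding e by (simp add: powr_mult powr_powr)
      qed
      have "EH n u - ?q n / 2 = (\<Sum>i=1..n. \<Sum>k=1..c i. expectation (\<lambda>\<xi>. bump (Y i k \<xi> - X i k \<xi> \<bullet> \<beta>0) (X i k \<xi> \<bullet> ?v)) - q i k ?v / 2)"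
        unfolding EH_def tB_def scaled_inner qv fst_conv snd_conv sum_subtractf
        by (simp only: sum_distrib_left sum_divide_distrib)
      then have "\<bar>EH n u - ?q n / 2\<bar> = \<bar>\<Sum>i=1..n. \<Sum>k=1..c i. expectation (\<lambda>\<xi>. bump (Y i k \<xi> - X i k \<xi> \<bullet> \<beta>0) (X i k \<xi> \<bullet> ?v)) - q i k ?v / 2\<bar>"
        by (rule arg_cong)
      also have "\<dots> \<le> (\<Sum>i=1..n. \<Sum>k=1..c i. \<bar>expectation (\<lambda>\<xi>. bump (Y i k \<xi> - X i k \<xi> \<bullet> \<beta>0) (X i k \<xi> \<bullet> ?v)) - q i k ?v / 2\<bar>)"
        by (rule order_trans[OF sum_abs], rule sum_mono, rule sum_abs)
      also have "\<dots> \<le> real n * (real cmax * (C * norm ?v powr p))"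
        using C0 by (intro double_sum_le bump_approx) auto
      also have "\<dots> = real cmax * C * norm u powr p * (real n * real n powr (- (p / 2)))"
        unfolding nv by (simp add: ac_simps)
      also have "real n * real n powr (- (p / 2)) = real n powr (1 - p / 2)"
        using elim powr_add[of "real n" 1 "- (p / 2)"] by simp
      finally show ?case by simp
    qed
    have "(\<lambda>n. real n powr (1 - p / 2)) \<longlonglongrightarrow> 0"
      using p by (intro tendsto_neg_powr filterlim_real_sequentially) auto
    then show "(\<lambda>n. real cmax * C * norm u powr p * real n powr (1 - p / 2)) \<longlonglongrightarrow> 0"
      by (rule tendsto_mult_right_zero)
  qed
  moreover have "(\<lambda>n. ?q n / 2) \<longlonglongrightarrow> (u \<bullet> (J *v u)) / 2"
    by (intro tendsto_divide J_lim) auto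
  ultimately show ?thesis using tendsto_add by fastforce
qed

text \<open>Pointwise convergence on a finite net becomes uniform because both sides are Lipschitz
  on the ball, \<open>H\<close> with the random constant \<open>T n K\<close>, which is bounded with
  high probability.\<close>

lemma quadratic_approx:
  assumes K: "0 < K" and \<eta>: "0 < \<eta>" and \<zeta>: "0 < \<zeta>"
  shows "\<forall>\<^sub>F n in sequentially. hp M (\<F> {1..n}) \<zeta> (\<lambda>\<xi>. \<forall>u. norm u \<le> K \<longrightarrow> \<bar>H n u \<xi> - (u \<bullet> (J *v u)) / 2\<bar> \<le> \<eta>)"
proof -
  obtain L where L: "0 < L" "\<And>x. norm (J *v x) \<le> L * norm x"
    using bounded_linear.pos_bounded[OF matrix_vector_mul_bounded_linear[of J]] by (auto simp: mult.commute)
  define a where "a = 1 + sqrt (2 * ((real cmax)\<^sup>2 * (2 * C)) / \<zeta>)"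
  have a: "1 \<le> a" using C0 \<zeta> by (simp add: a_def)
  have "2 * ((real cmax)\<^sup>2 * (2 * C)) / \<zeta> = (sqrt (2 * ((real cmax)\<^sup>2 * (2 * C)) / \<zeta>))\<^sup>2" using C0 \<zeta> by simp
  also have "\<dots> \<le> a\<^sup>2" using C0 \<zeta> by (intro power_mono) (auto simp: a_def)
  finally have a2: "(real cmax)\<^sup>2 * (2 * C) / a\<^sup>2 \<le> \<zeta> / 2" using \<zeta> a by (simp add: field_simps)
  \<comment> \<open>\<open>b\<close> bounds the Lipschitz constant of \<open>H\<close> and the norm
    of \<open>J *v w\<close> on the ball. With mesh \<open>\<eta> / (4 * b)\<close>, the two
    Lipschitz errors, the deviation from the mean and the error of the mean contribute
    \<open>\<eta> / 4\<close> each.\<close>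
  define b where "b = real cmax * C * K + a + K * L"
  have "0 \<le> real cmax * C * K" "0 \<le> K * L" using C0 K L by auto
  then have b: "1 \<le> b" "real cmax * C * K + a \<le> b" "K * L \<le> b" using a unfolding b_def by linarith+
  define \<delta> where "\<delta> = \<eta> / (4 * b)"
  have \<delta>: "0 < \<delta>" "\<delta> * b = \<eta> / 4" using \<eta> b by (auto simp: \<delta>_def)
  obtain N :: "(real ^ 'd) set" where N: "finite N" "N \<subseteq> cball 0 K" "\<And>u. norm u \<le> K \<Longrightarrow> \<exists>f\<in>N. norm (u - f) \<le> \<delta>"
    using finite_net_ball[OF \<delta>(1), of K] K by auto
  define v where "v = (\<lambda>n (f :: real ^ 'd). (real cmax)\<^sup>2 * ((norm f)\<^sup>2 * (C * (norm f / sqrt (real n)) powr (p - 2))) / (\<eta> / 4)\<^sup>2)"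
  have "(\<lambda>n. \<Sum>f\<in>N. v n f) \<longlonglongrightarrow> (\<Sum>f\<in>N. (real cmax)\<^sup>2 * ((norm f)\<^sup>2 * (C * 0)) / (\<eta> / 4)\<^sup>2)"
    unfolding v_def
  proof (intro tendsto_intros)
    fix f :: "real ^ 'd"
    have "(\<lambda>n. norm f / sqrt (real n)) \<longlonglongrightarrow> 0"
      by (rule real_tendsto_divide_at_top[OF tendsto_const])
        (intro filterlim_compose[OF sqrt_at_top] filterlim_real_sequentially)
    then show "(\<lambda>n. (norm f / sqrt (real n)) powr (p - 2)) \<longlonglongrightarrow> 0"
      by (rule tendsto_zero_powrI) (use p in auto)
  qed (use \<eta> in auto)
  then have "\<forall>\<^sub>F n in sequentially. (\<Sum>f\<in>N. v n f) < \<zeta> / 2" using \<zeta> by (intro order_tendstoD(2)) auto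
  moreover have "\<forall>\<^sub>F n in sequentially. \<forall>f\<in>N. \<bar>EH n f - (f \<bullet> (J *v f)) / 2\<bar> < \<eta> / 4"
  proof (rule eventually_ball_finite[OF N(1)], rule ballI)
    fix f
    show "\<forall>\<^sub>F n in sequentially. \<bar>EH n f - (f \<bullet> (J *v f)) / 2\<bar> < \<eta> / 4"
      using tendstoD[OF EH_tendsto[of f], of "\<eta> / 4"] \<eta> by (simp add: dist_real_def)
  qed
  ultimately show ?thesis using eventually_ge_at_top[of 1]
  proof eventually_elim
    case (elim n)
    have sub: "subalgebra M (\<F> {1..n})" by (rule subalgebra_F) auto
    have n: "n \<ge> 1" using elim by simp
    have "hp M (\<F> {1..n}) (\<zeta> / 2) (\<lambda>\<xi>. T n K \<xi> < real cmax * C * K + a)"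
      by (rule hp_mono[OF T_hp[OF n, of K a]]) (use a K a2 in auto)
    moreover have "hp M (\<F> {1..n}) (\<Sum>f\<in>N. v n f) (\<lambda>\<xi>. \<forall>f\<in>N. \<bar>H n f \<xi> - EH n f\<bar> < \<eta> / 4)"
      unfolding v_def using \<eta> by (intro hp_ball[OF sub N(1)] H_hp_small n) auto
    ultimately have "hp M (\<F> {1..n}) (\<zeta> / 2 + (\<Sum>f\<in>N. v n f)) (\<lambda>\<xi>. T n K \<xi> < real cmax * C * K + a \<and> (\<forall>f\<in>N. \<bar>H n f \<xi> - EH n f\<bar> < \<eta> / 4))"
      by (rule hp_conj[OF sub])
    then show ?case
    proof (rule hp_mono)
      show "\<zeta> / 2 + (\<Sum>f\<in>N. v n f) \<le> \<zeta>" using elim by linarith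
      fix \<xi> assume \<xi>: "T n K \<xi> < real cmax * C * K + a \<and> (\<forall>f\<in>N. \<bar>H n f \<xi> - EH n f\<bar> < \<eta> / 4)"
      show "\<forall>u. norm u \<le> K \<longrightarrow> \<bar>H n u \<xi> - (u \<bullet> (J *v u)) / 2\<bar> \<le> \<eta>"
      proof (intro allI impI)
        fix u :: "real ^ 'd" assume u: "norm u \<le> K"
        obtain f where f: "f \<in> N" "norm (u - f) \<le> \<delta>" using N(3)[OF u] by blast
        have f1: "norm f \<le> K" using N f by auto
        have "\<bar>H n u \<xi> - H n f \<xi>\<bar> \<le> norm (u - f) * T n K \<xi>" using u f1 by (rule H_lipschitz)
        also have "\<dots> \<le> norm (u - f) * b" using \<xi> b by (intro mult_left_mono) auto
        also have "\<dots> \<le> \<delta> * b" using f b by (intro mult_right_mono) auto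
        finally have 1: "\<bar>H n u \<xi> - H n f \<xi>\<bar> \<le> \<eta> / 4" using \<delta> by simp
        have eqd: "u \<bullet> (J *v u) - f \<bullet> (J *v f) = (u - f) \<bullet> (J *v u) + (u - f) \<bullet> (J *v f)"
          using symmetric_adjoint[OF J_sym, of f u] inner_commute[of u "J *v f"] by (simp add: inner_diff_left)
        have *: "\<bar>(u - f) \<bullet> (J *v w)\<bar> \<le> \<delta> * b" if "norm w \<le> K" for w
        proof -
          have "norm (J *v w) \<le> K * L"
            using order_trans[OF L(2)[of w] mult_left_mono[OF that, of L]] L(1) by (simp add: mult.commute)
          then have "norm (J *v w) \<le> b" using b(3) by simp
          then have "norm (u - f) * norm (J *v w) \<le> \<delta> * b" using f \<delta> by (intro mult_mono) auto
          then show ?thesis using Cauchy_Schwarz_ineq2[of "u - f" "J *v w"] by linarith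
        qed
        have "\<bar>u \<bullet> (J *v u) - f \<bullet> (J *v f)\<bar> \<le> \<eta> / 4 + \<eta> / 4"
          using *[OF u] *[OF f1] unfolding eqd \<delta>(2) by linarith
        moreover have "\<bar>H n f \<xi> - EH n f\<bar> < \<eta> / 4" "\<bar>EH n f - (f \<bullet> (J *v f)) / 2\<bar> < \<eta> / 4" using \<xi> elim f by auto
        ultimately show "\<bar>H n u \<xi> - (u \<bullet> (J *v u)) / 2\<bar> \<le> \<eta>" using 1 by linarith
      qed
    qed simp
  qed
qed

end

section \<open>Approximate minimisers\<close>

text \<open>Completing the square: the quadratic objective at \<open>u1\<close> exceeds its minimum
  at \<open>u0\<close> by half the form of \<open>u1 - u0\<close>. Replacing \<open>h\<close> by its
  approximation costs \<open>\<eta>\<close> at each of the two points.\<close>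

lemma argmin_quadratic:
  fixes J :: "real ^ 'd ^ 'd"
  assumes J: "transpose J = J" "\<And>u. lam * (norm u)\<^sup>2 \<le> u \<bullet> (J *v u)" and u0: "J *v u0 = g"
    and h: "\<bar>h u1 - (u1 \<bullet> (J *v u1)) / 2\<bar> \<le> \<eta>" "\<bar>h u0 - (u0 \<bullet> (J *v u0)) / 2\<bar> \<le> \<eta>"
    and min: "h u1 - g \<bullet> u1 \<le> h u0 - g \<bullet> u0"
  shows "lam * (norm (u1 - u0))\<^sup>2 \<le> 4 * \<eta>"
proof -
  have "(u1 - u0) \<bullet> (J *v (u1 - u0)) = u1 \<bullet> (J *v u1) - 2 * (g \<bullet> u1) + g \<bullet> u0"
    using symmetric_adjoint[OF J(1), of u0 u1] u0
    by (simp add: matrix_vector_mult_diff_distrib inner_diff_left inner_diff_right inner_commute)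
  moreover have "u0 \<bullet> (J *v u0) = g \<bullet> u0" using u0 by (simp add: inner_commute)
  ultimately have "(u1 - u0) \<bullet> (J *v (u1 - u0)) \<le> 4 * \<eta>" using h min unfolding abs_le_iff by linarith
  with J(2)[of "u1 - u0"] show ?thesis by linarith
qed

lemma norm_add_sq_le:
  fixes a b :: "'a::real_normed_vector"
  shows "(norm (a + b))\<^sup>2 \<le> 2 * (norm a)\<^sup>2 + 2 * (norm b)\<^sup>2"
proof -
  have "(norm (a + b))\<^sup>2 \<le> (norm a + norm b)\<^sup>2" by (intro power_mono norm_triangle_ineq) auto
  also have "\<dots> \<le> 2 * (norm a)\<^sup>2 + 2 * (norm b)\<^sup>2"
    using sum_squares_bound[of "norm a" "norm b"] by (simp add: power2_sum)
  finally show ?thesis .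
qed

text \<open>To do as well as the value 0 at the origin, \<open>u\<close> must satisfy
  \<open>\<kappa> * (norm u)\<^sup>2 \<le> norm g * norm u\<close>, unless it lies in the ball where
  no growth is assumed.\<close>

lemma coercive_argmin_bound:
  fixes g :: "real ^ 'd"
  assumes \<kappa>: "0 < \<kappa>" and growth: "K \<le> norm u \<longrightarrow> \<kappa> * (norm u)\<^sup>2 \<le> h u" and K: "0 \<le> K"
    and min: "h u - g \<bullet> u \<le> 0"
  shows "norm u \<le> K + norm g / \<kappa>"
proof (cases "K \<le> norm u")
  case True
  then have "\<kappa> * (norm u)\<^sup>2 \<le> norm g * norm u"
    using growth min norm_cauchy_schwarz[of g u] by linarith
  then have "norm u * (\<kappa> * norm u) \<le> norm u * norm g" by (simp add: power2_eq_square algebra_simps)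
  then have "norm u = 0 \<or> \<kappa> * norm u \<le> norm g" by (auto simp: mult_le_cancel_left)
  then have "norm u \<le> norm g / \<kappa>" using \<kappa> by (auto simp: field_simps)
  then show ?thesis using K by simp
next
  case False
  moreover have "0 \<le> norm g / \<kappa>" using \<kappa> by simp
  ultimately show ?thesis by linarith
qed

text \<open>The deterministic core, at one sample point: \<open>h\<close> stands for
  \<open>H n\<close>, \<open>g\<close> for the score, \<open>w\<close> for the wild gradient. The
  radius \<open>K'\<close> contains both minimisers and their linear approximations as long as
  \<open>norm w \<le> w0\<close>; for larger \<open>w\<close> only the growth condition is
  available.\<close>

locale perturbed_argmin =
  fixes J :: "real ^ 'd ^ 'd" and lam :: real and h :: "real ^ 'd \<Rightarrow> real" and S :: "(real ^ 'd) set"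
    and g w uh us :: "real ^ 'd" and \<kappa> K K' \<eta> g0 w0 :: real
  assumes J: "transpose J = J" "\<And>u. lam * (norm u)\<^sup>2 \<le> u \<bullet> (J *v u)" "0 < lam"
    and h0: "h 0 = 0" and S: "cball 0 K' \<subseteq> S"
    and growth: "\<And>u. u \<in> S \<Longrightarrow> K \<le> norm u \<Longrightarrow> \<kappa> * (norm u)\<^sup>2 \<le> h u"
    and quad: "\<And>u. norm u \<le> K' \<Longrightarrow> \<bar>h u - (u \<bullet> (J *v u)) / 2\<bar> \<le> \<eta>"
    and pos: "0 < \<kappa>" "0 \<le> K" "0 \<le> w0"
    and g: "norm g \<le> g0" and K': "K + (g0 + w0) / \<kappa> \<le> K'" "(g0 + w0) / lam \<le> K'"
    and uh: "uh \<in> S" "\<And>u. u \<in> S \<Longrightarrow> h uh - g \<bullet> uh \<le> h u - g \<bullet> u"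
    and us: "us \<in> S" "\<And>u. u \<in> S \<Longrightarrow> h us - (g - w) \<bullet> us \<le> h u - (g - w) \<bullet> u"
begin

lemma g0: "0 \<le> g0" using g norm_ge_zero[of g] by linarith

lemma zero_in: "0 \<in> S"
proof -
  have "0 \<le> (g0 + w0) / lam" using g0 pos J(3) by simp
  then show ?thesis using S K'(2) by auto
qed

lemma uh_bound: "norm uh \<le> K + g0 / \<kappa>"
proof -
  have "norm uh \<le> K + norm g / \<kappa>"
    using growth[OF uh(1)] uh(2)[OF zero_in] h0 pos by (intro coercive_argmin_bound[where h = h]) auto
  also have "\<dots> \<le> K + g0 / \<kappa>" using g pos by (simp add: divide_right_mono)
  finally show ?thesis .
qed

lemma us_bound: "norm us \<le> K + (g0 + norm w) / \<kappa>"
proof -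
  have "norm us \<le> K + norm (g - w) / \<kappa>"
    using growth[OF us(1)] us(2)[OF zero_in] h0 pos by (intro coercive_argmin_bound[where h = h]) auto
  also have "\<dots> \<le> K + (g0 + norm w) / \<kappa>"
    using g pos norm_triangle_ineq4[of g w] by (simp add: divide_right_mono)
  finally show ?thesis .
qed

lemma inv_bound: "J *v x = y \<Longrightarrow> norm x \<le> norm y / lam"
  by (rule coercive_inv_norm[OF J(3) J(2)])

lemma J_inv: "J *v (matrix_inv J *v x) = x"
proof (rule matrix_inv_vec(1), rule pos_def_invertible)
  fix x :: "real ^ 'd" assume "x \<noteq> 0"
  then have "0 < lam * (norm x)\<^sup>2" using J(3) by simp
  then show "0 < x \<bullet> (J *v x)" using J(2)[of x] by linarith
qed

lemma uh_linear: "lam * (norm (uh - matrix_inv J *v g))\<^sup>2 \<le> 4 * \<eta>"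
proof -
  let ?u0 = "matrix_inv J *v g"
  have "norm ?u0 \<le> norm g / lam" by (rule inv_bound[OF J_inv])
  also have "\<dots> \<le> (g0 + w0) / lam" using g pos J(3) by (intro divide_right_mono) auto
  finally have u0: "norm ?u0 \<le> K'" using K'(2) by simp
  have "g0 / \<kappa> \<le> (g0 + w0) / \<kappa>" using pos by (intro divide_right_mono) auto
  then have "norm uh \<le> K'" using uh_bound K'(1) by linarith
  then show ?thesis
    using u0 S uh(2)[of ?u0] by (intro argmin_quadratic[OF J(1,2) J_inv, where h = h] quad) auto
qed

lemma us_linear:
  assumes w: "norm w \<le> w0"
  shows "lam * (norm (us - matrix_inv J *v (g - w)))\<^sup>2 \<le> 4 * \<eta>"
proof -
  let ?u0 = "matrix_inv J *v (g - w)"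
  have "norm ?u0 \<le> norm (g - w) / lam" by (rule inv_bound[OF J_inv])
  also have "\<dots> \<le> (g0 + w0) / lam"
    using g w norm_triangle_ineq4[of g w] J(3) by (intro divide_right_mono) auto
  finally have u0: "norm ?u0 \<le> K'" using K'(2) by simp
  have "(g0 + norm w) / \<kappa> \<le> (g0 + w0) / \<kappa>" using pos w by (intro divide_right_mono) auto
  then have "norm us \<le> K'" using us_bound K'(1) by linarith
  then show ?thesis
    using u0 S us(2)[of ?u0] by (intro argmin_quadratic[OF J(1,2) J_inv, where h = h] quad) auto
qed

lemma difference_small:
  assumes w: "norm w \<le> w0"
  shows "(norm (us - uh + matrix_inv J *v w))\<^sup>2 \<le> 16 * \<eta> / lam"
proof -
  have e: "us - uh + matrix_inv J *v w = (us - matrix_inv J *v (g - w)) + (matrix_inv J *v g - uh)"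
    by (simp add: matrix_vector_mult_diff_distrib)
  have "(norm (us - uh + matrix_inv J *v w))\<^sup>2 \<le> 2 * (norm (us - matrix_inv J *v (g - w)))\<^sup>2 + 2 * (norm (uh - matrix_inv J *v g))\<^sup>2"
    unfolding e using norm_add_sq_le[of "us - matrix_inv J *v (g - w)" "matrix_inv J *v g - uh"]
    by (simp only: norm_minus_commute[of uh])
  also have "\<dots> \<le> 2 * (4 * \<eta> / lam) + 2 * (4 * \<eta> / lam)"
    using uh_linear us_linear[OF w] J(3) by (intro add_mono mult_left_mono) (auto simp: field_simps)
  finally show ?thesis by simp
qed

text \<open>No restriction on the size of \<open>w\<close>. Growth that is at most linear in
  \<open>norm w\<close> is what makes the squared error controllable by tails of the squared
  gradient.\<close>

lemma difference_bound:
  "norm (us - uh + matrix_inv J *v w) \<le> (2 * K + 2 * g0 / \<kappa>) + (1 / \<kappa> + 1 / lam) * norm w"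
proof -
  have "norm (us - uh + matrix_inv J *v w) \<le> norm us + norm uh + norm (matrix_inv J *v w)"
    using norm_triangle_ineq[of "us - uh" "matrix_inv J *v w"] norm_triangle_ineq4[of us uh] by linarith
  also have "\<dots> \<le> (K + (g0 + norm w) / \<kappa>) + (K + g0 / \<kappa>) + norm w / lam"
    by (intro add_mono us_bound uh_bound inv_bound J_inv)
  finally show ?thesis by (simp add: add_divide_distrib algebra_simps)
qed

end

section \<open>Scores and bootstrap gradients\<close>

context qr_core
begin

definition sc :: "real ^ 'd \<Rightarrow> nat \<Rightarrow> nat \<Rightarrow> real \<times> (real ^ 'd) \<Rightarrow> real" where
  "sc a = (\<lambda>i k z. psi \<tau> (fst z - snd z \<bullet> \<beta>0) * (snd z \<bullet> a))"

definition G :: "nat \<Rightarrow> 'a \<Rightarrow> real ^ 'd" where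
  "G n \<xi> = (1 / sqrt (real n)) *\<^sub>R (\<Sum>i=1..n. \<Sum>k=1..c i. psi \<tau> (Y i k \<xi> - X i k \<xi> \<bullet> \<beta>0) *\<^sub>R X i k \<xi>)"

definition V :: "nat \<Rightarrow> real ^ 'd \<Rightarrow> 'a \<Rightarrow> real ^ 'd" where
  "V n b \<xi> = wild_gradient c (\<lambda>i. W i \<xi>) (\<lambda>i k. Y i k \<xi>) (\<lambda>i k. X i k \<xi>) n \<tau> b"

lemma sc_meas: "sc a i k \<in> borel_measurable borel"
  unfolding sc_def by measurable

lemma sc_dom: "\<bar>sc a i k (y, x)\<bar> \<le> norm a * norm x"
proof -
  have "\<bar>sc a i k (y, x)\<bar> \<le> 1 * \<bar>x \<bullet> a\<bar>"
    unfolding sc_def fst_conv snd_conv abs_mult using tau by (intro mult_right_mono abs_psi_le_1) auto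
  also have "\<dots> \<le> norm a * norm x" using Cauchy_Schwarz_ineq2[of x a] by (simp add: mult.commute)
  finally show ?thesis .
qed

lemma inner_G: "G n \<xi> \<bullet> a = (1 / sqrt (real n)) * (\<Sum>i=1..n. csum (sc a) i \<xi>)"
  by (simp add: G_def csum_def sc_def inner_sum_left)

lemma inner_V: "V n \<beta>0 \<xi> \<bullet> a = (1 / sqrt (real n)) * (\<Sum>i=1..n. W i \<xi> * csum (sc a) i \<xi>)"
  by (simp add: V_def wild_gradient_def csum_def sc_def inner_sum_left)

lemma objective_expansion:
  assumes "n \<ge> 1"
  shows "real n * qr_objective c (\<lambda>i k. Y i k \<xi>) (\<lambda>i k. X i k \<xi>) n \<tau> (\<beta>0 + u /\<^sub>R sqrt (real n))
    = real n * qr_objective c (\<lambda>i k. Y i k \<xi>) (\<lambda>i k. X i k \<xi>) n \<tau> \<beta>0 - G n \<xi> \<bullet> u + H n u \<xi>"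
proof -
  have "rho \<tau> (Y i k \<xi> - X i k \<xi> \<bullet> (\<beta>0 + u /\<^sub>R sqrt (real n)))
    = rho \<tau> (Y i k \<xi> - X i k \<xi> \<bullet> \<beta>0) - (1 / sqrt (real n)) * sc u i k (Y i k \<xi>, X i k \<xi>) + tB n u i k (Y i k \<xi>, X i k \<xi>)" for i k
    using rho_bump[of \<tau> "Y i k \<xi> - X i k \<xi> \<bullet> \<beta>0" "X i k \<xi> \<bullet> u / sqrt (real n)"]
    by (simp add: sc_def tB_def inner_add_right divide_inverse algebra_simps)
  then show ?thesis
    using assms unfolding qr_objective_def inner_G H_def csum_def
    by (simp add: sum.distrib sum_subtractf sum_distrib_left)
qed

lemma sc_int:
  assumes "i \<in> {1..n}" "k \<in> {1..c i}"
  shows "integrable M (\<lambda>\<xi>. (sc a i k (Y i k \<xi>, X i k \<xi>))\<^sup>2)"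
    "expectation (\<lambda>\<xi>. (sc a i k (Y i k \<xi>, X i k \<xi>))\<^sup>2) \<le> (norm a)\<^sup>2 * (2 * C)"
  using assms by (intro dominated[OF _ _ sc_meas sc_dom]; simp)+

lemma sc_mean: "i \<ge> 1 \<Longrightarrow> k \<in> {1..c i} \<Longrightarrow> expectation (\<lambda>\<xi>. sc a i k (Y i k \<xi>, X i k \<xi>)) = 0"
  unfolding sc_def using psi_mean by simp

lemma G_tight:
  assumes \<zeta>: "0 < \<zeta>"
  obtains g where "0 < g" "\<And>n. n \<ge> 1 \<Longrightarrow> hp M (\<F> {1..n}) \<zeta> (\<lambda>\<xi>. norm (G n \<xi>) \<le> g)"
proof -
  let ?d = "real CARD('d)"
  define v where "v = ?d * ((real cmax)\<^sup>2 * (2 * C))"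
  have v: "0 \<le> v" using C0 by (simp add: v_def)
  define a where "a = 1 + sqrt (v / \<zeta>)"
  have a: "1 \<le> a" using v \<zeta> by (simp add: a_def)
  have "v / \<zeta> = (sqrt (v / \<zeta>))\<^sup>2" using v \<zeta> by simp
  also have "\<dots> \<le> a\<^sup>2" using v \<zeta> by (intro power_mono) (auto simp: a_def)
  finally have a2: "v / a\<^sup>2 \<le> \<zeta>" using \<zeta> a by (simp add: field_simps)
  have "hp M (\<F> {1..n}) \<zeta> (\<lambda>\<xi>. norm (G n \<xi>) \<le> ?d * a)" if n: "n \<ge> 1" for n
  proof -
    have sub: "subalgebra M (\<F> {1..n})" by (rule subalgebra_F) auto
    have "hp M (\<F> {1..n}) (\<Sum>j\<in>(UNIV :: 'd set). (real cmax)\<^sup>2 * (2 * C) / a\<^sup>2) (\<lambda>\<xi>. \<forall>j\<in>UNIV. \<bar>G n \<xi> \<bullet> axis j 1\<bar> < a)"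
    proof (rule hp_ball[OF sub])
      fix j :: 'd
      have "hp M (\<F> {1..n}) (real n * ((real cmax)\<^sup>2 * ((norm (axis j 1 :: real ^ 'd))\<^sup>2 * (2 * C))) / (sqrt (real n) * a)\<^sup>2)
        (\<lambda>\<xi>. \<bar>(\<Sum>i=1..n. csum (sc (axis j 1)) i \<xi>) - (\<Sum>i=1..n. \<Sum>k=1..c i. expectation (\<lambda>\<xi>. sc (axis j 1) i k (Y i k \<xi>, X i k \<xi>)))\<bar> < sqrt (real n) * a)"
        using n a C0 by (intro csum_sum_hp sc_int sc_meas) auto
      then show "hp M (\<F> {1..n}) ((real cmax)\<^sup>2 * (2 * C) / a\<^sup>2) (\<lambda>\<xi>. \<bar>G n \<xi> \<bullet> axis j 1\<bar> < a)"
      proof (rule hp_mono)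
        show "real n * ((real cmax)\<^sup>2 * ((norm (axis j 1 :: real ^ 'd))\<^sup>2 * (2 * C))) / (sqrt (real n) * a)\<^sup>2 \<le> (real cmax)\<^sup>2 * (2 * C) / a\<^sup>2"
          using n by (simp add: power_mult_distrib)
        fix \<xi>
        have "(\<Sum>i=1..n. \<Sum>k=1..c i. expectation (\<lambda>\<xi>. sc (axis j 1) i k (Y i k \<xi>, X i k \<xi>))) = 0"
          using sc_mean by (intro sum.neutral ballI) auto
        moreover assume "\<bar>(\<Sum>i=1..n. csum (sc (axis j 1)) i \<xi>) - (\<Sum>i=1..n. \<Sum>k=1..c i. expectation (\<lambda>\<xi>. sc (axis j 1) i k (Y i k \<xi>, X i k \<xi>)))\<bar> < sqrt (real n) * a"
        ultimately show "\<bar>G n \<xi> \<bullet> axis j 1\<bar> < a"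
          unfolding inner_G using n by (simp add: abs_mult divide_less_eq mult.commute)
      qed simp
    qed simp
    then show ?thesis
    proof (rule hp_mono)
      show "(\<Sum>j\<in>(UNIV :: 'd set). (real cmax)\<^sup>2 * (2 * C) / a\<^sup>2) \<le> \<zeta>" using a2 by (simp add: v_def)
      fix \<xi> assume \<xi>: "\<forall>j\<in>UNIV. \<bar>G n \<xi> \<bullet> axis j 1\<bar> < a"
      have "norm (G n \<xi>) \<le> (\<Sum>j\<in>UNIV. \<bar>G n \<xi> $ j\<bar>)" by (rule norm_le_l1_cart)
      also have "\<dots> \<le> (\<Sum>j\<in>(UNIV :: 'd set). a)" using \<xi> by (intro sum_mono) (auto simp: inner_axis less_imp_le)
      finally show "norm (G n \<xi>) \<le> ?d * a" by simp
    qed simp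
  qed
  moreover have "0 < ?d * a" using a by simp
  ultimately show ?thesis using that by blast
qed

lemma norm_sq_vec: "(norm (x :: real ^ 'd))\<^sup>2 = (\<Sum>j\<in>UNIV. (x \<bullet> axis j 1)\<^sup>2)"
  by (simp add: norm_vec_def L2_set_def inner_axis sum_nonneg)

section \<open>Uniform increments of the wild gradient\<close>

text \<open>Change of the score in direction \<open>a\<close> when the parameter moves from
  \<open>\<beta>0\<close> to \<open>\<beta>0 + u /\<^sub>R sqrt (real n)\<close>.\<close>

definition tI :: "nat \<Rightarrow> real ^ 'd \<Rightarrow> real ^ 'd \<Rightarrow> nat \<Rightarrow> nat \<Rightarrow> real \<times> (real ^ 'd) \<Rightarrow> real" where
  "tI n u a = (\<lambda>i k z. (psi \<tau> (fst z - snd z \<bullet> \<beta>0 - snd z \<bullet> u / sqrt (real n)) - psi \<tau> (fst z - snd z \<bullet> \<beta>0)) * (snd z \<bullet> a))"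

text \<open>Envelope for changes of the score within distance \<open>\<delta>\<close> of the net
  point \<open>u\<close>. The band is centred at the shifted parameter, so the band estimates are
  needed at every \<open>b\<close>, not only at \<open>\<beta>0\<close>.\<close>

definition tR :: "nat \<Rightarrow> real \<Rightarrow> real ^ 'd \<Rightarrow> nat \<Rightarrow> nat \<Rightarrow> real \<times> (real ^ 'd) \<Rightarrow> real" where
  "tR n \<delta> u = (\<lambda>i k z. norm (snd z) * of_bool (\<bar>fst z - snd z \<bullet> (\<beta>0 + u /\<^sub>R sqrt (real n))\<bar> \<le> \<delta> / sqrt (real n) * norm (snd z)))"

lemma tI_meas: "tI n u a i k \<in> borel_measurable borel"
  unfolding tI_def by measurable

lemma tR_meas: "tR n \<delta> u i k \<in> borel_measurable borel"
proof -
  let ?A = "{z :: real \<times> (real ^ 'd). \<bar>fst z - snd z \<bullet> (\<beta>0 + u /\<^sub>R sqrt (real n))\<bar> \<le> \<delta> / sqrt (real n) * norm (snd z)}"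
  have "?A \<in> sets borel" by (intro borel_closed closed_Collect_le continuous_intros)
  then have "(\<lambda>z. norm (snd z) * indicator ?A z) \<in> borel_measurable borel"
    by (intro borel_measurable_times borel_measurable_indicator measurable_compose[OF measurable_fst_snd_borel(2) borel_measurable_norm])
  moreover have "tR n \<delta> u i k = (\<lambda>z. norm (snd z) * indicator ?A z)"
    by (rule ext) (simp only: tR_def indicator_def of_bool_def mem_Collect_eq)
  ultimately show ?thesis by (simp only:)
qed

lemma tR_band: "\<bar>tR n \<delta> u i k (y, x)\<bar> \<le> norm x * of_bool (\<bar>y - x \<bullet> (\<beta>0 + u /\<^sub>R sqrt (real n))\<bar> \<le> \<delta> / sqrt (real n) * norm x)"
  unfolding tR_def by simp

lemma tI_band:
  assumes "norm a \<le> 1"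
  shows "\<bar>tI n u a i k (y, x)\<bar> \<le> norm x * of_bool (\<bar>y - x \<bullet> \<beta>0\<bar> \<le> norm u / sqrt (real n) * norm x)"
proof -
  have "\<bar>psi \<tau> (y - x \<bullet> \<beta>0 - x \<bullet> u / sqrt (real n)) - psi \<tau> (y - x \<bullet> \<beta>0)\<bar> \<le> of_bool (\<bar>y - x \<bullet> \<beta>0\<bar> \<le> \<bar>x \<bullet> u / sqrt (real n)\<bar>)"
    using psi_lipschitz[of \<tau> "y - x \<bullet> \<beta>0" "x \<bullet> u / sqrt (real n)" 0] by simp
  also have "\<dots> \<le> of_bool (\<bar>y - x \<bullet> \<beta>0\<bar> \<le> norm u / sqrt (real n) * norm x)"
    using inner_scaled_le[of x u n] by (auto simp: of_bool_def)
  finally have 1: "\<bar>psi \<tau> (y - x \<bullet> \<beta>0 - x \<bullet> u / sqrt (real n)) - psi \<tau> (y - x \<bullet> \<beta>0)\<bar> \<le> of_bool (\<bar>y - x \<bullet> \<beta>0\<bar> \<le> norm u / sqrt (real n) * norm x)" .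
  have "\<bar>x \<bullet> a\<bar> \<le> norm x * norm a" by (rule Cauchy_Schwarz_ineq2)
  also have "\<dots> \<le> norm x" using assms by (simp add: mult_left_le)
  finally show ?thesis
    unfolding tI_def fst_conv snd_conv abs_mult using mult_mono[OF 1, of "\<bar>x \<bullet> a\<bar>" "norm x"] by (simp add: mult.commute)
qed

lemma band_second_moment:
  assumes i: "i \<ge> 1" "k \<in> {1..c i}" and t: "t \<in> borel_measurable borel" and r: "0 \<le> r"
    and le: "\<And>y x. \<bar>t (y, x)\<bar> \<le> norm x * of_bool (\<bar>y - x \<bullet> b\<bar> \<le> r * norm x)"
  shows "integrable M (\<lambda>\<xi>. (t (Y i k \<xi>, X i k \<xi>))\<^sup>2)" "expectation (\<lambda>\<xi>. (t (Y i k \<xi>, X i k \<xi>))\<^sup>2) \<le> C * r powr (p - 2)"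
proof -
  note [measurable] = rv[OF i]
  have le1: "\<bar>t (y, x)\<bar> \<le> 1 * norm x" for y x
    by (rule order_trans[OF le]) (auto simp: of_bool_def)
  show i1: "integrable M (\<lambda>\<xi>. (t (Y i k \<xi>, X i k \<xi>))\<^sup>2)"
    by (rule dominated(1)[OF i t le1]) simp
  have le2: "(t (y, x))\<^sup>2 \<le> (norm x)\<^sup>2 * of_bool (\<bar>y - x \<bullet> b\<bar> \<le> r * norm x)" for y x
    using power_mono[OF le abs_ge_zero, of y x 2] by (auto simp: power_mult_distrib of_bool_def split: if_splits)
  have i2: "integrable M (\<lambda>\<xi>. (norm (X i k \<xi>))\<^sup>2 * of_bool (\<bar>Y i k \<xi> - X i k \<xi> \<bullet> b\<bar> \<le> r * norm (X i k \<xi>)))"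
    by (rule Bochner_Integration.integrable_bound[OF sq_le_mom(1)[OF i]]) (auto simp: of_bool_def)
  have "expectation (\<lambda>\<xi>. (t (Y i k \<xi>, X i k \<xi>))\<^sup>2) \<le> expectation (\<lambda>\<xi>. (norm (X i k \<xi>))\<^sup>2 * of_bool (\<bar>Y i k \<xi> - X i k \<xi> \<bullet> b\<bar> \<le> r * norm (X i k \<xi>)))"
    using i1 i2 le2 by (intro integral_mono) auto
  also have "\<dots> \<le> C * r powr (p - 2)" by (rule band(2)[OF i r])
  finally show "expectation (\<lambda>\<xi>. (t (Y i k \<xi>, X i k \<xi>))\<^sup>2) \<le> C * r powr (p - 2)" .
qed

lemma inner_V_diff:
  "(V n (\<beta>0 + u /\<^sub>R sqrt (real n)) \<xi> - V n \<beta>0 \<xi>) \<bullet> a = (1 / sqrt (real n)) * (\<Sum>i=1..n. W i \<xi> * csum (tI n u a) i \<xi>)"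
proof -
  have "V n (\<beta>0 + u /\<^sub>R sqrt (real n)) \<xi> \<bullet> a = (1 / sqrt (real n)) * (\<Sum>i=1..n. W i \<xi> * (\<Sum>k=1..c i. psi \<tau> (Y i k \<xi> - X i k \<xi> \<bullet> \<beta>0 - X i k \<xi> \<bullet> u / sqrt (real n)) * (X i k \<xi> \<bullet> a)))"
    by (simp add: V_def wild_gradient_def inner_sum_left inner_add_right divide_inverse diff_diff_eq mult.commute)
  then show ?thesis
    unfolding inner_diff_left inner_V
    by (simp only: right_diff_distrib[symmetric] sum_subtractf[symmetric]) (simp add: csum_def sc_def tI_def sum_subtractf[symmetric] left_diff_distrib right_diff_distrib)
qed

lemma V_increment:
  assumes n: "n \<ge> 1" and uf: "norm (u - f) \<le> \<delta>"
  shows "norm (V n (\<beta>0 + u /\<^sub>R sqrt (real n)) \<xi> - V n (\<beta>0 + f /\<^sub>R sqrt (real n)) \<xi>) \<le> (1 / sqrt (real n)) * (\<Sum>i=1..n. \<bar>W i \<xi>\<bar> * csum (tR n \<delta> f) i \<xi>)"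
proof -
  let ?bu = "\<beta>0 + u /\<^sub>R sqrt (real n)" and ?bf = "\<beta>0 + f /\<^sub>R sqrt (real n)"
  have 1: "norm ((psi \<tau> (Y i k \<xi> - X i k \<xi> \<bullet> ?bu) - psi \<tau> (Y i k \<xi> - X i k \<xi> \<bullet> ?bf)) *\<^sub>R X i k \<xi>) \<le> tR n \<delta> f i k (Y i k \<xi>, X i k \<xi>)" for i k
  proof -
    have "X i k \<xi> \<bullet> ?bu - X i k \<xi> \<bullet> ?bf = X i k \<xi> \<bullet> (u - f) / sqrt (real n)"
      by (simp add: inner_add_right inner_diff_right divide_inverse algebra_simps)
    moreover have "\<bar>X i k \<xi> \<bullet> (u - f) / sqrt (real n)\<bar> \<le> \<delta> / sqrt (real n) * norm (X i k \<xi>)"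
      by (rule order_trans[OF inner_scaled_le]) (use uf in \<open>auto intro!: mult_right_mono divide_right_mono\<close>)
    ultimately have "\<bar>psi \<tau> (Y i k \<xi> - X i k \<xi> \<bullet> ?bu) - psi \<tau> (Y i k \<xi> - X i k \<xi> \<bullet> ?bf)\<bar> \<le> of_bool (\<bar>Y i k \<xi> - X i k \<xi> \<bullet> ?bf\<bar> \<le> \<delta> / sqrt (real n) * norm (X i k \<xi>))"
      using psi_lipschitz[of \<tau> "Y i k \<xi>" "X i k \<xi> \<bullet> ?bu" "X i k \<xi> \<bullet> ?bf"] by (auto simp: of_bool_def split: if_splits)
    then show ?thesis
      unfolding tR_def fst_conv snd_conv norm_scaleR real_norm_def mult.commute[of "norm (X i k \<xi>)"]
      by (rule mult_right_mono) simp
  qed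
  have e: "V n ?bu \<xi> - V n ?bf \<xi> = (1 / sqrt (real n)) *\<^sub>R (\<Sum>i=1..n. W i \<xi> *\<^sub>R (\<Sum>k=1..c i. (psi \<tau> (Y i k \<xi> - X i k \<xi> \<bullet> ?bu) - psi \<tau> (Y i k \<xi> - X i k \<xi> \<bullet> ?bf)) *\<^sub>R X i k \<xi>))"
    by (simp add: V_def wild_gradient_def scaleR_diff_right scaleR_diff_left sum_subtractf)
  have "norm (V n ?bu \<xi> - V n ?bf \<xi>) \<le> (1 / sqrt (real n)) * (\<Sum>i=1..n. norm (W i \<xi> *\<^sub>R (\<Sum>k=1..c i. (psi \<tau> (Y i k \<xi> - X i k \<xi> \<bullet> ?bu) - psi \<tau> (Y i k \<xi> - X i k \<xi> \<bullet> ?bf)) *\<^sub>R X i k \<xi>)))"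
    unfolding e norm_scaleR[of "1 / sqrt (real n)"] by (intro mult_mono norm_sum) auto
  also have "\<dots> \<le> (1 / sqrt (real n)) * (\<Sum>i=1..n. \<bar>W i \<xi>\<bar> * csum (tR n \<delta> f) i \<xi>)"
    unfolding norm_scaleR csum_def real_norm_def using 1
    by (intro mult_left_mono sum_mono sum_norm_le) auto
  finally show ?thesis .
qed

text \<open>The wild gradient is needed at the estimator, which depends on the data and need not be
  measurable, so the bound is uniform over a ball and dominated by one integrable \<open>D\<close>.
  At the points of a finite net the increments are centred with variances tending to zero. Between
  net points an envelope with weights \<open>\<bar>W i\<bar>\<close> is used: its fluctuation
  vanishes with \<open>n\<close>, its mean is only of the order of the mesh.\<close>

lemma wild_increment:
  assumes K: "0 \<le> K" and \<eta>: "0 < \<eta>"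
  shows "\<forall>\<^sub>F n in sequentially. \<exists>D. integrable M D \<and> expectation D \<le> \<eta> \<and> (\<forall>\<xi>. 0 \<le> D \<xi>) \<and>
    (\<forall>\<xi> u. norm u \<le> K \<longrightarrow> (norm (V n (\<beta>0 + u /\<^sub>R sqrt (real n)) \<xi> - V n \<beta>0 \<xi>))\<^sup>2 \<le> D \<xi>)"
proof -
  define e where "e = min 1 (\<eta> / 4)"
  have e: "0 < e" "2 * e\<^sup>2 \<le> \<eta> / 2"
  proof -
    show e0: "0 < e" using \<eta> by (simp add: e_def)
    have "e * e \<le> 1 * (\<eta> / 4)" using e0 by (intro mult_mono) (auto simp: e_def)
    then show "2 * e\<^sup>2 \<le> \<eta> / 2" by (simp add: power2_eq_square)
  qed
  \<comment> \<open>The mesh keeps the mean of the envelope below \<open>e\<close> for every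
    \<open>n\<close>; this part does not shrink as \<open>n\<close> grows.\<close>
  define \<delta> where "\<delta> = e / (real cmax * C + 1)"
  have cC: "0 < real cmax * C + 1" using C0 by (simp add: add_nonneg_pos)
  have \<delta>: "0 < \<delta>" "real cmax * (C * \<delta>) \<le> e"
  proof -
    show "0 < \<delta>" using e cC by (simp add: \<delta>_def)
    have "real cmax * (C * \<delta>) \<le> (real cmax * C + 1) * \<delta>" using \<open>0 < \<delta>\<close> by (simp add: algebra_simps)
    also have "\<dots> = e" using cC by (simp add: \<delta>_def)
    finally show "real cmax * (C * \<delta>) \<le> e" .
  qed
  obtain N :: "(real ^ 'd) set" where N: "finite N" "N \<subseteq> cball 0 K" "\<And>u. norm u \<le> K \<Longrightarrow> \<exists>f\<in>N. norm (u - f) \<le> \<delta>"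
    using finite_net_ball[OF \<delta>(1) K] by auto
  let ?d = "real CARD('d)"
  define v1 where "v1 = (\<lambda>n (f :: real ^ 'd). C * (norm f / sqrt (real n)) powr (p - 2))"
  define v2 where "v2 = (\<lambda>n::nat. C * (\<delta> / sqrt (real n)) powr (p - 2))"
  \<comment> \<open>Bound for the part of the expectation of \<open>D\<close> that vanishes with
    \<open>n\<close>. The factors 4 come from splitting the square twice: off the mean of the
    envelope first, then into net increment and fluctuation.\<close>
  define tot where "tot = (\<lambda>n. (\<Sum>f\<in>N. 4 * (?d * ((real cmax)\<^sup>2 * v1 n f)) + 4 * ((real cmax)\<^sup>2 * v2 n)))"
  have z: "(\<lambda>n. (a / sqrt (real n)) powr (p - 2)) \<longlonglongrightarrow> 0" if "0 \<le> a" for a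
  proof -
    have "(\<lambda>n. a / sqrt (real n)) \<longlonglongrightarrow> 0"
      by (rule real_tendsto_divide_at_top[OF tendsto_const])
        (intro filterlim_compose[OF sqrt_at_top] filterlim_real_sequentially)
    then show ?thesis by (rule tendsto_zero_powrI) (use p that in auto)
  qed
  have "tot \<longlonglongrightarrow> (\<Sum>f\<in>N. 4 * (?d * ((real cmax)\<^sup>2 * (C * 0))) + 4 * ((real cmax)\<^sup>2 * (C * 0)))"
    unfolding tot_def v1_def v2_def by (intro tendsto_intros z) (use \<delta> in auto)
  then have "\<forall>\<^sub>F n in sequentially. tot n < \<eta> / 2" using \<eta> by (intro order_tendstoD(2)) auto
  then show ?thesis using eventually_ge_at_top[of 1]
  proof eventually_elim
    case (elim n)
    then have n: "n \<ge> 1" by simp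
    define SI where "SI = (\<lambda>f j \<xi>. (1 / sqrt (real n)) * (\<Sum>i=1..n. W i \<xi> * csum (tI n f (axis j 1)) i \<xi>))"
    define SR where "SR = (\<lambda>f \<xi>. (1 / sqrt (real n)) * (\<Sum>i=1..n. \<bar>W i \<xi>\<bar> * csum (tR n \<delta> f) i \<xi>))"
    define \<mu> where "\<mu> = (\<lambda>f. (1 / sqrt (real n)) * (\<Sum>i=1..n. expectation (\<lambda>\<xi>. \<bar>W i \<xi>\<bar>) * (\<Sum>k=1..c i. expectation (\<lambda>\<xi>. tR n \<delta> f i k (Y i k \<xi>, X i k \<xi>)))))"
    have SI: "integrable M (\<lambda>\<xi>. (SI f j \<xi>)\<^sup>2)" "expectation (\<lambda>\<xi>. (SI f j \<xi>)\<^sup>2) \<le> (real cmax)\<^sup>2 * v1 n f" for f j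
    proof -
      have 1: "integrable M (\<lambda>\<xi>. (tI n f (axis j 1) i k (Y i k \<xi>, X i k \<xi>))\<^sup>2)" "expectation (\<lambda>\<xi>. (tI n f (axis j 1) i k (Y i k \<xi>, X i k \<xi>))\<^sup>2) \<le> v1 n f"
        if "i \<in> {1..n}" "k \<in> {1..c i}" for i k
        unfolding v1_def using that by (intro band_second_moment[OF _ _ tI_meas _ tI_band]; simp)+
      have m: "(1 / sqrt (real n)) * (\<Sum>i=1..n. expectation (\<lambda>\<xi>. (\<lambda>x. x) (W i \<xi>)) * (\<Sum>k=1..c i. expectation (\<lambda>\<xi>. tI n f (axis j 1) i k (Y i k \<xi>, X i k \<xi>)))) = 0"
        using W_mean by simp
      note wsum_second_moment[where t = "tI n f (axis j 1)" and n = n and v = "v1 n f" and h = "\<lambda>x. x", OF tI_meas 1 _ _ n]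
      from this(2,3)[unfolded m] show "integrable M (\<lambda>\<xi>. (SI f j \<xi>)\<^sup>2)" "expectation (\<lambda>\<xi>. (SI f j \<xi>)\<^sup>2) \<le> (real cmax)\<^sup>2 * v1 n f"
        unfolding SI_def using C0 by (simp_all add: v1_def)
    qed
    have SR: "integrable M (\<lambda>\<xi>. (SR f \<xi> - \<mu> f)\<^sup>2)" "expectation (\<lambda>\<xi>. (SR f \<xi> - \<mu> f)\<^sup>2) \<le> (real cmax)\<^sup>2 * v2 n" for f
    proof -
      have 1: "integrable M (\<lambda>\<xi>. (tR n \<delta> f i k (Y i k \<xi>, X i k \<xi>))\<^sup>2)" "expectation (\<lambda>\<xi>. (tR n \<delta> f i k (Y i k \<xi>, X i k \<xi>))\<^sup>2) \<le> v2 n"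
        if "i \<in> {1..n}" "k \<in> {1..c i}" for i k
        unfolding v2_def using that \<delta>
        by (intro band_second_moment[OF _ _ tR_meas _ tR_band]; simp)+
      note wsum_second_moment[where t = "tR n \<delta> f" and n = n and v = "v2 n" and h = abs, OF tR_meas 1 _ _ n]
      from this(2,3) show "integrable M (\<lambda>\<xi>. (SR f \<xi> - \<mu> f)\<^sup>2)" "expectation (\<lambda>\<xi>. (SR f \<xi> - \<mu> f)\<^sup>2) \<le> (real cmax)\<^sup>2 * v2 n"
        unfolding SR_def \<mu>_def using C0 by (simp_all add: v2_def)
    qed
    have \<mu>: "0 \<le> \<mu> f" "\<mu> f \<le> e" for f
    proof -
      have t0: "0 \<le> expectation (\<lambda>\<xi>. tR n \<delta> f i k (Y i k \<xi>, X i k \<xi>))" for i k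
        by (rule Bochner_Integration.integral_nonneg) (simp add: tR_def)
      show "0 \<le> \<mu> f" unfolding \<mu>_def using t0 by (intro mult_nonneg_nonneg sum_nonneg) auto
      have "\<mu> f \<le> (1 / sqrt (real n)) * (\<Sum>i=1..n. 1 * (\<Sum>k=1..c i. expectation (\<lambda>\<xi>. tR n \<delta> f i k (Y i k \<xi>, X i k \<xi>))))"
        unfolding \<mu>_def using abs_W_mean t0 by (intro mult_left_mono sum_mono mult_right_mono sum_nonneg) auto
      also have "\<dots> \<le> (1 / sqrt (real n)) * (real n * (real cmax * (C * (\<delta> / sqrt (real n)))))"
        unfolding mult_1 tR_def fst_conv snd_conv using \<delta> C0 by (intro mult_left_mono double_sum_le band) auto
      also have "\<dots> = real cmax * (C * \<delta>)" using n by (simp add: field_simps)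
      finally show "\<mu> f \<le> e" using \<delta> by simp
    qed
    define Q where "Q = (\<lambda>f \<xi>. 4 * (\<Sum>j\<in>(UNIV :: 'd set). (SI f j \<xi>)\<^sup>2) + 4 * (SR f \<xi> - \<mu> f)\<^sup>2)"
    define D where "D = (\<lambda>\<xi>. (\<Sum>f\<in>N. Q f \<xi>) + 2 * e\<^sup>2)"
    have Q0: "0 \<le> Q f \<xi>" for f \<xi>
      unfolding Q_def by (intro add_nonneg_nonneg mult_nonneg_nonneg sum_nonneg zero_le_power2) simp_all
    have iD: "integrable M D" unfolding D_def Q_def using SI SR by auto
    have "expectation D = (\<Sum>f\<in>N. 4 * (\<Sum>j\<in>(UNIV :: 'd set). expectation (\<lambda>\<xi>. (SI f j \<xi>)\<^sup>2)) + 4 * expectation (\<lambda>\<xi>. (SR f \<xi> - \<mu> f)\<^sup>2)) + 2 * e\<^sup>2"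
      unfolding D_def Q_def using SI(1) SR(1) by (simp add: prob_space)
    also have "\<dots> \<le> (\<Sum>f\<in>N. 4 * (\<Sum>j\<in>(UNIV :: 'd set). (real cmax)\<^sup>2 * v1 n f) + 4 * ((real cmax)\<^sup>2 * v2 n)) + 2 * e\<^sup>2"
      by (intro add_mono sum_mono mult_left_mono SI(2) SR(2)) auto
    also have "\<dots> = tot n + 2 * e\<^sup>2" by (simp add: tot_def)
    also have "\<dots> \<le> \<eta>" using elim e by linarith
    finally have ED: "expectation D \<le> \<eta>" .
    have D0: "0 \<le> D \<xi>" for \<xi> unfolding D_def by (intro add_nonneg_nonneg sum_nonneg Q0) auto
    have "(norm (V n (\<beta>0 + u /\<^sub>R sqrt (real n)) \<xi> - V n \<beta>0 \<xi>))\<^sup>2 \<le> D \<xi>" if u: "norm u \<le> K" for u \<xi>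
    proof -
      obtain f where f: "f \<in> N" "norm (u - f) \<le> \<delta>" using N(3)[OF u] by blast
      let ?A = "V n (\<beta>0 + u /\<^sub>R sqrt (real n)) \<xi> - V n (\<beta>0 + f /\<^sub>R sqrt (real n)) \<xi>"
      let ?B = "V n (\<beta>0 + f /\<^sub>R sqrt (real n)) \<xi> - V n \<beta>0 \<xi>"
      have B: "(norm ?B)\<^sup>2 = (\<Sum>j\<in>UNIV. (SI f j \<xi>)\<^sup>2)"
        unfolding norm_sq_vec inner_V_diff SI_def ..
      have "norm ?A \<le> SR f \<xi>" unfolding SR_def by (rule V_increment[OF n f(2)])
      also have "\<dots> \<le> \<bar>SR f \<xi> - \<mu> f\<bar> + e" using \<mu>[of f] by linarith
      finally have A: "norm ?A \<le> \<bar>SR f \<xi> - \<mu> f\<bar> + e" .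
      have "norm (V n (\<beta>0 + u /\<^sub>R sqrt (real n)) \<xi> - V n \<beta>0 \<xi>) \<le> norm ?A + norm ?B"
        using norm_triangle_ineq[of ?A ?B] by simp
      also have "\<dots> \<le> (norm ?B + \<bar>SR f \<xi> - \<mu> f\<bar>) + e" using A by simp
      finally have "(norm (V n (\<beta>0 + u /\<^sub>R sqrt (real n)) \<xi> - V n \<beta>0 \<xi>))\<^sup>2 \<le> ((norm ?B + \<bar>SR f \<xi> - \<mu> f\<bar>) + e)\<^sup>2"
        by (intro power_mono) auto
      also have "\<dots> \<le> 2 * (norm ?B + \<bar>SR f \<xi> - \<mu> f\<bar>)\<^sup>2 + 2 * e\<^sup>2"
        using norm_add_sq_le[of "norm ?B + \<bar>SR f \<xi> - \<mu> f\<bar>" e] by simp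
      also have "(norm ?B + \<bar>SR f \<xi> - \<mu> f\<bar>)\<^sup>2 \<le> 2 * (norm ?B)\<^sup>2 + 2 * (SR f \<xi> - \<mu> f)\<^sup>2"
        using norm_add_sq_le[of "norm ?B" "\<bar>SR f \<xi> - \<mu> f\<bar>"] by simp
      finally have "(norm (V n (\<beta>0 + u /\<^sub>R sqrt (real n)) \<xi> - V n \<beta>0 \<xi>))\<^sup>2 \<le> Q f \<xi> + 2 * e\<^sup>2"
        unfolding B Q_def by simp
      also have "\<dots> \<le> D \<xi>"
        unfolding D_def using member_le_sum[of f N "\<lambda>f. Q f \<xi>"] N(1) f(1) Q0 by simp
      finally show ?thesis .
    qed
    then show ?case using iD ED D0 by (intro exI[of _ D]) auto
  qed
qed

end

section \<open>The bootstrap covariance matrix\<close>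

text \<open>The sum is at most \<open>m\<close> times its largest term, whose power is at most the
  sum of the powers.\<close>

lemma powr_sum_le:
  fixes x :: "'i \<Rightarrow> real"
  assumes A: "finite A" and m: "real (card A) \<le> m" and x: "\<And>k. k \<in> A \<Longrightarrow> 0 \<le> x k" and p: "0 < p"
  shows "(\<Sum>k\<in>A. x k) powr p \<le> m powr p * (\<Sum>k\<in>A. x k powr p)"
proof (cases "A = {}")
  case False
  define M where "M = Max (x ` A)"
  have "M \<in> x ` A" unfolding M_def using A False by (intro Max_in) auto
  then obtain j where j: "j \<in> A" "M = x j" by auto
  have "(\<Sum>k\<in>A. x k) \<le> real (card A) * M"
    unfolding M_def using A by (intro sum_bounded_above Max_ge) auto
  also have "\<dots> \<le> m * M" using m x j by (intro mult_right_mono) auto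
  finally have "(\<Sum>k\<in>A. x k) powr p \<le> (m * M) powr p"
    using p x by (intro powr_mono2 sum_nonneg) auto
  also have "\<dots> = m powr p * x j powr p" using j x m by (simp add: powr_mult)
  also have "\<dots> \<le> m powr p * (\<Sum>k\<in>A. x k powr p)"
    using A j by (intro mult_left_mono member_le_sum) auto
  finally show ?thesis .
qed simp

locale qr_boot = qr_core M c cmax Y X W \<tau> \<beta>0 C p \<epsilon> r0 lam J \<Sigma> q
  for M :: "'a measure" and c :: "nat \<Rightarrow> nat" and cmax :: nat
    and Y :: "nat \<Rightarrow> nat \<Rightarrow> 'a \<Rightarrow> real" and X :: "nat \<Rightarrow> nat \<Rightarrow> 'a \<Rightarrow> real ^ 'd"
    and W :: "nat \<Rightarrow> 'a \<Rightarrow> real"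
    and \<tau> :: real and \<beta>0 :: "real ^ 'd" and C p \<epsilon> r0 lam :: real
    and J \<Sigma> :: "real ^ 'd ^ 'd" and q :: "nat \<Rightarrow> nat \<Rightarrow> real ^ 'd \<Rightarrow> real" +
  fixes B :: "(real ^ 'd) set" and Dm :: real and bhat bstar :: "nat \<Rightarrow> 'a \<Rightarrow> real ^ 'd"
  assumes W_mom: "\<And>i. i \<ge> 1 \<Longrightarrow> integrable M (\<lambda>\<xi>. \<bar>W i \<xi>\<bar> powr p)"
      "\<And>i. i \<ge> 1 \<Longrightarrow> expectation (\<lambda>\<xi>. \<bar>W i \<xi>\<bar> powr p) \<le> C"
    and Sigma_lim: "\<And>a b. (\<lambda>n. (1 / real n) * (\<Sum>i=1..n. expectation (\<lambda>\<xi>. csum (sc a) i \<xi> * csum (sc b) i \<xi>))) \<longlonglongrightarrow> a \<bullet> (\<Sigma> *v b)"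
    and B: "cball \<beta>0 r0 \<subseteq> B" "\<And>b. b \<in> B \<Longrightarrow> norm (b - \<beta>0) \<le> Dm" "0 < Dm"
    and bhat: "\<And>n \<xi>. n \<ge> 1 \<Longrightarrow> \<xi> \<in> space M \<Longrightarrow>
      is_arg_min (qr_objective c (\<lambda>i k. Y i k \<xi>) (\<lambda>i k. X i k \<xi>) n \<tau>) (\<lambda>b. b \<in> B) (bhat n \<xi>)"
    and bstar: "\<And>n \<xi>. n \<ge> 1 \<Longrightarrow> \<xi> \<in> space M \<Longrightarrow>
      is_arg_min (wild_objective c (\<lambda>i. W i \<xi>) (\<lambda>i k. Y i k \<xi>) (\<lambda>i k. X i k \<xi>) n \<tau> (bhat n \<xi>))
        (\<lambda>b. b \<in> B) (bstar n \<xi>)"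
begin

text \<open>Bound for the moment of order \<open>p\<close> of a cluster score in direction
  \<open>a\<close>: one power of \<open>cmax\<close> for passing to single observations, one factor
  \<open>cmax\<close> for their number.\<close>

definition A0 :: "real ^ 'd \<Rightarrow> real" where
  "A0 a = norm a powr p * (real cmax powr p * (real cmax * C))"

lemma A0_nonneg: "0 \<le> A0 a" using C0 by (simp add: A0_def)

lemma csum_sc_measurable: "i \<ge> 1 \<Longrightarrow> csum (sc a) i \<in> borel_measurable M"
  by (intro csum_measurable sc_meas) auto

lemma csum_sc_powr:
  assumes i: "i \<ge> 1"
  shows "integrable M (\<lambda>\<xi>. \<bar>csum (sc a) i \<xi>\<bar> powr p)" "expectation (\<lambda>\<xi>. \<bar>csum (sc a) i \<xi>\<bar> powr p) \<le> A0 a"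
proof -
  note [measurable] = csum_sc_measurable[OF i]
  have le: "\<bar>csum (sc a) i \<xi>\<bar> powr p \<le> norm a powr p * (real cmax powr p * (\<Sum>k=1..c i. norm (X i k \<xi>) powr p))" for \<xi>
  proof -
    have "\<bar>csum (sc a) i \<xi>\<bar> \<le> (\<Sum>k=1..c i. norm a * norm (X i k \<xi>))"
      unfolding csum_def using sc_dom by (intro order_trans[OF sum_abs] sum_mono)
    then have "\<bar>csum (sc a) i \<xi>\<bar> powr p \<le> (norm a * (\<Sum>k=1..c i. norm (X i k \<xi>))) powr p"
      using p by (intro powr_mono2) (auto simp: sum_distrib_left)
    also have "\<dots> = norm a powr p * (\<Sum>k=1..c i. norm (X i k \<xi>)) powr p"
      by (simp add: powr_mult sum_nonneg)
    also have "\<dots> \<le> norm a powr p * (real cmax powr p * (\<Sum>k=1..c i. norm (X i k \<xi>) powr p))"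
      using p cluster_size[OF i] by (intro mult_left_mono powr_sum_le) auto
    finally show ?thesis .
  qed
  have int: "integrable M (\<lambda>\<xi>. norm a powr p * (real cmax powr p * (\<Sum>k=1..c i. norm (X i k \<xi>) powr p)))"
    using mom(1)[OF i] by (intro integrable_mult_right Bochner_Integration.integrable_sum) auto
  show i1: "integrable M (\<lambda>\<xi>. \<bar>csum (sc a) i \<xi>\<bar> powr p)"
  proof (rule Bochner_Integration.integrable_bound[OF int])
    show "AE \<xi> in M. norm (\<bar>csum (sc a) i \<xi>\<bar> powr p) \<le> norm (norm a powr p * (real cmax powr p * (\<Sum>k=1..c i. norm (X i k \<xi>) powr p)))"
      unfolding real_norm_def by (intro AE_I2 order_trans[OF _ abs_ge_self]) (simp only: abs_of_nonneg[OF powr_ge_zero] le)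
  qed measurable
  have "expectation (\<lambda>\<xi>. \<bar>csum (sc a) i \<xi>\<bar> powr p) \<le> expectation (\<lambda>\<xi>. norm a powr p * (real cmax powr p * (\<Sum>k=1..c i. norm (X i k \<xi>) powr p)))"
    using i1 int le by (intro integral_mono) auto
  also have "\<dots> = norm a powr p * (real cmax powr p * (\<Sum>k=1..c i. expectation (\<lambda>\<xi>. norm (X i k \<xi>) powr p)))"
    using mom(1)[OF i] by simp
  also have "\<dots> \<le> A0 a"
  proof -
    have "(\<Sum>k=1..c i. expectation (\<lambda>\<xi>. norm (X i k \<xi>) powr p)) \<le> real (card {1..c i}) * C"
      using mom(2)[OF i] by (intro sum_bounded_above)
    also have "\<dots> \<le> real cmax * C" using cluster_size[OF i] C0 by (intro mult_right_mono) auto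
    finally show ?thesis unfolding A0_def by (intro mult_left_mono) auto
  qed
  finally show "expectation (\<lambda>\<xi>. \<bar>csum (sc a) i \<xi>\<bar> powr p) \<le> A0 a" .
qed

lemma csum_sc_sq: "i \<ge> 1 \<Longrightarrow> integrable M (\<lambda>\<xi>. (csum (sc a) i \<xi>)\<^sup>2)"
  using sc_int(1)[of i i] by (intro csum_sq(1) sc_meas) auto

lemma csum_sc_integrable: "i \<ge> 1 \<Longrightarrow> integrable M (csum (sc a) i)"
  by (rule square_integrable_imp_integrable[OF csum_sc_measurable csum_sc_sq])

lemma csum_sc_mean:
  assumes "i \<ge> 1"
  shows "expectation (csum (sc a) i) = 0"
proof -
  have "integrable M (\<lambda>\<xi>. sc a i k (Y i k \<xi>, X i k \<xi>))" if "k \<in> {1..c i}" for k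
    using dominated(2)[OF assms that sc_meas sc_dom] by simp
  then have "expectation (csum (sc a) i) = (\<Sum>k=1..c i. expectation (\<lambda>\<xi>. sc a i k (Y i k \<xi>, X i k \<xi>)))"
    unfolding csum_def[abs_def] by (intro Bochner_Integration.integral_sum) auto
  also have "\<dots> = 0" using sc_mean[OF assms] by (intro sum.neutral) auto
  finally show ?thesis .
qed

lemma G_char_tendsto:
  "(\<lambda>n. expectation (\<lambda>\<xi>. cos (G n \<xi> \<bullet> a))) \<longlonglongrightarrow> exp (- (a \<bullet> (\<Sigma> *v a)) / 2)"
  unfolding inner_G
proof (rule char_indep_sum_tendsto[OF indep_csum p, of _ "A0 a"])
  show "(\<lambda>n. 1 / real n * (\<Sum>i=1..n. expectation (\<lambda>\<xi>. (csum (sc a) i \<xi>)\<^sup>2))) \<longlonglongrightarrow> a \<bullet> (\<Sigma> *v a)"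
    using Sigma_lim[of a a] by (simp add: power2_eq_square)
qed (use csum_sc_powr csum_sc_mean sc_meas in auto)

text \<open>A weak law of large numbers with moments of order \<open>p / 2 > 1\<close> only, hence by truncation.\<close>

lemma score_lln:
  assumes \<zeta>: "0 < \<zeta>" and \<eta>: "0 < \<eta>"
  shows "\<forall>\<^sub>F n in sequentially. hp M (\<F> {1..n}) \<zeta>
    (\<lambda>\<xi>. \<bar>(1 / real n) * (\<Sum>i=1..n. csum (sc a) i \<xi> * csum (sc b) i \<xi>) - a \<bullet> (\<Sigma> *v b)\<bar> < \<eta>)"
proof -
  define A where "A = A0 a + A0 b"
  have A: "0 \<le> A" using A0_nonneg by (simp add: A_def)
  define U where "U = (\<lambda>i \<xi>. csum (sc a) i \<xi> * csum (sc b) i \<xi>)"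
  \<comment> \<open>Where \<open>\<bar>U i\<bar>\<close> exceeds the level \<open>m\<close>, it is
    at most \<open>m powr (1 - p / 2) * \<bar>U i\<bar> powr (p / 2)\<close>, since
    \<open>1 - p / 2\<close> is negative. The moment of order \<open>p / 2\<close> of a product of
    two scores is at most \<open>A\<close>, so one large \<open>m\<close> makes all tails small at
    once.\<close>
  have "((\<lambda>m. A * m powr (1 - p / 2)) \<longlongrightarrow> A * 0) at_top"
    using p by (intro tendsto_mult tendsto_const tendsto_neg_powr filterlim_ident) auto
  then have "\<forall>\<^sub>F m in at_top. A * m powr (1 - p / 2) < min (\<eta> / 4) (\<zeta> * \<eta> / 8)"
    using \<zeta> \<eta> by (intro order_tendstoD(2)) auto
  then have "\<forall>\<^sub>F m in at_top. 0 < m \<and> A * m powr (1 - p / 2) < min (\<eta> / 4) (\<zeta> * \<eta> / 8)"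
    using eventually_gt_at_top[of "0::real"] by eventually_elim auto
  from eventually_happens'[OF trivial_limit_at_top_linorder this]
  obtain m where m: "0 < m" "A * m powr (1 - p / 2) < min (\<eta> / 4) (\<zeta> * \<eta> / 8)" by blast
  define \<rho> where "\<rho> = A * m powr (1 - p / 2)"
  have \<rho>: "0 \<le> \<rho>" "\<rho> < \<eta> / 4" "\<rho> < \<zeta> * \<eta> / 8" using m A by (auto simp: \<rho>_def)
  define U1 where "U1 = (\<lambda>i \<xi>. U i \<xi> * of_bool (\<bar>U i \<xi>\<bar> \<le> m))"
  define U2 where "U2 = (\<lambda>i \<xi>. \<bar>U i \<xi>\<bar> * of_bool (m < \<bar>U i \<xi>\<bar>))"
  have U20: "0 \<le> U2 i \<xi>" for i \<xi> by (simp add: U2_def)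
  have Um: "U i \<in> borel_measurable M" if "i \<ge> 1" for i
    unfolding U_def using csum_sc_measurable[OF that] by auto
  have UF: "U i \<in> borel_measurable (\<F> {1..n})" if "i \<in> {1..n}" for i n
    unfolding U_def using that by (intro borel_measurable_times csum_measurable_F sc_meas)
  have U1F: "U1 i \<in> borel_measurable (\<F> {1..n})" "U2 i \<in> borel_measurable (\<F> {1..n})" if "i \<in> {1..n}" for i n
  proof -
    note [measurable] = UF[OF that]
    show "U1 i \<in> borel_measurable (\<F> {1..n})" "U2 i \<in> borel_measurable (\<F> {1..n})"
      unfolding U1_def U2_def of_bool_def by measurable
  qed
  have Ui: "integrable M (U i)" if "i \<ge> 1" for i
    unfolding U_def using that by (intro integrable_mult_square csum_sc_sq csum_sc_measurable)
  have U1i: "integrable M (U1 i)" "integrable M (\<lambda>\<xi>. (U1 i \<xi>)\<^sup>2)" "expectation (\<lambda>\<xi>. (U1 i \<xi>)\<^sup>2) \<le> m\<^sup>2" if "i \<ge> 1" for i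
  proof -
    note [measurable] = Um[OF that]
    have [measurable]: "U1 i \<in> borel_measurable M" unfolding U1_def of_bool_def by measurable
    have b: "\<bar>U1 i \<xi>\<bar> \<le> m" for \<xi> using m by (auto simp: U1_def of_bool_def)
    then have b2: "(U1 i \<xi>)\<^sup>2 \<le> m\<^sup>2" for \<xi> using power_mono[OF b abs_ge_zero, of \<xi> 2] by simp
    show "integrable M (U1 i)" using b by (intro integrable_const_bound[of _ m]) auto
    show i2: "integrable M (\<lambda>\<xi>. (U1 i \<xi>)\<^sup>2)" using b2 by (intro integrable_const_bound[of _ "m\<^sup>2"]) auto
    have "expectation (\<lambda>\<xi>. (U1 i \<xi>)\<^sup>2) \<le> expectation (\<lambda>\<xi>. m\<^sup>2)" using i2 b2 by (intro integral_mono) auto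
    then show "expectation (\<lambda>\<xi>. (U1 i \<xi>)\<^sup>2) \<le> m\<^sup>2" by (simp add: prob_space)
  qed
  have U2i: "integrable M (U2 i)" "expectation (U2 i) \<le> \<rho>" if i: "i \<ge> 1" for i
  proof -
    note [measurable] = Um[OF i]
    have [measurable]: "U2 i \<in> borel_measurable M" unfolding U2_def of_bool_def by measurable
    show i2: "integrable M (U2 i)"
      by (rule Bochner_Integration.integrable_bound[OF Ui[OF i]]) (auto simp: U2_def of_bool_def)
    have le: "U2 i \<xi> \<le> m powr (1 - p / 2) * (\<bar>csum (sc a) i \<xi>\<bar> powr p + \<bar>csum (sc b) i \<xi>\<bar> powr p)" for \<xi>
    proof (cases "m < \<bar>U i \<xi>\<bar>")
      case True
      let ?x = "\<bar>csum (sc a) i \<xi>\<bar>" and ?y = "\<bar>csum (sc b) i \<xi>\<bar>"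
      have U0: "0 < \<bar>U i \<xi>\<bar>" using True m by linarith
      have "\<bar>U i \<xi>\<bar> = \<bar>U i \<xi>\<bar> powr (1 - p / 2) * \<bar>U i \<xi>\<bar> powr (p / 2)"
        using U0 by (simp add: powr_add[symmetric])
      also have "\<dots> \<le> m powr (1 - p / 2) * \<bar>U i \<xi>\<bar> powr (p / 2)"
        using True m p by (intro mult_right_mono powr_mono2') auto
      also have "\<bar>U i \<xi>\<bar> powr (p / 2) \<le> ?x powr p + ?y powr p"
      proof -
        have "\<bar>U i \<xi>\<bar> \<le> (max ?x ?y)\<^sup>2"
          unfolding U_def abs_mult power2_eq_square by (intro mult_mono) auto
        then have "\<bar>U i \<xi>\<bar> powr (p / 2) \<le> ((max ?x ?y)\<^sup>2) powr (p / 2)" using p by (intro powr_mono2) auto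
        also have "\<dots> = (max ?x ?y) powr p"
        proof -
          have "z\<^sup>2 = z powr 2" if "0 \<le> z" for z :: real
            using that by (cases "z = 0") (auto simp: powr_numeral)
          from this[of "max ?x ?y"] have "(max ?x ?y)\<^sup>2 = (max ?x ?y) powr 2" by simp
          then show ?thesis by (simp only: powr_powr) simp
        qed
        also have "\<dots> \<le> ?x powr p + ?y powr p" by (simp add: max_def)
        finally show ?thesis .
      qed
      finally show ?thesis using True m by (simp add: U2_def mult_left_mono)
    next
      case False
      then show ?thesis using m by (simp add: U2_def)
    qed
    have "expectation (U2 i) \<le> expectation (\<lambda>\<xi>. m powr (1 - p / 2) * (\<bar>csum (sc a) i \<xi>\<bar> powr p + \<bar>csum (sc b) i \<xi>\<bar> powr p))"
      using i2 le csum_sc_powr(1)[OF i] by (intro integral_mono) auto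
    also have "\<dots> \<le> m powr (1 - p / 2) * A"
      using csum_sc_powr[OF i] by (simp add: A_def add_mono mult_left_mono)
    finally show "expectation (U2 i) \<le> \<rho>" by (simp add: \<rho>_def mult.commute)
  qed
  have ind: "indep_vars (\<lambda>_. borel) U1 {1..}"
  proof -
    have "(\<lambda>(x :: real, y). x * y * of_bool (\<bar>x * y\<bar> \<le> m)) \<in> borel_measurable (borel \<Otimes>\<^sub>M borel)"
      unfolding of_bool_def by measurable
    from indep_csum2[OF sc_meas sc_meas this] show ?thesis unfolding U1_def U_def by simp
  qed
  have "(\<lambda>n. 36 * m\<^sup>2 / \<eta>\<^sup>2 / real n) \<longlonglongrightarrow> 0" by (rule lim_const_over_n)
  then have e1: "\<forall>\<^sub>F n in sequentially. 36 * m\<^sup>2 / \<eta>\<^sup>2 / real n < \<zeta> / 2" using \<zeta> by (intro order_tendstoD(2)) auto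
  have "\<forall>\<^sub>F n in sequentially. dist ((1 / real n) * (\<Sum>i=1..n. expectation (U i))) (a \<bullet> (\<Sigma> *v b)) < \<eta> / 4"
    unfolding U_def using \<eta> by (intro tendstoD Sigma_lim) auto
  with e1 show ?thesis using eventually_ge_at_top[of 1]
  proof eventually_elim
    case (elim n)
    then have n: "n \<ge> 1" by simp
    have sub: "subalgebra M (\<F> {1..n})" by (rule subalgebra_F) auto
    have v1: "integrable M (\<lambda>\<xi>. ((\<Sum>i\<in>{1..n}. U1 i \<xi>) - (\<Sum>i\<in>{1..n}. expectation (U1 i)))\<^sup>2)"
      "expectation (\<lambda>\<xi>. ((\<Sum>i\<in>{1..n}. U1 i \<xi>) - (\<Sum>i\<in>{1..n}. expectation (U1 i)))\<^sup>2) \<le> (\<Sum>i\<in>{1..n}. expectation (\<lambda>\<xi>. (U1 i \<xi>)\<^sup>2))"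
      using U1i(2) by (intro indep_sum_variance[OF ind]; auto)+
    have "(\<Sum>i\<in>{1..n}. expectation (\<lambda>\<xi>. (U1 i \<xi>)\<^sup>2)) \<le> real (card {1..n}) * m\<^sup>2" using U1i(3) by (intro sum_bounded_above) auto
    then have "hp M (\<F> {1..n}) (real n * m\<^sup>2 / (real n * \<eta> / 6)\<^sup>2) (\<lambda>\<xi>. \<bar>(\<Sum>i=1..n. U1 i \<xi>) - (\<Sum>i=1..n. expectation (U1 i))\<bar> < real n * \<eta> / 6)"
      using v1 n \<eta> U1F by (intro hp_Chebyshev sub borel_measurable_sum) auto
    moreover have "hp M (\<F> {1..n}) (real n * \<rho> / (real n * \<eta> / 4)) (\<lambda>\<xi>. (\<Sum>i=1..n. U2 i \<xi>) < real n * \<eta> / 4)"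
    proof (rule hp_Markov[OF sub])
      have "expectation (\<lambda>\<xi>. \<Sum>i=1..n. U2 i \<xi>) = (\<Sum>i=1..n. expectation (U2 i))" using U2i by (intro Bochner_Integration.integral_sum) auto
      also have "\<dots> \<le> real (card {1..n}) * \<rho>" using U2i by (intro sum_bounded_above) auto
      finally show "expectation (\<lambda>\<xi>. \<Sum>i=1..n. U2 i \<xi>) \<le> real n * \<rho>" by simp
    qed (use U1F U2i U20 n \<eta> in \<open>auto intro!: sum_nonneg Bochner_Integration.integrable_sum borel_measurable_sum\<close>)
    ultimately have "hp M (\<F> {1..n}) (real n * m\<^sup>2 / (real n * \<eta> / 6)\<^sup>2 + real n * \<rho> / (real n * \<eta> / 4))
      (\<lambda>\<xi>. \<bar>(\<Sum>i=1..n. U1 i \<xi>) - (\<Sum>i=1..n. expectation (U1 i))\<bar> < real n * \<eta> / 6 \<and> (\<Sum>i=1..n. U2 i \<xi>) < real n * \<eta> / 4)"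
      by (rule hp_conj[OF sub])
    then show ?case
    proof (rule hp_mono)
      have "real n * m\<^sup>2 / (real n * \<eta> / 6)\<^sup>2 = 36 * m\<^sup>2 / \<eta>\<^sup>2 / real n"
        using n by (simp add: power2_eq_square field_simps)
      moreover have "real n * \<rho> / (real n * \<eta> / 4) \<le> \<zeta> / 2" using n \<eta> \<rho>(3) by (simp add: field_simps)
      ultimately show "real n * m\<^sup>2 / (real n * \<eta> / 6)\<^sup>2 + real n * \<rho> / (real n * \<eta> / 4) \<le> \<zeta>" using elim(1) by linarith
      fix \<xi> assume \<xi>: "\<bar>(\<Sum>i=1..n. U1 i \<xi>) - (\<Sum>i=1..n. expectation (U1 i))\<bar> < real n * \<eta> / 6 \<and> (\<Sum>i=1..n. U2 i \<xi>) < real n * \<eta> / 4"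
      have UU: "\<bar>U i \<xi> - U1 i \<xi>\<bar> = U2 i \<xi>" for i \<xi> by (auto simp: U1_def U2_def of_bool_def)
      have d1: "\<bar>(\<Sum>i=1..n. U i \<xi>) - (\<Sum>i=1..n. U1 i \<xi>)\<bar> \<le> (\<Sum>i=1..n. U2 i \<xi>)"
        unfolding sum_subtractf[symmetric] by (rule order_trans[OF sum_abs]) (simp add: UU)
      have d2: "\<bar>(\<Sum>i=1..n. expectation (U i)) - (\<Sum>i=1..n. expectation (U1 i))\<bar> \<le> real n * (\<eta> / 4)"
      proof -
        have "\<bar>expectation (U i) - expectation (U1 i)\<bar> \<le> \<eta> / 4" if "i \<in> {1..n}" for i
        proof -
          have "expectation (U i) - expectation (U1 i) = expectation (\<lambda>\<xi>. U i \<xi> - U1 i \<xi>)"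
            using Ui U1i that by simp
          also have "\<bar>\<dots>\<bar> \<le> expectation (\<lambda>\<xi>. \<bar>U i \<xi> - U1 i \<xi>\<bar>)" by (rule integral_abs_bound)
          also have "\<dots> \<le> \<rho>" unfolding UU using U2i that by simp
          finally show ?thesis using \<rho> by simp
        qed
        then have "(\<Sum>i=1..n. \<bar>expectation (U i) - expectation (U1 i)\<bar>) \<le> real (card {1..n}) * (\<eta> / 4)" by (intro sum_bounded_above)
        then show ?thesis unfolding sum_subtractf[symmetric] by (intro order_trans[OF sum_abs]) simp
      qed
      \<comment> \<open>In units of \<open>n * \<eta>\<close>: 1/6 from Chebyshev and 1/4 each from
        the tails and their means. Together this is 2/3 and leaves room for the 1/4 from convergence
        of the means.\<close>
      have "\<bar>(\<Sum>i=1..n. U i \<xi>) - (\<Sum>i=1..n. expectation (U i))\<bar> < real n * (\<eta> * 2 / 3)"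
      proof -
        define r where "r = real n * \<eta>"
        have "real n * \<eta> / 6 = r / 6" "real n * \<eta> / 4 = r / 4" "real n * (\<eta> / 4) = r / 4" "real n * (\<eta> * 2 / 3) = r * 2 / 3"
          by (simp_all add: r_def)
        then show ?thesis using conjunct1[OF \<xi>] conjunct2[OF \<xi>] d1 d2 \<eta> n
          by (simp only:)
      qed
      then have "\<bar>(1 / real n) * (\<Sum>i=1..n. U i \<xi>) - (1 / real n) * (\<Sum>i=1..n. expectation (U i))\<bar> < \<eta> * 2 / 3"
        using n by (simp add: diff_divide_distrib[symmetric] divide_less_eq mult.commute)
      then show "\<bar>(1 / real n) * (\<Sum>i=1..n. csum (sc a) i \<xi> * csum (sc b) i \<xi>) - a \<bullet> (\<Sigma> *v b)\<bar> < \<eta>"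
        using elim(2) \<eta> unfolding dist_real_def U_def by linarith
    qed simp
  qed
qed

lemma V_measurable: "n \<ge> 1 \<Longrightarrow> (\<lambda>\<xi>. V n \<beta>0 \<xi> \<bullet> a) \<in> borel_measurable M"
  unfolding inner_V by (intro borel_measurable_times borel_measurable_const borel_measurable_sum W_measurable csum_sc_measurable) auto

lemma V_second_moment:
  assumes n: "n \<ge> 1"
  shows "integrable M (\<lambda>\<xi>. (V n \<beta>0 \<xi> \<bullet> a)\<^sup>2)" "expectation (\<lambda>\<xi>. (V n \<beta>0 \<xi> \<bullet> a)\<^sup>2) \<le> (real cmax)\<^sup>2 * ((norm a)\<^sup>2 * (2 * C))"
proof -
  have m: "(1 / sqrt (real n)) * (\<Sum>i=1..n. expectation (\<lambda>\<xi>. (\<lambda>x. x) (W i \<xi>)) * (\<Sum>k=1..c i. expectation (\<lambda>\<xi>. sc a i k (Y i k \<xi>, X i k \<xi>)))) = 0"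
    using W_mean by simp
  note wsum_second_moment[where t = "sc a" and n = n and v = "(norm a)\<^sup>2 * (2 * C)" and h = "\<lambda>x. x", OF sc_meas sc_int[where n = n] _ _ n]
  from this(2,3)[unfolded m] show "integrable M (\<lambda>\<xi>. (V n \<beta>0 \<xi> \<bullet> a)\<^sup>2)" "expectation (\<lambda>\<xi>. (V n \<beta>0 \<xi> \<bullet> a)\<^sup>2) \<le> (real cmax)\<^sup>2 * ((norm a)\<^sup>2 * (2 * C))"
    unfolding inner_V using C0 by simp_all
qed

lemma V_norm_second_moment:
  assumes n: "n \<ge> 1"
  shows "integrable M (\<lambda>\<xi>. (norm (V n \<beta>0 \<xi>))\<^sup>2)" "expectation (\<lambda>\<xi>. (norm (V n \<beta>0 \<xi>))\<^sup>2) \<le> real CARD('d) * ((real cmax)\<^sup>2 * (2 * C))"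
proof -
  show "integrable M (\<lambda>\<xi>. (norm (V n \<beta>0 \<xi>))\<^sup>2)"
    unfolding norm_sq_vec using V_second_moment(1)[OF n] by simp
  have "expectation (\<lambda>\<xi>. (norm (V n \<beta>0 \<xi>))\<^sup>2) = (\<Sum>j\<in>(UNIV :: 'd set). expectation (\<lambda>\<xi>. (V n \<beta>0 \<xi> \<bullet> axis j 1)\<^sup>2))"
    unfolding norm_sq_vec using V_second_moment(1)[OF n] by simp
  also have "\<dots> \<le> (\<Sum>j\<in>(UNIV :: 'd set). (real cmax)\<^sup>2 * (2 * C))"
    using V_second_moment(2)[OF n, of "axis _ 1"] by (intro sum_mono) simp
  finally show "expectation (\<lambda>\<xi>. (norm (V n \<beta>0 \<xi>))\<^sup>2) \<le> real CARD('d) * ((real cmax)\<^sup>2 * (2 * C))" by simp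
qed

section \<open>Uniform integrability of the wild gradient\<close>

text \<open>A coordinate of the gradient is a sum of independent centred terms, so
  \<open>clamp_excess_indep_sum\<close> reduces its tail to tails of single terms. Those are bounded
  by moments of order \<open>p\<close>, which factorise into weight and score. The scaling
  contributes \<open>n powr (- p / 2) \<le> 1 / n\<close> per term, so the bound does not depend on
  \<open>n\<close>.\<close>

lemma V_coordinate_tail:
  assumes n: "n \<ge> 1" and w: "0 < w" and a: "norm a = 1"
  shows "expectation (\<lambda>\<xi>. (V n \<beta>0 \<xi> \<bullet> a)\<^sup>2 * of_bool (2 * w < \<bar>V n \<beta>0 \<xi> \<bullet> a\<bar>))
    \<le> 4 * (4 * ((real cmax)\<^sup>2 * (2 * C))\<^sup>2 / w\<^sup>2 + C * A0 a * (w / 2) powr (2 - p))"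
proof -
  define Z where "Z = (\<lambda>i \<xi>. (1 / sqrt (real n)) * (W i \<xi> * csum (sc a) i \<xi>))"
  have SZ: "V n \<beta>0 \<xi> \<bullet> a = (\<Sum>i=1..n. Z i \<xi>)" for \<xi> unfolding inner_V Z_def sum_distrib_left ..
  have ind: "indep_vars (\<lambda>_. borel) Z {1..}"
    unfolding Z_def using indep_wsum[where t = "sc a" and h = "\<lambda>x. x" and a = "1 / sqrt (real n)", OF sc_meas] by simp
  have Zm [measurable]: "Z i \<in> borel_measurable M" if "i \<ge> 1" for i
    using ind that by (auto simp: indep_vars_def2)
  have Zsq: "(Z i \<xi>)\<^sup>2 = (1 / real n) * (W i \<xi> * csum (sc a) i \<xi>)\<^sup>2" for i \<xi>
    using n by (simp add: Z_def power_mult_distrib power_divide)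
  have Zi: "integrable M (\<lambda>\<xi>. (Z i \<xi>)\<^sup>2)" if "i \<ge> 1" for i
    unfolding Zsq using that csum_sc_sq by (intro integrable_mult_right weight_csum_sq(1) sc_meas) auto
  have Zmean: "expectation (Z i) = 0" if "i \<ge> 1" for i
    using weight_csum(2)[where t = "sc a" and h = "\<lambda>x. x" and i = i, OF sc_meas] that W_integrable csum_sc_integrable W_mean by (simp add: Z_def)
  have "(\<Sum>i=1..n. expectation (\<lambda>\<xi>. (Z i \<xi>)\<^sup>2)) = (\<Sum>i=1..n. (1 / real n) * expectation (\<lambda>\<xi>. (csum (sc a) i \<xi>)\<^sup>2))"
    unfolding Zsq using csum_sc_sq weight_csum_sq(2)[OF sc_meas] by (intro sum.cong refl) auto
  also have "\<dots> \<le> (\<Sum>i=1..n. (1 / real n) * (real cmax * (\<Sum>k=1..c i. expectation (\<lambda>\<xi>. (sc a i k (Y i k \<xi>, X i k \<xi>))\<^sup>2))))"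
    using sc_int by (intro sum_mono mult_left_mono csum_sq(2) sc_meas) auto
  also have "\<dots> = (1 / real n) * (real cmax * (\<Sum>i=1..n. \<Sum>k=1..c i. expectation (\<lambda>\<xi>. (sc a i k (Y i k \<xi>, X i k \<xi>))\<^sup>2)))"
    by (simp only: sum_distrib_left)
  also have "\<dots> \<le> (1 / real n) * (real cmax * (real n * (real cmax * (2 * C))))"
    using sc_int(2)[of _ n _ a] a C0 by (intro mult_left_mono double_sum_le) auto
  also have "\<dots> = (real cmax)\<^sup>2 * (2 * C)" using n by (simp add: power2_eq_square)
  finally have VV: "(\<Sum>i=1..n. expectation (\<lambda>\<xi>. (Z i \<xi>)\<^sup>2)) \<le> (real cmax)\<^sup>2 * (2 * C)" .
  have tail: "expectation (\<lambda>\<xi>. (Z i \<xi>)\<^sup>2 * of_bool (w / 2 < \<bar>Z i \<xi>\<bar>)) \<le> (1 / real n) * (C * A0 a * (w / 2) powr (2 - p))" if i: "i \<ge> 1" for i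
  proof -
    note [measurable] = Zm[OF i]
    have "(\<lambda>\<xi>. \<bar>W i \<xi>\<bar> powr p) \<in> borel_measurable \<W>" using W_measurable_W[OF i] by measurable
    moreover have "(\<lambda>\<xi>. \<bar>csum (sc a) i \<xi>\<bar> powr p) \<in> borel_measurable (\<F> {1..})"
    proof -
      have [measurable]: "csum (sc a) i \<in> borel_measurable (\<F> {1..})"
        using i by (intro csum_measurable_F sc_meas) auto
      show ?thesis by measurable
    qed
    ultimately have iv: "indep_var borel (\<lambda>\<xi>. \<bar>csum (sc a) i \<xi>\<bar> powr p) borel (\<lambda>\<xi>. \<bar>W i \<xi>\<bar> powr p)"
      by (intro indep_data_weight)
    note prod = indep_var_integrable[OF iv csum_sc_powr(1)[OF i] W_mom(1)[OF i]] indep_var_lebesgue_integral[OF iv csum_sc_powr(1)[OF i] W_mom(1)[OF i]]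
    have le: "(Z i \<xi>)\<^sup>2 * of_bool (w / 2 < \<bar>Z i \<xi>\<bar>) \<le> (w / 2) powr (2 - p) * ((1 / real n) * (\<bar>csum (sc a) i \<xi>\<bar> powr p * \<bar>W i \<xi>\<bar> powr p))" for \<xi>
    proof (cases "w / 2 < \<bar>Z i \<xi>\<bar>")
      case True
      then have z: "0 < \<bar>Z i \<xi>\<bar>" using w by linarith
      have "(Z i \<xi>)\<^sup>2 = \<bar>Z i \<xi>\<bar> powr (2 - p) * \<bar>Z i \<xi>\<bar> powr p"
        using z by (simp add: powr_add[symmetric] powr_numeral)
      also have "\<dots> \<le> (w / 2) powr (2 - p) * \<bar>Z i \<xi>\<bar> powr p"
        using True w p by (intro mult_right_mono powr_mono2') auto
      also have "\<bar>Z i \<xi>\<bar> powr p = (1 / sqrt (real n)) powr p * (\<bar>csum (sc a) i \<xi>\<bar> powr p * \<bar>W i \<xi>\<bar> powr p)"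
        by (simp add: Z_def abs_mult abs_divide powr_mult powr_divide mult.commute)
      also have "(1 / sqrt (real n)) powr p \<le> 1 / real n"
      proof -
        have "(1 / sqrt (real n)) powr p \<le> (1 / sqrt (real n)) powr 2"
          using p n by (intro powr_mono') auto
        also have "\<dots> = 1 / real n" using n by (simp add: powr_numeral power_divide)
        finally show ?thesis .
      qed
      finally show ?thesis using True by (simp add: mult_left_mono mult_right_mono)
    qed simp
    have i1: "integrable M (\<lambda>\<xi>. (Z i \<xi>)\<^sup>2 * of_bool (w / 2 < \<bar>Z i \<xi>\<bar>))"
      by (rule Bochner_Integration.integrable_bound[OF Zi[OF i]]) (auto simp: of_bool_def)
    have "expectation (\<lambda>\<xi>. (Z i \<xi>)\<^sup>2 * of_bool (w / 2 < \<bar>Z i \<xi>\<bar>)) \<le> expectation (\<lambda>\<xi>. (w / 2) powr (2 - p) * ((1 / real n) * (\<bar>csum (sc a) i \<xi>\<bar> powr p * \<bar>W i \<xi>\<bar> powr p)))"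
      using le prod(1) i1 by (intro integral_mono) auto
    also have "\<dots> = (w / 2) powr (2 - p) * ((1 / real n) * (expectation (\<lambda>\<xi>. \<bar>csum (sc a) i \<xi>\<bar> powr p) * expectation (\<lambda>\<xi>. \<bar>W i \<xi>\<bar> powr p)))"
      using prod by simp
    also have "\<dots> \<le> (w / 2) powr (2 - p) * ((1 / real n) * (A0 a * C))"
      using csum_sc_powr(2)[OF i] W_mom(2)[OF i] A0_nonneg by (intro mult_left_mono mult_mono) auto
    finally show ?thesis by (simp add: ac_simps)
  qed
  have "expectation (\<lambda>\<xi>. (clamp_excess w (\<Sum>i=1..n. Z i \<xi>))\<^sup>2) \<le> 4 * ((real cmax)\<^sup>2 * (2 * C))\<^sup>2 / w\<^sup>2 + (\<Sum>i=1..n. expectation (\<lambda>\<xi>. (Z i \<xi>)\<^sup>2 * of_bool (w / 2 < \<bar>Z i \<xi>\<bar>)))"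
    using Zi Zmean VV by (intro clamp_excess_indep_sum[OF ind w])
  also have "(\<Sum>i=1..n. expectation (\<lambda>\<xi>. (Z i \<xi>)\<^sup>2 * of_bool (w / 2 < \<bar>Z i \<xi>\<bar>))) \<le> real (card {1..n}) * ((1 / real n) * (C * A0 a * (w / 2) powr (2 - p)))"
    using tail by (intro sum_bounded_above) auto
  finally have cl: "expectation (\<lambda>\<xi>. (clamp_excess w (V n \<beta>0 \<xi> \<bullet> a))\<^sup>2) \<le> 4 * ((real cmax)\<^sup>2 * (2 * C))\<^sup>2 / w\<^sup>2 + C * A0 a * (w / 2) powr (2 - p)"
    unfolding SZ using n by simp
  note [measurable] = V_measurable[OF n, of a]
  have ic: "integrable M (\<lambda>\<xi>. (clamp_excess w (V n \<beta>0 \<xi> \<bullet> a))\<^sup>2)"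
    by (rule Bochner_Integration.integrable_bound[OF V_second_moment(1)[OF n, of a]])
      (use w clamp_excess_bounds(1)[of w] in \<open>auto simp: abs_le_square_iff\<close>)
  have it: "integrable M (\<lambda>\<xi>. (V n \<beta>0 \<xi> \<bullet> a)\<^sup>2 * of_bool (2 * w < \<bar>V n \<beta>0 \<xi> \<bullet> a\<bar>))"
    by (rule Bochner_Integration.integrable_bound[OF V_second_moment(1)[OF n, of a]]) (auto simp: of_bool_def)
  have "expectation (\<lambda>\<xi>. (V n \<beta>0 \<xi> \<bullet> a)\<^sup>2 * of_bool (2 * w < \<bar>V n \<beta>0 \<xi> \<bullet> a\<bar>)) \<le> expectation (\<lambda>\<xi>. 4 * (clamp_excess w (V n \<beta>0 \<xi> \<bullet> a))\<^sup>2)"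
    using ic it w clamp_excess_bounds(2)[of w] by (intro integral_mono) auto
  also have "\<dots> \<le> 4 * (4 * ((real cmax)\<^sup>2 * (2 * C))\<^sup>2 / w\<^sup>2 + C * A0 a * (w / 2) powr (2 - p))"
    using cl by simp
  finally show ?thesis .
qed

text \<open>The norm is at most the dimension times the largest coordinate, so that coordinate is
  large too and its square carries the norm.\<close>

lemma norm_sq_tail_le:
  fixes x :: "real ^ 'd"
  assumes "0 \<le> t"
  shows "(norm x)\<^sup>2 * of_bool (real CARD('d) * t < norm x) \<le> (real CARD('d))\<^sup>2 * (\<Sum>j\<in>(UNIV :: 'd set). (x \<bullet> axis j 1)\<^sup>2 * of_bool (t < \<bar>x \<bullet> axis j 1\<bar>))"
proof (cases "real CARD('d) * t < norm x")
  case True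
  let ?d = "real CARD('d)"
  define m where "m = Max ((\<lambda>j. \<bar>x \<bullet> axis j 1\<bar>) ` (UNIV :: 'd set))"
  have "m \<in> (\<lambda>j. \<bar>x \<bullet> axis j 1\<bar>) ` (UNIV :: 'd set)" unfolding m_def by (intro Max_in) auto
  then obtain j :: 'd where j: "m = \<bar>x \<bullet> axis j 1\<bar>" by auto
  have "norm x \<le> (\<Sum>j\<in>(UNIV :: 'd set). \<bar>x $ j\<bar>)" by (rule norm_le_l1_cart)
  also have "\<dots> \<le> real (card (UNIV :: 'd set)) * m"
    unfolding m_def by (intro sum_bounded_above Max_ge) (auto simp: inner_axis)
  finally have nx: "norm x \<le> ?d * m" .
  then have "?d * t < ?d * m" using True by linarith
  then have tm: "t < m" by simp
  have "(norm x)\<^sup>2 \<le> (?d * m)\<^sup>2" using nx by (intro power_mono) auto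
  also have "\<dots> = ?d\<^sup>2 * ((x \<bullet> axis j 1)\<^sup>2 * of_bool (t < \<bar>x \<bullet> axis j 1\<bar>))"
    using j tm by (simp add: power_mult_distrib)
  also have "\<dots> \<le> ?d\<^sup>2 * (\<Sum>j\<in>(UNIV :: 'd set). (x \<bullet> axis j 1)\<^sup>2 * of_bool (t < \<bar>x \<bullet> axis j 1\<bar>))"
    by (intro mult_left_mono member_le_sum) auto
  finally show ?thesis using True by simp
next
  case False
  then show ?thesis by (simp add: sum_nonneg)
qed

lemma V_tail:
  assumes \<eta>: "0 < \<eta>"
  obtains w where "1 \<le> w" "\<And>n. n \<ge> 1 \<Longrightarrow> expectation (\<lambda>\<xi>. (norm (V n \<beta>0 \<xi>))\<^sup>2 * of_bool (w < norm (V n \<beta>0 \<xi>))) \<le> \<eta>"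
proof -
  let ?d = "real CARD('d)"
  define k1 where "k1 = 4 * ((real cmax)\<^sup>2 * (2 * C))\<^sup>2"
  define k2 where "k2 = C * (real cmax powr p * (real cmax * C))"
  have "((\<lambda>w. ?d\<^sup>2 * (?d * (4 * (k1 / w\<^sup>2 + k2 * (w / 2) powr (2 - p))))) \<longlongrightarrow> ?d\<^sup>2 * (?d * (4 * (0 + k2 * 0)))) at_top"
  proof (intro tendsto_intros)
    show "((\<lambda>w::real. k1 / w\<^sup>2) \<longlongrightarrow> 0) at_top"
      by (rule real_tendsto_divide_at_top[OF tendsto_const]) (auto intro: filterlim_pow_at_top filterlim_ident)
    have "filterlim (\<lambda>w::real. 1 / 2 * w) at_top at_top"
      by (intro filterlim_tendsto_pos_mult_at_top[OF tendsto_const] filterlim_ident) auto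
    then have "filterlim (\<lambda>w::real. w / 2) at_top at_top" by simp
    then show "((\<lambda>w::real. (w / 2) powr (2 - p)) \<longlongrightarrow> 0) at_top"
      using p by (intro tendsto_neg_powr) auto
  qed
  then have "\<forall>\<^sub>F w in at_top. ?d\<^sup>2 * (?d * (4 * (k1 / w\<^sup>2 + k2 * (w / 2) powr (2 - p)))) < \<eta>"
    using \<eta> by (intro order_tendstoD(2)) auto
  then have "\<forall>\<^sub>F w in at_top. 1 \<le> w \<and> ?d\<^sup>2 * (?d * (4 * (k1 / w\<^sup>2 + k2 * (w / 2) powr (2 - p)))) < \<eta>"
    using eventually_ge_at_top[of "1::real"] by eventually_elim auto
  from eventually_happens'[OF trivial_limit_at_top_linorder this]
  obtain w where w: "1 \<le> w" "?d\<^sup>2 * (?d * (4 * (k1 / w\<^sup>2 + k2 * (w / 2) powr (2 - p)))) < \<eta>" by blast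
  have "expectation (\<lambda>\<xi>. (norm (V n \<beta>0 \<xi>))\<^sup>2 * of_bool (?d * (2 * w) < norm (V n \<beta>0 \<xi>))) \<le> \<eta>" if n: "n \<ge> 1" for n
  proof -
    note [measurable] = V_measurable[OF n]
    have it: "integrable M (\<lambda>\<xi>. (V n \<beta>0 \<xi> \<bullet> a)\<^sup>2 * of_bool (2 * w < \<bar>V n \<beta>0 \<xi> \<bullet> a\<bar>))" for a
      by (rule Bochner_Integration.integrable_bound[OF V_second_moment(1)[OF n, of a]]) (auto simp: of_bool_def)
    have nm: "(\<lambda>\<xi>. norm (V n \<beta>0 \<xi>)) \<in> borel_measurable M"
    proof -
      have "(\<lambda>\<xi>. sqrt ((norm (V n \<beta>0 \<xi>))\<^sup>2)) \<in> borel_measurable M" unfolding norm_sq_vec by measurable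
      then show ?thesis by simp
    qed
    have in1: "integrable M (\<lambda>\<xi>. (norm (V n \<beta>0 \<xi>))\<^sup>2 * of_bool (?d * (2 * w) < norm (V n \<beta>0 \<xi>)))"
      by (rule Bochner_Integration.integrable_bound[OF V_norm_second_moment(1)[OF n]]) (use nm in \<open>auto simp: of_bool_def\<close>)
    have "expectation (\<lambda>\<xi>. (norm (V n \<beta>0 \<xi>))\<^sup>2 * of_bool (?d * (2 * w) < norm (V n \<beta>0 \<xi>)))
      \<le> expectation (\<lambda>\<xi>. ?d\<^sup>2 * (\<Sum>j\<in>(UNIV :: 'd set). (V n \<beta>0 \<xi> \<bullet> axis j 1)\<^sup>2 * of_bool (2 * w < \<bar>V n \<beta>0 \<xi> \<bullet> axis j 1\<bar>)))"
      using in1 it w norm_sq_tail_le[of "2 * w"] by (intro integral_mono integrable_mult_right Bochner_Integration.integrable_sum) auto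
    also have "\<dots> = ?d\<^sup>2 * (\<Sum>j\<in>(UNIV :: 'd set). expectation (\<lambda>\<xi>. (V n \<beta>0 \<xi> \<bullet> axis j 1)\<^sup>2 * of_bool (2 * w < \<bar>V n \<beta>0 \<xi> \<bullet> axis j 1\<bar>)))"
      using it by (simp only: integral_mult_right_zero Bochner_Integration.integral_sum)
    also have "\<dots> \<le> ?d\<^sup>2 * (\<Sum>j\<in>(UNIV :: 'd set). 4 * (k1 / w\<^sup>2 + k2 * (w / 2) powr (2 - p)))"
    proof (intro mult_left_mono sum_mono)
      fix j :: 'd
      show "expectation (\<lambda>\<xi>. (V n \<beta>0 \<xi> \<bullet> axis j 1)\<^sup>2 * of_bool (2 * w < \<bar>V n \<beta>0 \<xi> \<bullet> axis j 1\<bar>)) \<le> 4 * (k1 / w\<^sup>2 + k2 * (w / 2) powr (2 - p))"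
        using V_coordinate_tail[OF n, of w "axis j 1"] w by (simp add: k1_def k2_def A0_def)
    qed simp
    also have "\<dots> \<le> \<eta>" using w(2) by simp
    finally show ?thesis .
  qed
  moreover have "1 \<le> ?d * (2 * w)"
  proof -
    have "1 * 1 \<le> ?d * (2 * w)" using w by (intro mult_mono) auto
    then show ?thesis by simp
  qed
  ultimately show ?thesis using that by blast
qed

section \<open>Linearisation of the two estimators\<close>

definition uh :: "nat \<Rightarrow> 'a \<Rightarrow> real ^ 'd" where
  "uh n \<xi> = sqrt (real n) *\<^sub>R (bhat n \<xi> - \<beta>0)"

text \<open>Centred at \<open>\<beta>0\<close> rather than at \<open>bhat\<close>, so that both
  estimators minimise perturbations of the same function \<open>H\<close> over the same set.\<close>

definition us :: "nat \<Rightarrow> 'a \<Rightarrow> real ^ 'd" where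
  "us n \<xi> = sqrt (real n) *\<^sub>R (bstar n \<xi> - \<beta>0)"

definition dom :: "nat \<Rightarrow> (real ^ 'd) set" where
  "dom n = {u. \<beta>0 + u /\<^sub>R sqrt (real n) \<in> B}"

lemma unscale: "n \<ge> 1 \<Longrightarrow> \<beta>0 + (sqrt (real n) *\<^sub>R (b - \<beta>0)) /\<^sub>R sqrt (real n) = b"
  by simp

lemma uh_dom: "n \<ge> 1 \<Longrightarrow> \<xi> \<in> space M \<Longrightarrow> uh n \<xi> \<in> dom n"
  using bhat[of n \<xi>] unfolding dom_def uh_def is_arg_min_def by (simp add: unscale)

lemma us_dom: "n \<ge> 1 \<Longrightarrow> \<xi> \<in> space M \<Longrightarrow> us n \<xi> \<in> dom n"
  using bstar[of n \<xi>] unfolding dom_def us_def is_arg_min_def by (simp add: unscale)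

lemma dom_bound:
  assumes "n \<ge> 1" "u \<in> dom n"
  shows "norm u \<le> Dm * sqrt (real n)"
proof -
  have "norm (u /\<^sub>R sqrt (real n)) \<le> Dm" using B(2)[of "\<beta>0 + u /\<^sub>R sqrt (real n)"] assms by (simp add: dom_def)
  then show ?thesis using assms(1) by (simp add: field_simps)
qed

lemma cball_dom: "n \<ge> 1 \<Longrightarrow> K \<le> r0 * sqrt (real n) \<Longrightarrow> cball 0 K \<subseteq> dom n"
proof
  fix u assume n: "n \<ge> 1" and K: "K \<le> r0 * sqrt (real n)" and u: "u \<in> cball (0 :: real ^ 'd) K"
  then have "norm u \<le> r0 * sqrt (real n)" by simp
  then have "norm (u /\<^sub>R sqrt (real n)) \<le> r0" using n by (simp add: field_simps)
  then have "\<beta>0 + u /\<^sub>R sqrt (real n) \<in> cball \<beta>0 r0" by (simp add: dist_norm)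
  then show "u \<in> dom n" using B(1) by (auto simp: dom_def)
qed

lemma uh_min:
  assumes n: "n \<ge> 1" and \<xi>: "\<xi> \<in> space M" and u: "u \<in> dom n"
  shows "H n (uh n \<xi>) \<xi> - G n \<xi> \<bullet> uh n \<xi> \<le> H n u \<xi> - G n \<xi> \<bullet> u"
proof -
  let ?f = "qr_objective c (\<lambda>i k. Y i k \<xi>) (\<lambda>i k. X i k \<xi>) n \<tau>"
  have "?f (bhat n \<xi>) \<le> ?f (\<beta>0 + u /\<^sub>R sqrt (real n))"
    using bhat[OF n \<xi>] u by (auto simp: is_arg_min_linorder dom_def)
  then have "real n * ?f (\<beta>0 + uh n \<xi> /\<^sub>R sqrt (real n)) \<le> real n * ?f (\<beta>0 + u /\<^sub>R sqrt (real n))"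
    unfolding uh_def unscale[OF n] by (simp add: mult_left_mono)
  then show ?thesis unfolding objective_expansion[OF n] by linarith
qed

lemma us_min:
  assumes n: "n \<ge> 1" and \<xi>: "\<xi> \<in> space M" and u: "u \<in> dom n"
  defines "w \<equiv> V n (bhat n \<xi>) \<xi>"
  shows "H n (us n \<xi>) \<xi> - (G n \<xi> - w) \<bullet> us n \<xi> \<le> H n u \<xi> - (G n \<xi> - w) \<bullet> u"
proof -
  let ?g = "wild_objective c (\<lambda>i. W i \<xi>) (\<lambda>i k. Y i k \<xi>) (\<lambda>i k. X i k \<xi>) n \<tau> (bhat n \<xi>)"
  let ?f = "qr_objective c (\<lambda>i k. Y i k \<xi>) (\<lambda>i k. X i k \<xi>) n \<tau>"
  have "?g (bstar n \<xi>) \<le> ?g (\<beta>0 + u /\<^sub>R sqrt (real n))"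
    using bstar[OF n \<xi>] u by (auto simp: is_arg_min_linorder dom_def)
  then have le: "real n * ?g (\<beta>0 + us n \<xi> /\<^sub>R sqrt (real n)) \<le> real n * ?g (\<beta>0 + u /\<^sub>R sqrt (real n))"
    unfolding us_def unscale[OF n] by (simp add: mult_left_mono)
  have "real n * ?g (\<beta>0 + v /\<^sub>R sqrt (real n)) = real n * ?f (\<beta>0 + v /\<^sub>R sqrt (real n)) + (sqrt (real n) * (w \<bullet> \<beta>0) + w \<bullet> v)" for v
  proof -
    have r: "real n * (x / sqrt (real n)) = sqrt (real n) * x" for x
      using n by (simp add: field_simps)
    have "?g b = ?f b + (w \<bullet> b) / sqrt (real n)" for b
      unfolding wild_objective_def w_def V_def ..
    then have "real n * ?g (\<beta>0 + v /\<^sub>R sqrt (real n)) = real n * ?f (\<beta>0 + v /\<^sub>R sqrt (real n)) + sqrt (real n) * (w \<bullet> (\<beta>0 + v /\<^sub>R sqrt (real n)))"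
      by (simp only: distrib_left r)
    also have "sqrt (real n) * (w \<bullet> (\<beta>0 + v /\<^sub>R sqrt (real n))) = sqrt (real n) * (w \<bullet> \<beta>0) + w \<bullet> v"
      using n by (simp add: inner_add_right distrib_left)
    finally show ?thesis .
  qed
  with le show ?thesis unfolding objective_expansion[OF n] by (simp add: inner_diff_left)
qed

text \<open>None of the three conditions involves the weights, so the witnessing events belong to
  the data. The weights enter \<open>perturbed_argmin\<close> only through \<open>w\<close>.\<close>

definition good :: "nat \<Rightarrow> real \<Rightarrow> real \<Rightarrow> real \<Rightarrow> real \<Rightarrow> real \<Rightarrow> 'a \<Rightarrow> bool" where
  "good n \<kappa> K g0 K' \<eta> \<xi> \<longleftrightarrow>
    (\<forall>u. K \<le> norm u \<longrightarrow> norm u \<le> Dm * sqrt (real n) \<longrightarrow> \<kappa> * (norm u)\<^sup>2 \<le> H n u \<xi>) \<and>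
    (\<forall>u. norm u \<le> K' \<longrightarrow> \<bar>H n u \<xi> - (u \<bullet> (J *v u)) / 2\<bar> \<le> \<eta>) \<and> norm (G n \<xi>) \<le> g0"

text \<open>The order of quantifiers matters. \<open>\<kappa>\<close> is universal, \<open>K\<close>
  and \<open>g0\<close> depend on the error probability alone, and only then are the radius
  \<open>K'\<close> and the precision \<open>\<eta>\<close> chosen, in terms of the former.\<close>

lemma good_hp:
  obtains \<kappa> where "0 < \<kappa>" "\<And>\<zeta>. 0 < \<zeta> \<Longrightarrow> \<exists>K>0. \<exists>g0>0. \<forall>K'>0. \<forall>\<eta>>0. \<forall>\<^sub>F n in sequentially.
    n \<ge> 1 \<and> K' \<le> r0 * sqrt (real n) \<and> hp M (\<F> {1..n}) \<zeta> (good n \<kappa> K g0 K' \<eta>)"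
proof -
  obtain \<kappa> where \<kappa>: "0 < \<kappa>" "\<And>\<eta>. 0 < \<eta> \<Longrightarrow> \<exists>K>0. \<forall>\<^sub>F n in sequentially.
    hp M (\<F> {1..n}) \<eta> (\<lambda>\<xi>. \<forall>u. K \<le> norm u \<longrightarrow> norm u \<le> Dm * sqrt (real n) \<longrightarrow> \<kappa> * (norm u)\<^sup>2 \<le> H n u \<xi>)"
    using growth[OF B(3)] by blast
  have "\<exists>K>0. \<exists>g0>0. \<forall>K'>0. \<forall>\<eta>>0. \<forall>\<^sub>F n in sequentially.
    n \<ge> 1 \<and> K' \<le> r0 * sqrt (real n) \<and> hp M (\<F> {1..n}) \<zeta> (good n \<kappa> K g0 K' \<eta>)" if \<zeta>: "0 < \<zeta>" for \<zeta>
  proof -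
    have \<zeta>3: "0 < \<zeta> / 3" using \<zeta> by simp
    obtain K where K: "0 < K" "\<forall>\<^sub>F n in sequentially.
      hp M (\<F> {1..n}) (\<zeta> / 3) (\<lambda>\<xi>. \<forall>u. K \<le> norm u \<longrightarrow> norm u \<le> Dm * sqrt (real n) \<longrightarrow> \<kappa> * (norm u)\<^sup>2 \<le> H n u \<xi>)"
      using \<kappa>(2)[OF \<zeta>3] by blast
    obtain g0 where g0: "0 < g0" "\<And>n. n \<ge> 1 \<Longrightarrow> hp M (\<F> {1..n}) (\<zeta> / 3) (\<lambda>\<xi>. norm (G n \<xi>) \<le> g0)"
      using G_tight[OF \<zeta>3] by blast
    have "\<forall>\<^sub>F n in sequentially. n \<ge> 1 \<and> K' \<le> r0 * sqrt (real n) \<and> hp M (\<F> {1..n}) \<zeta> (good n \<kappa> K g0 K' \<eta>)"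
      if K': "0 < K'" and \<eta>: "0 < \<eta>" for K' \<eta>
    proof -
      have "filterlim (\<lambda>n. r0 * sqrt (real n)) at_top sequentially"
        using pos by (intro filterlim_tendsto_pos_mult_at_top[OF tendsto_const] filterlim_compose[OF sqrt_at_top] filterlim_real_sequentially)
      then have "\<forall>\<^sub>F n in sequentially. K' \<le> r0 * sqrt (real n)" by (simp add: filterlim_at_top)
      then show ?thesis using K(2) quadratic_approx[OF K' \<eta> \<zeta>3] eventually_ge_at_top[of 1]
      proof eventually_elim
        case (elim n)
        have sub: "subalgebra M (\<F> {1..n})" by (rule subalgebra_F) auto
        from hp_conj[OF sub elim(2) hp_conj[OF sub elim(3) g0(2)[OF elim(4)]]]
        have "hp M (\<F> {1..n}) \<zeta> (good n \<kappa> K g0 K' \<eta>)"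
          by (rule hp_mono) (auto simp: good_def)
        then show ?case using elim by blast
      qed
    qed
    then show ?thesis using K(1) g0(1) by blast
  qed
  with \<kappa>(1) show ?thesis using that by blast
qed

lemma good_perturbed_argmin:
  assumes g: "good n \<kappa> K g0 K' \<eta> \<xi>" and n: "n \<ge> 1" and \<xi>: "\<xi> \<in> space M"
    and K': "K' \<le> r0 * sqrt (real n)" and pos': "0 < \<kappa>" "0 < K" "0 \<le> w0"
    and Kw: "K + (g0 + w0) / \<kappa> \<le> K'" "(g0 + w0) / lam \<le> K'"
    and v: "v \<in> dom n" "\<And>u. u \<in> dom n \<Longrightarrow> H n v \<xi> - (G n \<xi> - w) \<bullet> v \<le> H n u \<xi> - (G n \<xi> - w) \<bullet> u"
  shows "perturbed_argmin J lam (\<lambda>u. H n u \<xi>) (dom n) (G n \<xi>) w (uh n \<xi>) v \<kappa> K K' \<eta> g0 w0"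
proof
  show "cball 0 K' \<subseteq> dom n" by (rule cball_dom[OF n K'])
  show "\<kappa> * (norm u)\<^sup>2 \<le> H n u \<xi>" if "u \<in> dom n" "K \<le> norm u" for u
    using g that dom_bound[OF n that(1)] by (auto simp: good_def)
qed (use g pos pos' Kw v uh_dom[OF n \<xi>] uh_min[OF n \<xi>] J_sym J_pos in \<open>auto simp: good_def\<close>)

lemma bhat_linear:
  assumes \<zeta>: "0 < \<zeta>" and \<theta>: "0 < \<theta>"
  shows "\<forall>\<^sub>F n in sequentially. hp M M \<zeta> (\<lambda>\<xi>. norm (uh n \<xi> - matrix_inv J *v G n \<xi>) \<le> \<theta>)"
proof -
  obtain \<kappa> where \<kappa>: "0 < \<kappa>" "\<And>\<zeta>. 0 < \<zeta> \<Longrightarrow> \<exists>K>0. \<exists>g0>0. \<forall>K'>0. \<forall>\<eta>>0. \<forall>\<^sub>F n in sequentially.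
    n \<ge> 1 \<and> K' \<le> r0 * sqrt (real n) \<and> hp M (\<F> {1..n}) \<zeta> (good n \<kappa> K g0 K' \<eta>)"
    using good_hp by blast
  obtain K g0 where Kg: "0 < K" "0 < g0" "\<forall>K'>0. \<forall>\<eta>>0. \<forall>\<^sub>F n in sequentially.
    n \<ge> 1 \<and> K' \<le> r0 * sqrt (real n) \<and> hp M (\<F> {1..n}) \<zeta> (good n \<kappa> K g0 K' \<eta>)"
    using \<kappa>(2)[OF \<zeta>] by blast
  define K' where "K' = K + g0 / \<kappa> + g0 / lam"
  have K': "0 < K'" "K + (g0 + 0) / \<kappa> \<le> K'" "(g0 + 0) / lam \<le> K'" using Kg \<kappa> pos by (auto simp: K'_def add_pos_pos)
  define \<eta> where "\<eta> = lam * \<theta>\<^sup>2 / 4"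
  have \<eta>: "0 < \<eta>" using pos \<theta> by (simp add: \<eta>_def)
  have "\<forall>\<^sub>F n in sequentially. n \<ge> 1 \<and> K' \<le> r0 * sqrt (real n) \<and> hp M (\<F> {1..n}) \<zeta> (good n \<kappa> K g0 K' \<eta>)"
    using Kg(3) K'(1) \<eta> by blast
  then show ?thesis
  proof eventually_elim
    case (elim n)
    then have n: "n \<ge> 1" by simp
    have "hp M M \<zeta> (good n \<kappa> K g0 K' \<eta>)" using elim subalgebra_F[of "{1..n}"] by (auto intro: hp_subalgebra)
    then show ?case
    proof (rule hp_mono)
      fix \<xi> assume \<xi>: "\<xi> \<in> space M" and gd: "good n \<kappa> K g0 K' \<eta> \<xi>"
      \<comment> \<open>No perturbation here: \<open>w\<close> and \<open>w0\<close> are zero, and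
        the estimator itself takes the place of the perturbed minimiser.\<close>
      interpret pa: perturbed_argmin J lam "\<lambda>u. H n u \<xi>" "dom n" "G n \<xi>" 0 "uh n \<xi>" "uh n \<xi>" \<kappa> K K' \<eta> g0 0
        using elim \<kappa>(1) Kg K' uh_dom[OF n \<xi>] uh_min[OF n \<xi>] by (intro good_perturbed_argmin[OF gd n \<xi>]) auto
      have "lam * (norm (uh n \<xi> - matrix_inv J *v G n \<xi>))\<^sup>2 \<le> lam * \<theta>\<^sup>2"
        using pa.uh_linear by (simp add: \<eta>_def)
      then have "(norm (uh n \<xi> - matrix_inv J *v G n \<xi>))\<^sup>2 \<le> \<theta>\<^sup>2"
        by (rule mult_left_le_imp_le[OF _ pos(3)])
      then show "norm (uh n \<xi> - matrix_inv J *v G n \<xi>) \<le> \<theta>"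
        by (rule power2_le_imp_le) (use \<theta> in linarith)
    qed auto
  qed
qed

lemma V_norm_measurable: "n \<ge> 1 \<Longrightarrow> (\<lambda>\<xi>. norm (V n \<beta>0 \<xi>)) \<in> borel_measurable M"
proof -
  assume n: "n \<ge> 1"
  note [measurable] = V_measurable[OF n]
  have "(\<lambda>\<xi>. sqrt ((norm (V n \<beta>0 \<xi>))\<^sup>2)) \<in> borel_measurable M" unfolding norm_sq_vec by measurable
  then show ?thesis by simp
qed

text \<open>Either \<open>v\<close> carries at least half of \<open>w\<close>, so that
  \<open>v\<close> is itself in its tail, or the difference does.\<close>

lemma tail_transfer:
  fixes w v :: "'b::real_normed_vector"
  assumes t: "0 < t" "t < norm w" and D: "(norm (w - v))\<^sup>2 \<le> D"
  shows "(norm w)\<^sup>2 \<le> 4 * ((norm v)\<^sup>2 * of_bool (t / 2 < norm v)) + 4 * D"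
proof (cases "norm (w - v) \<le> norm v")
  case True
  then have "norm w \<le> 2 * norm v" using norm_triangle_ineq[of "w - v" v] by simp
  moreover from this have "t / 2 < norm v" using t by simp
  moreover have "0 \<le> D" by (rule order_trans[OF zero_le_power2 D])
  moreover have "(norm w)\<^sup>2 \<le> (2 * norm v)\<^sup>2" using calculation(1) by (intro power_mono) auto
  ultimately show ?thesis by (simp add: power_mult_distrib)
next
  case False
  then have "norm w \<le> 2 * norm (w - v)" using norm_triangle_ineq[of "w - v" v] by simp
  then have "(norm w)\<^sup>2 \<le> (2 * norm (w - v))\<^sup>2" by (intro power_mono) auto
  then have "(norm w)\<^sup>2 \<le> 4 * D" using D by (simp add: power_mult_distrib)
  moreover have "0 \<le> 4 * ((norm v)\<^sup>2 * of_bool (t / 2 < norm v))" by simp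
  ultimately show ?thesis by linarith
qed

text \<open>The event \<open>A\<close> is measurable with respect to the data, so conditional expectations can be localised to it.\<close>

lemma bstar_linear:
  assumes \<zeta>: "0 < \<zeta>" and \<theta>: "0 < \<theta>"
  shows "\<forall>\<^sub>F n in sequentially. n \<ge> 1 \<and> (\<exists>A\<in>sets (\<F> {1..n}). 1 - \<zeta> \<le> prob A \<and>
    (\<exists>D. integrable M D \<and> expectation D \<le> \<theta> \<and> (\<forall>\<xi>. 0 \<le> D \<xi>) \<and>
      (\<forall>\<xi>\<in>A. (norm (us n \<xi> - uh n \<xi> + matrix_inv J *v V n \<beta>0 \<xi>))\<^sup>2 \<le> D \<xi>)))"
proof -
  obtain \<kappa> where \<kappa>: "0 < \<kappa>" "\<And>\<zeta>. 0 < \<zeta> \<Longrightarrow> \<exists>K>0. \<exists>g0>0. \<forall>K'>0. \<forall>\<eta>>0. \<forall>\<^sub>F n in sequentially.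
    n \<ge> 1 \<and> K' \<le> r0 * sqrt (real n) \<and> hp M (\<F> {1..n}) \<zeta> (good n \<kappa> K g0 K' \<eta>)"
    using good_hp by blast
  obtain K g0 where Kg: "0 < K" "0 < g0" "\<forall>K'>0. \<forall>\<eta>>0. \<forall>\<^sub>F n in sequentially.
    n \<ge> 1 \<and> K' \<le> r0 * sqrt (real n) \<and> hp M (\<F> {1..n}) \<zeta> (good n \<kappa> K g0 K' \<eta>)"
    using \<kappa>(2)[OF \<zeta>] by blast
  \<comment> \<open>Once \<open>norm w \<ge> 1\<close>, the affine bound of
    \<open>difference_bound\<close> is at most \<open>a * norm w\<close>.\<close>
  define a where "a = (2 * K + 2 * g0 / \<kappa>) + (1 / \<kappa> + 1 / lam)"
  have a: "0 < a" "0 \<le> 2 * K + 2 * g0 / \<kappa>" "0 \<le> 1 / \<kappa> + 1 / lam"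
  proof -
    have "0 < 2 * K" "0 < 2 * g0 / \<kappa>" "0 < 1 / \<kappa>" "0 < 1 / lam" using Kg(1,2) \<kappa>(1) pos(3) by simp_all
    then show "0 < a" "0 \<le> 2 * K + 2 * g0 / \<kappa>" "0 \<le> 1 / \<kappa> + 1 / lam" unfolding a_def by linarith+
  qed
  define \<theta>1 where "\<theta>1 = \<theta> / (24 * a\<^sup>2)"
  have \<theta>1: "0 < \<theta>1" "8 * a\<^sup>2 * \<theta>1 = \<theta> / 3" using \<theta> a by (simp_all add: \<theta>1_def)
  obtain t0 where t0: "1 \<le> t0" "\<And>n. n \<ge> 1 \<Longrightarrow> expectation (\<lambda>\<xi>. (norm (V n \<beta>0 \<xi>))\<^sup>2 * of_bool (t0 < norm (V n \<beta>0 \<xi>))) \<le> \<theta>1"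
    using V_tail[OF \<theta>1(1)] by blast
  define t where "t = 2 * t0"
  have t: "1 \<le> t" "t / 2 = t0" using t0 by (auto simp: t_def)
  define K' where "K' = K + (g0 + t) / \<kappa> + (g0 + t) / lam"
  have K': "0 < K'" "K + (g0 + t) / \<kappa> \<le> K'" "(g0 + t) / lam \<le> K'" using Kg \<kappa>(1) pos t by (auto simp: K'_def add_pos_pos)
  define \<eta> where "\<eta> = \<theta> * lam / 96"
  have \<eta>: "0 < \<eta>" "2 * (16 * \<eta> / lam) = \<theta> / 3" using \<theta> pos by (simp_all add: \<eta>_def)
  define k0 where "k0 = K + g0 / \<kappa>"
  have k0: "0 \<le> k0" using Kg \<kappa>(1) by (simp add: k0_def)
  \<comment> \<open>The total coefficient of \<open>Dx\<close> in the final estimate: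
    \<open>8 * a\<^sup>2\<close> from the tail of the gradient at the estimator, and
    \<open>2 / lam\<^sup>2\<close> from exchanging that gradient for the one at
    \<open>\<beta>0\<close>.\<close>
  define b where "b = 8 * a\<^sup>2 + 2 / lam\<^sup>2"
  have b: "0 < b" using a pos by (simp add: b_def add_pos_pos)
  have "0 < \<theta> / (3 * b)" using \<theta> b by simp
  note wi = wild_increment[OF k0 this]
  have "\<forall>\<^sub>F n in sequentially. n \<ge> 1 \<and> K' \<le> r0 * sqrt (real n) \<and> hp M (\<F> {1..n}) \<zeta> (good n \<kappa> K g0 K' \<eta>)"
    using Kg(3) K'(1) \<eta>(1) by blast
  with wi show ?thesis
  proof eventually_elim
    case (elim n)
    then have n: "n \<ge> 1" by simp
    obtain Dx where Dx: "integrable M Dx" "expectation Dx \<le> \<theta> / (3 * b)" "\<And>\<xi>. 0 \<le> Dx \<xi>"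
      "\<And>\<xi> u. norm u \<le> k0 \<Longrightarrow> (norm (V n (\<beta>0 + u /\<^sub>R sqrt (real n)) \<xi> - V n \<beta>0 \<xi>))\<^sup>2 \<le> Dx \<xi>"
      using elim(1) by blast
    have "hp M (\<F> {1..n}) \<zeta> (good n \<kappa> K g0 K' \<eta>)" using elim(2) by blast
    then obtain A where A: "A \<in> sets (\<F> {1..n})" "1 - \<zeta> \<le> prob A" "\<And>\<xi>. \<xi> \<in> A \<Longrightarrow> good n \<kappa> K g0 K' \<eta> \<xi>"
      unfolding hp_def by blast
    define Tl where "Tl = (\<lambda>\<xi>. (norm (V n \<beta>0 \<xi>))\<^sup>2 * of_bool (t0 < norm (V n \<beta>0 \<xi>)))"
    note [measurable] = V_norm_measurable[OF n]
    have Tl: "integrable M Tl" "expectation Tl \<le> \<theta>1" "\<And>\<xi>. 0 \<le> Tl \<xi>"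
    proof -
      show "integrable M Tl"
        unfolding Tl_def by (rule Bochner_Integration.integrable_bound[OF V_norm_second_moment(1)[OF n]]) (auto simp: of_bool_def)
      show "expectation Tl \<le> \<theta>1" unfolding Tl_def by (rule t0(2)[OF n])
    qed (simp add: Tl_def)
    \<comment> \<open>The error for moderate gradients, the tail of the gradient at
      \<open>\<beta>0\<close>, and the increment of the gradient. Each has expectation at most
      \<open>\<theta> / 3\<close>.\<close>
    define D where "D = (\<lambda>\<xi>. \<theta> / 3 + 8 * a\<^sup>2 * Tl \<xi> + b * Dx \<xi>)"
    have "integrable M D" unfolding D_def using Tl Dx by simp
    moreover have "expectation D \<le> \<theta>"
    proof -
      have "expectation D = \<theta> / 3 + 8 * a\<^sup>2 * expectation Tl + b * expectation Dx"
        unfolding D_def using Tl Dx by (simp add: prob_space)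
      also have "\<dots> \<le> \<theta> / 3 + 8 * a\<^sup>2 * \<theta>1 + b * (\<theta> / (3 * b))"
        using Tl(2) Dx(2) b by (intro add_mono mult_left_mono) auto
      also have "\<dots> = \<theta>" using \<theta>1(2) b by simp
      finally show ?thesis .
    qed
    moreover have "0 \<le> D \<xi>" for \<xi> unfolding D_def using Tl(3) Dx(3) \<theta> b by (intro add_nonneg_nonneg mult_nonneg_nonneg) auto
    moreover have "(norm (us n \<xi> - uh n \<xi> + matrix_inv J *v V n \<beta>0 \<xi>))\<^sup>2 \<le> D \<xi>" if "\<xi> \<in> A" for \<xi>
    proof -
      have \<xi>: "\<xi> \<in> space M" using A(1) that sets.sets_into_space by fastforce
      \<comment> \<open>The bootstrap objective contains the gradient at the estimator, but only the
        gradient at \<open>\<beta>0\<close> is a sum of independent terms. They are exchanged at the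
        cost \<open>Dx\<close>, which is uniform over the ball that contains the rescaled
        estimator.\<close>
      define w where "w = V n (bhat n \<xi>) \<xi>"
      interpret pa: perturbed_argmin J lam "\<lambda>u. H n u \<xi>" "dom n" "G n \<xi>" w "uh n \<xi>" "us n \<xi>" \<kappa> K K' \<eta> g0 t
        using elim(2) \<kappa>(1) Kg K' t us_dom[OF n \<xi>] us_min[OF n \<xi>] by (intro good_perturbed_argmin[OF A(3)[OF that] n \<xi>]) (auto simp: w_def)
      have "norm (uh n \<xi>) \<le> k0" using pa.uh_bound by (simp add: k0_def)
      then have wv: "(norm (w - V n \<beta>0 \<xi>))\<^sup>2 \<le> Dx \<xi>"
        unfolding w_def uh_def using Dx(4)[of "sqrt (real n) *\<^sub>R (bhat n \<xi> - \<beta>0)" \<xi>] unfolding unscale[OF n] by blast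
      let ?\<Delta> = "us n \<xi> - uh n \<xi> + matrix_inv J *v w"
      have \<Delta>: "(norm ?\<Delta>)\<^sup>2 \<le> 16 * \<eta> / lam + a\<^sup>2 * (4 * Tl \<xi> + 4 * Dx \<xi>)"
      proof (cases "norm w \<le> t")
        case True
        have "0 \<le> a\<^sup>2 * (4 * Tl \<xi> + 4 * Dx \<xi>)" using Tl(3) Dx(3) by simp
        then show ?thesis using pa.difference_small[OF True] by linarith
      next
        case False
        have w1: "1 \<le> norm w" using False t by linarith
        have "norm ?\<Delta> \<le> (2 * K + 2 * g0 / \<kappa>) * norm w + (1 / \<kappa> + 1 / lam) * norm w"
          using pa.difference_bound mult_left_mono[OF w1 a(2)] by simp
        also have "\<dots> = a * norm w" by (simp add: a_def distrib_right)
        finally have "(norm ?\<Delta>)\<^sup>2 \<le> (a * norm w)\<^sup>2" by (intro power_mono) auto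
        also have "\<dots> = a\<^sup>2 * (norm w)\<^sup>2" by (simp add: power_mult_distrib)
        also have "\<dots> \<le> a\<^sup>2 * (4 * Tl \<xi> + 4 * Dx \<xi>)"
          using tail_transfer[of t w "V n \<beta>0 \<xi>" "Dx \<xi>"] False t wv unfolding Tl_def by (intro mult_left_mono) auto
        finally show ?thesis using \<eta>(1) pos(3) by (smt (verit) divide_nonneg_pos)
      qed
      have i: "(norm (matrix_inv J *v (V n \<beta>0 \<xi> - w)))\<^sup>2 \<le> Dx \<xi> / lam\<^sup>2"
      proof -
        have "norm (matrix_inv J *v (V n \<beta>0 \<xi> - w)) \<le> norm (V n \<beta>0 \<xi> - w) / lam" by (rule pa.inv_bound[OF pa.J_inv])
        then have "(norm (matrix_inv J *v (V n \<beta>0 \<xi> - w)))\<^sup>2 \<le> (norm (V n \<beta>0 \<xi> - w) / lam)\<^sup>2" by (intro power_mono) auto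
        also have "\<dots> \<le> Dx \<xi> / lam\<^sup>2" using wv by (simp add: power_divide norm_minus_commute divide_right_mono)
        finally show ?thesis .
      qed
      have "us n \<xi> - uh n \<xi> + matrix_inv J *v V n \<beta>0 \<xi> = ?\<Delta> + matrix_inv J *v (V n \<beta>0 \<xi> - w)"
        by (simp add: matrix_vector_mult_diff_distrib)
      then have "(norm (us n \<xi> - uh n \<xi> + matrix_inv J *v V n \<beta>0 \<xi>))\<^sup>2 \<le> 2 * (norm ?\<Delta>)\<^sup>2 + 2 * (norm (matrix_inv J *v (V n \<beta>0 \<xi> - w)))\<^sup>2"
        using norm_add_sq_le by metis
      also have "\<dots> \<le> 2 * (16 * \<eta> / lam + a\<^sup>2 * (4 * Tl \<xi> + 4 * Dx \<xi>)) + 2 * (Dx \<xi> / lam\<^sup>2)"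
        by (rule add_mono[OF mult_left_mono[OF \<Delta>] mult_left_mono[OF i]]) simp_all
      also have "\<dots> = D \<xi>"
        unfolding D_def b_def using \<eta>(2) by (simp add: algebra_simps)
      finally show ?thesis .
    qed
    ultimately show ?case using n A(1,2) by blast
  qed
qed

lemma inv_J: "J *v (matrix_inv J *v x) = x" "transpose (matrix_inv J) = matrix_inv J"
proof -
  have inv: "invertible J"
  proof (rule pos_def_invertible)
    fix x :: "real ^ 'd" assume "x \<noteq> 0"
    then have "0 < lam * (norm x)\<^sup>2" using pos by simp
    then show "0 < x \<bullet> (J *v x)" using J_pos[of x] by linarith
  qed
  then show "J *v (matrix_inv J *v x) = x" "transpose (matrix_inv J) = matrix_inv J"
    using matrix_inv_vec(1) matrix_inv_symmetric J_sym by auto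
qed

section \<open>Limit of the bootstrap covariance matrix\<close>

text \<open>Write the rescaled difference of the estimators as \<open>\<delta> - v\<close> with
  \<open>v\<close> the linear part; its sign disappears in the product. The conditional expectation
  of the product of two coordinates of \<open>v\<close> is an average of products of cluster scores,
  which \<open>score_lln\<close> handles. The terms with \<open>\<delta>\<close> are absorbed into
  \<open>D'\<close> and passed to \<open>outer_cond_exp_approx\<close>.\<close>

lemma boot_cov_tendsto:
  assumes \<zeta>: "0 < \<zeta>" and \<theta>: "0 < \<theta>"
  shows "\<forall>\<^sub>F n in sequentially. hp M M \<zeta> (\<lambda>\<xi>. \<bar>boot_cov M c Y X n (bstar n) (bhat n) \<xi> $ j $ l
    - (matrix_inv J *v axis j 1) \<bullet> (\<Sigma> *v (matrix_inv J *v axis l 1))\<bar> < \<theta>)"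
proof -
  let ?a = "matrix_inv J *v axis j 1" and ?b = "matrix_inv J *v axis l 1"
  define V2 where "V2 = real CARD('d) * ((real cmax)\<^sup>2 * (2 * C))"
  have V2: "0 \<le> V2" using C0 by (simp add: V2_def)
  \<comment> \<open>Weight in Young's inequality for the cross terms: \<open>norm v\<close> is
    bounded but not small in mean square, so it gets the small factor \<open>\<alpha>\<close>. The
    mean-square precision \<open>\<theta>1\<close> is chosen afterwards, as \<open>\<delta>\<close>
    pays with \<open>1 + 1 / \<alpha>\<close>. Each part then contributes at most
    \<open>\<zeta> * \<theta> / 16\<close>.\<close>
  define \<alpha> where "\<alpha> = \<zeta> * \<theta> / (16 * (V2 / lam\<^sup>2 + 1))"
  have p1: "0 < V2 / lam\<^sup>2 + 1" using V2 by (simp add: add_nonneg_pos)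
  have \<alpha>: "0 < \<alpha>" "\<alpha> * (V2 / lam\<^sup>2) \<le> \<zeta> * \<theta> / 16"
  proof -
    show a0: "0 < \<alpha>" using \<zeta> \<theta> p1 by (simp add: \<alpha>_def)
    have "\<alpha> * (V2 / lam\<^sup>2) \<le> \<alpha> * (V2 / lam\<^sup>2 + 1)" using a0 by (intro mult_left_mono) auto
    also have "\<dots> = \<zeta> * \<theta> / 16" 
    proof -
      have "x / (16 * y) * y = x / 16" if "0 < y" for x y :: real using that by simp
      from this[OF p1] show ?thesis by (simp only: \<alpha>_def)
    qed
    finally show "\<alpha> * (V2 / lam\<^sup>2) \<le> \<zeta> * \<theta> / 16" .
  qed
  define \<theta>1 where "\<theta>1 = \<zeta> * \<theta> / (16 * (1 + 1 / \<alpha>))"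
  have q1: "0 < 1 + 1 / \<alpha>" using \<alpha> by (simp add: add_pos_pos)
  have \<theta>1: "0 < \<theta>1" "(1 + 1 / \<alpha>) * \<theta>1 = \<zeta> * \<theta> / 16"
  proof -
    show "0 < \<theta>1" using \<zeta> \<theta> q1 by (simp add: \<theta>1_def)
    have "y * (x / (16 * y)) = x / 16" if "0 < y" for x y :: real using that by simp
    from this[OF q1] show "(1 + 1 / \<alpha>) * \<theta>1 = \<zeta> * \<theta> / 16" by (simp only: \<theta>1_def)
  qed
  have z4: "0 < \<zeta> / 4" "0 < \<theta> / 2" using \<zeta> \<theta> by auto
  from bstar_linear[OF z4(1) \<theta>1(1)] score_lln[OF z4, of ?a ?b]
  show ?thesis
  proof eventually_elim
    case (elim n)
    have n: "n \<ge> 1" using elim(1) by blast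
    obtain A D where A: "A \<in> sets (\<F> {1..n})" "1 - \<zeta> / 4 \<le> prob A"
      and D: "integrable M D" "expectation D \<le> \<theta>1" "\<And>\<xi>. 0 \<le> D \<xi>"
        "\<And>\<xi>. \<xi> \<in> A \<Longrightarrow> (norm (us n \<xi> - uh n \<xi> + matrix_inv J *v V n \<beta>0 \<xi>))\<^sup>2 \<le> D \<xi>"
      using elim(1) by blast
    have sub: "subalgebra M (\<F> {1..n})" by (rule subalgebra_F) auto
    have AM: "A \<in> events" "A \<subseteq> space M" using A(1) sub sets.sets_into_space[OF A(1)] by (auto simp: subalgebra_def)
    define Z where "Z = (\<lambda>\<xi>. (real n *\<^sub>R outer_prod (bstar n \<xi> - bhat n \<xi>) (bstar n \<xi> - bhat n \<xi>)) $ j $ l)"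
    have Zu: "Z \<xi> = (us n \<xi> - uh n \<xi>) $ j * (us n \<xi> - uh n \<xi>) $ l" for \<xi>
    proof -
      have "us n \<xi> - uh n \<xi> = sqrt (real n) *\<^sub>R (bstar n \<xi> - bhat n \<xi>)"
        by (simp add: us_def uh_def algebra_simps)
      then have "(us n \<xi> - uh n \<xi>) $ j * (us n \<xi> - uh n \<xi>) $ l = (sqrt (real n) * sqrt (real n)) * ((bstar n \<xi> - bhat n \<xi>) $ j * (bstar n \<xi> - bhat n \<xi>) $ l)"
        by simp
      then show ?thesis by (simp add: Z_def outer_prod_def)
    qed
    define L where "L = (\<lambda>\<xi>. ((1 / sqrt (real n)) * (\<Sum>i=1..n. W i \<xi> * csum (sc ?a) i \<xi>)) * ((1 / sqrt (real n)) * (\<Sum>i=1..n. W i \<xi> * csum (sc ?b) i \<xi>)))"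
    define g where "g = (\<lambda>\<xi>. (1 / real n) * (\<Sum>i=1..n. csum (sc ?a) i \<xi> * csum (sc ?b) i \<xi>))"
    have Lc: "L \<xi> = (matrix_inv J *v V n \<beta>0 \<xi>) $ j * (matrix_inv J *v V n \<beta>0 \<xi>) $ l" for \<xi>
    proof -
      have "(matrix_inv J *v V n \<beta>0 \<xi>) $ m = V n \<beta>0 \<xi> \<bullet> (matrix_inv J *v axis m 1)" for m
        using symmetric_adjoint[OF inv_J(2), of "V n \<beta>0 \<xi>" "axis m 1"] by (simp add: inner_axis)
      then show ?thesis by (simp only: L_def inner_V)
    qed
    note wp = wsum_product_cond[where t = "sc ?a" and t' = "sc ?b" and n = n, OF sc_meas sc_meas sc_int(1)[where n = n] sc_int(1)[where n = n] n, folded L_def g_def]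
    define D' where "D' = (\<lambda>\<xi>. (1 + 1 / \<alpha>) * D \<xi> + \<alpha> * ((norm (V n \<beta>0 \<xi>))\<^sup>2 / lam\<^sup>2))"
    have iD': "integrable M D'" unfolding D'_def using D(1) V_norm_second_moment(1)[OF n] by simp
    have ED': "expectation D' \<le> \<zeta> * \<theta> / 8"
    proof -
      have "expectation D' = (1 + 1 / \<alpha>) * expectation D + \<alpha> * (expectation (\<lambda>\<xi>. (norm (V n \<beta>0 \<xi>))\<^sup>2) / lam\<^sup>2)"
        unfolding D'_def using D(1) V_norm_second_moment(1)[OF n] by simp
      also have "\<dots> \<le> (1 + 1 / \<alpha>) * \<theta>1 + \<alpha> * (V2 / lam\<^sup>2)"
        using D(2) V_norm_second_moment(2)[OF n] q1 \<alpha>(1) unfolding V2_def by (intro add_mono mult_left_mono divide_right_mono) auto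
      also have "\<dots> \<le> \<zeta> * \<theta> / 8" using \<theta>1(2) \<alpha>(2) by linarith
      finally show ?thesis .
    qed
    have "hp M (\<F> {1..n}) (prob (space M - A) + expectation D' / (\<theta> / 2)) (\<lambda>\<xi>. \<bar>outer_cond_exp M (\<F> {1..n}) Z \<xi> - g \<xi>\<bar> < \<theta> / 2)"
    proof (rule outer_cond_exp_approx[OF sub _ A(1) _ iD'])
      show "\<bar>Z \<xi>\<bar> \<le> (2 * (Dm * sqrt (real n)))\<^sup>2" if \<xi>: "\<xi> \<in> space M" for \<xi>
      proof -
        have b: "norm (us n \<xi> - uh n \<xi>) \<le> 2 * (Dm * sqrt (real n))"
          using dom_bound[OF n us_dom[OF n \<xi>]] dom_bound[OF n uh_dom[OF n \<xi>]] norm_triangle_ineq4[of "us n \<xi>" "uh n \<xi>"] by linarith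
        have "\<bar>Z \<xi>\<bar> \<le> norm (us n \<xi> - uh n \<xi>) * norm (us n \<xi> - uh n \<xi>)"
          unfolding Zu abs_mult by (intro mult_mono component_le_norm_cart) auto
        also have "\<dots> \<le> (2 * (Dm * sqrt (real n))) * (2 * (Dm * sqrt (real n)))" using b order_trans[OF norm_ge_zero b] by (intro mult_mono) (assumption | rule norm_ge_zero)+
        finally show ?thesis by (simp add: power2_eq_square)
      qed
      show "\<And>\<xi>. \<xi> \<in> space M \<Longrightarrow> 0 \<le> D' \<xi>" unfolding D'_def using D(3) q1 \<alpha>(1) by (intro add_nonneg_nonneg mult_nonneg_nonneg) auto
      show "\<bar>Z \<xi> - L \<xi>\<bar> \<le> D' \<xi>" if \<xi>: "\<xi> \<in> A" for \<xi>
      proof -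
        define \<delta> where "\<delta> = us n \<xi> - uh n \<xi> + matrix_inv J *v V n \<beta>0 \<xi>"
        define v where "v = matrix_inv J *v V n \<beta>0 \<xi>"
        have e: "us n \<xi> - uh n \<xi> = \<delta> - v" by (simp add: \<delta>_def v_def)
        have "Z \<xi> - L \<xi> = \<delta> $ j * \<delta> $ l - \<delta> $ j * v $ l - v $ j * \<delta> $ l"
          unfolding Zu Lc e v_def[symmetric] by (simp add: algebra_simps)
        also have "\<bar>\<dots>\<bar> \<le> norm \<delta> * norm \<delta> + norm \<delta> * norm v + norm v * norm \<delta>"
        proof -
          have "\<bar>x $ m * y $ m'\<bar> \<le> norm x * norm y" for x y :: "real ^ 'd" and m m'
            unfolding abs_mult by (intro mult_mono component_le_norm_cart) auto
          from this[of \<delta> j \<delta> l] this[of \<delta> j v l] this[of v j \<delta> l] show ?thesis by linarith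
        qed
        also have "\<dots> \<le> (1 + 1 / \<alpha>) * (norm \<delta>)\<^sup>2 + \<alpha> * (norm v)\<^sup>2"
        proof -
          have "2 * (norm \<delta> / sqrt \<alpha>) * (sqrt \<alpha> * norm v) \<le> (norm \<delta> / sqrt \<alpha>)\<^sup>2 + (sqrt \<alpha> * norm v)\<^sup>2"
            by (rule sum_squares_bound)
          then have "2 * (norm \<delta> * norm v) \<le> (norm \<delta>)\<^sup>2 / \<alpha> + \<alpha> * (norm v)\<^sup>2"
            using \<alpha>(1) by (simp add: power_divide power_mult_distrib)
          then show ?thesis by (simp add: power2_eq_square algebra_simps)
        qed
        also have "\<dots> \<le> D' \<xi>"
        proof -
          have "norm v \<le> norm (V n \<beta>0 \<xi>) / lam"
            unfolding v_def by (rule coercive_inv_norm[OF pos(3) J_pos inv_J(1)])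
          then have "(norm v)\<^sup>2 \<le> (norm (V n \<beta>0 \<xi>) / lam)\<^sup>2" by (intro power_mono) auto
          then show ?thesis
            unfolding D'_def using D(4)[OF \<xi>] q1 \<alpha>(1) unfolding \<delta>_def[symmetric] power_divide by (intro add_mono mult_left_mono) auto
        qed
        finally show ?thesis .
      qed
    qed (use wp z4 in auto)
    moreover have "prob (space M - A) + expectation D' / (\<theta> / 2) \<le> \<zeta> / 2"
    proof -
      have "expectation D' / (\<theta> / 2) \<le> (\<zeta> * \<theta> / 8) / (\<theta> / 2)" using ED' \<theta> by (intro divide_right_mono) auto
      also have "\<dots> = \<zeta> / 4" using \<theta> by simp
      finally show ?thesis using A(2) prob_compl[OF AM(1)] by simp
    qed
    ultimately have "hp M (\<F> {1..n}) (\<zeta> / 2) (\<lambda>\<xi>. \<bar>outer_cond_exp M (\<F> {1..n}) Z \<xi> - g \<xi>\<bar> < \<theta> / 2)"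
      by (rule hp_mono) auto
    from hp_conj[OF sub this elim(2)]
    have "hp M (\<F> {1..n}) (\<zeta> / 2 + \<zeta> / 4) (\<lambda>\<xi>. \<bar>outer_cond_exp M (\<F> {1..n}) Z \<xi> - g \<xi>\<bar> < \<theta> / 2 \<and> \<bar>g \<xi> - ?a \<bullet> (\<Sigma> *v ?b)\<bar> < \<theta> / 2)"
      unfolding g_def .
    then have "hp M M (\<zeta> / 2 + \<zeta> / 4) (\<lambda>\<xi>. \<bar>outer_cond_exp M (\<F> {1..n}) Z \<xi> - g \<xi>\<bar> < \<theta> / 2 \<and> \<bar>g \<xi> - ?a \<bullet> (\<Sigma> *v ?b)\<bar> < \<theta> / 2)"
      using sub by (rule hp_subalgebra)
    then show ?case
    proof (rule hp_mono)
      fix \<xi> assume "\<bar>outer_cond_exp M (\<F> {1..n}) Z \<xi> - g \<xi>\<bar> < \<theta> / 2 \<and> \<bar>g \<xi> - ?a \<bullet> (\<Sigma> *v ?b)\<bar> < \<theta> / 2"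
      moreover have "boot_cov M c Y X n (bstar n) (bhat n) \<xi> $ j $ l = outer_cond_exp M (\<F> {1..n}) Z \<xi>"
        by (simp add: boot_cov_def Z_def \<F>_def)
      ultimately show "\<bar>boot_cov M c Y X n (bstar n) (bhat n) \<xi> $ j $ l - ?a \<bullet> (\<Sigma> *v ?b)\<bar> < \<theta>" by linarith
    qed (use \<zeta> in auto)
  qed
qed

lemma boot_cov_symmetric: "transpose (boot_cov M c Y X n (bstar n) (bhat n) \<xi>) = boot_cov M c Y X n (bstar n) (bhat n) \<xi>"
  by (simp add: transpose_def boot_cov_def outer_prod_def vec_eq_iff mult.commute)

end

section \<open>The Wald statistic\<close>

lemma norm_matrix_vector_le: "norm (A *v x) \<le> onorm ((*v) A) * norm x" for A :: "real ^ 'n ^ 'm"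
  by (rule onorm) (rule matrix_vector_mul_bounded_linear)

lemma onorm_matrix_nonneg: "0 \<le> onorm ((*v) A)" for A :: "real ^ 'n ^ 'm"
  by (rule onorm_pos_le) (rule matrix_vector_mul_bounded_linear)

text \<open>The inverse forms are compared through solutions of linear systems:
  \<open>A *v (y - y0)\<close> equals \<open>x - x0\<close> minus the defect of \<open>A'\<close> at
  \<open>y\<close>, and coercivity converts this into a bound for \<open>y - y0\<close>. The bound
  is linear in \<open>\<eta>\<close>.\<close>

lemma inv_quad_form_perturb:
  fixes A A' :: "real ^ 'n ^ 'n"
  assumes l: "0 < l" "\<And>x. l * (norm x)\<^sup>2 \<le> x \<bullet> (A *v x)" "\<And>x. l * (norm x)\<^sup>2 \<le> x \<bullet> (A' *v x)"
    and y: "A' *v y = x" and y0: "A *v y0 = x0"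
    and close: "\<And>z. norm (A' *v z - A *v z) \<le> \<eta> * norm z"
    and x: "norm (x - x0) \<le> \<eta>" "norm x0 \<le> b" and \<eta>: "0 \<le> \<eta>" "\<eta> \<le> 1"
  shows "\<bar>x \<bullet> y - x0 \<bullet> y0\<bar> \<le> \<eta> * ((b + 1) / l + b * ((1 + (b + 1) / l) / l))"
proof -
  have b: "0 \<le> b" using x(2) norm_ge_zero[of x0] by linarith
  have nx: "norm x \<le> b + 1" using x \<eta>(2) norm_triangle_ineq[of "x - x0" x0] by simp
  have ny: "norm y \<le> (b + 1) / l"
    using coercive_inv_norm[OF l(1,3) y] divide_right_mono[OF nx, of l] l(1) by linarith
  have e: "A *v (y - y0) = (x - x0) - (A' *v y - A *v y)"
    using y y0 by (simp add: matrix_vector_mult_diff_distrib)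
  have "norm (A *v (y - y0)) \<le> \<eta> + \<eta> * ((b + 1) / l)"
    unfolding e using norm_triangle_ineq4[of "x - x0" "A' *v y - A *v y"] close[of y] x(1) mult_left_mono[OF ny \<eta>(1)] by linarith
  then have "norm (y - y0) \<le> (\<eta> + \<eta> * ((b + 1) / l)) / l"
    using coercive_inv_norm[OF l(1,2) refl, of "y - y0"] divide_right_mono[of "norm (A *v (y - y0))" _ l] l(1) by force
  then have 1: "norm x0 * norm (y - y0) \<le> b * ((\<eta> + \<eta> * ((b + 1) / l)) / l)"
    using x(2) b by (intro mult_mono) auto
  have 2: "norm (x - x0) * norm y \<le> \<eta> * ((b + 1) / l)" using x(1) ny \<eta>(1) by (intro mult_mono) auto
  have "x \<bullet> y - x0 \<bullet> y0 = (x - x0) \<bullet> y + x0 \<bullet> (y - y0)" by (simp add: inner_diff_left inner_diff_right)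
  then have "\<bar>x \<bullet> y - x0 \<bullet> y0\<bar> \<le> norm (x - x0) * norm y + norm x0 * norm (y - y0)"
    using Cauchy_Schwarz_ineq2[of "x - x0" y] Cauchy_Schwarz_ineq2[of x0 "y - y0"] by linarith
  also have "\<dots> \<le> \<eta> * ((b + 1) / l) + b * ((\<eta> + \<eta> * ((b + 1) / l)) / l)" using 1 2 by linarith
  also have "\<dots> = \<eta> * ((b + 1) / l + b * ((1 + (b + 1) / l) / l))" using l(1) by (simp add: field_simps)
  finally show ?thesis .
qed

lemma coercive_perturb:
  fixes A A' :: "real ^ 'n ^ 'n"
  assumes "\<And>x. l * (norm x)\<^sup>2 \<le> x \<bullet> (A *v x)" "\<And>z. norm (A' *v z - A *v z) \<le> \<eta> * norm z" "\<eta> \<le> l / 2"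
  shows "l / 2 * (norm x)\<^sup>2 \<le> x \<bullet> (A' *v x)"
proof -
  have "\<bar>x \<bullet> (A' *v x - A *v x)\<bar> \<le> norm x * (\<eta> * norm x)"
    using Cauchy_Schwarz_ineq2[of x "A' *v x - A *v x"] mult_left_mono[OF assms(2)[of x], of "norm x"] by simp
  moreover have "norm x * (\<eta> * norm x) \<le> l / 2 * (norm x)\<^sup>2"
    using mult_right_mono[OF assms(3), of "(norm x)\<^sup>2"] by (simp add: power2_eq_square mult.assoc mult.left_commute)
  ultimately show ?thesis using assms(1)[of x] by (simp add: inner_diff_right)
qed

lemma inv_sqrt_norm_sq:
  assumes "is_inv_sqrt A S"
  shows "(norm (S *v x))\<^sup>2 = x \<bullet> (matrix_inv A *v x)"
proof -
  have "(S *v x) \<bullet> (S *v x) = x \<bullet> (S *v (S *v x))"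
    using assms by (intro symmetric_adjoint) (simp add: is_inv_sqrt_def)
  then show ?thesis using assms by (simp add: is_inv_sqrt_def power2_norm_eq_inner matrix_vector_mul_assoc)
qed

text \<open>\<open>S ** (S ** A) = mat 1\<close>, and a one-sided inverse of a square matrix is
  two-sided, so \<open>S ** A ** S = mat 1\<close> as well.\<close>

lemma inv_sqrt_whitening:
  assumes "is_inv_sqrt A S"
  shows "(S *v z) \<bullet> (A *v (S *v z)) = (norm z)\<^sup>2"
proof -
  have "S ** S ** A = mat 1" using assms matrix_inv_mult[of A] by (simp add: is_inv_sqrt_def)
  then have "S ** (S ** A) = mat 1" by (simp add: matrix_mul_assoc)
  then have "(S ** A) ** S = mat 1" by (simp only: matrix_left_right_inverse)
  then have "((S ** A) ** S) *v z = z" by simp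
  then have "S *v (A *v (S *v z)) = z" by (simp only: matrix_vector_mul_assoc[symmetric])
  then show ?thesis using symmetric_adjoint[of S z "A *v (S *v z)"] assms
    by (simp add: is_inv_sqrt_def power2_norm_eq_inner)
qed

text \<open>For non-measurable sets the first limit does not imply the second. Both follow because
  \<open>hp\<close> provides a measurable event inside the set.\<close>

lemma outer_measure_tendsto:
  assumes M: "prob_space M" and hp: "\<And>\<zeta>. 0 < \<zeta> \<Longrightarrow> \<forall>\<^sub>F n in sequentially. hp M M \<zeta> (P n)"
  shows "(\<lambda>n. outer_measure_of M {\<xi>\<in>space M. P n \<xi>}) \<longlonglongrightarrow> 1"
    and "(\<lambda>n. outer_measure_of M {\<xi>\<in>space M. \<not> P n \<xi>}) \<longlonglongrightarrow> 0"
proof -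
  interpret prob_space M by (rule M)
  have bnd: "ennreal (1 - \<zeta>) \<le> outer_measure_of M {\<xi>\<in>space M. P n \<xi>}" "outer_measure_of M {\<xi>\<in>space M. \<not> P n \<xi>} \<le> ennreal \<zeta>"
    if h: "hp M M \<zeta> (P n)" for \<zeta> n
  proof -
    obtain A where A: "A \<in> events" "1 - \<zeta> \<le> prob A" "\<forall>\<xi>\<in>A. P n \<xi>" using h unfolding hp_def by blast
    have "A \<subseteq> {\<xi>\<in>space M. P n \<xi>}" using A sets.sets_into_space[OF A(1)] by auto
    from outer_measure_of_mono[OF this, of M] show "ennreal (1 - \<zeta>) \<le> outer_measure_of M {\<xi>\<in>space M. P n \<xi>}"
      using A(1) by (intro order_trans[OF ennreal_leI[OF A(2)]]) (simp add: emeasure_eq_measure)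
    have "{\<xi>\<in>space M. \<not> P n \<xi>} \<subseteq> space M - A" using A(3) by auto
    from outer_measure_of_mono[OF this, of M] show "outer_measure_of M {\<xi>\<in>space M. \<not> P n \<xi>} \<le> ennreal \<zeta>"
    proof (rule order_trans)
      have "prob (space M - A) \<le> \<zeta>" using A(2) prob_compl[OF A(1)] by simp
      from ennreal_leI[OF this] show "outer_measure_of M (space M - A) \<le> ennreal \<zeta>"
        using A(1) by (simp add: emeasure_eq_measure)
    qed
  qed
  show "(\<lambda>n. outer_measure_of M {\<xi>\<in>space M. P n \<xi>}) \<longlonglongrightarrow> 1"
  proof (rule order_tendstoI)
    fix a :: ennreal assume a: "a < 1"
    then obtain a' where a': "a = ennreal a'" "0 \<le> a'" "a' < 1" by (cases a) (auto simp: ennreal_less_one_iff)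
    have "0 < (1 - a') / 2" using a' by simp
    from hp[OF this] show "\<forall>\<^sub>F n in sequentially. a < outer_measure_of M {\<xi>\<in>space M. P n \<xi>}"
    proof eventually_elim
      case (elim n)
      have "a' < 1 - (1 - a') / 2" using a'(3) by (simp add: field_simps)
      then have "a < ennreal (1 - (1 - a') / 2)" unfolding a'(1) using a' by (intro ennreal_lessI) auto
      then show ?case using bnd(1)[OF elim] by (rule less_le_trans)
    qed
  next
    fix a :: ennreal assume a: "1 < a"
    have "outer_measure_of M {\<xi>\<in>space M. P n \<xi>} \<le> 1" for n
      using outer_measure_of_mono[of "{\<xi>\<in>space M. P n \<xi>}" "space M" M] by (auto simp: emeasure_space_1)
    then show "\<forall>\<^sub>F n in sequentially. outer_measure_of M {\<xi>\<in>space M. P n \<xi>} < a"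
      using a by (intro always_eventually allI) (rule le_less_trans)
  qed
  show "(\<lambda>n. outer_measure_of M {\<xi>\<in>space M. \<not> P n \<xi>}) \<longlonglongrightarrow> 0"
  proof (rule order_tendstoI)
    fix a :: ennreal assume a: "0 < a"
    obtain b where b: "0 < b" "b < a" using dense[OF a] by blast
    then obtain e where "b = ennreal e" "0 \<le> e" by (cases b) auto
    then have e: "0 < e" "ennreal e < a" using b by auto
    from hp[OF e(1)] show "\<forall>\<^sub>F n in sequentially. outer_measure_of M {\<xi>\<in>space M. \<not> P n \<xi>} < a"
      by eventually_elim (use bnd(2) e(2) le_less_trans in blast)
  qed simp
qed

lemma chi_square_real_distribution: "real_distribution (chi_square m)"
  and AE_chi_square_nonneg: "AE y in chi_square m. 0 \<le> y"
proof -
  let ?N = "\<Pi>\<^sub>M j\<in>{..<m}. density lborel (\<lambda>x. ennreal (std_normal_density x))"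
  interpret N: real_distribution std_normal_distribution by (rule real_dist_normal_dist)
  interpret P: product_prob_space "\<lambda>_::nat. std_normal_distribution" "{..<m}" by unfold_locales
  have PP: "prob_space ?N" by unfold_locales
  have me [measurable]: "(\<lambda>z. \<Sum>j<m. (z j)\<^sup>2) \<in> borel_measurable ?N" by measurable
  show "real_distribution (chi_square m)"
    unfolding chi_square_def by (rule prob_space.real_distribution_distr[OF PP me])
  show "AE y in chi_square m. 0 \<le> y"
    unfolding chi_square_def by (subst AE_distr_iff) (auto intro!: AE_I2 sum_nonneg)
qed

text \<open>Full rank of \<open>R\<close> enters as injectivity of its transpose. \<open>K\<close>
  is specified only at sample points where an inverse square root exists, so it stays arbitrary
  where the bootstrap matrix is singular.\<close>

locale wald_test = qr_boot M c cmax Y X W \<tau> \<beta>0 C p \<epsilon> r0 lam J \<Sigma> q B Dm bhat bstar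
  for M :: "'a measure" and c :: "nat \<Rightarrow> nat" and cmax :: nat
    and Y :: "nat \<Rightarrow> nat \<Rightarrow> 'a \<Rightarrow> real" and X :: "nat \<Rightarrow> nat \<Rightarrow> 'a \<Rightarrow> real ^ 'd"
    and W :: "nat \<Rightarrow> 'a \<Rightarrow> real"
    and \<tau> :: real and \<beta>0 :: "real ^ 'd" and C p \<epsilon> r0 lam :: real
    and J \<Sigma> :: "real ^ 'd ^ 'd" and q :: "nat \<Rightarrow> nat \<Rightarrow> real ^ 'd \<Rightarrow> real"
    and B :: "(real ^ 'd) set" and Dm :: real and bhat bstar :: "nat \<Rightarrow> 'a \<Rightarrow> real ^ 'd" +
  fixes R :: "real ^ 'd ^ 'h" and r :: "real ^ 'h" and K :: "nat \<Rightarrow> 'a \<Rightarrow> real"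
  assumes Sigma_pos: "\<And>a. a \<noteq> 0 \<Longrightarrow> 0 < a \<bullet> (\<Sigma> *v a)"
    and R_inj: "\<And>x. transpose R *v x = 0 \<Longrightarrow> x = 0"
    and K: "\<And>n \<xi> S. n \<ge> 1 \<Longrightarrow> \<xi> \<in> space M \<Longrightarrow>
      is_inv_sqrt (R ** boot_cov M c Y X n (bstar n) (bhat n) \<xi> ** transpose R) S \<Longrightarrow>
      K n \<xi> = norm (S *v (sqrt (real n) *\<^sub>R (R *v bhat n \<xi> - r)))"
begin

definition Om :: "nat \<Rightarrow> 'a \<Rightarrow> real ^ 'h ^ 'h" where
  "Om n \<xi> = R ** boot_cov M c Y X n (bstar n) (bhat n) \<xi> ** transpose R"

text \<open>The asymptotic covariance matrix of \<open>R\<close> applied to the rescaled estimator,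
  with the sandwich form of quantile regression in the middle.\<close>

definition \<Omega> :: "real ^ 'h ^ 'h" where
  "\<Omega> = R ** (matrix_inv J ** \<Sigma> ** matrix_inv J) ** transpose R"

lemma transpose_R: "(R *v x) \<bullet> y = x \<bullet> (transpose R *v y)"
  by (metis dot_lmul_matrix matrix_transpose_mul transpose_matrix_vector transpose_transpose inner_commute)

lemma Omega_form: "x \<bullet> (\<Omega> *v y) = (matrix_inv J *v (transpose R *v x)) \<bullet> (\<Sigma> *v (matrix_inv J *v (transpose R *v y)))"
proof -
  have "\<Omega> *v y = R *v (matrix_inv J *v (\<Sigma> *v (matrix_inv J *v (transpose R *v y))))"
    by (simp only: \<Omega>_def matrix_vector_mul_assoc matrix_mul_assoc)
  moreover have "(R *v (matrix_inv J *v s)) \<bullet> x = s \<bullet> (matrix_inv J *v (transpose R *v x))" for s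
    by (simp only: transpose_R symmetric_adjoint[OF inv_J(2)])
  ultimately show ?thesis by (metis inner_commute)
qed

lemma Sigma_symmetric: "a \<bullet> (\<Sigma> *v b) = b \<bullet> (\<Sigma> *v a)"
  using LIMSEQ_unique[OF Sigma_lim[of a b]] Sigma_lim[of b a] by (simp add: mult.commute)

lemma Omega_symmetric: "transpose \<Omega> = \<Omega>"
  by (rule transpose_eqI) (subst inner_commute, simp add: Omega_form Sigma_symmetric)

lemma Omega_pos:
  assumes "x \<noteq> 0"
  shows "0 < x \<bullet> (\<Omega> *v x)"
proof -
  have "transpose R *v x \<noteq> 0" using assms R_inj by blast
  then have "matrix_inv J *v (transpose R *v x) \<noteq> 0" using inv_J(1)[of "transpose R *v x"] by force
  then show ?thesis unfolding Omega_form by (rule Sigma_pos)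
qed

lemma Omega_coercive:
  obtains l where "0 < l" "\<And>x. l * (norm x)\<^sup>2 \<le> x \<bullet> (\<Omega> *v x)"
  using pos_def_coercive[OF Omega_symmetric Omega_pos] by blast

lemma Om_symmetric: "transpose (Om n \<xi>) = Om n \<xi>"
  by (simp add: Om_def matrix_transpose_mul boot_cov_symmetric matrix_mul_assoc)

lemma Om_close:
  assumes \<zeta>: "0 < \<zeta>" and \<eta>: "0 < \<eta>"
  shows "\<forall>\<^sub>F n in sequentially. hp M M \<zeta> (\<lambda>\<xi>. \<forall>z. norm (Om n \<xi> *v z - \<Omega> *v z) \<le> \<eta> * norm z)"
proof -
  let ?V = "matrix_inv J ** \<Sigma> ** matrix_inv J" and ?I = "UNIV :: ('d \<times> 'd) set"
  let ?B = "\<lambda>n \<xi>. boot_cov M c Y X n (bstar n) (bhat n) \<xi>"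
  define a where "a = onorm ((*v) R) * onorm ((*v) (transpose R))"
  define d where "d = real CARD('d) * real CARD('d)"
  have ad: "0 \<le> a" "0 < d" by (simp_all add: a_def d_def onorm_matrix_nonneg)
  \<comment> \<open>Entries within \<open>\<theta>\<close> give an operator norm of at most
    \<open>d * \<theta>\<close>, multiplied by \<open>a\<close> when passing through
    \<open>R\<close>. The \<open>+ 1\<close> guards against \<open>a = 0\<close>.\<close>
  define \<theta> where "\<theta> = \<eta> / ((a + 1) * d)"
  have \<theta>: "0 < \<theta>" using ad \<eta> by (simp add: \<theta>_def)
  have "a * (d * \<theta>) \<le> (a + 1) * (d * \<theta>)" using ad \<theta> by (intro mult_right_mono) auto
  also have "\<dots> = \<eta>" using ad by (simp add: \<theta>_def)
  finally have \<theta>a: "a * (d * \<theta>) \<le> \<eta>" .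
  define z where "z = \<zeta> / real (card ?I)"
  have z: "0 < z" "(\<Sum>i\<in>?I. z) = \<zeta>" using \<zeta> by (simp_all add: z_def)
  have entry: "(matrix_inv J *v axis j 1) \<bullet> (\<Sigma> *v (matrix_inv J *v axis l 1)) = ?V $ j $ l" for j l
  proof -
    have "(matrix_inv J *v axis j 1) \<bullet> (\<Sigma> *v (matrix_inv J *v axis l 1)) = axis j 1 \<bullet> (?V *v axis l 1)"
      using symmetric_adjoint[OF inv_J(2), of "axis j 1"] by (simp add: matrix_vector_mul_assoc matrix_mul_assoc)
    then show ?thesis by (simp add: inner_axis' matrix_vector_mul_component inner_axis)
  qed
  have "\<forall>\<^sub>F n in sequentially. \<forall>jl\<in>?I. hp M M z (\<lambda>\<xi>. \<bar>?B n \<xi> $ fst jl $ snd jl - ?V $ fst jl $ snd jl\<bar> < \<theta>)"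
    using boot_cov_tendsto[OF z(1) \<theta>] by (intro eventually_ball_finite) (auto simp: entry)
  then show ?thesis
  proof eventually_elim
    case (elim n)
    have "hp M M (\<Sum>i\<in>?I. z) (\<lambda>\<xi>. \<forall>jl\<in>?I. \<bar>?B n \<xi> $ fst jl $ snd jl - ?V $ fst jl $ snd jl\<bar> < \<theta>)"
      using elim by (intro hp_ball subalgebra_refl) auto
    then show ?case
    proof (rule hp_mono)
      fix \<xi> assume *: "\<forall>jl\<in>?I. \<bar>?B n \<xi> $ fst jl $ snd jl - ?V $ fst jl $ snd jl\<bar> < \<theta>"
      define D where "D = ?B n \<xi> - ?V"
      have "\<bar>D $ j $ l\<bar> \<le> \<theta>" for j l using bspec[OF *, of "(j, l)"] by (simp add: D_def)
      then have oD: "onorm ((*v) D) \<le> d * \<theta>" unfolding d_def by (rule onorm_le_matrix_component)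
      show "\<forall>z. norm (Om n \<xi> *v z - \<Omega> *v z) \<le> \<eta> * norm z"
      proof
        fix x
        have "Om n \<xi> *v x - \<Omega> *v x = R *v (D *v (transpose R *v x))"
          unfolding Om_def \<Omega>_def D_def
          by (simp add: matrix_vector_mul_assoc[symmetric] matrix_vector_mult_diff_rdistrib matrix_vector_mult_diff_distrib)
        also have "norm \<dots> \<le> onorm ((*v) R) * (onorm ((*v) D) * (onorm ((*v) (transpose R)) * norm x))"
          by (intro order_trans[OF norm_matrix_vector_le] mult_left_mono norm_matrix_vector_le onorm_matrix_nonneg)
        also have "\<dots> = (a * norm x) * onorm ((*v) D)" by (simp add: a_def)
        also have "\<dots> \<le> (a * norm x) * (d * \<theta>)" using oD ad by (intro mult_left_mono) auto
        also have "\<dots> = a * (d * \<theta>) * norm x" by simp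
        also have "\<dots> \<le> \<eta> * norm x" using \<theta>a by (rule mult_right_mono) simp
        finally show "norm (Om n \<xi> *v x - \<Omega> *v x) \<le> \<eta> * norm x" .
      qed
    qed (use z in auto)
  qed
qed

text \<open>Positive definiteness supplies an inverse square root, which then drops out of the
  square: only the inverse quadratic form has to be analysed.\<close>

lemma K_sq:
  assumes n: "n \<ge> 1" and \<xi>: "\<xi> \<in> space M" and pd: "\<And>x. x \<noteq> 0 \<Longrightarrow> 0 < x \<bullet> (Om n \<xi> *v x)"
  defines "x \<equiv> sqrt (real n) *\<^sub>R (R *v bhat n \<xi> - r)"
  shows "(K n \<xi>)\<^sup>2 = x \<bullet> (matrix_inv (Om n \<xi>) *v x)" "Om n \<xi> *v (matrix_inv (Om n \<xi>) *v x) = x"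
proof -
  obtain S where S: "is_inv_sqrt (Om n \<xi>) S" using pos_def_inv_sqrt[OF Om_symmetric pd] by blast
  then show "(K n \<xi>)\<^sup>2 = x \<bullet> (matrix_inv (Om n \<xi>) *v x)"
    using K[OF n \<xi>, of S] inv_sqrt_norm_sq[OF S, of x] by (simp add: Om_def x_def)
  show "Om n \<xi> *v (matrix_inv (Om n \<xi>) *v x) = x" by (rule matrix_inv_vec) (rule pos_def_invertible[OF pd])
qed

lemma statistic_decomposition:
  "sqrt (real n) *\<^sub>R (R *v bhat n \<xi> - r) = R *v uh n \<xi> + sqrt (real n) *\<^sub>R (R *v \<beta>0 - r)"
  by (simp add: uh_def matrix_vector_mult_diff_distrib matrix_vector_mult_scaleR scaleR_diff_right)

lemma hp_G_bound:
  assumes "0 < \<zeta>"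
  obtains g where "0 < g" "\<And>n. n \<ge> 1 \<Longrightarrow> hp M M \<zeta> (\<lambda>\<xi>. norm (G n \<xi>) \<le> g)"
proof -
  obtain g where g: "0 < g" "\<And>n. n \<ge> 1 \<Longrightarrow> hp M (\<F> {1..n}) \<zeta> (\<lambda>\<xi>. norm (G n \<xi>) \<le> g)"
    using G_tight[OF assms] by blast
  have "hp M M \<zeta> (\<lambda>\<xi>. norm (G n \<xi>) \<le> g)" if "n \<ge> 1" for n
    using g(2)[OF that] by (rule hp_subalgebra) (rule subalgebra_F, auto)
  with g(1) show ?thesis using that by blast
qed

lemma inv_J_norm: "norm (matrix_inv J *v x) \<le> norm x / lam"
  by (rule coercive_inv_norm[OF pos(3) J_pos inv_J(1)])

text \<open>The drift \<open>sqrt n\<close> times \<open>R *v \<beta>0 - r\<close> dominates the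
  bounded random part, so \<open>x\<close> is large. As the bootstrap matrix is bounded, the
  solution \<open>y\<close> of \<open>Om n \<xi> *v y = x\<close> is large as well, and coercivity
  makes \<open>x \<bullet> y\<close> large.\<close>

lemma consistency:
  assumes H1: "R *v \<beta>0 \<noteq> r" and \<zeta>: "0 < \<zeta>"
  shows "\<forall>\<^sub>F n in sequentially. hp M M \<zeta> (\<lambda>\<xi>. s < (K n \<xi>)\<^sup>2)"
proof -
  obtain l where l: "0 < l" "\<And>x. l * (norm x)\<^sup>2 \<le> x \<bullet> (\<Omega> *v x)" using Omega_coercive by blast
  have \<zeta>3: "0 < \<zeta> / 3" using \<zeta> by simp
  obtain g where g: "0 < g" "\<And>n. n \<ge> 1 \<Longrightarrow> hp M M (\<zeta> / 3) (\<lambda>\<xi>. norm (G n \<xi>) \<le> g)" using hp_G_bound[OF \<zeta>3] by blast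
  define u where "u = onorm ((*v) R) * (1 + g / lam)"
  define \<rho> where "\<rho> = norm (R *v \<beta>0 - r)"
  have \<rho>: "0 < \<rho>" using H1 by (simp add: \<rho>_def)
  define L where "L = onorm ((*v) \<Omega>) + l / 2"
  have L: "0 < L" using l(1) onorm_matrix_nonneg[of \<Omega>] by (simp add: L_def)
  \<comment> \<open>If \<open>norm x \<ge> b\<close>, then \<open>norm y \<ge> b / L\<close>, and
    \<open>l / 2 * (norm y)\<^sup>2\<close> is at least \<open>\<bar>s\<bar> + 1\<close>.\<close>
  define b where "b = L * sqrt (2 * (\<bar>s\<bar> + 1) / l)"
  have l2: "0 < l / 2" using l(1) by simp
  have "filterlim (\<lambda>n. \<rho> * sqrt (real n)) at_top sequentially"
    using \<rho> by (intro filterlim_tendsto_pos_mult_at_top[OF tendsto_const] filterlim_compose[OF sqrt_at_top] filterlim_real_sequentially)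
  then have "\<forall>\<^sub>F n in sequentially. b + u \<le> \<rho> * sqrt (real n)" by (simp add: filterlim_at_top)
  then show ?thesis
    using Om_close[OF \<zeta>3 l2] bhat_linear[OF \<zeta>3 zero_less_one] eventually_ge_at_top[of 1]
  proof eventually_elim
    case (elim n)
    from hp_conj[OF subalgebra_refl elim(2) hp_conj[OF subalgebra_refl elim(3) g(2)[OF elim(4)]]]
    show ?case
    proof (rule hp_mono)
      fix \<xi> assume \<xi>: "\<xi> \<in> space M" and *: "(\<forall>z. norm (Om n \<xi> *v z - \<Omega> *v z) \<le> l / 2 * norm z) \<and>
        norm (uh n \<xi> - matrix_inv J *v G n \<xi>) \<le> 1 \<and> norm (G n \<xi>) \<le> g"
      have co: "l / 2 * (norm x)\<^sup>2 \<le> x \<bullet> (Om n \<xi> *v x)" for x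
        using * by (intro coercive_perturb[OF l(2), of _ "l / 2"]) auto
      have pd: "0 < x \<bullet> (Om n \<xi> *v x)" if "x \<noteq> 0" for x
      proof -
        have "0 < l / 2 * (norm x)\<^sup>2" using that l(1) by simp
        then show ?thesis using co[of x] by linarith
      qed
      define x where "x = sqrt (real n) *\<^sub>R (R *v bhat n \<xi> - r)"
      define y where "y = matrix_inv (Om n \<xi>) *v x"
      have y: "(K n \<xi>)\<^sup>2 = x \<bullet> y" "Om n \<xi> *v y = x"
        using K_sq[OF elim(4) \<xi> pd] by (simp_all add: x_def y_def)
      have "norm (G n \<xi>) / lam \<le> g / lam" using * pos(3) by (intro divide_right_mono) auto
      then have "norm (uh n \<xi>) \<le> 1 + g / lam"
        using * inv_J_norm[of "G n \<xi>"] norm_triangle_sub[of "uh n \<xi>" "matrix_inv J *v G n \<xi>"] by linarith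
      then have "norm (R *v uh n \<xi>) \<le> u"
        unfolding u_def by (intro order_trans[OF norm_matrix_vector_le] mult_left_mono onorm_matrix_nonneg)
      moreover have "norm (sqrt (real n) *\<^sub>R (R *v \<beta>0 - r)) = \<rho> * sqrt (real n)" by (simp add: \<rho>_def)
      moreover have "norm (sqrt (real n) *\<^sub>R (R *v \<beta>0 - r)) \<le> norm x + norm (R *v uh n \<xi>)"
        using norm_triangle_ineq4[of x "R *v uh n \<xi>"] by (simp add: x_def statistic_decomposition)
      ultimately have bx: "b \<le> norm x" using elim(1) by linarith
      have "norm x \<le> norm (\<Omega> *v y) + norm (Om n \<xi> *v y - \<Omega> *v y)"
        using norm_triangle_sub[of "Om n \<xi> *v y" "\<Omega> *v y"] y(2) by simp
      also have "\<dots> \<le> L * norm y"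
        using norm_matrix_vector_le[of \<Omega> y] * by (simp add: L_def distrib_right add_mono)
      finally have "sqrt (2 * (\<bar>s\<bar> + 1) / l) \<le> norm y" using bx L by (simp add: b_def) (metis mult_le_cancel_left_pos order_trans)
      then have "(sqrt (2 * (\<bar>s\<bar> + 1) / l))\<^sup>2 \<le> (norm y)\<^sup>2" using l(1) by (intro power_mono) auto
      then have "2 * (\<bar>s\<bar> + 1) / l \<le> (norm y)\<^sup>2" using l(1) by simp
      then have "l / 2 * (2 * (\<bar>s\<bar> + 1) / l) \<le> l / 2 * (norm y)\<^sup>2" using l(1) by (intro mult_left_mono) auto
      then have "\<bar>s\<bar> + 1 \<le> l / 2 * (norm y)\<^sup>2" using l(1) by simp
      then show "s < (K n \<xi>)\<^sup>2" using co[of y] y by (simp add: inner_commute)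
    qed auto
  qed
qed

lemma statistic_approx:
  assumes H0: "R *v \<beta>0 = r" and \<eta>: "0 < \<eta>"
  shows "\<forall>\<^sub>F n in sequentially. hp M M \<eta> (\<lambda>\<xi>. \<bar>(K n \<xi>)\<^sup>2 - (R *v (matrix_inv J *v G n \<xi>)) \<bullet> (matrix_inv \<Omega> *v (R *v (matrix_inv J *v G n \<xi>)))\<bar> < \<eta>)"
proof -
  obtain l' where l': "0 < l'" "\<And>x. l' * (norm x)\<^sup>2 \<le> x \<bullet> (\<Omega> *v x)" using Omega_coercive by blast
  \<comment> \<open>Half the coercivity constant, so that it serves \<open>\<Omega>\<close> and its
    perturbation \<open>Om n \<xi>\<close> alike.\<close>
  define l where "l = l' / 2"
  have l: "0 < l" using l' by (simp add: l_def)
  have \<Omega>l: "l * (norm x)\<^sup>2 \<le> x \<bullet> (\<Omega> *v x)" for x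
  proof -
    have "l * (norm x)\<^sup>2 \<le> l' * (norm x)\<^sup>2" using l'(1) by (intro mult_right_mono) (auto simp: l_def)
    then show ?thesis using l'(2)[of x] by linarith
  qed
  have \<Omega>inv: "invertible \<Omega>" by (rule pos_def_invertible[OF Omega_pos])
  have \<zeta>3: "0 < \<eta> / 3" using \<eta> by simp
  obtain g where g: "0 < g" "\<And>n. n \<ge> 1 \<Longrightarrow> hp M M (\<eta> / 3) (\<lambda>\<xi>. norm (G n \<xi>) \<le> g)" using hp_G_bound[OF \<zeta>3] by blast
  define b where "b = onorm ((*v) R) * (g / lam)"
  have b: "0 \<le> b" using g(1) pos(3) by (simp add: b_def onorm_matrix_nonneg)
  define k where "k = (b + 1) / l + b * ((1 + (b + 1) / l) / l)"
  have k: "0 \<le> k" using b l by (simp add: k_def)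
  define \<theta> where "\<theta> = min (min 1 l) (\<eta> / (2 * (k + 1)))"
  have \<theta>: "0 < \<theta>" "\<theta> \<le> 1" "\<theta> \<le> l" using \<eta> l k by (auto simp: \<theta>_def)
  have "\<theta> * k \<le> \<eta> / (2 * (k + 1)) * (k + 1)" using \<theta>(1) k \<eta> by (intro mult_mono) (auto simp: \<theta>_def)
  also have "\<dots> = \<eta> / 2"
  proof -
    have "\<eta> / (2 * m) * m = \<eta> / 2" if "0 < m" for m using that by simp
    from this[of "k + 1"] show ?thesis using k by linarith
  qed
  also have "\<dots> < \<eta>" using \<eta> by simp
  finally have \<theta>k: "\<theta> * k < \<eta>" .
  define \<theta>2 where "\<theta>2 = \<theta> / (onorm ((*v) R) + 1)"
  have R1: "0 < onorm ((*v) R) + 1" using onorm_matrix_nonneg[of R] by linarith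
  have \<theta>2: "0 < \<theta>2" using \<theta> R1 by (simp add: \<theta>2_def)
  have "onorm ((*v) R) * \<theta>2 \<le> (onorm ((*v) R) + 1) * \<theta>2" using \<theta>2 by (intro mult_right_mono) auto
  also have "\<dots> = \<theta>" using R1 by (simp add: \<theta>2_def)
  finally have R\<theta>: "onorm ((*v) R) * \<theta>2 \<le> \<theta>" .
  from Om_close[OF \<zeta>3 \<theta>(1)] bhat_linear[OF \<zeta>3 \<theta>2] eventually_ge_at_top[of 1]
  show ?thesis
  proof eventually_elim
    case (elim n)
    from hp_conj[OF subalgebra_refl elim(1) hp_conj[OF subalgebra_refl elim(2) g(2)[OF elim(3)]]]
    show ?case
    proof (rule hp_mono)
      fix \<xi> assume \<xi>: "\<xi> \<in> space M" and *: "(\<forall>z. norm (Om n \<xi> *v z - \<Omega> *v z) \<le> \<theta> * norm z) \<and>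
        norm (uh n \<xi> - matrix_inv J *v G n \<xi>) \<le> \<theta>2 \<and> norm (G n \<xi>) \<le> g"
      have co: "l * (norm x)\<^sup>2 \<le> x \<bullet> (Om n \<xi> *v x)" for x
        unfolding l_def using * \<theta>(3) by (intro coercive_perturb[OF l'(2), of _ \<theta>]) (auto simp: l_def)
      have pd: "0 < x \<bullet> (Om n \<xi> *v x)" if "x \<noteq> 0" for x
      proof -
        have "0 < l * (norm x)\<^sup>2" using that l by simp
        then show ?thesis using co[of x] by linarith
      qed
      define x where "x = sqrt (real n) *\<^sub>R (R *v bhat n \<xi> - r)"
      define y where "y = matrix_inv (Om n \<xi>) *v x"
      define x0 where "x0 = R *v (matrix_inv J *v G n \<xi>)"
      have y: "(K n \<xi>)\<^sup>2 = x \<bullet> y" "Om n \<xi> *v y = x"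
        using K_sq[OF elim(3) \<xi> pd] by (simp_all add: x_def y_def)
      have "x = R *v uh n \<xi>" unfolding x_def statistic_decomposition using H0 by simp
      then have "x - x0 = R *v (uh n \<xi> - matrix_inv J *v G n \<xi>)"
        by (simp add: x0_def matrix_vector_mult_diff_distrib)
      then have "norm (x - x0) \<le> onorm ((*v) R) * norm (uh n \<xi> - matrix_inv J *v G n \<xi>)"
        by (simp add: norm_matrix_vector_le)
      also have "\<dots> \<le> onorm ((*v) R) * \<theta>2" using * by (intro mult_left_mono onorm_matrix_nonneg) auto
      finally have xx: "norm (x - x0) \<le> \<theta>" using R\<theta> by linarith
      have "norm (G n \<xi>) / lam \<le> g / lam" using * pos(3) by (intro divide_right_mono) auto
      then have "norm (matrix_inv J *v G n \<xi>) \<le> g / lam" using inv_J_norm[of "G n \<xi>"] by linarith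
      then have x0b: "norm x0 \<le> b"
        unfolding x0_def b_def by (rule order_trans[OF norm_matrix_vector_le mult_left_mono[OF _ onorm_matrix_nonneg]])
      have "\<bar>x \<bullet> y - x0 \<bullet> (matrix_inv \<Omega> *v x0)\<bar> \<le> \<theta> * k"
        unfolding k_def using * \<theta> by (intro inv_quad_form_perturb[OF l \<Omega>l co y(2) matrix_inv_vec(1)[OF \<Omega>inv] _ xx x0b]) auto
      then show "\<bar>(K n \<xi>)\<^sup>2 - (R *v (matrix_inv J *v G n \<xi>)) \<bullet> (matrix_inv \<Omega> *v (R *v (matrix_inv J *v G n \<xi>)))\<bar> < \<eta>"
        using \<theta>k y(1) unfolding x0_def by linarith
    qed auto
  qed
qed

lemma null_distribution:
  assumes H0: "R *v \<beta>0 = r"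
  shows "converges_in_distribution M (\<lambda>n \<xi>. (K n \<xi>)\<^sup>2) (chi_square CARD('h))"
proof -
  obtain S where S: "is_inv_sqrt \<Omega> S" using pos_def_inv_sqrt[OF Omega_symmetric Omega_pos] by blast
  have Sadj: "(S *v x) \<bullet> y = x \<bullet> (S *v y)" for x y
    using S by (intro symmetric_adjoint) (simp add: is_inv_sqrt_def)
  \<comment> \<open>\<open>chi_square\<close> indexes its coordinates by naturals, vectors theirs by
    the type \<open>'h\<close>; \<open>e\<close> translates.\<close>
  obtain e where e: "bij_betw e {..<CARD('h)} (UNIV :: 'h set)"
    using ex_bij_betw_nat_finite[of "UNIV :: 'h set"] by (auto simp: atLeast0LessThan)
  define T where "T n \<xi> = S *v (R *v (matrix_inv J *v G n \<xi>))" for n \<xi>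
  define x where "x n j \<xi> = T n \<xi> $ e j" for n j \<xi>
  define Q where "Q n \<xi> = (\<Sum>j<CARD('h). (x n j \<xi>)\<^sup>2)" for n \<xi>
  have T_inner: "z \<bullet> T n \<xi> = G n \<xi> \<bullet> (matrix_inv J *v (transpose R *v (S *v z)))" for z n \<xi>
    unfolding T_def Sadj[symmetric] by (subst inner_commute) (simp add: transpose_R symmetric_adjoint[OF inv_J(2)])
  have Q_eq: "Q n \<xi> = (R *v (matrix_inv J *v G n \<xi>)) \<bullet> (matrix_inv \<Omega> *v (R *v (matrix_inv J *v G n \<xi>)))" for n \<xi>
  proof -
    have "Q n \<xi> = (\<Sum>i\<in>UNIV. (T n \<xi> $ i)\<^sup>2)"
      unfolding Q_def x_def by (rule sum.reindex_bij_betw[OF e])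
    also have "\<dots> = (norm (T n \<xi>))\<^sup>2" by (simp only: power2_norm_eq_inner inner_vec_def) (simp add: power2_eq_square)
    finally show ?thesis using inv_sqrt_norm_sq[OF S] by (simp add: T_def)
  qed
  have xm: "x n j \<in> borel_measurable M" for n j
  proof -
    have "x n j = (\<lambda>\<xi>. G n \<xi> \<bullet> (matrix_inv J *v (transpose R *v (S *v axis (e j) 1))))"
      unfolding T_inner[symmetric] by (simp add: x_def fun_eq_iff inner_axis')
    also have "\<dots> \<in> borel_measurable M"
      unfolding inner_G by (intro borel_measurable_times borel_measurable_const borel_measurable_sum csum_sc_measurable) auto
    finally show ?thesis .
  qed
  then have Qm: "Q n \<in> borel_measurable M" for n unfolding Q_def[abs_def] by measurable
  \<comment> \<open>The Cramer-Wold device: every fixed combination of the whitened coordinates is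
    \<open>G n \<xi> \<bullet> a\<close> for a suitable \<open>a\<close>, so the scalar limit
    theorem is enough. Whitening turns the variance into the sum of squares of
    \<open>z\<close>.\<close>
  have cf: "(\<lambda>n. expectation (\<lambda>\<xi>. cos (\<Sum>j<CARD('h). z j * x n j \<xi>))) \<longlonglongrightarrow> exp (- (\<Sum>j<CARD('h). (z j)\<^sup>2) / 2)" for z :: "nat \<Rightarrow> real"
  proof -
    define v :: "real ^ 'h" where "v = (\<chi> i. z (the_inv_into {..<CARD('h)} e i))"
    have vz: "v $ e j = z j" if "j < CARD('h)" for j
      using that the_inv_into_f_f[of e "{..<CARD('h)}" j] e by (simp add: v_def bij_betw_def)
    let ?a = "matrix_inv J *v (transpose R *v (S *v v))"
    have "(\<Sum>j<CARD('h). z j * x n j \<xi>) = G n \<xi> \<bullet> ?a" for n \<xi>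
    proof -
      have "(\<Sum>j<CARD('h). z j * x n j \<xi>) = (\<Sum>j<CARD('h). v $ e j * T n \<xi> $ e j)"
        by (rule sum.cong) (auto simp: vz x_def)
      also have "\<dots> = (\<Sum>i\<in>UNIV. v $ i * T n \<xi> $ i)" by (rule sum.reindex_bij_betw[OF e])
      also have "\<dots> = v \<bullet> T n \<xi>" by (simp add: inner_vec_def)
      finally show ?thesis by (simp only: T_inner)
    qed
    moreover have "(\<Sum>j<CARD('h). (z j)\<^sup>2) = ?a \<bullet> (\<Sigma> *v ?a)"
    proof -
      have "(\<Sum>j<CARD('h). (z j)\<^sup>2) = (\<Sum>j<CARD('h). (v $ e j)\<^sup>2)" by (rule sum.cong) (auto simp: vz)
      also have "\<dots> = (\<Sum>i\<in>UNIV. (v $ i)\<^sup>2)" by (rule sum.reindex_bij_betw[OF e])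
      also have "\<dots> = (norm v)\<^sup>2" by (simp only: power2_norm_eq_inner inner_vec_def) (simp add: power2_eq_square)
      finally show ?thesis using inv_sqrt_whitening[OF S, of v] by (simp add: Omega_form)
    qed
    ultimately show ?thesis using G_char_tendsto[of ?a] by simp
  qed
  have Q0: "0 \<le> Q n \<xi>" for n \<xi> by (simp add: Q_def sum_nonneg)
  have lap: "(\<lambda>n. expectation (\<lambda>\<xi>. exp (- s * Q n \<xi> / 2))) \<longlonglongrightarrow> (\<integral>y. exp (- s * y / 2) \<partial>chi_square CARD('h))" if "0 \<le> s" for s
    unfolding Q_def by (rule laplace_tendsto_chi_square[OF xm cf that])
  have conv: "(\<lambda>n. expectation (\<lambda>\<xi>. h (Q n \<xi>))) \<longlonglongrightarrow> (\<integral>y. h y \<partial>chi_square CARD('h))"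
    if "continuous_on UNIV h" "bounded (range h)" for h :: "real \<Rightarrow> real"
    by (rule integral_tendsto_of_laplace[OF Qm Q0 chi_square_real_distribution AE_chi_square_nonneg lap[OF of_nat_0_le_iff] that])
  show ?thesis
    by (rule converges_in_distribution_perturb[OF Qm Q0 chi_square_real_distribution conv])
      (use statistic_approx[OF H0] in \<open>simp_all only: Q_eq\<close>)
qed

end

section \<open>From the hypotheses to the abstract setting\<close>

lemma bounded_linear_quad_form: "bounded_linear (\<lambda>A :: real ^ 'n ^ 'm. u \<bullet> (A *v v))"
  unfolding linear_conv_bounded_linear[symmetric]
  by (rule linearI) (simp_all add: matrix_vector_mult_add_rdistrib inner_add_right scaleR_matrix_vector_assoc[symmetric])

lemma outer_prod_quad_form: "u \<bullet> (outer_prod x y *v v) = (x \<bullet> u) * (y \<bullet> v)"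
proof -
  have "outer_prod x y *v v = (y \<bullet> v) *\<^sub>R x"
    by (simp add: vec_eq_iff matrix_vector_mult_def outer_prod_def inner_vec_def sum_distrib_right sum_distrib_left mult_ac)
  then show ?thesis by (simp add: inner_commute mult.commute)
qed

lemma norm_outer_prod: "norm (outer_prod x y) = norm x * norm y"
proof -
  have "norm (outer_prod x y) = L2_set (\<lambda>i. norm (x $ i) * norm y) UNIV"
    unfolding norm_vec_def[of "outer_prod x y"]
  proof (rule arg_cong[where f = "\<lambda>h. L2_set h UNIV"], rule ext)
    fix i
    have "outer_prod x y $ i = x $ i *\<^sub>R y" by (simp add: outer_prod_def vec_eq_iff)
    then show "norm (outer_prod x y $ i) = norm (x $ i) * norm y" by simp
  qed
  also have "\<dots> = norm x * norm y"
    by (simp add: L2_set_left_distrib[symmetric] norm_vec_def[of x])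
  finally show ?thesis .
qed

lemma integrable_outer_prod:
  fixes X Z :: "'a \<Rightarrow> real ^ 'd" and g :: "'a \<Rightarrow> real"
  assumes [measurable]: "X \<in> borel_measurable M" "Z \<in> borel_measurable M" "g \<in> borel_measurable M"
    and g: "AE \<xi> in M. \<bar>g \<xi>\<bar> \<le> C" and sq: "integrable M (\<lambda>\<xi>. (norm (X \<xi>))\<^sup>2)" "integrable M (\<lambda>\<xi>. (norm (Z \<xi>))\<^sup>2)"
  shows "integrable M (\<lambda>\<xi>. g \<xi> *\<^sub>R outer_prod (X \<xi>) (Z \<xi>))"
proof (rule Bochner_Integration.integrable_bound)
  show "integrable M (\<lambda>\<xi>. \<bar>C\<bar> * ((norm (X \<xi>))\<^sup>2 + (norm (Z \<xi>))\<^sup>2))" using sq by simp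
  have "continuous_on UNIV (\<lambda>z :: (real ^ 'd) \<times> (real ^ 'd). outer_prod (fst z) (snd z))"
    unfolding outer_prod_def by (intro continuous_intros)
  then have [measurable]: "(\<lambda>z :: (real ^ 'd) \<times> (real ^ 'd). outer_prod (fst z) (snd z)) \<in> borel_measurable borel"
    by (rule borel_measurable_continuous_onI)
  have "(\<lambda>\<xi>. (X \<xi>, Z \<xi>)) \<in> borel_measurable M" by simp
  from measurable_compose[OF this, of "\<lambda>z. outer_prod (fst z) (snd z)"]
  show "(\<lambda>\<xi>. g \<xi> *\<^sub>R outer_prod (X \<xi>) (Z \<xi>)) \<in> borel_measurable M" by simp
  show "AE \<xi> in M. norm (g \<xi> *\<^sub>R outer_prod (X \<xi>) (Z \<xi>)) \<le> norm (\<bar>C\<bar> * ((norm (X \<xi>))\<^sup>2 + (norm (Z \<xi>))\<^sup>2))"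
    using g
  proof eventually_elim
    case (elim \<xi>)
    have "norm (X \<xi>) * norm (Z \<xi>) \<le> (norm (X \<xi>))\<^sup>2 + (norm (Z \<xi>))\<^sup>2"
      using sum_squares_bound[of "norm (X \<xi>)" "norm (Z \<xi>)"] mult_nonneg_nonneg[OF norm_ge_zero norm_ge_zero, of "X \<xi>" "Z \<xi>"]
      by linarith
    then have "\<bar>g \<xi>\<bar> * (norm (X \<xi>) * norm (Z \<xi>)) \<le> \<bar>C\<bar> * ((norm (X \<xi>))\<^sup>2 + (norm (Z \<xi>))\<^sup>2)"
      using elim by (intro mult_mono) auto
    then show ?case by (simp add: norm_outer_prod)
  qed
qed

text \<open>The matrix limits are used only through their bilinear forms. The index \<open>s\<close>
  ranges over observations for \<open>J\<close> and over pairs of observations for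
  \<open>\<Sigma>\<close>.\<close>

lemma quad_form_mean:
  fixes F :: "nat \<Rightarrow> 'i \<Rightarrow> 'a \<Rightarrow> real ^ 'n ^ 'm"
  assumes "\<And>i s. i \<in> {1..n} \<Longrightarrow> s \<in> I i \<Longrightarrow> integrable M (F i s)"
  shows "u \<bullet> (((1 / real n) *\<^sub>R (\<Sum>i=1..n. \<Sum>s\<in>I i. (LINT \<xi>|M. F i s \<xi>))) *v v)
    = (1 / real n) * (\<Sum>i=1..n. \<Sum>s\<in>I i. (LINT \<xi>|M. u \<bullet> (F i s \<xi> *v v)))"
proof -
  interpret bounded_linear "\<lambda>A :: real ^ 'n ^ 'm. u \<bullet> (A *v v)" by (rule bounded_linear_quad_form)
  have "(LINT \<xi>|M. u \<bullet> (F i s \<xi> *v v)) = u \<bullet> ((LINT \<xi>|M. F i s \<xi>) *v v)" if "i \<in> {1..n}" "s \<in> I i" for i s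
    by (rule integral_bounded_linear[OF bounded_linear_quad_form assms[OF that]])
  then have "(\<Sum>i=1..n. \<Sum>s\<in>I i. (LINT \<xi>|M. u \<bullet> (F i s \<xi> *v v))) = (\<Sum>i=1..n. \<Sum>s\<in>I i. u \<bullet> ((LINT \<xi>|M. F i s \<xi>) *v v))"
    by (intro sum.cong refl)
  then show ?thesis by (simp only: scaleR sum real_scaleR_def)
qed

lemma powr_le_one_plus: "0 \<le> x \<Longrightarrow> p \<le> q \<Longrightarrow> 0 \<le> p \<Longrightarrow> x powr p \<le> 1 + x powr q" for x :: real
proof (cases "x \<le> 1")
  case True
  assume "0 \<le> x" "0 \<le> p"
  then have "x powr p \<le> 1" using True by (simp add: powr_le1)
  then show ?thesis using powr_ge_zero[of x q] by linarith
next
  case False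
  assume "p \<le> q"
  then have "x powr p \<le> x powr q" using False by (intro powr_mono) auto
  then show ?thesis by simp
qed

lemma (in prob_space) lower_moment:
  fixes x :: "'a \<Rightarrow> real"
  assumes [measurable]: "x \<in> borel_measurable M" and x: "\<And>\<xi>. 0 \<le> x \<xi>" and p: "0 \<le> p" "p \<le> q"
    and i: "integrable M (\<lambda>\<xi>. x \<xi> powr q)"
  shows "integrable M (\<lambda>\<xi>. x \<xi> powr p)" "expectation (\<lambda>\<xi>. x \<xi> powr p) \<le> 1 + expectation (\<lambda>\<xi>. x \<xi> powr q)"
proof -
  show 1: "integrable M (\<lambda>\<xi>. x \<xi> powr p)"
  proof (rule Bochner_Integration.integrable_bound)
    show "integrable M (\<lambda>\<xi>. 1 + x \<xi> powr q)" using i by simp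
    show "AE \<xi> in M. norm (x \<xi> powr p) \<le> norm (1 + x \<xi> powr q)"
      using powr_le_one_plus[OF x p(2,1)] by (intro AE_I2) (smt (verit) powr_ge_zero real_norm_def)
  qed measurable
  have "expectation (\<lambda>\<xi>. x \<xi> powr p) \<le> expectation (\<lambda>\<xi>. 1 + x \<xi> powr q)"
    using powr_le_one_plus[OF x p(2,1)] 1 i by (intro integral_mono) auto
  then show "expectation (\<lambda>\<xi>. x \<xi> powr p) \<le> 1 + expectation (\<lambda>\<xi>. x \<xi> powr q)" using i by (simp add: prob_space)
qed

theorem corollary3p7:
  fixes M :: "'a measure"
    and c :: "nat \<Rightarrow> nat" and cmax :: nat
    and Y :: "nat \<Rightarrow> nat \<Rightarrow> 'a \<Rightarrow> real"
    and X :: "nat \<Rightarrow> nat \<Rightarrow> 'a \<Rightarrow> real ^ 'd"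
    and W :: "nat \<Rightarrow> 'a \<Rightarrow> real"
    and \<kappa> :: "nat \<Rightarrow> nat \<Rightarrow> real ^ 'd \<Rightarrow> real measure"
    and f f' :: "nat \<Rightarrow> nat \<Rightarrow> real ^ 'd \<Rightarrow> real \<Rightarrow> real"
    and \<tau>0 q :: real
    and B :: "(real ^ 'd) set" and \<beta>0 :: "real ^ 'd"
    and J \<Sigma> :: "real ^ 'd ^ 'd"
    and R :: "real ^ 'd ^ 'h" and r :: "real ^ 'h"
    and bhat bstar :: "nat \<Rightarrow> 'a \<Rightarrow> real ^ 'd"
    and K :: "nat \<Rightarrow> 'a \<Rightarrow> real"
  assumes M: "prob_space M"
    and tau: "0 < \<tau>0" "\<tau>0 < 1"
    and rv: "\<forall>i\<ge>1. \<forall>k\<in>{1..c i}. Y i k \<in> borel_measurable M \<and> X i k \<in> borel_measurable M"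
    and clusters_indep:
      "prob_space.indep_vars M (\<lambda>i. data_space c {i}) (\<lambda>i. data c Y X {i}) {1..}"
    and cluster_size: "\<forall>i\<ge>1. c i \<le> cmax"
    and B: "compact B" "convex B" "\<beta>0 \<in> interior B"
    and cond_dist: "\<forall>i\<ge>1. \<forall>k\<in>{1..c i}. cond_distribution M (X i k) (Y i k) (\<kappa> i k)"
    and quantile: "\<forall>i\<ge>1. \<forall>k\<in>{1..c i}. \<forall>x\<in>rv_support M (X i k).
      cond_quantile (\<kappa> i k) \<tau>0 x = x \<bullet> \<beta>0"
    and q: "2 < q"
    and X_moment: "\<exists>C. \<forall>i\<ge>1. \<forall>k\<in>{1..c i}.
      integrable M (\<lambda>\<omega>. norm (X i k \<omega>) powr q) \<and> (LINT \<omega>|M. norm (X i k \<omega>) powr q) \<le> C"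
    and X_pos_def: "\<exists>\<delta>>0. \<forall>n\<ge>1.
      \<delta> \<le> min_eigenvalue ((1 / real n) *\<^sub>R (\<Sum>i=1..n. \<Sum>k=1..c i.
             (LINT \<omega>|M. outer_prod (X i k \<omega>) (X i k \<omega>))))"
    and cond_dens: "\<forall>i\<ge>1. \<forall>k\<in>{1..c i}. cond_density (\<kappa> i k) (rv_support M (X i k)) (f i k)"
    and dens_deriv: "\<forall>i\<ge>1. \<forall>k\<in>{1..c i}. \<forall>x\<in>rv_support M (X i k). \<forall>y.
      ((f i k x) has_real_derivative f' i k x y) (at y)"
    and dens_bounded: "\<exists>C. \<forall>i\<ge>1. \<forall>k\<in>{1..c i}. \<forall>x\<in>rv_support M (X i k). \<forall>y.
      \<bar>f i k x y\<bar> \<le> C \<and> \<bar>f' i k x y\<bar> \<le> C"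
    and dens_below: "\<exists>\<epsilon>>0. \<forall>i\<ge>1. \<forall>k\<in>{1..c i}. \<forall>x\<in>rv_support M (X i k). \<forall>b\<in>B.
      \<epsilon> \<le> f i k x (x \<bullet> b)"
    and J_lim: "J_mat M c X f \<beta>0 \<longlonglongrightarrow> J"
    and Sigma_lim: "Sigma_mat M c Y X \<tau>0 \<beta>0 \<tau>0 \<beta>0 \<longlonglongrightarrow> \<Sigma>"
    and Sigma_pos: "\<forall>a. a \<noteq> 0 \<longrightarrow> 0 < a \<bullet> (\<Sigma> *v a)"
    \<comment> \<open>bootstrap weights\<close>
    and W_indep: "prob_space.indep_vars M (\<lambda>_. borel) W {1..}"
    and W_ident: "\<forall>i\<ge>1. distr M borel (W i) = distr M borel (W 1)"
    and W_data_indep: "prob_space.indep_set M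
      (sets (vimage_algebra (space M) (data c Y X {1..}) (data_space c {1..})))
      (sets (vimage_algebra (space M) (\<lambda>\<omega>. \<lambda>i\<in>{1..}. W i \<omega>) (PiM {1..} (\<lambda>_. borel))))"
    and W_moments: "prob_space.expectation M (W 1) = 0" "prob_space.variance M (W 1) = 1"
      "integrable M (\<lambda>\<omega>. \<bar>W 1 \<omega>\<bar> powr q)"
    \<comment> \<open>estimators\<close>
    and bhat: "\<forall>n\<ge>1. \<forall>\<omega>\<in>space M.
      is_arg_min (qr_objective c (\<lambda>i k. Y i k \<omega>) (\<lambda>i k. X i k \<omega>) n \<tau>0) (\<lambda>b. b \<in> B) (bhat n \<omega>)"
    and bstar: "\<forall>n\<ge>1. \<forall>\<omega>\<in>space M.
      is_arg_min (wild_objective c (\<lambda>i. W i \<omega>) (\<lambda>i k. Y i k \<omega>) (\<lambda>i k. X i k \<omega>) n \<tau>0 (bhat n \<omega>))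
        (\<lambda>b. b \<in> B) (bstar n \<omega>)"
    \<comment> \<open>hypothesis and test statistic\<close>
    and R: "CARD('h) \<le> CARD('d)" "rank R = CARD('h)"
    and K: "\<forall>n\<ge>1. \<forall>\<omega>\<in>space M. \<forall>S.
      is_inv_sqrt (R ** boot_cov M c Y X n (bstar n) (bhat n) \<omega> ** transpose R) S \<longrightarrow>
      K n \<omega> = norm (S *v (sqrt (real n) *\<^sub>R (R *v bhat n \<omega> - r)))"
  shows "(R *v \<beta>0 = r \<longrightarrow>
            converges_in_distribution M (\<lambda>n \<omega>. (K n \<omega>)\<^sup>2) (chi_square (rank R))) \<and>
         (R *v \<beta>0 \<noteq> r \<longrightarrow>
            (\<forall>s::real.
               (\<lambda>n. outer_measure_of M {\<omega> \<in> space M. (K n \<omega>)\<^sup>2 > s}) \<longlonglongrightarrow> 1 \<and>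
               (\<lambda>n. outer_measure_of M {\<omega> \<in> space M. (K n \<omega>)\<^sup>2 \<le> s}) \<longlonglongrightarrow> 0))"
proof -
  interpret prob_space M by (rule M)
  obtain CX where CX: "\<And>i k. i \<ge> 1 \<Longrightarrow> k \<in> {1..c i} \<Longrightarrow> integrable M (\<lambda>\<xi>. norm (X i k \<xi>) powr q)"
    "\<And>i k. i \<ge> 1 \<Longrightarrow> k \<in> {1..c i} \<Longrightarrow> expectation (\<lambda>\<xi>. norm (X i k \<xi>) powr q) \<le> CX"
    using X_moment by blast
  obtain \<delta> where \<delta>: "0 < \<delta>" "\<And>n. n \<ge> 1 \<Longrightarrow> \<delta> \<le> min_eigenvalue ((1 / real n) *\<^sub>R (\<Sum>i=1..n. \<Sum>k=1..c i.
    (LINT \<xi>|M. outer_prod (X i k \<xi>) (X i k \<xi>))))" using X_pos_def by blast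
  obtain Cf where Cf: "\<And>i k x y. i \<ge> 1 \<Longrightarrow> k \<in> {1..c i} \<Longrightarrow> x \<in> rv_support M (X i k) \<Longrightarrow> \<bar>f i k x y\<bar> \<le> Cf"
    "\<And>i k x y. i \<ge> 1 \<Longrightarrow> k \<in> {1..c i} \<Longrightarrow> x \<in> rv_support M (X i k) \<Longrightarrow> \<bar>f' i k x y\<bar> \<le> Cf"
    using dens_bounded by blast
  obtain \<epsilon> where \<epsilon>: "0 < \<epsilon>" "\<And>i k x b. i \<ge> 1 \<Longrightarrow> k \<in> {1..c i} \<Longrightarrow> x \<in> rv_support M (X i k) \<Longrightarrow> b \<in> B \<Longrightarrow> \<epsilon> \<le> f i k x (x \<bullet> b)"
    using dens_below by blast
  obtain r0 where r0: "0 < r0" "cball \<beta>0 r0 \<subseteq> B" using B(3) by (auto simp: mem_interior_cball)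
  have \<beta>0B: "\<beta>0 \<in> B" using B(3) interior_subset by blast
  obtain Dm where Dm: "0 < Dm" "\<And>b. b \<in> B \<Longrightarrow> norm (b - \<beta>0) \<le> Dm"
  proof -
    have "bounded ((\<lambda>b. b - \<beta>0) ` B)"
      using compact_imp_bounded[OF B(1)] by (rule bounded_translation_minus)
    then show ?thesis using that unfolding bounded_pos by blast
  qed
  define p where "p = min q 3"
  have p: "2 < p" "p \<le> 3" "p \<le> q" "0 \<le> p" using q by (auto simp: p_def)
  define D where "D = \<bar>Cf\<bar>"
  define m where "m = 1 + \<bar>CX\<bar>"
  define w where "w = 1 + expectation (\<lambda>\<xi>. \<bar>W 1 \<xi>\<bar> powr q)"
  \<comment> \<open>One constant above every upper bound that \<open>qr_core\<close> and
    \<open>qr_boot\<close> ask for: moments, the two band estimates, the expansion of the bump, and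
    the weights.\<close>
  define C where "C = 1 + m + 2 * D * (1 + m) + (2 * D) powr (p - 2) * m + D * m + w"
  have Dm0: "0 \<le> D" "1 \<le> m" "1 \<le> w" by (auto simp: D_def m_def w_def)
  have C_bounds: "1 \<le> C" "m \<le> C" "2 * D * (1 + m) \<le> C" "(2 * D) powr (p - 2) * m \<le> C" "D * m \<le> C" "w \<le> C"
  proof -
    have "0 \<le> 2 * D * (1 + m)" "0 \<le> (2 * D) powr (p - 2) * m" "0 \<le> D * m" using Dm0 by auto
    then show "1 \<le> C" "m \<le> C" "2 * D * (1 + m) \<le> C" "(2 * D) powr (p - 2) * m \<le> C" "D * m \<le> C" "w \<le> C"
      using Dm0 unfolding C_def by linarith+
  qed
  have obs: "observation M (X i k) (Y i k) (\<kappa> i k) (f i k) (f' i k) \<tau>0 \<beta>0 D" if "i \<ge> 1" "k \<in> {1..c i}" for i k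
    using that M rv cond_dist cond_dens dens_deriv quantile tau Cf[OF that] order_trans[OF Cf(1)[OF that] abs_ge_self] order_trans[OF Cf(2)[OF that] abs_ge_self]
    by (intro observation.intro observation_axioms.intro) (auto simp: D_def)
  have rvX [measurable]: "X i k \<in> borel_measurable M" "Y i k \<in> borel_measurable M" if "i \<ge> 1" "k \<in> {1..c i}" for i k
    using rv that by auto
  have mom: "integrable M (\<lambda>\<xi>. norm (X i k \<xi>) powr p)" "expectation (\<lambda>\<xi>. norm (X i k \<xi>) powr p) \<le> m"
    if "i \<ge> 1" "k \<in> {1..c i}" for i k
  proof -
    note [measurable] = rvX[OF that]
    note lm = lower_moment[of "\<lambda>\<xi>. norm (X i k \<xi>)", OF _ norm_ge_zero p(4,3) CX(1)[OF that]]
    show "integrable M (\<lambda>\<xi>. norm (X i k \<xi>) powr p)" by (rule lm(1)) measurable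
    have "expectation (\<lambda>\<xi>. norm (X i k \<xi>) powr p) \<le> 1 + expectation (\<lambda>\<xi>. norm (X i k \<xi>) powr q)" by (rule lm(2)) measurable
    then show "expectation (\<lambda>\<xi>. norm (X i k \<xi>) powr p) \<le> m" using CX(2)[OF that] by (simp add: m_def)
  qed
  have sq: "integrable M (\<lambda>\<xi>. (norm (X i k \<xi>))\<^sup>2)" "expectation (\<lambda>\<xi>. (norm (X i k \<xi>))\<^sup>2) \<le> 1 + m"
    if "i \<ge> 1" "k \<in> {1..c i}" for i k
    using second_moment_le[OF p(1), of "\<lambda>\<xi>. norm (X i k \<xi>)"] rvX[OF that] mom[OF that] by auto
  have fX [measurable]: "(\<lambda>\<xi>. f i k (X i k \<xi>) (X i k \<xi> \<bullet> \<beta>0)) \<in> borel_measurable M" if "i \<ge> 1" "k \<in> {1..c i}" for i k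
  proof -
    interpret observation M "X i k" "Y i k" "\<kappa> i k" "f i k" "f' i k" \<tau>0 \<beta>0 D by (rule obs[OF that])
    show ?thesis by measurable
  qed
  have fb: "AE \<xi> in M. \<bar>f i k (X i k \<xi>) (X i k \<xi> \<bullet> \<beta>0)\<bar> \<le> D" "AE \<xi> in M. \<epsilon> \<le> f i k (X i k \<xi>) (X i k \<xi> \<bullet> \<beta>0)" if "i \<ge> 1" "k \<in> {1..c i}" for i k
  proof -
    interpret observation M "X i k" "Y i k" "\<kappa> i k" "f i k" "f' i k" \<tau>0 \<beta>0 D by (rule obs[OF that])
    show "AE \<xi> in M. \<bar>f i k (X i k \<xi>) (X i k \<xi> \<bullet> \<beta>0)\<bar> \<le> D"
      using AE_support by eventually_elim (rule bounded_f)
    show "AE \<xi> in M. \<epsilon> \<le> f i k (X i k \<xi>) (X i k \<xi> \<bullet> \<beta>0)"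
      using AE_support by eventually_elim (rule \<epsilon>(2)[OF that _ \<beta>0B])
  qed
  define qf where "qf i k u = expectation (\<lambda>\<xi>. f i k (X i k \<xi>) (X i k \<xi> \<bullet> \<beta>0) * (X i k \<xi> \<bullet> u)\<^sup>2)" for i k u
  have Jn: "u \<bullet> (J_mat M c X f \<beta>0 n *v v) = (1 / real n) * (\<Sum>i=1..n. \<Sum>k=1..c i.
    expectation (\<lambda>\<xi>. f i k (X i k \<xi>) (X i k \<xi> \<bullet> \<beta>0) * ((X i k \<xi> \<bullet> u) * (X i k \<xi> \<bullet> v))))" for n u v
  proof -
    have "u \<bullet> (J_mat M c X f \<beta>0 n *v v) = (1 / real n) * (\<Sum>i=1..n. \<Sum>k=1..c i.
      expectation (\<lambda>\<xi>. u \<bullet> ((f i k (X i k \<xi>) (X i k \<xi> \<bullet> \<beta>0) *\<^sub>R outer_prod (X i k \<xi>) (X i k \<xi>)) *v v)))"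
      unfolding J_mat_def
      by (rule quad_form_mean, rule integrable_outer_prod) (auto intro: rvX fX fb sq)
    then show ?thesis by (simp add: scaleR_matrix_vector_assoc[symmetric] outer_prod_quad_form)
  qed
  have J_tendsto: "(\<lambda>n. u \<bullet> (J_mat M c X f \<beta>0 n *v v)) \<longlonglongrightarrow> u \<bullet> (J *v v)" for u v
    by (rule bounded_linear.tendsto[OF bounded_linear_quad_form J_lim])
  have J_sym: "transpose J = J"
  proof (rule transpose_eqI)
    fix x y
    have "(\<lambda>n. y \<bullet> (J_mat M c X f \<beta>0 n *v x)) = (\<lambda>n. x \<bullet> (J_mat M c X f \<beta>0 n *v y))"
      unfolding Jn by (simp add: mult.commute)
    then have "y \<bullet> (J *v x) = x \<bullet> (J *v y)" using LIMSEQ_unique[OF J_tendsto] J_tendsto[of x y] by metis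
    then show "(J *v x) \<bullet> y = x \<bullet> (J *v y)" by (simp add: inner_commute)
  qed
  have sqi: "integrable M (\<lambda>\<xi>. (X i k \<xi> \<bullet> u)\<^sup>2)" if "i \<ge> 1" "k \<in> {1..c i}" for i k u
    by (rule integrable_inner_square[OF rvX(1)[OF that] sq(1)[OF that]])
  have eig: "\<delta> * (norm u)\<^sup>2 \<le> (1 / real n) * (\<Sum>i=1..n. \<Sum>k=1..c i. expectation (\<lambda>\<xi>. (X i k \<xi> \<bullet> u)\<^sup>2))" if n: "n \<ge> 1" for n u
  proof -
    let ?A = "(1 / real n) *\<^sub>R (\<Sum>i=1..n. \<Sum>k=1..c i. (LINT \<xi>|M. outer_prod (X i k \<xi>) (X i k \<xi>)))"
    have A: "v \<bullet> (?A *v w) = (1 / real n) * (\<Sum>i=1..n. \<Sum>k=1..c i. expectation (\<lambda>\<xi>. (X i k \<xi> \<bullet> v) * (X i k \<xi> \<bullet> w)))" for v w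
    proof -
      have "integrable M (\<lambda>\<xi>. outer_prod (X i k \<xi>) (X i k \<xi>))" if "i \<in> {1..n}" "k \<in> {1..c i}" for i k
        using integrable_outer_prod[of "X i k" M "X i k" "\<lambda>_. 1" 1] that rvX sq by simp
      from quad_form_mean[OF this] show ?thesis by (simp only: outer_prod_quad_form)
    qed
    have "transpose ?A = ?A"
    proof (rule transpose_eqI)
      fix x y
      have "y \<bullet> (?A *v x) = x \<bullet> (?A *v y)" unfolding A by (simp add: mult.commute)
      then show "(?A *v x) \<bullet> y = x \<bullet> (?A *v y)" by (simp only: inner_commute)
    qed
    from quad_form_ge_min_eigenvalue[OF this, of u] have "min_eigenvalue ?A * (norm u)\<^sup>2 \<le> u \<bullet> (?A *v u)" .
    moreover have "\<delta> * (norm u)\<^sup>2 \<le> min_eigenvalue ?A * (norm u)\<^sup>2" by (intro mult_right_mono \<delta>(2) n) simp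
    ultimately show ?thesis unfolding A by (simp add: power2_eq_square)
  qed
  have J_pos: "\<epsilon> * \<delta> * (norm u)\<^sup>2 \<le> u \<bullet> (J *v u)" for u
  proof (rule LIMSEQ_le_const[OF J_tendsto], intro exI[of _ 1] allI impI)
    fix n :: nat assume n: "1 \<le> n"
    have "\<epsilon> * (\<delta> * (norm u)\<^sup>2) \<le> \<epsilon> * ((1 / real n) * (\<Sum>i=1..n. \<Sum>k=1..c i. expectation (\<lambda>\<xi>. (X i k \<xi> \<bullet> u)\<^sup>2)))"
      using eig[OF n] \<epsilon>(1) by (intro mult_left_mono) auto
    also have "\<dots> = (1 / real n) * (\<Sum>i=1..n. \<Sum>k=1..c i. expectation (\<lambda>\<xi>. \<epsilon> * (X i k \<xi> \<bullet> u)\<^sup>2))"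
      by (simp add: sum_distrib_left mult.left_commute)
    also have "\<dots> \<le> (1 / real n) * (\<Sum>i=1..n. \<Sum>k=1..c i. expectation (\<lambda>\<xi>. f i k (X i k \<xi>) (X i k \<xi> \<bullet> \<beta>0) * ((X i k \<xi> \<bullet> u) * (X i k \<xi> \<bullet> u))))"
    proof (intro mult_left_mono sum_mono)
      fix i k assume "i \<in> {1..n}" and k: "k \<in> {1..c i}"
      then have ik: "i \<ge> 1" "k \<in> {1..c i}" by auto
      interpret observation M "X i k" "Y i k" "\<kappa> i k" "f i k" "f' i k" \<tau>0 \<beta>0 D by (rule obs[OF ik])
      show "expectation (\<lambda>\<xi>. \<epsilon> * (X i k \<xi> \<bullet> u)\<^sup>2) \<le> expectation (\<lambda>\<xi>. f i k (X i k \<xi>) (X i k \<xi> \<bullet> \<beta>0) * ((X i k \<xi> \<bullet> u) * (X i k \<xi> \<bullet> u)))"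
        unfolding power2_eq_square[symmetric]
      proof (rule integral_mono_AE)
        show "AE \<xi> in M. \<epsilon> * (X i k \<xi> \<bullet> u)\<^sup>2 \<le> f i k (X i k \<xi>) (X i k \<xi> \<bullet> \<beta>0) * (X i k \<xi> \<bullet> u)\<^sup>2"
          using fb(2)[OF ik] by eventually_elim (rule mult_right_mono, auto)
      qed (use sqi[OF ik] expectation_bump_approx(2)[OF p(1,2) mom(1)[OF ik] Dm0(1)] in auto)
    qed simp
    finally show "\<epsilon> * \<delta> * (norm u)\<^sup>2 \<le> u \<bullet> (J_mat M c X f \<beta>0 n *v u)" by (simp add: Jn)
  qed
  have Wm: "W i \<in> borel_measurable M" if "i \<ge> 1" for i
    using W_indep that unfolding indep_vars_def by auto
  have W_transfer: "integrable M (\<lambda>\<xi>. g (W i \<xi>)) \<longleftrightarrow> integrable M (\<lambda>\<xi>. g (W 1 \<xi>))"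
    "expectation (\<lambda>\<xi>. g (W i \<xi>)) = expectation (\<lambda>\<xi>. g (W 1 \<xi>))"
    if "i \<ge> 1" and [measurable]: "g \<in> borel_measurable borel" for i and g :: "real \<Rightarrow> real"
  proof -
    note [measurable] = Wm[OF that(1)] Wm[OF order_refl]
    have d: "distr M borel (W i) = distr M borel (W 1)" using W_ident that(1) by blast
    show "integrable M (\<lambda>\<xi>. g (W i \<xi>)) \<longleftrightarrow> integrable M (\<lambda>\<xi>. g (W 1 \<xi>))"
      using integrable_distr_eq[OF Wm[OF that(1)] that(2)] integrable_distr_eq[OF Wm[OF order_refl] that(2)] d by simp
    show "expectation (\<lambda>\<xi>. g (W i \<xi>)) = expectation (\<lambda>\<xi>. g (W 1 \<xi>))"
      using integral_distr[OF Wm[OF that(1)] that(2)] integral_distr[OF Wm[OF order_refl] that(2)] d by simp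
  qed
  note [measurable] = Wm[OF order_refl]
  have W2: "integrable M (\<lambda>\<xi>. (W 1 \<xi>)\<^sup>2)" by (rule second_moment_le(1)[OF q Wm[OF order_refl] W_moments(3)])
  have Wp: "integrable M (\<lambda>\<xi>. \<bar>W 1 \<xi>\<bar> powr p)" "expectation (\<lambda>\<xi>. \<bar>W 1 \<xi>\<bar> powr p) \<le> w"
    unfolding w_def by (rule lower_moment[OF borel_measurable_abs[OF Wm[OF order_refl]] abs_ge_zero p(4,3) W_moments(3)])+
  interpret clusters M c cmax Y X W
  proof unfold_locales
    show "Y i k \<in> borel_measurable M" "X i k \<in> borel_measurable M" if "i \<ge> 1" "k \<in> {1..c i}" for i k
      by (rule rvX[OF that])+
    show "integrable M (\<lambda>\<xi>. (W i \<xi>)\<^sup>2)" "expectation (W i) = 0" "expectation (\<lambda>\<xi>. (W i \<xi>)\<^sup>2) = 1" if "i \<ge> 1" for i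
      using W_transfer[OF that, of "\<lambda>x. x\<^sup>2"] W_transfer[OF that, of "\<lambda>x. x"] W2 W_moments by simp_all
  qed (use clusters_indep cluster_size W_indep W_data_indep in auto)
  \<comment> \<open>\<open>\<delta>\<close> bounds the averaged design matrices from below and
    \<open>\<epsilon> * \<delta>\<close> bounds \<open>J\<close>, as the density at the quantile is
    at least \<open>\<epsilon>\<close>.\<close>
  define lam where "lam = min \<delta> (\<epsilon> * \<delta>)"
  have lam: "0 < lam" "lam \<le> \<delta>" "lam \<le> \<epsilon> * \<delta>" using \<delta> \<epsilon> by (auto simp: lam_def)
  \<comment> \<open>The growth constant is \<open>\<epsilon> / 2\<close> because the bump integrates
    to \<open>v\<^sup>2 / 2\<close>.\<close>
  interpret qr_core M c cmax Y X W \<tau>0 \<beta>0 C p "\<epsilon> / 2" r0 lam J \<Sigma> qf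
  proof unfold_locales
    fix i k assume ik: "i \<ge> 1" "k \<in> {1..c i}"
    interpret observation M "X i k" "Y i k" "\<kappa> i k" "f i k" "f' i k" \<tau>0 \<beta>0 D by (rule obs[OF ik])
    show "integrable M (\<lambda>\<xi>. norm (X i k \<xi>) powr p)" by (rule mom(1)[OF ik])
    show "expectation (\<lambda>\<xi>. norm (X i k \<xi>) powr p) \<le> C" using mom(2)[OF ik] C_bounds(2) by linarith
    show "expectation (\<lambda>\<xi>. norm (X i k \<xi>) * of_bool (\<bar>Y i k \<xi> - X i k \<xi> \<bullet> b\<bar> \<le> r * norm (X i k \<xi>))) \<le> C * r" if "0 \<le> r" for r b
    proof -
      have "2 * D * r * expectation (\<lambda>\<xi>. (norm (X i k \<xi>))\<^sup>2) \<le> 2 * D * r * (1 + m)"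
        using sq(2)[OF ik] Dm0(1) that by (intro mult_left_mono) auto
      also have "\<dots> \<le> C * r" using mult_right_mono[OF C_bounds(3) that] by (simp add: mult_ac)
      finally show ?thesis using expectation_band[OF sq(1)[OF ik] that Dm0(1), of b] by linarith
    qed
    show "expectation (\<lambda>\<xi>. (norm (X i k \<xi>))\<^sup>2 * of_bool (\<bar>Y i k \<xi> - X i k \<xi> \<bullet> b\<bar> \<le> r * norm (X i k \<xi>))) \<le> C * r powr (p - 2)" if "0 \<le> r" for r b
    proof -
      have "(2 * D * r) powr (p - 2) * expectation (\<lambda>\<xi>. norm (X i k \<xi>) powr p) \<le> (2 * D * r) powr (p - 2) * m"
        using mom(2)[OF ik] by (intro mult_left_mono) auto
      also have "\<dots> = ((2 * D) powr (p - 2) * m) * r powr (p - 2)" using Dm0(1) that by (simp add: powr_mult)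
      also have "\<dots> \<le> C * r powr (p - 2)" by (rule mult_right_mono[OF C_bounds(4)]) simp
      finally show ?thesis using expectation_band_sq[OF p(1,2) mom(1)[OF ik] that Dm0(1), of b] by linarith
    qed
    show "\<epsilon> / 2 * expectation (\<lambda>\<xi>. (X i k \<xi> \<bullet> u)\<^sup>2) \<le> expectation (\<lambda>\<xi>. bump (Y i k \<xi> - X i k \<xi> \<bullet> \<beta>0) (X i k \<xi> \<bullet> u))" if "norm u \<le> r0" for u
    proof (rule expectation_bump_ge[OF sq(1)[OF ik] B(2) \<beta>0B])
      show "\<beta>0 + u \<in> B" using r0(2) that by (auto simp: dist_norm)
    qed (use \<epsilon> ik in auto)
    show "\<bar>expectation (\<lambda>\<xi>. bump (Y i k \<xi> - X i k \<xi> \<bullet> \<beta>0) (X i k \<xi> \<bullet> u)) - qf i k u / 2\<bar> \<le> C * norm u powr p" for u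
    proof -
      have "D * (norm u powr p * expectation (\<lambda>\<xi>. norm (X i k \<xi>) powr p)) \<le> D * (norm u powr p * m)"
        using mom(2)[OF ik] Dm0(1) by (intro mult_left_mono) auto
      also have "\<dots> \<le> C * norm u powr p" using mult_right_mono[OF C_bounds(5), of "norm u powr p"] by (simp add: mult_ac)
      finally show ?thesis using expectation_bump_approx(1)[OF p(1,2) mom(1)[OF ik] Dm0(1), of u] unfolding qf_def by linarith
    qed
    show "expectation (\<lambda>\<xi>. psi \<tau>0 (Y i k \<xi> - X i k \<xi> \<bullet> \<beta>0) * (X i k \<xi> \<bullet> a)) = 0" for a
    proof (rule expectation_psi[of "\<lambda>x. x \<bullet> a"])
      show "integrable M (\<lambda>\<xi>. X i k \<xi> \<bullet> a)"
        by (rule square_integrable_imp_integrable[OF _ sqi[OF ik]]) measurable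
    qed measurable
  next
    show "qf i k (t *\<^sub>R u) = t\<^sup>2 * qf i k u" for i k t u
      by (simp add: qf_def power_mult_distrib mult.left_commute)
    show "lam * (norm u)\<^sup>2 \<le> (1 / real n) * (\<Sum>i=1..n. \<Sum>k=1..c i. expectation (\<lambda>\<xi>. (X i k \<xi> \<bullet> u)\<^sup>2))" if "n \<ge> 1" for n u
      using eig[OF that, of u] mult_right_mono[OF lam(2), of "(norm u)\<^sup>2"] by simp
    show "(\<lambda>n. (1 / real n) * (\<Sum>i=1..n. \<Sum>k=1..c i. qf i k u)) \<longlonglongrightarrow> u \<bullet> (J *v u)" for u
      using J_tendsto[of u u] unfolding Jn qf_def power2_eq_square .
    show "lam * (norm u)\<^sup>2 \<le> u \<bullet> (J *v u)" for u
      using J_pos[of u] mult_right_mono[OF lam(3), of "(norm u)\<^sup>2"] by simp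
  qed (use tau p C_bounds(1) \<epsilon> r0 lam J_sym in auto)
  have Sn: "a \<bullet> (Sigma_mat M c Y X \<tau>0 \<beta>0 \<tau>0 \<beta>0 n *v b) = (1 / real n) * (\<Sum>i=1..n. expectation (\<lambda>\<xi>. csum (sc a) i \<xi> * csum (sc b) i \<xi>))" for n a b
  proof -
    \<comment> \<open>The double sum over \<open>k\<close> and \<open>l\<close> becomes one sum over
      pairs; it then matches the product of two cluster totals term by term, and
      \<open>quad_form_mean\<close> applies.\<close>
    let ?F = "\<lambda>i kl \<xi>. (psi \<tau>0 (Y i (fst kl) \<xi> - X i (fst kl) \<xi> \<bullet> \<beta>0) * psi \<tau>0 (Y i (snd kl) \<xi> - X i (snd kl) \<xi> \<bullet> \<beta>0)) *\<^sub>R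
      outer_prod (X i (fst kl) \<xi>) (X i (snd kl) \<xi>)"
    let ?I = "\<lambda>i. {1..c i} \<times> {1..c i}"
    have int: "integrable M (?F i kl)" if "i \<in> {1..n}" "kl \<in> ?I i" for i kl
    proof (rule integrable_outer_prod[where C = 1])
      have ik: "i \<ge> 1" "fst kl \<in> {1..c i}" "snd kl \<in> {1..c i}" using that by auto
      note [measurable] = rvX[OF ik(1,2)] rvX[OF ik(1,3)]
      show "X i (fst kl) \<in> borel_measurable M" "X i (snd kl) \<in> borel_measurable M" by measurable
      show "(\<lambda>\<xi>. psi \<tau>0 (Y i (fst kl) \<xi> - X i (fst kl) \<xi> \<bullet> \<beta>0) * psi \<tau>0 (Y i (snd kl) \<xi> - X i (snd kl) \<xi> \<bullet> \<beta>0)) \<in> borel_measurable M"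
        unfolding psi_def by measurable
      have "\<bar>psi \<tau>0 x\<bar> \<le> 1" for x using tau by (simp add: psi_def)
      then show "AE \<xi> in M. \<bar>psi \<tau>0 (Y i (fst kl) \<xi> - X i (fst kl) \<xi> \<bullet> \<beta>0) * psi \<tau>0 (Y i (snd kl) \<xi> - X i (snd kl) \<xi> \<bullet> \<beta>0)\<bar> \<le> 1"
        unfolding abs_mult by (intro AE_I2 mult_le_one) auto
    qed (use that sq in auto)
    have cs: "expectation (\<lambda>\<xi>. csum (sc a) i \<xi> * csum (sc b) i \<xi>) = (\<Sum>kl\<in>?I i. expectation (\<lambda>\<xi>. a \<bullet> (?F i kl \<xi> *v b)))" if "i \<in> {1..n}" for i
    proof -
      have "csum (sc a) i \<xi> * csum (sc b) i \<xi> = (\<Sum>kl\<in>?I i. a \<bullet> (?F i kl \<xi> *v b))" for \<xi>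
        by (simp add: csum_def sc_def sum_product sum.cartesian_product case_prod_beta scaleR_matrix_vector_assoc[symmetric] outer_prod_quad_form mult_ac)
      then show ?thesis
        by (simp only:) (rule Bochner_Integration.integral_sum, rule integrable_bounded_linear[OF bounded_linear_quad_form int[OF that]])
    qed
    have "Sigma_mat M c Y X \<tau>0 \<beta>0 \<tau>0 \<beta>0 n = (1 / real n) *\<^sub>R (\<Sum>i=1..n. \<Sum>kl\<in>?I i. (LINT \<xi>|M. ?F i kl \<xi>))"
      by (simp add: Sigma_mat_def sum.cartesian_product case_prod_beta)
    then have "a \<bullet> (Sigma_mat M c Y X \<tau>0 \<beta>0 \<tau>0 \<beta>0 n *v b) = (1 / real n) * (\<Sum>i=1..n. \<Sum>kl\<in>?I i. expectation (\<lambda>\<xi>. a \<bullet> (?F i kl \<xi> *v b)))"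
      by (simp only: quad_form_mean[OF int])
    also have "\<dots> = (1 / real n) * (\<Sum>i=1..n. expectation (\<lambda>\<xi>. csum (sc a) i \<xi> * csum (sc b) i \<xi>))"
      by (intro arg_cong[where f = "\<lambda>x. (1 / real n) * x"] sum.cong refl cs[symmetric])
    finally show ?thesis .
  qed
  interpret wald_test M c cmax Y X W \<tau>0 \<beta>0 C p "\<epsilon> / 2" r0 lam J \<Sigma> qf B Dm bhat bstar R r K
  proof unfold_locales
    show "integrable M (\<lambda>\<xi>. \<bar>W i \<xi>\<bar> powr p)" "expectation (\<lambda>\<xi>. \<bar>W i \<xi>\<bar> powr p) \<le> C" if "i \<ge> 1" for i
      using W_transfer[OF that, of "\<lambda>x. \<bar>x\<bar> powr p"] Wp C_bounds(6) by simp_all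
    show "(\<lambda>n. (1 / real n) * (\<Sum>i=1..n. expectation (\<lambda>\<xi>. csum (sc a) i \<xi> * csum (sc b) i \<xi>))) \<longlonglongrightarrow> a \<bullet> (\<Sigma> *v b)" for a b
      using bounded_linear.tendsto[OF bounded_linear_quad_form Sigma_lim, of a b] unfolding Sn .
    have "inj ((*v) (transpose R))" using R(2) by (simp only: full_rank_injective[symmetric] rank_transpose)
    then show "x = 0" if "transpose R *v x = 0" for x
      using that matrix_vector_mult_0_right[of "transpose R"] unfolding inj_def by metis
  qed (use r0 Dm bhat bstar Sigma_pos K in auto)
  show ?thesis
  proof (intro conjI impI allI)
    assume "R *v \<beta>0 = r"
    then show "converges_in_distribution M (\<lambda>n \<xi>. (K n \<xi>)\<^sup>2) (chi_square (rank R))"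
      unfolding R(2) by (rule null_distribution)
  next
    fix s :: real assume H1: "R *v \<beta>0 \<noteq> r"
    note lim = outer_measure_tendsto[OF M consistency[OF H1]]
    show "(\<lambda>n. outer_measure_of M {\<xi> \<in> space M. (K n \<xi>)\<^sup>2 > s}) \<longlonglongrightarrow> 1" by (rule lim(1))
    show "(\<lambda>n. outer_measure_of M {\<xi> \<in> space M. (K n \<xi>)\<^sup>2 \<le> s}) \<longlonglongrightarrow> 0"
      using lim(2) by (simp only: not_less)
  qed
qed

end
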